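(* Let $\psi\in\mathrm{Conv}(0,\infty)$ and let $a,b\ge 0$, with $a,b$ not both zero. Suppose that the function $G(t)=\psi(t^{n+1})$ is convex for $t\in(0,\infty)$. Let $K_1,K_2\in\mathcal{K}_o^n$ be such that $K_1|e_n^\perp=K_2|e_n^\perp$, and assume that $K_1$ and $K_2$ have positive Gaussian curvature almost everywhere. Then $$\mathrm{as}_\psi\left(a\diamond_{e_n} K_1 +^{\diamond}_{e_n} b\diamond_{e_n} K_2\right)\ \le\ \frac{a}{a+b}\,\mathrm{as}_\psi\big((a+b)\diamond_{e_n} K_1\big)+\frac{b}{a+b}\,\mathrm{as}_\psi\big((a+b)\diamond_{e_n} K_2\big).$$
   Context: A convex body in $\mathbb{R}^n$ is a compact convex set with nonempty interior; $\mathcal{K}_o^n$ is the set of convex bodies in $\mathbb{R}^n$ containing the origin in their interior. $e_n$ is the last standard basis vector. For a unit vector $u$, $u^\perp$ is the hyperplane through the origin orthogonal to $u$, and $K|u^\perp$ is the orthogonal projection of $K$ onto $u^\perp$. Write $(x',t)$ for $x'+tu$ with $x'\in u^\perp$, $t\in\mathbb{R}$. For a convex body $K$, the overgraph and undergraph functions $f,g:K|u^\perp\to\mathbb{R}$ are $f(x')=\max\{t:(x',t)\in K\}$ and $g(x')=-\min\{t:(x',t)\in K\}$, so that $K=\{(x',t):x'\in K|u^\perp,\ -g(x')\le t\le f(x')\}$; one writes $K\approx(f,-g)_u$. Graph combination: if $K_1|u^\perp=K_2|u^\perp$ and $K_i\approx(f_i,-g_i)_u$ for $i=1,2$, then for $a,b\ge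 0$ $$a\diamond_u K_1+^{\diamond}_u b\diamond_u K_2=\{(x',t):x'\in K_1|u^\perp,\ -(ag_1(x')+bg_2(x'))\le t\le af_1(x')+bf_2(x')\},$$ and the graph dilation is $a\diamond_u K_1=\{(x',t):x'\in K_1|u^\perp,\ -ag_1(x')\le t\le af_1(x')\}$. For $a,b\geq 0$ not both zero and $K_1,K_2\in\mathcal{K}_o^n$ the graph combination again belongs to $\mathcal{K}_o^n$. $\mathrm{Conv}(0,\infty)$ is the class of functions $\psi:(0,\infty)\to(0,\infty)$ such that either $\psi$ is a nonzero constant function, or $\psi$ is convex with $\lim_{t\to0^+}\psi(t)=\infty$ and $\lim_{t\to\infty}\psi(t)=0$ (in the latter case one sets $\psi(0)=\infty$). For $K\in\mathcal{K}_o^n$ the $L_\psi$ affine surface area is $$\mathrm{as}_\psi(K)=\int_{\partial K}\psi\left(\frac{\kappa_K(x)}{\langle x,N_K(x)\rangle^{n+1}}\right)\langle x,N_K(x)\rangle\,dS_K(x),$$ where $\kappa_K(x)$ is the (generalized) Gaussian curvature of $\partial K$ at $x$ and $N_K(x)$ the outer unit normal (both exist for almost every $x\in\partial K$), and $S_K$ is the surface area measure ($(n-1)$-dimensional Hausdorff measure) on $\partial K$; the value $+\infty$ is allowed. *)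

theory Defs
  imports "HOL-Analysis.Analysis"
begin

section \<open>Convex bodies and their graph functions\<close>

definition convex_body :: "'a::euclidean_space set \<Rightarrow> bool" where
  "convex_body K \<longleftrightarrow> compact K \<and> convex K \<and> interior K \<noteq> {}"

definition convex_body_o :: "'a::euclidean_space set \<Rightarrow> bool" where
  "convex_body_o K \<longleftrightarrow> convex_body K \<and> 0 \<in> interior K"

definition last_basis :: "real ^ 'n::{finite,linorder}" where
  "last_basis = axis (Max UNIV) 1"

text \<open>In the following definitions \<open>u\<close> is meant to be a unit vector; \<open>hproj u K\<close> is $K|u^\perp$.\<close>

definition hproj :: "'a::euclidean_space \<Rightarrow> 'a set \<Rightarrow> 'a set" where
  "hproj u K = (\<lambda>x. x - (x \<bullet> u) *\<^sub>R u) ` K"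

text \<open>For compact \<open>K\<close> and \<open>x' \<in> hproj u K\<close> the supremum and infimum are attained, so they are
  the maximum and the minimum.\<close>

definition overgraph :: "'a::euclidean_space \<Rightarrow> 'a set \<Rightarrow> 'a \<Rightarrow> real" where
  "overgraph u K x' = Sup {t. x' + t *\<^sub>R u \<in> K}"

definition undergraph :: "'a::euclidean_space \<Rightarrow> 'a set \<Rightarrow> 'a \<Rightarrow> real" where
  "undergraph u K x' = - Inf {t. x' + t *\<^sub>R u \<in> K}"

text \<open>Only used when \<open>hproj u K1 = hproj u K2\<close> and \<open>a, b \<ge> 0\<close>.\<close>

definition graph_combination ::
  "'a::euclidean_space \<Rightarrow> real \<Rightarrow> 'a set \<Rightarrow> real \<Rightarrow> 'a set \<Rightarrow> 'a set" where
  "graph_combination u a K1 b K2 =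
     {x' + t *\<^sub>R u | x' t. x' \<in> hproj u K1 \<and>
        - (a * undergraph u K1 x' + b * undergraph u K2 x') \<le> t \<and>
        t \<le> a * overgraph u K1 x' + b * overgraph u K2 x'}"

definition graph_dilation :: "'a::euclidean_space \<Rightarrow> real \<Rightarrow> 'a set \<Rightarrow> 'a set" where
  "graph_dilation u a K =
     {x' + t *\<^sub>R u | x' t. x' \<in> hproj u K \<and>
        - (a * undergraph u K x') \<le> t \<and> t \<le> a * overgraph u K x'}"


section \<open>Hausdorff measure and surface area measure\<close>

text \<open>The usual normalisation is used: \<open>d\<close>-dimensional Hausdorff measure agrees with Lebesgue
  measure on \<open>d\<close>-dimensional Euclidean space. The empty set is treated separately so that the
  case \<open>d = 0\<close> gives the counting measure.\<close>

definition hausdorff_weight :: "nat \<Rightarrow> 'a::metric_space set \<Rightarrow> ennreal" where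
  "hausdorff_weight d U =
     (if U = {} then 0 else ennreal (unit_ball_vol (real d) * (diameter U / 2) ^ d))"

definition hausdorff_premeasure :: "nat \<Rightarrow> real \<Rightarrow> 'a::metric_space set \<Rightarrow> ennreal" where
  "hausdorff_premeasure d \<delta> A =
     (INF U \<in> {U :: nat \<Rightarrow> 'a set. A \<subseteq> (\<Union>i. U i) \<and> (\<forall>i. bounded (U i) \<and> diameter (U i) \<le> \<delta>)}.
        \<Sum>i. hausdorff_weight d (U i))"

definition hausdorff_outer_measure :: "nat \<Rightarrow> 'a::metric_space set \<Rightarrow> ennreal" where
  "hausdorff_outer_measure d A = (SUP \<delta> \<in> {0<..}. hausdorff_premeasure d \<delta> A)"

text \<open>The Hausdorff outer measure is a metric outer measure, hence countably additive on the Borel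
  sets, so \<open>measure_of\<close> does not fall back to the zero measure.\<close>

definition hausdorff_measure :: "nat \<Rightarrow> 'a::metric_space measure" where
  "hausdorff_measure d = measure_of UNIV (sets borel) (hausdorff_outer_measure d)"

definition surface_measure :: "(real ^ 'n::finite) set \<Rightarrow> (real ^ 'n) measure" where
  "surface_measure K = restrict_space (hausdorff_measure (CARD('n) - 1)) (frontier K)"


section \<open>Outer unit normal and generalised Gaussian curvature\<close>

definition is_outer_unit_normal :: "'a::euclidean_space set \<Rightarrow> 'a \<Rightarrow> 'a \<Rightarrow> bool" where
  "is_outer_unit_normal K x u \<longleftrightarrow> norm u = 1 \<and> (\<forall>y\<in>K. (y - x) \<bullet> u \<le> 0)"

definition smooth_boundary_point :: "'a::euclidean_space set \<Rightarrow> 'a \<Rightarrow> bool" where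
  "smooth_boundary_point K x \<longleftrightarrow> x \<in> frontier K \<and> (\<exists>!u. is_outer_unit_normal K x u)"

definition outer_normal :: "'a::euclidean_space set \<Rightarrow> 'a \<Rightarrow> 'a" where
  "outer_normal K x = (THE u. is_outer_unit_normal K x u)"

text \<open>At a smooth boundary point \<open>x\<close> with outer normal \<open>u\<close>, the boundary of \<open>K\<close> near \<open>x\<close> is
  \<open>{x + y - tangent_graph K x y *\<^sub>R u | y}\<close> with \<open>y\<close> small and orthogonal to \<open>u\<close>; the function
  \<open>tangent_graph K x\<close> is convex and nonnegative there, and vanishes at \<open>0\<close>.\<close>

definition tangent_graph :: "'a::euclidean_space set \<Rightarrow> 'a \<Rightarrow> 'a \<Rightarrow> real" where
  "tangent_graph K x y = Inf {s. x + y - s *\<^sub>R outer_normal K x \<in> K}"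

text \<open>Second-order differentiability in the sense of Alexandrov. The second fundamental form on
  the tangent hyperplane is represented by the symmetric matrix \<open>A\<close> that extends it by \<open>0\<close> along
  the normal.\<close>

definition has_second_fundamental_form ::
  "(real ^ 'n::finite) set \<Rightarrow> real ^ 'n \<Rightarrow> real ^ 'n ^ 'n \<Rightarrow> bool" where
  "has_second_fundamental_form K x A \<longleftrightarrow>
     smooth_boundary_point K x \<and> transpose A = A \<and> A *v outer_normal K x = 0 \<and>
     ((\<lambda>y. (tangent_graph K x y - (1/2) * (y \<bullet> (A *v y))) / (norm y)\<^sup>2) \<longlongrightarrow> 0)
        (at 0 within {y. y \<bullet> outer_normal K x = 0})"

text \<open>Adding the projection matrix onto the normal direction turns the determinant on the tangent
  hyperplane, which is the product of the principal curvatures, into a determinant on the whole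
  space.\<close>

definition has_gauss_curvature :: "(real ^ 'n::finite) set \<Rightarrow> real ^ 'n \<Rightarrow> real \<Rightarrow> bool" where
  "has_gauss_curvature K x k \<longleftrightarrow>
     (\<exists>A. has_second_fundamental_form K x A \<and>
          k = det (A + (\<chi> i j. outer_normal K x $ i * outer_normal K x $ j)))"

definition gauss_curvature :: "(real ^ 'n::finite) set \<Rightarrow> real ^ 'n \<Rightarrow> real" where
  "gauss_curvature K x = (THE k. has_gauss_curvature K x k)"

definition positive_gauss_curvature_ae :: "(real ^ 'n::finite) set \<Rightarrow> bool" where
  "positive_gauss_curvature_ae K \<longleftrightarrow>
     (AE x in surface_measure K. \<exists>k>0. has_gauss_curvature K x k)"


section \<open>The affine surface area\<close>

text \<open>Elements of the class are total functions of which only the values on \<open>{0<..}\<close> matter.\<close>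

definition Conv_class :: "(real \<Rightarrow> real) set" where
  "Conv_class = {\<psi>. (\<forall>t>0. \<psi> t > 0) \<and>
     (\<psi> constant_on {0<..} \<or>
      convex_on {0<..} \<psi> \<and> filterlim \<psi> at_top (at_right 0) \<and> (\<psi> \<longlongrightarrow> 0) at_top)}"

text \<open>The value at \<open>0\<close> is the constant itself for constant functions, and \<open>\<infinity>\<close> otherwise.\<close>

definition psi_ext :: "(real \<Rightarrow> real) \<Rightarrow> real \<Rightarrow> ennreal" where
  "psi_ext \<psi> t =
     (if t > 0 then ennreal (\<psi> t) else if \<psi> constant_on {0<..} then ennreal (\<psi> 1) else \<infinity>)"

definition as_psi :: "(real \<Rightarrow> real) \<Rightarrow> (real ^ 'n::finite) set \<Rightarrow> ennreal" where
  "as_psi \<psi> K =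
     (\<integral>\<^sup>+ x. psi_ext \<psi> (gauss_curvature K x / (x \<bullet> outer_normal K x) ^ (CARD('n) + 1))
             * ennreal (x \<bullet> outer_normal K x) \<partial>surface_measure K)"

end

theory Submission
  imports Defs
begin

text \<open>Over the relative interior of the common projection the boundaries of the bodies are graphs of
  concave functions \<open>f\<close>. If \<open>f\<close> has gradient \<open>p\<close> and Hessian \<open>-B\<close> at \<open>x\<close>, then
  \<open>\<kappa> / \<langle>x, N\<rangle>\<^sup>n\<^sup>+\<^sup>1 = det B / s\<^sup>n\<^sup>+\<^sup>1\<close> and \<open>\<langle>x, N\<rangle> dS = s dx\<close> with \<open>s = f - \<langle>p, x\<rangle>\<close>, so that a body contributes
  \<open>\<integral> \<psi> (det B / s\<^sup>n\<^sup>+\<^sup>1) s dx\<close>. Both \<open>s\<close> and \<open>B\<close> are linear in \<open>f\<close>. The integrand is convex in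
  \<open>(B, s)\<close>: it is the perspective of the convex decreasing function \<open>G\<close> evaluated at the concave
  function \<open>det\<close> to the power \<open>1 / (n + 1)\<close>. The part of the boundary over the relative boundary of
  the projection is null, because positive curvature rules out vertical segments.

  The second-order differentiability of \<open>f\<close> almost everywhere is read off from the existence of the
  curvature, so Alexandrov's theorem is not needed. The normalisation of the Hausdorff measure is
  irrelevant, since only the ratio of the measures of a hyperplane piece and of its shear enters.
  The Hessian is represented by an \<open>n \<times> n\<close> matrix \<open>B\<close> with \<open>B u = 0\<close>; adding \<open>u u\<^sup>T\<close> gives the
  determinant on \<open>u\<^sup>\<bottom>\<close>.\<close>

section \<open>Hausdorff measure\<close>

text \<open>A graph combination is linear in coordinates over \<open>u\<^sup>\<bottom>\<close>,
  while curvature is defined in coordinates over the tangent hyperplane at each point. To pass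
  between the two is the main obstacle; \<open>contact\<close> states the expansion of the boundary
  without a parametrisation and mediates in both directions. Nothing is assumed about the curvature
  of the combination: its expansion comes from those of \<open>K1\<close> and \<open>K2\<close>, and
  its curvature is deduced.

  The dilates by \<open>a + b\<close> have a simple origin: with the weights
  \<open>a / (a + b)\<close> and \<open>b / (a + b)\<close>, the matrices
  \<open>(a + b) B\<^sub>i + u u\<^sup>T\<close> average to
  \<open>a B\<^sub>1 + b B\<^sub>2 + u u\<^sup>T\<close>.

  Gradients exist almost everywhere because the curvature does, so the area formula follows by
  cutting the graph into countably many nearly affine pieces; on these, uniqueness of translation
  invariant measures supplies the area factor. Curvature and normal are description operators, so
  Borel selections made of limits of difference quotients stand in for them. The lower boundary is
  the upper boundary in direction \<open>- u\<close>.\<close>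

lemma hausdorff_weight_empty [simp]: "hausdorff_weight d {} = 0"
  by (simp add: hausdorff_weight_def)

lemma hausdorff_premeasure_le:
  assumes "A \<subseteq> (\<Union>i. U i)" "\<And>i. bounded (U i)" "\<And>i. diameter (U i) \<le> \<delta>"
  shows "hausdorff_premeasure d \<delta> A \<le> (\<Sum>i. hausdorff_weight d (U i))"
  unfolding hausdorff_premeasure_def by (rule INF_lower) (use assms in auto)

lemma hausdorff_premeasure_mono:
  "A \<subseteq> B \<Longrightarrow> hausdorff_premeasure d \<delta> A \<le> hausdorff_premeasure d \<delta> B"
  unfolding hausdorff_premeasure_def by (rule INF_superset_mono) auto

lemma hausdorff_premeasure_antimono:
  "\<delta> \<le> \<delta>' \<Longrightarrow> hausdorff_premeasure d \<delta>' A \<le> hausdorff_premeasure d \<delta> A"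
  unfolding hausdorff_premeasure_def by (rule INF_superset_mono) (auto intro: order_trans)

lemma hausdorff_premeasure_empty [simp]:
  assumes "\<delta> > 0"
  shows "hausdorff_premeasure d \<delta> {} = 0"
  using hausdorff_premeasure_le[of "{}" "\<lambda>_. {}" \<delta> d] assms by simp

lemma hausdorff_premeasure_approx:
  assumes "hausdorff_premeasure d \<delta> A < c"
  obtains U where "A \<subseteq> (\<Union>i. U i)" "\<And>i. bounded (U i)" "\<And>i. diameter (U i) \<le> \<delta>"
    "(\<Sum>i. hausdorff_weight d (U i)) < c"
  using assms that unfolding hausdorff_premeasure_def INF_less_iff by auto

text \<open>Each \<open>A i\<close> gets a cover that is optimal up to \<open>e / 2^(i+1)\<close>,
  and the double sequence of covering sets is enumerated by \<open>prod_decode\<close>. Assuming the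
  right-hand side finite makes every infimum strictly smaller than its enlargement, so that such
  covers exist.\<close>

lemma hausdorff_premeasure_countably_subadditive:
  "hausdorff_premeasure d \<delta> (\<Union>i::nat. A i) \<le> (\<Sum>i. hausdorff_premeasure d \<delta> (A i))"
proof (rule ennreal_le_epsilon)
  fix e :: real
  assume fin: "(\<Sum>i. hausdorff_premeasure d \<delta> (A i)) < top" and e: "e > 0"
  have "\<exists>U. A i \<subseteq> (\<Union>j. U j) \<and> (\<forall>j. bounded (U j) \<and> diameter (U j) \<le> \<delta>) \<and>
      (\<Sum>j. hausdorff_weight d (U j)) \<le> hausdorff_premeasure d \<delta> (A i) + ennreal (e * (1/2)^Suc i)" for i
  proof -
    have "hausdorff_premeasure d \<delta> (A i) < top"
      using fin by (metis ennreal_suminf_lessD)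
    then have "hausdorff_premeasure d \<delta> (A i)
        < hausdorff_premeasure d \<delta> (A i) + ennreal (e * (1/2)^Suc i)"
      using e ennreal_add_left_cancel_less[of "hausdorff_premeasure d \<delta> (A i)" 0 "ennreal (e * (1/2)^Suc i)"]
      by simp
    then show ?thesis
      by (rule hausdorff_premeasure_approx) (metis order.strict_implies_order)
  qed
  then obtain U where U: "\<And>i. A i \<subseteq> (\<Union>j. U i j)" "\<And>i j. bounded (U i j)"
    "\<And>i j. diameter (U i j) \<le> \<delta>"
    "\<And>i. (\<Sum>j. hausdorff_weight d (U i j)) \<le> hausdorff_premeasure d \<delta> (A i) + ennreal (e * (1/2)^Suc i)"
    by metis
  define V where "V k = case_prod U (prod_decode k)" for k
  have "(\<Union>i. A i) \<subseteq> (\<Union>k. V k)"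
  proof
    fix x assume "x \<in> (\<Union>i. A i)"
    then obtain i j where "x \<in> U i j" using U(1) by blast
    then have "x \<in> V (prod_encode (i, j))" by (simp add: V_def)
    then show "x \<in> (\<Union>k. V k)" by blast
  qed
  then have "hausdorff_premeasure d \<delta> (\<Union>i. A i) \<le> (\<Sum>k. hausdorff_weight d (V k))"
    using U by (intro hausdorff_premeasure_le) (auto simp: V_def split: prod.split)
  also have "\<dots> = (\<Sum>i. \<Sum>j. hausdorff_weight d (U i j))"
  proof -
    have "(\<Sum>k. (\<lambda>(i,j). hausdorff_weight d (U i j)) (prod_decode k)) = (\<Sum>i. \<Sum>j. hausdorff_weight d (U i j))"
      by (rule suminf_ennreal_2dimen) simp
    then show ?thesis by (simp add: V_def split_beta)
  qed
  also have "\<dots> \<le> (\<Sum>i. hausdorff_premeasure d \<delta> (A i) + ennreal (e * (1/2)^Suc i))"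
    by (intro suminf_le U) auto
  also have "\<dots> = (\<Sum>i. hausdorff_premeasure d \<delta> (A i)) + (\<Sum>i. ennreal (e * (1/2)^Suc i))"
    by (intro suminf_add[symmetric]) auto
  also have "(\<Sum>i. ennreal (e * (1/2)^Suc i)) = ennreal e"
  proof -
    have "(\<lambda>i. e * (1/2)^Suc i) sums (e * 1)"
      by (intro sums_mult power_half_series)
    then show ?thesis using e by (intro suminf_ennreal_eq) auto
  qed
  finally show "hausdorff_premeasure d \<delta> (\<Union>i. A i)
      \<le> (\<Sum>i. hausdorff_premeasure d \<delta> (A i)) + ennreal e" .
qed

lemma hausdorff_premeasure_le_outer:
  "\<delta> > 0 \<Longrightarrow> hausdorff_premeasure d \<delta> A \<le> hausdorff_outer_measure d A"
  unfolding hausdorff_outer_measure_def by (rule SUP_upper) auto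

lemma hausdorff_outer_measure_leI:
  assumes "\<And>\<delta>. \<delta> > 0 \<Longrightarrow> hausdorff_premeasure d \<delta> A \<le> c"
  shows "hausdorff_outer_measure d A \<le> c"
  unfolding hausdorff_outer_measure_def by (rule SUP_least) (use assms in auto)

text \<open>Only small scales matter, since the premeasure decreases in the scale.\<close>

lemma hausdorff_outer_measure_leI_small:
  assumes "\<eta> > 0" "\<And>\<delta>. \<delta> > 0 \<Longrightarrow> \<delta> < \<eta> \<Longrightarrow> hausdorff_premeasure d \<delta> A \<le> c"
  shows "hausdorff_outer_measure d A \<le> c"
proof (rule hausdorff_outer_measure_leI)
  fix \<delta> :: real assume "\<delta> > 0"
  define \<delta>' where "\<delta>' = min \<delta> (\<eta> / 2)"
  have "hausdorff_premeasure d \<delta> A \<le> hausdorff_premeasure d \<delta>' A"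
    by (rule hausdorff_premeasure_antimono) (simp add: \<delta>'_def)
  also have "\<dots> \<le> c" using assms \<open>\<delta> > 0\<close> by (auto simp: \<delta>'_def)
  finally show "hausdorff_premeasure d \<delta> A \<le> c" .
qed

lemma hausdorff_outer_measure_mono:
  "A \<subseteq> B \<Longrightarrow> hausdorff_outer_measure d A \<le> hausdorff_outer_measure d B"
  unfolding hausdorff_outer_measure_def by (rule SUP_mono) (use hausdorff_premeasure_mono in blast)

lemma hausdorff_outer_measure_empty [simp]: "hausdorff_outer_measure d {} = 0"
  using hausdorff_outer_measure_leI[of d "{}" 0] by simp

lemma hausdorff_outer_measure_countably_subadditive:
  "hausdorff_outer_measure d (\<Union>i::nat. A i) \<le> (\<Sum>i. hausdorff_outer_measure d (A i))"
proof (rule hausdorff_outer_measure_leI)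
  fix \<delta> :: real assume "\<delta> > 0"
  have "hausdorff_premeasure d \<delta> (\<Union>i::nat. A i) \<le> (\<Sum>i. hausdorff_premeasure d \<delta> (A i))"
    by (rule hausdorff_premeasure_countably_subadditive)
  also have "\<dots> \<le> (\<Sum>i. hausdorff_outer_measure d (A i))"
    using \<open>\<delta> > 0\<close> by (intro suminf_le hausdorff_premeasure_le_outer) auto
  finally show "hausdorff_premeasure d \<delta> (\<Union>i::nat. A i) \<le> (\<Sum>i. hausdorff_outer_measure d (A i))" .
qed

section \<open>Caratheodory measurability of Borel sets\<close>

lemma outer_measure_space_hausdorff: "outer_measure_space UNIV (hausdorff_outer_measure d)"
  unfolding outer_measure_space_def positive_def increasing_def countably_subadditive_def
  using hausdorff_outer_measure_mono hausdorff_outer_measure_countably_subadditive by auto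

lemma hausdorff_outer_measure_Un:
  "hausdorff_outer_measure d (A \<union> B) \<le> hausdorff_outer_measure d A + hausdorff_outer_measure d B"
proof -
  have "hausdorff_outer_measure d (A \<union> B) = hausdorff_outer_measure d (\<Union>i::nat. if i = 0 then A else if i = 1 then B else {})"
    by (rule arg_cong[where f="hausdorff_outer_measure d"]) (auto split: if_splits)
  also have "\<dots> \<le> (\<Sum>i. hausdorff_outer_measure d (if i = 0 then A else if i = 1 then B else {}))"
    by (rule hausdorff_outer_measure_countably_subadditive)
  also have "\<dots> = (\<Sum>i\<in>{0,1::nat}. hausdorff_outer_measure d (if i = 0 then A else if i = 1 then B else {}))"
    by (rule suminf_finite) auto
  finally show ?thesis by simp
qed

text \<open>A covering set of diameter less than the distance of two sets meets at most one of them.\<close>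

lemma hausdorff_outer_measure_separated:
  assumes "\<eta> > 0" and sep: "\<And>x y. x \<in> A \<Longrightarrow> y \<in> B \<Longrightarrow> dist x y \<ge> \<eta>"
  shows "hausdorff_outer_measure d A + hausdorff_outer_measure d B \<le> hausdorff_outer_measure d (A \<union> B)"
proof -
  have pre: "hausdorff_premeasure d \<delta> A + hausdorff_premeasure d \<delta> B \<le> hausdorff_premeasure d \<delta> (A \<union> B)"
    if \<delta>: "\<delta> < \<eta>" for \<delta>
    unfolding hausdorff_premeasure_def[of d \<delta> "A \<union> B"]
  proof (rule INF_greatest, clarify)
    fix U :: "nat \<Rightarrow> 'a set" assume cov: "A \<union> B \<subseteq> (\<Union>i. U i)"
      and bd: "\<forall>i. bounded (U i) \<and> diameter (U i) \<le> \<delta>"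
    define UA where "UA i = (if U i \<inter> A = {} then {} else U i)" for i
    define UB where "UB i = (if U i \<inter> A = {} then U i else {})" for i
    have disj: "U i \<inter> B = {}" if UA: "U i \<inter> A \<noteq> {}" for i
    proof (rule ccontr)
      assume "U i \<inter> B \<noteq> {}"
      then obtain x y where xy: "x \<in> U i" "x \<in> A" "y \<in> U i" "y \<in> B" using UA by blast
      then have "dist x y \<le> \<delta>" using bd diameter_bounded_bound order_trans by blast
      with sep[OF xy(2,4)] \<delta> show False by simp
    qed
    \<comment> \<open>Empty sets replace the discarded covering sets; their diameter 0 has to
      respect the scale.\<close>
    have b2: "\<delta> \<ge> 0" using bd diameter_ge_0 order_trans by blast
    have "A \<subseteq> (\<Union>i. UA i)"
    proof
      fix x assume x: "x \<in> A"
      then obtain i where "x \<in> U i" using cov by blast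
      then have "x \<in> UA i" using x by (auto simp: UA_def)
      then show "x \<in> (\<Union>i. UA i)" by blast
    qed
    moreover have "B \<subseteq> (\<Union>i. UB i)"
    proof
      fix x assume x: "x \<in> B"
      then obtain i where "x \<in> U i" using cov by blast
      then have "x \<in> UB i" using x disj[of i] by (auto simp: UB_def)
      then show "x \<in> (\<Union>i. UB i)" by blast
    qed
    ultimately have "hausdorff_premeasure d \<delta> A + hausdorff_premeasure d \<delta> B
       \<le> (\<Sum>i. hausdorff_weight d (UA i)) + (\<Sum>i. hausdorff_weight d (UB i))"
      using bd b2 by (intro add_mono hausdorff_premeasure_le) (auto simp: UA_def UB_def)
    also have "\<dots> = (\<Sum>i. hausdorff_weight d (UA i) + hausdorff_weight d (UB i))"
      by (intro suminf_add) auto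
    also have "\<dots> = (\<Sum>i. hausdorff_weight d (U i))"
      by (intro suminf_cong) (auto simp: UA_def UB_def)
    finally show "hausdorff_premeasure d \<delta> A + hausdorff_premeasure d \<delta> B
       \<le> (\<Sum>i. hausdorff_weight d (U i))" .
  qed
  have *: "hausdorff_premeasure d \<delta> A + hausdorff_premeasure d \<delta>' B \<le> hausdorff_outer_measure d (A \<union> B)"
    if "\<delta> > 0" "\<delta>' > 0" for \<delta> \<delta>'
  proof -
    \<comment> \<open>The two suprema are taken one after the other over independent scales; a
      common finer scale below \<open>\<eta>\<close> dominates both premeasures.\<close>
    define e where "e = min (min \<delta> \<delta>') (\<eta>/2)"
    have "hausdorff_premeasure d \<delta> A + hausdorff_premeasure d \<delta>' B
       \<le> hausdorff_premeasure d e A + hausdorff_premeasure d e B"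
      by (intro add_mono hausdorff_premeasure_antimono) (auto simp: e_def)
    also have "\<dots> \<le> hausdorff_premeasure d e (A \<union> B)" using assms by (intro pre) (auto simp: e_def)
    also have "\<dots> \<le> hausdorff_outer_measure d (A \<union> B)"
      using assms that by (intro hausdorff_premeasure_le_outer) (auto simp: e_def)
    finally show ?thesis .
  qed
  have "hausdorff_outer_measure d A + hausdorff_outer_measure d B
      = (SUP \<delta>\<in>{0<..}. hausdorff_premeasure d \<delta> A + hausdorff_outer_measure d B)"
    unfolding hausdorff_outer_measure_def[of d A] by (rule ennreal_SUP_add_left[symmetric]) simp
  also have "\<dots> \<le> hausdorff_outer_measure d (A \<union> B)"
  proof (rule SUP_least)
    fix \<delta> :: real assume "\<delta> \<in> {0<..}"
    have "hausdorff_premeasure d \<delta> A + hausdorff_outer_measure d B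
        = (SUP \<delta>'\<in>{0<..}. hausdorff_premeasure d \<delta> A + hausdorff_premeasure d \<delta>' B)"
      unfolding hausdorff_outer_measure_def[of d B] by (rule ennreal_SUP_add_right) simp
    also have "\<dots> \<le> hausdorff_outer_measure d (A \<union> B)"
      using * \<open>\<delta> \<in> {0<..}\<close> by (intro SUP_least) auto
    finally show "hausdorff_premeasure d \<delta> A + hausdorff_outer_measure d B
        \<le> hausdorff_outer_measure d (A \<union> B)" .
  qed
  finally show ?thesis .
qed

text \<open>Finiteness allows the tail to be computed in the reals, where it is the difference of
  the sum and a partial sum.\<close>

lemma ennreal_suminf_tail_tendsto:
  fixes a :: "nat \<Rightarrow> ennreal"
  assumes "(\<Sum>k. a k) < top"
  shows "(\<lambda>k. \<Sum>j. a (j + k)) \<longlonglongrightarrow> 0"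
proof -
  have lt: "a k < top" for k using assms by (metis ennreal_suminf_lessD)
  define b where "b k = enn2real (a k)" for k
  have ab: "a = (\<lambda>k. ennreal (b k))" and b0: "b k \<ge> 0" for k
    using lt by (auto simp: b_def fun_eq_iff)
  have sb: "summable b"
    using assms b0 unfolding ab by (intro summable_suminf_not_top) (auto simp: less_top)
  have "(\<lambda>k. ennreal (\<Sum>j. b (j + k))) \<longlonglongrightarrow> ennreal 0"
  proof (rule tendsto_ennrealI)
    have "(\<lambda>k. suminf b - (\<Sum>i<k. b i)) \<longlonglongrightarrow> suminf b - suminf b"
      by (intro tendsto_diff tendsto_const summable_LIMSEQ sb)
    then show "(\<lambda>k. \<Sum>j. b (j + k)) \<longlonglongrightarrow> 0"
      by (simp add: suminf_minus_initial_segment[OF sb])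
  qed
  moreover have "(\<Sum>j. a (j + k)) = ennreal (\<Sum>j. b (j + k))" for k
    unfolding ab by (rule suminf_ennreal_eq) (auto intro: b0 summable_sums summable_ignore_initial_segment sb)
  ultimately show ?thesis by simp
qed

text \<open>Caratheodory's criterion for metric outer measures: the shells at distance between
  \<open>1/(k+2)\<close> and \<open>1/(k+1)\<close> from a closed set have summable measure, since shells with
  indices differing by at least two are separated.\<close>

lemma hausdorff_closed_lambda_system:
  fixes C :: "'a::metric_space set"
  assumes "closed C"
  shows "C \<in> lambda_system UNIV UNIV (hausdorff_outer_measure d)"
proof -
  let ?\<mu> = "hausdorff_outer_measure d"
  have main: "?\<mu> (C \<inter> X) + ?\<mu> (X - C) \<le> ?\<mu> X" if fin: "?\<mu> X < top" and ne: "C \<noteq> {}" for X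
  proof -
    define r :: "nat \<Rightarrow> real" where "r k = 1 / real (Suc k)" for k
    have rpos: "r k > 0" for k by (simp add: r_def)
    have rdec: "r (Suc k) < r k" for k by (simp add: r_def field_simps)
    have rmono: "r j \<le> r k" if "k \<le> j" for j k
      using that by (simp add: r_def field_simps)
    define E where "E k = {x \<in> X - C. infdist x C \<ge> r k}" for k
    define S where "S k = {x \<in> X - C. r (Suc k) \<le> infdist x C \<and> infdist x C < r k}" for k
    have inf_pos: "infdist x C > 0" if "x \<notin> C" for x
      using assms ne that by (metis infdist_pos_not_in_closed)
    have ex: "\<exists>k. r k \<le> infdist x C" if "x \<notin> C" for x
      using inf_pos[OF that] unfolding r_def
      by (metis less_imp_le nat_approx_posE)
    have E_sep: "?\<mu> (C \<inter> X) + ?\<mu> (E k) \<le> ?\<mu> X" for k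
    proof -
      have "?\<mu> (C \<inter> X) + ?\<mu> (E k) \<le> ?\<mu> ((C \<inter> X) \<union> E k)"
      proof (rule hausdorff_outer_measure_separated[of "r k"])
        fix x y assume "x \<in> C \<inter> X" "y \<in> E k"
        then show "r k \<le> dist x y"
          using infdist_le[of x C y] by (auto simp: E_def dist_commute)
      qed (rule rpos)
      also have "\<dots> \<le> ?\<mu> X" by (rule hausdorff_outer_measure_mono) (auto simp: E_def)
      finally show ?thesis .
    qed
    have cover: "X - C \<subseteq> E k \<union> (\<Union>j. S (j + k))" for k
    proof
      fix x assume x: "x \<in> X - C"
      show "x \<in> E k \<union> (\<Union>j. S (j + k))"
      proof (cases "infdist x C \<ge> r k")
        case False
        obtain l where l: "r l \<le> infdist x C" "\<And>i. i < l \<Longrightarrow> \<not> r i \<le> infdist x C"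
          using ex[of x] x exists_least_iff[of "\<lambda>k. r k \<le> infdist x C"] by auto
        have "k < l" using l(1) False rmono[of l k] by (meson not_le order_trans)
        then obtain j where j: "l = Suc (j + k)" using less_imp_Suc_add by (metis add.commute)
        then have "x \<in> S (j + k)" using l x by (auto simp: S_def not_le)
        then show ?thesis by blast
      qed (use x in \<open>auto simp: E_def\<close>)
    qed
    \<comment> \<open>Shells of equal parity (\<open>i = 0\<close> even, \<open>i = 1\<close> odd)
      are separated from each other, so their measures add up inside \<open>X\<close>; the two
      parities together give twice the measure of \<open>X\<close> as a bound for the whole
      series.\<close>
    have par: "(\<Sum>j<N. ?\<mu> (S (2 * j + i))) \<le> ?\<mu> X" for N i
    proof -
      have "(\<Sum>j<N. ?\<mu> (S (2 * j + i))) \<le> ?\<mu> (\<Union>j<N. S (2 * j + i))"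
      proof (induction N)
        case (Suc N)
        have "?\<mu> (\<Union>j<N. S (2 * j + i)) + ?\<mu> (S (2 * N + i)) \<le> ?\<mu> ((\<Union>j<N. S (2 * j + i)) \<union> S (2 * N + i))"
        proof (rule hausdorff_outer_measure_separated)
          fix x y assume "x \<in> (\<Union>j<N. S (2 * j + i))" and y: "y \<in> S (2 * N + i)"
          then obtain j where j: "j < N" "x \<in> S (2 * j + i)" by blast
          have "infdist x C \<le> infdist y C + dist x y" by (rule infdist_triangle)
          moreover have "r (2*N+i-1) \<le> r (Suc (2*j+i))" using j by (intro rmono) auto
          \<comment> \<open>Earlier shells of the same parity stay at distance at least
            \<open>r (2*N+i-1)\<close> from \<open>C\<close>, the new one below
            \<open>r (2*N+i)\<close>; the gap separates them. For \<open>N = 0\<close> the union is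
            empty and any positive number serves.\<close>
          ultimately show "(if N = 0 then 1 else r (2*N+i-1) - r (2*N+i)) \<le> dist x y"
            using j y by (auto simp: S_def)
        next
          show "(if N = 0 then 1 else r (2*N+i-1) - r (2*N+i)) > 0"
            using rdec[of "2*N+i-1"] by (cases N) auto
        qed
        then show ?case using Suc by (simp add: lessThan_Suc Un_commute add.commute)
           (meson add_left_mono order_trans)
      qed simp
      also have "\<dots> \<le> ?\<mu> X" by (rule hausdorff_outer_measure_mono) (auto simp: S_def)
      finally show ?thesis .
    qed
    have "(\<Sum>k. ?\<mu> (S k)) \<le> 2 * ?\<mu> X"
    proof (rule suminf_le_const)
      show "summable (\<lambda>k. ?\<mu> (S k))" by simp
      fix N
      have "(\<Sum>k<N. ?\<mu> (S k)) \<le> (\<Sum>k<2*N. ?\<mu> (S k))" by (rule sum_mono2) auto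
      also have "\<dots> = (\<Sum>j<N. ?\<mu> (S (2 * j + 0))) + (\<Sum>j<N. ?\<mu> (S (2 * j + 1)))"
        by (induction N) (auto simp: algebra_simps)
      also have "\<dots> \<le> ?\<mu> X + ?\<mu> X" by (intro add_mono par)
      finally show "(\<Sum>k<N. ?\<mu> (S k)) \<le> 2 * ?\<mu> X" by (simp add: mult_2)
    qed
    then have sfin: "(\<Sum>k. ?\<mu> (S k)) < top"
      using fin by (metis ennreal_mult_less_top ennreal_numeral_less_top le_less_trans)
    have tail: "(\<lambda>k. (\<Sum>j. ?\<mu> (S (j + k)))) \<longlonglongrightarrow> 0"
      by (rule ennreal_suminf_tail_tendsto) (use sfin in simp)
    have bound: "?\<mu> (C \<inter> X) + ?\<mu> (X - C) \<le> ?\<mu> X + (\<Sum>j. ?\<mu> (S (j + k)))" for k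
    proof -
      have "?\<mu> (X - C) \<le> ?\<mu> (E k \<union> (\<Union>j. S (j + k)))"
        by (rule hausdorff_outer_measure_mono[OF cover])
      also have "\<dots> \<le> ?\<mu> (E k) + ?\<mu> (\<Union>j. S (j + k))" by (rule hausdorff_outer_measure_Un)
      also have "\<dots> \<le> ?\<mu> (E k) + (\<Sum>j. ?\<mu> (S (j + k)))"
        by (intro add_left_mono hausdorff_outer_measure_countably_subadditive)
      finally have "?\<mu> (C \<inter> X) + ?\<mu> (X - C) \<le> ?\<mu> (C \<inter> X) + (?\<mu> (E k) + (\<Sum>j. ?\<mu> (S (j + k))))"
        by (rule add_left_mono)
      also have "\<dots> = (?\<mu> (C \<inter> X) + ?\<mu> (E k)) + (\<Sum>j. ?\<mu> (S (j + k)))" by (simp add: add.assoc)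
      also have "\<dots> \<le> ?\<mu> X + (\<Sum>j. ?\<mu> (S (j + k)))" by (intro add_right_mono E_sep)
      finally show ?thesis .
    qed
    have "(\<lambda>k. ?\<mu> X + (\<Sum>j. ?\<mu> (S (j + k)))) \<longlonglongrightarrow> ?\<mu> X + 0"
      by (intro tendsto_add tail tendsto_const)
    then show ?thesis
      using LIMSEQ_le_const bound by fastforce
  qed
  have "?\<mu> (C \<inter> X) + ?\<mu> ((UNIV - C) \<inter> X) = ?\<mu> X" for X
  proof (rule antisym)
    have eq: "(UNIV - C) \<inter> X = X - C" by blast
    show "?\<mu> (C \<inter> X) + ?\<mu> ((UNIV - C) \<inter> X) \<le> ?\<mu> X"
      unfolding eq using main[of X] by (cases "C = {}"; cases "?\<mu> X = top") (auto simp: top.not_eq_extremum)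
    have "?\<mu> X = ?\<mu> ((C \<inter> X) \<union> (X - C))" by (rule arg_cong[where f="?\<mu>"]) blast
    also have "\<dots> \<le> ?\<mu> (C \<inter> X) + ?\<mu> (X - C)" by (rule hausdorff_outer_measure_Un)
    finally show "?\<mu> X \<le> ?\<mu> (C \<inter> X) + ?\<mu> ((UNIV - C) \<inter> X)" unfolding eq .
  qed
  then show ?thesis by (auto simp: lambda_system_def)
qed

text \<open>Caratheodory's theorem gives a measure on the measurable sets of the outer measure;
  these contain the closed sets, hence all Borel sets. This is what gives \<open>measure_of\<close>
  its intended value in \<open>hausdorff_measure\<close>.\<close>

lemma measure_space_hausdorff:
  "measure_space UNIV (sets borel) (hausdorff_outer_measure d :: 'a::metric_space set \<Rightarrow> ennreal)"
proof -
  let ?L = "lambda_system UNIV UNIV (hausdorff_outer_measure d :: 'a set \<Rightarrow> ennreal)"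
  have ms: "measure_space UNIV ?L (hausdorff_outer_measure d)"
    using sigma_algebra.caratheodory_lemma[of "UNIV :: 'a set" UNIV "hausdorff_outer_measure d"]
      outer_measure_space_hausdorff by (metis Pow_UNIV sigma_algebra_Pow)
  then interpret L: sigma_algebra UNIV ?L by (simp add: measure_space_def)
  have "sigma_sets UNIV {S :: 'a set. closed S} \<subseteq> ?L"
    by (rule L.sigma_sets_subset) (auto intro: hausdorff_closed_lambda_system)
  then have "sets (borel :: 'a measure) \<subseteq> ?L" by (simp add: borel_eq_closed)
  then show ?thesis
    using measure_down[OF ms] by (metis sets.sigma_algebra_axioms space_borel)
qed

lemma sets_hausdorff_measure [simp, measurable_cong]: "sets (hausdorff_measure d) = sets borel"
  unfolding hausdorff_measure_def by (metis sets.sigma_sets_eq space_borel sets_measure_of sets.space_closed)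

lemma space_hausdorff_measure [simp]: "space (hausdorff_measure d) = UNIV"
  by (metis sets_eq_imp_space_eq sets_hausdorff_measure space_borel)

lemma emeasure_hausdorff_measure:
  "A \<in> sets borel \<Longrightarrow> emeasure (hausdorff_measure d) A = hausdorff_outer_measure d A"
  unfolding hausdorff_measure_def
  using measure_space_hausdorff[of d]
  by (intro emeasure_measure_of_sigma) (auto simp: measure_space_def)

section \<open>Lipschitz images and null sets\<close>

lemma hausdorff_weight_lipschitz_image:
  assumes "L > 0" "\<And>x y. x \<in> U \<Longrightarrow> y \<in> U \<Longrightarrow> dist (f x) (f y) \<le> L * dist x y" "bounded U"
  shows "bounded (f ` U)" "diameter (f ` U) \<le> L * diameter U"
    "hausdorff_weight d (f ` U) \<le> ennreal (L ^ d) * hausdorff_weight d U"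
proof -
  have d: "dist (f x) (f y) \<le> L * diameter U" if "x \<in> U" "y \<in> U" for x y
  proof -
    have "dist (f x) (f y) \<le> L * dist x y" by (rule assms(2)[OF that])
    also have "\<dots> \<le> L * diameter U"
      using assms(1,3) that by (intro mult_left_mono diameter_bounded_bound) auto
    finally show ?thesis .
  qed
  show b: "bounded (f ` U)"
  proof (cases "U = {}")
    case False
    then obtain z where "z \<in> U" by blast
    then show ?thesis using d by (auto simp: bounded_def)
  qed simp
  show di: "diameter (f ` U) \<le> L * diameter U"
  proof (cases "U = {}")
    case False
    have "(SUP (x, y)\<in>f ` U \<times> f ` U. dist x y) \<le> L * diameter U"
      using False d by (intro cSUP_least) auto
    then show ?thesis using False by (simp add: diameter_def)
  qed simp
  show "hausdorff_weight d (f ` U) \<le> ennreal (L ^ d) * hausdorff_weight d U"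
  proof (cases "U = {}")
    case False
    have "(diameter (f ` U) / 2) ^ d \<le> (L * diameter U / 2) ^ d"
      using di diameter_ge_0[OF b] by (intro power_mono divide_right_mono) auto
    also have "\<dots> = L ^ d * (diameter U / 2) ^ d"
      by (metis power_mult_distrib times_divide_eq_right)
    finally have "(diameter (f ` U) / 2) ^ d \<le> L ^ d * (diameter U / 2) ^ d" .
    then have "unit_ball_vol (real d) * (diameter (f ` U) / 2) ^ d
        \<le> unit_ball_vol (real d) * (L ^ d * (diameter U / 2) ^ d)"
      by (intro mult_left_mono) auto
    then have "ennreal (unit_ball_vol (real d) * (diameter (f ` U) / 2) ^ d)
       \<le> ennreal (L ^ d * (unit_ball_vol (real d) * (diameter U / 2) ^ d))"
      by (intro ennreal_leI) (simp add: algebra_simps)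
    then show ?thesis
      using False \<open>L > 0\<close> diameter_ge_0[OF assms(3)]
      by (simp add: hausdorff_weight_def ennreal_mult)
  qed simp
qed

lemma hausdorff_outer_measure_lipschitz_image:
  assumes "L > 0" "\<And>x y. x \<in> A \<Longrightarrow> y \<in> A \<Longrightarrow> dist (f x) (f y) \<le> L * dist x y"
  shows "hausdorff_outer_measure d (f ` A) \<le> ennreal (L ^ d) * hausdorff_outer_measure d A"
proof (rule hausdorff_outer_measure_leI)
  fix \<delta> :: real assume "\<delta> > 0"
  let ?h = "hausdorff_premeasure d \<delta> (f ` A)"
  have Ld: "L ^ d > 0" using assms by simp
  have one: "ennreal (L ^ d) * ennreal (1 / L ^ d) = 1"
    using Ld assms(1) by (simp flip: ennreal_mult)
  \<comment> \<open>The Lipschitz constant is moved to the left, so that the infimum on the right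
    can be bounded cover by cover; a cover of \<open>A\<close> at scale \<open>\<delta> / L\<close>
    is carried to one of the image at scale \<open>\<delta>\<close>.\<close>
  have "ennreal (1 / L ^ d) * ?h \<le> hausdorff_premeasure d (\<delta> / L) A"
    unfolding hausdorff_premeasure_def[of d "\<delta> / L"]
  proof (rule INF_greatest, clarify)
    fix U :: "nat \<Rightarrow> 'a set" assume cov: "A \<subseteq> (\<Union>i. U i)"
      and bd: "\<forall>i. bounded (U i) \<and> diameter (U i) \<le> \<delta> / L"
    \<comment> \<open>The covering sets are cut down to \<open>A\<close>, since \<open>f\<close> is
      Lipschitz only there.\<close>
    define V where "V i = U i \<inter> A" for i
    have V: "bounded (V i)" "diameter (V i) \<le> diameter (U i)" for i
      using bd by (auto simp: V_def intro: bounded_subset diameter_subset)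
    note im = hausdorff_weight_lipschitz_image[OF assms(1), of "V _" f, OF assms(2) V(1)]
    have "?h \<le> (\<Sum>i. hausdorff_weight d (f ` V i))"
    proof (rule hausdorff_premeasure_le)
      show "f ` A \<subseteq> (\<Union>i. f ` V i)"
      proof
        fix y assume "y \<in> f ` A"
        then obtain x where x: "x \<in> A" "y = f x" by auto
        then obtain i where "x \<in> V i" using cov by (auto simp: V_def)
        then show "y \<in> (\<Union>i. f ` V i)" using x(2) by blast
      qed
      show "bounded (f ` V i)" for i by (rule im) (auto simp: V_def)
      have "diameter (f ` V i) \<le> L * diameter (V i)" for i by (rule im) (auto simp: V_def)
      moreover have "L * diameter (V i) \<le> \<delta>" for i
        using bd V(2)[of i] assms(1) by (metis mult.commute order_trans pos_le_divide_eq)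
      ultimately show "diameter (f ` V i) \<le> \<delta>" for i using order_trans by blast
    qed
    also have "\<dots> \<le> (\<Sum>i. ennreal (L ^ d) * hausdorff_weight d (U i))"
    proof (intro suminf_le)
      fix i
      have "hausdorff_weight d (f ` V i) \<le> ennreal (L ^ d) * hausdorff_weight d (V i)"
        by (rule im) (auto simp: V_def)
      also have "hausdorff_weight d (V i) \<le> hausdorff_weight d (U i)"
        using V[of i] diameter_ge_0[OF V(1)[of i]]
        by (auto simp: hausdorff_weight_def V_def intro!: ennreal_leI mult_left_mono power_mono divide_right_mono)
      finally show "hausdorff_weight d (f ` V i) \<le> ennreal (L ^ d) * hausdorff_weight d (U i)"
        by (simp add: mult_left_mono)
    qed auto
    also have "\<dots> = ennreal (L ^ d) * (\<Sum>i. hausdorff_weight d (U i))" by simp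
    finally have "ennreal (1 / L ^ d) * ?h \<le> ennreal (1 / L ^ d) * (ennreal (L ^ d) * (\<Sum>i. hausdorff_weight d (U i)))"
      by (rule mult_left_mono) simp
    also have "\<dots> = (ennreal (L ^ d) * ennreal (1 / L ^ d)) * (\<Sum>i. hausdorff_weight d (U i))"
      by (simp only: mult_ac)
    finally show "ennreal (1 / L ^ d) * ?h \<le> (\<Sum>i. hausdorff_weight d (U i))" by (simp add: one)
  qed
  also have "\<dots> \<le> hausdorff_outer_measure d A"
    using assms \<open>\<delta> > 0\<close> by (intro hausdorff_premeasure_le_outer) auto
  finally have "ennreal (L ^ d) * (ennreal (1 / L ^ d) * ?h) \<le> ennreal (L ^ d) * hausdorff_outer_measure d A"
    by (rule mult_left_mono) simp
  then show "?h \<le> ennreal (L ^ d) * hausdorff_outer_measure d A"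
    by (simp add: one mult.assoc[symmetric])
qed

text \<open>Both \<open>f\<close> and its inverse on the image have Lipschitz constant 1.\<close>

lemma hausdorff_outer_measure_isometric_image:
  assumes "\<And>x y. x \<in> A \<Longrightarrow> y \<in> A \<Longrightarrow> dist (f x) (f y) = dist x y"
  shows "hausdorff_outer_measure d (f ` A) = hausdorff_outer_measure d A"
proof (rule antisym)
  show "hausdorff_outer_measure d (f ` A) \<le> hausdorff_outer_measure d A"
    using hausdorff_outer_measure_lipschitz_image[of 1 A f d] assms by simp
  have inj: "inj_on f A" using assms by (metis dist_eq_0_iff inj_onI)
  have "dist (the_inv_into A f x) (the_inv_into A f y) \<le> 1 * dist x y" if "x \<in> f ` A" "y \<in> f ` A" for x y
    using that assms inj by (auto simp: the_inv_into_f_f)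
  then have "hausdorff_outer_measure d (the_inv_into A f ` (f ` A)) \<le> ennreal (1 ^ d) * hausdorff_outer_measure d (f ` A)"
    using hausdorff_outer_measure_lipschitz_image[of 1 "f ` A" "the_inv_into A f" d] by simp
  then have "hausdorff_outer_measure d (the_inv_into A f ` (f ` A)) \<le> hausdorff_outer_measure d (f ` A)" by simp
  moreover have "the_inv_into A f ` (f ` A) = A"
    using inj by (auto simp: the_inv_into_f_f image_iff)
  ultimately show "hausdorff_outer_measure d A \<le> hausdorff_outer_measure d (f ` A)" by simp
qed

lemma hausdorff_outer_measure_translation:
  fixes A :: "'a::real_normed_vector set"
  shows "hausdorff_outer_measure d ((+) z ` A) = hausdorff_outer_measure d A"
  by (rule hausdorff_outer_measure_isometric_image) simp

lemma hausdorff_outer_measure_null_UN: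
  assumes "\<And>i::nat. hausdorff_outer_measure d (A i) = 0"
  shows "hausdorff_outer_measure d (\<Union>i. A i) = 0"
  using hausdorff_outer_measure_countably_subadditive[of d A] assms by simp

lemma hausdorff_outer_measure_null_countable_UN:
  assumes "countable I" "\<And>i. i \<in> I \<Longrightarrow> hausdorff_outer_measure d (A i) = 0"
  shows "hausdorff_outer_measure d (\<Union>i\<in>I. A i) = 0"
proof (cases "I = {}")
  case False
  then have "(\<Union>i\<in>I. A i) = (\<Union>k. A (from_nat_into I k))"
    using assms(1) by (metis UN_extend_simps(10) range_from_nat_into)
  then show ?thesis
    using hausdorff_outer_measure_null_UN[of d "\<lambda>k. A (from_nat_into I k)"] assms False
    by (simp add: from_nat_into)
qed simp

lemma hausdorff_outer_measure_null_subset: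
  "hausdorff_outer_measure d B = 0 \<Longrightarrow> A \<subseteq> B \<Longrightarrow> hausdorff_outer_measure d A = 0"
  using hausdorff_outer_measure_mono[of A B d] by simp

text \<open>A finite cover is padded with empty sets, whose weight is 0 in every dimension by the
  convention in \<open>hausdorff_weight\<close>.\<close>

lemma hausdorff_premeasure_le_finite:
  assumes "finite S" "A \<subseteq> (\<Union>s\<in>S. U s)" "\<And>s. s \<in> S \<Longrightarrow> bounded (U s)"
    "\<And>s. s \<in> S \<Longrightarrow> diameter (U s) \<le> \<delta>" "\<delta> \<ge> 0"
  shows "hausdorff_premeasure d \<delta> A \<le> (\<Sum>s\<in>S. hausdorff_weight d (U s))"
proof -
  obtain h where h: "bij_betw h {..<card S} S"
    using assms(1) by (metis atLeast0LessThan ex_bij_betw_nat_finite)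
  define V where "V i = (if i < card S then U (h i) else {})" for i
  have hS: "h i \<in> S" if "i < card S" for i using h that by (auto simp: bij_betw_def)
  have "A \<subseteq> (\<Union>i. V i)"
  proof
    fix x assume "x \<in> A"
    then obtain s where "s \<in> S" "x \<in> U s" using assms(2) by blast
    then obtain i where "i < card S" "h i = s" using h by (metis bij_betw_def imageE lessThan_iff)
    then have "x \<in> V i" using \<open>x \<in> U s\<close> by (simp add: V_def)
    then show "x \<in> (\<Union>i. V i)" by blast
  qed
  then have "hausdorff_premeasure d \<delta> A \<le> (\<Sum>i. hausdorff_weight d (V i))"
    using assms hS by (intro hausdorff_premeasure_le) (auto simp: V_def)
  also have "\<dots> = (\<Sum>i<card S. hausdorff_weight d (V i))"
    by (rule suminf_finite) (auto simp: V_def)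
  also have "\<dots> = (\<Sum>i<card S. hausdorff_weight d (U (h i)))"
    by (rule sum.cong) (auto simp: V_def)
  also have "\<dots> = (\<Sum>s\<in>S. hausdorff_weight d (U s))"
    by (rule sum.reindex_bij_betw[OF h])
  finally show ?thesis .
qed

text \<open>A maximal separated set gives an efficient covering; its cardinality is bounded by comparing
  volumes.\<close>

lemma hausdorff_finite_if_minkowski_content_finite:
  fixes A :: "'a::euclidean_space set"
  assumes C: "\<And>\<delta>. 0 < \<delta> \<Longrightarrow> \<delta> < \<eta> \<Longrightarrow> \<exists>N\<in>sets lborel. (\<Union>x\<in>A. ball x \<delta>) \<subseteq> N \<and> emeasure lborel N \<le> ennreal (C * \<delta>)"
    and "\<eta> > 0"
  shows "hausdorff_outer_measure (DIM('a) - 1) A < top"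
proof -
  define n where "n = DIM('a)"
  have n: "n > 0" by (simp add: n_def)
  define c where "c = unit_ball_vol (real n)"
  have c: "c > 0" by (simp add: c_def)
  define c' where "c' = unit_ball_vol (real (n - 1))"
  have c': "c' > 0" by (simp add: c'_def)
  \<comment> \<open>At most \<open>\<bar>C\<bar> * \<delta> / (c * (\<delta> / 2)^n)\<close> points
    are pairwise at distance \<open>\<delta>\<close> or more, and a closed ball of radius
    \<open>\<delta>\<close> has weight \<open>c' * \<delta>^(n - 1)\<close>; in the product the
    powers of \<open>\<delta>\<close> cancel and \<open>M\<close> remains.\<close>
  define M where "M = \<bar>C\<bar> * 2 ^ n / c * c'"
  have key: "hausdorff_premeasure (n - 1) (2 * \<delta>) A \<le> ennreal M" if \<delta>: "0 < \<delta>" "\<delta> < \<eta>" for \<delta>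
  proof -
    define sep where "sep S \<longleftrightarrow> finite S \<and> S \<subseteq> A \<and> (\<forall>x\<in>S. \<forall>y\<in>S. x \<noteq> y \<longrightarrow> dist x y \<ge> \<delta>)" for S :: "'a set"
    have bnd: "real (card S) * (c * (\<delta> / 2) ^ n) \<le> \<bar>C\<bar> * \<delta>" if "sep S" for S
    proof -
      have S: "finite S" "S \<subseteq> A" "\<And>x y. x \<in> S \<Longrightarrow> y \<in> S \<Longrightarrow> x \<noteq> y \<Longrightarrow> dist x y \<ge> \<delta>"
        using that by (auto simp: sep_def)
      obtain N where N: "N \<in> sets lborel" "(\<Union>x\<in>A. ball x \<delta>) \<subseteq> N" "emeasure lborel N \<le> ennreal (C * \<delta>)"
        using C[OF \<delta>] by blast
      have disj: "disjoint_family_on (\<lambda>s. ball s (\<delta> / 2)) S"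
        unfolding disjoint_family_on_def
      proof (intro ballI impI)
        fix x y assume "x \<in> S" "y \<in> S" "x \<noteq> y"
        then have "dist x y \<ge> \<delta>" by (rule S)
        show "ball x (\<delta> / 2) \<inter> ball y (\<delta> / 2) = {}"
          by (rule disjoint_ballI) (use \<open>dist x y \<ge> \<delta>\<close> in simp)
      qed
      have "ennreal (real (card S) * (c * (\<delta> / 2) ^ n)) = (\<Sum>s\<in>S. emeasure lborel (ball s (\<delta> / 2)))"
        using \<delta> c by (simp add: emeasure_ball c_def n_def ennreal_mult ennreal_of_nat_eq_real_of_nat)
      also have "\<dots> = emeasure lborel (\<Union>s\<in>S. ball s (\<delta> / 2))"
        using S disj by (intro sum_emeasure) auto
      also have "\<dots> \<le> emeasure lborel N"
        using N S(2) \<delta> by (intro emeasure_mono) (auto simp: subset_eq)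
      also have "\<dots> \<le> ennreal (\<bar>C\<bar> * \<delta>)"
        using N(3) \<delta> by (meson ennreal_leI abs_ge_self mult_right_mono less_imp_le order_trans)
      finally show ?thesis using \<delta> by (subst (asm) ennreal_le_iff) auto
    qed
    have pos: "c * (\<delta> / 2) ^ n > 0" using c \<delta> by simp
    \<comment> \<open>A bound for the cardinality of separated sets, so that one of maximal
      cardinality exists.\<close>
    define b where "b = nat \<lceil>\<bar>C\<bar> * \<delta> / (c * (\<delta> / 2) ^ n)\<rceil>"
    have "card S < Suc b" if "sep S" for S
    proof -
      have "real (card S) \<le> \<bar>C\<bar> * \<delta> / (c * (\<delta> / 2) ^ n)"
        using bnd[OF that] pos by (simp add: pos_le_divide_eq)
      then show ?thesis unfolding b_def by linarith
    qed
    moreover have "sep {}" by (simp add: sep_def)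
    ultimately obtain S where S: "sep S" "\<And>S'. sep S' \<Longrightarrow> card S' \<le> card S"
      using ex_has_greatest_nat[of sep "{}" card "Suc b"] by blast
    have cov: "A \<subseteq> (\<Union>s\<in>S. cball s \<delta>)"
    proof (rule ccontr)
      assume "\<not> ?thesis"
      then obtain x where x: "x \<in> A" "\<And>s. s \<in> S \<Longrightarrow> dist s x > \<delta>" by (auto simp: subset_eq not_le)
      then have "x \<notin> S" using \<delta> by fastforce
      have "sep (insert x S)"
        using S(1) x by (auto simp: sep_def dist_commute intro: less_imp_le)
      then have "card (insert x S) \<le> card S" by (rule S)
      then show False using \<open>x \<notin> S\<close> S(1) by (simp add: sep_def)
    qed
    have dia: "diameter (cball s \<delta>) = 2 * \<delta>" for s :: 'a
      using \<delta> by (simp add: diameter_cball)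
    have "hausdorff_premeasure (n - 1) (2 * \<delta>) A \<le> (\<Sum>s\<in>S. hausdorff_weight (n - 1) (cball s \<delta>))"
      using S(1) cov dia \<delta> by (intro hausdorff_premeasure_le_finite) (auto simp: sep_def)
    also have "\<dots> = ennreal (real (card S) * (c' * \<delta> ^ (n - 1)))"
      using \<delta> c' by (simp add: hausdorff_weight_def dia c'_def ennreal_mult ennreal_of_nat_eq_real_of_nat)
    also have "\<dots> \<le> ennreal M"
    proof (rule ennreal_leI)
      have "real (card S) \<le> \<bar>C\<bar> * \<delta> / (c * (\<delta> / 2) ^ n)"
        using bnd[OF S(1)] pos by (simp add: pos_le_divide_eq)
      then have "real (card S) * (c' * \<delta> ^ (n - 1)) \<le> \<bar>C\<bar> * \<delta> / (c * (\<delta> / 2) ^ n) * (c' * \<delta> ^ (n - 1))"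
        using c' \<delta> by (intro mult_right_mono) auto
      also have "\<dots> = M"
      proof -
        have "\<delta> ^ n = \<delta> * \<delta> ^ (n - 1)" using n by (metis Suc_diff_1 power_Suc)
        then show ?thesis using \<delta> c by (simp add: M_def field_simps power_divide)
      qed
      finally show "real (card S) * (c' * \<delta> ^ (n - 1)) \<le> M" .
    qed
    finally show ?thesis .
  qed
  have "hausdorff_outer_measure (n - 1) A \<le> ennreal M"
  proof (rule hausdorff_outer_measure_leI_small[of "2 * \<eta>"])
    fix \<delta> :: real assume "0 < \<delta>" "\<delta> < 2 * \<eta>"
    then show "hausdorff_premeasure (n - 1) \<delta> A \<le> ennreal M" using key[of "\<delta> / 2"] by simp
  qed (use \<open>\<eta> > 0\<close> in simp)
  then show ?thesis unfolding n_def by (metis ennreal_less_top le_less_trans)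
qed

text \<open>The graph of the convex function \<open>(1 + t)^n\<close> lies below its chord over the
  unit interval. Together with Bernoulli's inequality for \<open>(1 - t)^n\<close> this makes the
  volume of a thin shell linear in \<open>t\<close>.\<close>

lemma one_plus_power_le:
  fixes t :: real
  assumes "0 \<le> t" "t \<le> 1"
  shows "(1 + t) ^ n \<le> 1 + t * (2 ^ n - 1)"
proof (induction n)
  case (Suc n)
  have "(1 + t) ^ Suc n \<le> (1 + t) * (1 + t * (2 ^ n - 1))"
    using Suc assms by (simp add: mult_left_mono)
  also have "\<dots> = 1 + t * 2 ^ n + t * t * (2 ^ n - 1)" by (simp add: algebra_simps)
  also have "t * t * (2 ^ n - 1) \<le> t * 1 * (2 ^ n - 1)"
    using assms by (intro mult_right_mono mult_left_mono) auto
  finally show ?case by (simp add: algebra_simps)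
qed simp

text \<open>A vector of norm at most \<open>\<delta>\<close> lies in
  \<open>(\<delta> / r) K\<close>, because \<open>K\<close> contains the ball of radius
  \<open>r\<close>. By convexity \<open>x\<close> moves within \<open>(1 + \<delta> / r) K\<close>;
  and if it moved into \<open>(1 - \<delta> / r) K\<close>, a whole neighbourhood of
  \<open>x\<close> would belong to \<open>K\<close>.\<close>

lemma frontier_neighbourhood_subset:
  fixes K :: "'a::euclidean_space set"
  assumes "convex K" "closed K" "cball 0 r \<subseteq> K" "0 < \<delta>" "\<delta> < r" "x \<in> frontier K"
  shows "ball x \<delta> \<subseteq> (*\<^sub>R) (1 + \<delta> / r) ` K - (*\<^sub>R) (1 - \<delta> / r) ` K"
proof
  fix y assume "y \<in> ball x \<delta>"
  define w where "w = y - x"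
  have w: "norm w < \<delta>" using \<open>y \<in> ball x \<delta>\<close> by (simp add: w_def dist_norm norm_minus_commute)
  define t where "t = \<delta> / r"
  have r: "r > 0" and t: "0 < t" "t < 1" using assms by (auto simp: t_def)
  have scl: "(r / \<delta>) *\<^sub>R v \<in> K" if "norm v \<le> \<delta>" for v
  proof -
    have "norm ((r / \<delta>) *\<^sub>R v) \<le> r" using that r assms by (simp add: field_simps)
    then show ?thesis using assms by auto
  qed
  have xK: "x \<in> K" using assms(2,6) by (auto simp: frontier_def)
  have "y \<in> (*\<^sub>R) (1 + t) ` K"
  proof
    have "(1 / (1 + t)) *\<^sub>R x + (t / (1 + t)) *\<^sub>R ((r / \<delta>) *\<^sub>R w) \<in> K"
      using t scl[of w] w xK by (intro convexD[OF assms(1)]) (auto simp: field_simps)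
    then show "(1 / (1 + t)) *\<^sub>R x + (t / (1 + t)) *\<^sub>R ((r / \<delta>) *\<^sub>R w) \<in> K" .
    have "(1 + t) * (t / (1 + t)) = t" using t by simp
    moreover have "t * (r / \<delta>) = 1" using r assms by (simp add: t_def)
    ultimately have e: "(1 + t) * ((t / (1 + t)) * (r / \<delta>)) = 1" "(1 + t) * (1 / (1 + t)) = 1"
      using t by (simp_all only: mult.assoc[symmetric]) simp
    show "y = (1 + t) *\<^sub>R ((1 / (1 + t)) *\<^sub>R x + (t / (1 + t)) *\<^sub>R ((r / \<delta>) *\<^sub>R w))"
      by (simp only: scaleR_add_right scaleR_scaleR e scaleR_one) (simp add: w_def)
  qed
  moreover have "y \<notin> (*\<^sub>R) (1 - t) ` K"
  proof
    assume "y \<in> (*\<^sub>R) (1 - t) ` K"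
    then obtain k where k: "k \<in> K" "y = (1 - t) *\<^sub>R k" by auto
    have "ball x (\<delta> - norm w) \<subseteq> K"
    proof
      fix z assume "z \<in> ball x (\<delta> - norm w)"
      then have "norm (z - x) < \<delta> - norm w" by (simp add: dist_norm norm_minus_commute)
      then have "norm (z - y) \<le> \<delta>"
        using norm_triangle_ineq4[of "z - x" w] by (simp add: w_def)
      then have "(1 - t) *\<^sub>R k + t *\<^sub>R ((r / \<delta>) *\<^sub>R (z - y)) \<in> K"
        using t k scl by (intro convexD[OF assms(1)]) auto
      moreover have "t * (r / \<delta>) = 1" using r assms by (simp add: t_def)
      ultimately have "y + 1 *\<^sub>R (z - y) \<in> K" unfolding k(2) by (metis scaleR_scaleR)
      then show "z \<in> K" by simp
    qed
    then have "x \<in> interior K" using w by (metis centre_in_ball diff_gt_0_iff_gt interiorI open_ball)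
    then show False using assms(6) by (simp add: frontier_def)
  qed
  ultimately show "y \<in> (*\<^sub>R) (1 + \<delta> / r) ` K - (*\<^sub>R) (1 - \<delta> / r) ` K" by (simp add: t_def)
qed

text \<open>The \<open>\<delta>\<close>-neighbourhood of the boundary lies between two dilates of
  \<open>K\<close>, whose volumes differ by \<open>((1 + t)^n - (1 - t)^n) V\<close> with
  \<open>t = \<delta> / r\<close>. This is at most \<open>(2^n - 1 + n) t V\<close>, so the boundary
  has finite upper Minkowski content of codimension 1.\<close>

lemma hausdorff_frontier_finite:
  fixes K :: "'a::euclidean_space set"
  assumes "convex K" "compact K" "0 \<in> interior K"
  shows "hausdorff_outer_measure (DIM('a) - 1) (frontier K) < top"
proof -
  obtain r where r: "r > 0" "cball 0 r \<subseteq> K" using assms(3) by (meson mem_interior_cball)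
  define n where "n = DIM('a)"
  define V where "V = measure lborel K"
  have V: "emeasure lborel K = ennreal V" "V \<ge> 0"
    using emeasure_bounded_finite[OF compact_imp_bounded[OF assms(2)]]
    by (auto simp: V_def emeasure_eq_ennreal_measure)
  have scl: "emeasure lborel ((*\<^sub>R) s ` K) = ennreal (s ^ n * V)" "(*\<^sub>R) s ` K \<in> sets lborel" if "s \<ge> 0" for s
  proof -
    have c: "compact ((*\<^sub>R) s ` K)" by (rule compact_scaling[OF assms(2)])
    then show b: "(*\<^sub>R) s ` K \<in> sets lborel" by (simp add: borel_compact)
    have "emeasure lebesgue ((\<lambda>x. s *\<^sub>R x + 0) ` K) = ennreal (\<bar>s\<bar> ^ DIM('a)) * emeasure lebesgue K"
      by (rule emeasure_lebesgue_affine)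
    moreover have "emeasure lebesgue K = ennreal V"
      using V assms(2) by (simp add: borel_compact)
    ultimately show "emeasure lborel ((*\<^sub>R) s ` K) = ennreal (s ^ n * V)"
      using that b V(2) by (simp add: n_def ennreal_mult)
  qed
  show ?thesis
  proof (rule hausdorff_finite_if_minkowski_content_finite)
    fix \<delta> :: real assume \<delta>: "0 < \<delta>" "\<delta> < r"
    define t where "t = \<delta> / r"
    have t: "0 < t" "t < 1" using \<delta> by (auto simp: t_def)
    let ?N = "(*\<^sub>R) (1 + t) ` K - (*\<^sub>R) (1 - t) ` K"
    have "(\<Union>x\<in>frontier K. ball x \<delta>) \<subseteq> ?N"
      using frontier_neighbourhood_subset[OF assms(1) compact_imp_closed[OF assms(2)] r(2) \<delta>] by (auto simp: t_def)
    moreover have "?N \<in> sets lborel" using scl(2) t by auto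
    moreover have "emeasure lborel ?N \<le> ennreal ((2 ^ n - 1 + real n) * V / r * \<delta>)"
    proof -
      have sub: "(*\<^sub>R) (1 - t) ` K \<subseteq> (*\<^sub>R) (1 + t) ` K"
      proof
        fix y assume "y \<in> (*\<^sub>R) (1 - t) ` K"
        then obtain k where k: "k \<in> K" "y = (1 - t) *\<^sub>R k" by auto
        have "(1 - t) / (1 + t) + 2 * t / (1 + t) = 1" using t by (simp add: add_divide_distrib[symmetric])
        moreover have "0 \<in> K" using r by auto
        ultimately have "((1 - t) / (1 + t)) *\<^sub>R k + (2 * t / (1 + t)) *\<^sub>R 0 \<in> K"
          using t k(1) by (intro convexD[OF assms(1)]) auto
        moreover have "(1 + t) * ((1 - t) / (1 + t)) = 1 - t" using t by simp
        then have "y = (1 + t) *\<^sub>R (((1 - t) / (1 + t)) *\<^sub>R k)" using k by (simp only: scaleR_scaleR)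
        ultimately show "y \<in> (*\<^sub>R) (1 + t) ` K" by (intro image_eqI[of y]) simp_all
      qed
      have "emeasure lborel ?N = emeasure lborel ((*\<^sub>R) (1 + t) ` K) - emeasure lborel ((*\<^sub>R) (1 - t) ` K)"
        using scl t sub by (intro emeasure_Diff) auto
      also have "\<dots> = ennreal ((1 + t) ^ n * V - (1 - t) ^ n * V)"
        using scl t V by (simp add: ennreal_minus)
      also have "\<dots> \<le> ennreal ((2 ^ n - 1 + real n) * V / r * \<delta>)"
      proof (rule ennreal_leI)
        have "(1 + t) ^ n - (1 - t) ^ n \<le> (1 + t * (2 ^ n - 1)) - (1 - n * t)"
          using one_plus_power_le[of t n] Bernoulli_inequality[of "-t" n] t
          by (intro diff_mono) auto
        then have "((1 + t) ^ n - (1 - t) ^ n) * V \<le> ((2 ^ n - 1 + real n) * t) * V"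
          using V by (intro mult_right_mono) (auto simp: algebra_simps)
        then show "(1 + t) ^ n * V - (1 - t) ^ n * V \<le> (2 ^ n - 1 + real n) * V / r * \<delta>"
          by (simp add: t_def right_diff_distrib mult_ac)
      qed
      finally show ?thesis .
    qed
    ultimately show "\<exists>N\<in>sets lborel. (\<Union>x\<in>frontier K. ball x \<delta>) \<subseteq> N \<and>
        emeasure lborel N \<le> ennreal ((2 ^ n - 1 + real n) * V / r * \<delta>)" by blast
  qed (use r in auto)
qed

section \<open>Hausdorff measure on hyperplanes\<close>

lemma sigma_finite_if_finite_on_balls:
  fixes M :: "'a::real_normed_vector measure"
  assumes "sets M = sets borel" "\<And>n::nat. emeasure M (ball 0 (real n)) < top"
  shows "sigma_finite_measure M"
proof
  have "x \<in> (\<Union>n::nat. ball 0 (real n))" for x :: 'a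
    using reals_Archimedean2[of "norm x"] by auto
  moreover have "space M = UNIV" using sets_eq_imp_space_eq[OF assms(1)] by simp
  ultimately show "\<exists>A. countable A \<and> A \<subseteq> sets M \<and> \<Union>A = space M \<and> (\<forall>a\<in>A. emeasure M a \<noteq> \<infinity>)"
    using assms by (intro exI[of _ "range (\<lambda>n::nat. ball 0 (real n))"]) (auto simp: less_top[symmetric])
qed

lemma borel_vimage_translation:
  fixes A :: "'a::euclidean_space set"
  assumes "A \<in> sets borel"
  shows "(\<lambda>x. x + w) -` A \<in> sets borel"
  by (rule measurable_sets_borel[OF _ assms]) measurable

lemma borel_vimage_uminus:
  fixes A :: "'a::euclidean_space set"
  assumes "A \<in> sets borel"
  shows "uminus -` A \<in> sets borel"
  by (rule measurable_sets_borel[OF _ assms]) measurable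

lemma linear_borel_measurable:
  fixes f :: "'a::euclidean_space \<Rightarrow> 'b::euclidean_space"
  assumes "linear f"
  shows "f \<in> borel_measurable borel"
  using assms by (metis borel_measurable_continuous_onI linear_continuous_on linear_conv_bounded_linear)

lemma unit_inner_self: "norm u = 1 \<Longrightarrow> u \<bullet> u = 1"
  by (simp add: dot_square_norm)

text \<open>Uniqueness of Haar measure: both sides are iterated integrals of
  \<open>indicator A x * indicator B (x + y)\<close> with respect to \<open>M\<close> and \<open>N\<close>.\<close>

lemma translation_invariant_measure_unique:
  fixes M N :: "'a::euclidean_space measure"
  assumes M: "sigma_finite_measure M" "sets M = sets borel" "AE x in M. x \<in> W"
      "\<And>A w. A \<in> sets borel \<Longrightarrow> w \<in> W \<Longrightarrow> emeasure M ((\<lambda>x. x + w) -` A) = emeasure M A"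
    and N: "sigma_finite_measure N" "sets N = sets borel" "AE x in N. x \<in> W"
      "\<And>A w. A \<in> sets borel \<Longrightarrow> w \<in> W \<Longrightarrow> emeasure N ((\<lambda>x. x + w) -` A) = emeasure N A"
    and W: "\<And>w. w \<in> W \<Longrightarrow> - w \<in> W"
    and A: "A \<in> sets borel" and B: "B \<in> sets borel"
  shows "emeasure M A * emeasure N B = emeasure M B * emeasure N (uminus -` A)"
proof -
  interpret M: sigma_finite_measure M by fact
  interpret N: sigma_finite_measure N by fact
  interpret MN: pair_sigma_finite M N ..
  note [measurable_cong] = M(2) N(2)
  note [measurable] = A B
  have spM: "space M = UNIV" and spN: "space N = UNIV"
    using sets_eq_imp_space_eq[OF M(2)] sets_eq_imp_space_eq[OF N(2)] by auto
  have b2: "sets (M \<Otimes>\<^sub>M N) = sets borel"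
    by (subst borel_prod[symmetric]) (intro sets_pair_measure_cong M N)
  have [measurable]: "(\<lambda>(x, y). indicator A x * indicator B (y + x) :: ennreal) \<in> borel_measurable (M \<Otimes>\<^sub>M N)"
    "(\<lambda>(x, y). indicator A (x - y) * indicator B x :: ennreal) \<in> borel_measurable (M \<Otimes>\<^sub>M N)"
    by measurable
  have "emeasure M A * emeasure N B = (\<integral>\<^sup>+ x. emeasure N B * indicator A x \<partial>M)"
    using A M(2) by (subst nn_integral_cmult_indicator) (simp_all add: mult.commute)
  also have "\<dots> = (\<integral>\<^sup>+ x. \<integral>\<^sup>+ y. indicator A x * indicator B (y + x) \<partial>N \<partial>M)"
  proof (rule nn_integral_cong_AE, use M(3) in eventually_elim)
    fix x assume x: "x \<in> W"
    have s: "(\<lambda>y. y + x) -` B \<in> sets N" unfolding N(2) by (intro borel_vimage_translation) fact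
    have "(\<integral>\<^sup>+ y. indicator A x * indicator B (y + x) \<partial>N) = (\<integral>\<^sup>+ y. indicator A x * indicator ((\<lambda>y. y + x) -` B) y \<partial>N)"
      by (intro nn_integral_cong) (auto simp: indicator_def)
    also have "\<dots> = indicator A x * emeasure N ((\<lambda>y. y + x) -` B)"
      using s by (rule nn_integral_cmult_indicator)
    also have "\<dots> = emeasure N B * indicator A x" using N(4)[OF B x] by (simp add: mult.commute)
    finally show "emeasure N B * indicator A x = (\<integral>\<^sup>+ y. indicator A x * indicator B (y + x) \<partial>N)" by simp
  qed
  also have "\<dots> = (\<integral>\<^sup>+ y. \<integral>\<^sup>+ x. indicator A x * indicator B (y + x) \<partial>M \<partial>N)"
    by (rule MN.Fubini'[symmetric]) measurable
  \<comment> \<open>Invariance of \<open>M\<close> under the shift by \<open>y\<close>, which lies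
    in \<open>W\<close> for \<open>N\<close>-almost every \<open>y\<close>, moves the shift from
    \<open>B\<close> to \<open>A\<close>.\<close>
  also have "\<dots> = (\<integral>\<^sup>+ y. \<integral>\<^sup>+ x. indicator A (x - y) * indicator B x \<partial>M \<partial>N)"
  proof (rule nn_integral_cong_AE, use N(3) in eventually_elim)
    fix y assume y: "y \<in> W"
    let ?C = "{z. z - y \<in> A \<and> z \<in> B}"
    have C: "?C \<in> sets borel" by measurable
    have s: "(\<lambda>x. x + y) -` ?C \<in> sets M" unfolding M(2) by (intro borel_vimage_translation) fact
    have "(\<integral>\<^sup>+ x. indicator A x * indicator B (y + x) \<partial>M) = (\<integral>\<^sup>+ x. indicator ((\<lambda>x. x + y) -` ?C) x \<partial>M)"
      by (intro nn_integral_cong) (auto simp: indicator_def add.commute)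
    also have "\<dots> = emeasure M ((\<lambda>x. x + y) -` ?C)" using s by (rule nn_integral_indicator)
    also have "\<dots> = emeasure M ?C" by (rule M(4)[OF C y])
    also have "\<dots> = (\<integral>\<^sup>+ x. indicator ?C x \<partial>M)" using C M(2) by (intro nn_integral_indicator[symmetric]) simp
    also have "\<dots> = (\<integral>\<^sup>+ x. indicator A (x - y) * indicator B x \<partial>M)"
      by (intro nn_integral_cong) (auto simp: indicator_def)
    finally show "(\<integral>\<^sup>+ x. indicator A x * indicator B (y + x) \<partial>M) = (\<integral>\<^sup>+ x. indicator A (x - y) * indicator B x \<partial>M)" .
  qed
  also have "\<dots> = (\<integral>\<^sup>+ x. \<integral>\<^sup>+ y. indicator A (x - y) * indicator B x \<partial>N \<partial>M)"
    by (rule MN.Fubini') measurable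
  \<comment> \<open>As a condition on \<open>y\<close>, membership of \<open>x - y\<close> in
    \<open>A\<close> describes a translate of the reflected set; this is the origin of
    \<open>uminus\<close>.\<close>
  also have "\<dots> = (\<integral>\<^sup>+ x. emeasure N (uminus -` A) * indicator B x \<partial>M)"
  proof (rule nn_integral_cong_AE, use M(3) in eventually_elim)
    fix x assume x: "x \<in> W"
    have mA: "uminus -` A \<in> sets borel" by (rule measurable_sets_borel[OF _ A]) measurable
    have s: "(\<lambda>y. y + - x) -` (uminus -` A) \<in> sets N" unfolding N(2) by (intro borel_vimage_translation) fact
    have "(\<integral>\<^sup>+ y. indicator A (x - y) * indicator B x \<partial>N) = (\<integral>\<^sup>+ y. indicator B x * indicator ((\<lambda>y. y + - x) -` (uminus -` A)) y \<partial>N)"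
      by (intro nn_integral_cong) (auto simp: indicator_def)
    also have "\<dots> = indicator B x * emeasure N ((\<lambda>y. y + - x) -` (uminus -` A))"
      using s by (rule nn_integral_cmult_indicator)
    also have "\<dots> = emeasure N (uminus -` A) * indicator B x" using N(4)[OF mA W[OF x]] by (simp add: mult.commute)
    finally show "(\<integral>\<^sup>+ y. indicator A (x - y) * indicator B x \<partial>N) = emeasure N (uminus -` A) * indicator B x" .
  qed
  also have "\<dots> = emeasure M B * emeasure N (uminus -` A)"
    using B M(2) by (subst nn_integral_cmult_indicator) (simp_all add: mult.commute)
  finally show ?thesis .
qed

section \<open>Lebesgue measure under linear maps\<close>

lemma lborel_vimage_translation:
  fixes A :: "'a::euclidean_space set"
  assumes "A \<in> sets borel"
  shows "emeasure lborel ((\<lambda>x. x + w) -` A) = emeasure lborel A"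
proof -
  have "emeasure lborel A = emeasure (distr lborel borel ((+) w)) A" by (simp only: lborel_distr_plus)
  also have "\<dots> = emeasure lborel ((+) w -` A)" using assms by (subst emeasure_distr) auto
  also have "(+) w -` A = (\<lambda>x. x + w) -` A" by (auto simp: add.commute)
  finally show ?thesis by simp
qed

text \<open>The image measure of Lebesgue measure under an injective linear map is again translation
  invariant, hence proportional to it. The factor is left implicit and read off later from a
  well-chosen test set \<open>B\<close>.\<close>

lemma lborel_linear_vimage_proportional:
  fixes T :: "'a::euclidean_space \<Rightarrow> 'a"
  assumes T: "linear T" "inj T" and A: "A \<in> sets borel" and B: "B \<in> sets borel"
  shows "emeasure lborel (T -` A) * emeasure lborel B = emeasure lborel (T -` B) * emeasure lborel (uminus -` A)"
proof -
  have surj: "surj T" using T linear_injective_imp_surjective by blast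
  obtain T' where T': "linear T'" "\<And>x. T' (T x) = x" "\<And>x. T (T' x) = x"
    using linear_injective_isomorphism[OF T] by metis
  have Tm[measurable]: "T \<in> borel_measurable borel"
    using T(1) by (rule linear_borel_measurable)
  define M where "M = distr lborel borel T"
  have em: "emeasure M C = emeasure lborel (T -` C)" if "C \<in> sets borel" for C
    using that by (simp add: M_def emeasure_distr)
  have "emeasure M A * emeasure lborel B = emeasure M B * emeasure lborel (uminus -` A)"
  proof (rule translation_invariant_measure_unique[where W=UNIV])
    show "sigma_finite_measure M"
    proof (rule sigma_finite_if_finite_on_balls)
      fix n :: nat
      have "T -` ball 0 (real n) \<subseteq> T' ` ball 0 (real n)" using T'(2) by (metis image_eqI subsetI vimage_eq)
      moreover have "bounded (T' ` ball 0 (real n))"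
        using T'(1) by (intro bounded_linear_image linear_conv_bounded_linear[THEN iffD1]) auto
      ultimately have "bounded (T -` ball 0 (real n))" using bounded_subset by blast
      then have "emeasure lborel (T -` ball 0 (real n)) < \<infinity>" by (rule emeasure_bounded_finite)
      then show "emeasure M (ball 0 (real n)) < top" by (simp add: em)
    qed (simp add: M_def)
    fix C w assume C: "C \<in> sets (borel :: 'a measure)"
    have "(\<lambda>x. x + w) -` C \<in> sets borel" by (rule borel_vimage_translation[OF C])
    moreover have "T -` ((\<lambda>x. x + w) -` C) = (\<lambda>x. x + T' w) -` (T -` C)"
      using T' by (auto simp: linear_add[OF T(1)])
    moreover have "T -` C \<in> sets borel" by (rule measurable_sets_borel[OF Tm C])
    ultimately show "emeasure M ((\<lambda>x. x + w) -` C) = emeasure M C"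
      using C by (simp add: em lborel_vimage_translation)
  qed (use A B in \<open>auto simp: M_def lborel_vimage_translation lborel.sigma_finite_measure_axioms\<close>)
  then show ?thesis using A B by (simp add: em)
qed

lemma lborel_ball_0_1: "0 < emeasure lborel (ball (0::'a::euclidean_space) 1)" "emeasure lborel (ball (0::'a) 1) < top"
  by (auto simp: emeasure_ball)

lemma ennreal_mult_cancel_finite:
  fixes a b c :: ennreal
  assumes "a * c = b * c" "0 < c" "c < top"
  shows "a = b"
  using assms by (metis ennreal_mult_cancel_left less_irrefl mult.commute)

text \<open>The proportionality for the identity map, tested on the unit ball, removes the
  reflection that the uniqueness argument leaves behind.\<close>

lemma lborel_vimage_uminus:
  fixes A :: "'a::euclidean_space set"
  assumes "A \<in> sets borel"
  shows "emeasure lborel (uminus -` A) = emeasure lborel A"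
proof (rule ennreal_mult_cancel_finite[OF _ lborel_ball_0_1])
  have e: "(\<lambda>x. x) -` X = X" for X :: "'a set" by auto
  show "emeasure lborel (uminus -` A) * emeasure lborel (ball (0::'a) 1) = emeasure lborel A * emeasure lborel (ball (0::'a) 1)"
    using lborel_linear_vimage_proportional[of "\<lambda>x::'a. x" A "ball 0 1"] assms
    by (simp add: e linear_id[unfolded id_def] inj_on_id2 mult.commute)
qed

text \<open>The unit ball is its own preimage, so the factor of proportionality is 1.\<close>

lemma lborel_orthogonal_vimage:
  fixes f :: "'a::euclidean_space \<Rightarrow> 'a"
  assumes f: "linear f" "\<And>x. norm (f x) = norm x" and A: "A \<in> sets borel"
  shows "emeasure lborel (f -` A) = emeasure lborel A"
proof (rule ennreal_mult_cancel_finite[OF _ lborel_ball_0_1])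
  have "inj f" using f by (metis linear_injective_0 norm_eq_zero)
  moreover have "f -` ball 0 1 = ball 0 1" using f by auto
  ultimately show "emeasure lborel (f -` A) * emeasure lborel (ball (0::'a) 1) = emeasure lborel A * emeasure lborel (ball (0::'a) 1)"
    using lborel_linear_vimage_proportional[of f A "ball 0 1"] f A by (simp add: lborel_vimage_uminus mult.commute)
qed

lemma lborel_stretch_axis_vimage:
  fixes A :: "(real ^ 'n) set" and k :: 'n
  assumes J: "J > 0" and A: "A \<in> sets borel"
  defines "D \<equiv> \<lambda>x::real ^ 'n. x + ((J - 1) * x $ k) *\<^sub>R axis k 1"
  shows "ennreal J * emeasure lborel (D -` A) = emeasure lborel A"
proof -
  \<comment> \<open>The test set: a box with edge \<open>J\<close> in direction \<open>k\<close> and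
    edges 1 otherwise, whose preimage is the unit cube.\<close>
  let ?B = "cbox 0 (1 + (J - 1) *\<^sub>R axis k 1) :: (real ^ 'n) set"
  have lin: "linear D" by (rule linearI) (simp_all add: D_def algebra_simps)
  have comp: "D x $ i = (if i = k then J * x $ k else x $ i)" for x i
    by (simp add: D_def axis_def algebra_simps)
  have inj: "inj D"
  proof (rule injI)
    fix x y assume "D x = D y"
    then have "D x $ i = D y $ i" for i by simp
    then show "x = y" using J unfolding comp vec_eq_iff by (metis mult_left_cancel less_irrefl)
  qed
  have DB: "D -` ?B = cbox 0 1"
  proof (rule set_eqI)
    fix x
    have "(0 \<le> D x $ i \<and> D x $ i \<le> 1 + (J - 1) * axis k 1 $ i) \<longleftrightarrow> (0 \<le> x $ i \<and> x $ i \<le> 1)" for i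
      using J by (cases "i = k") (simp_all add: comp axis_def zero_le_mult_iff)
    then show "x \<in> D -` ?B \<longleftrightarrow> x \<in> cbox 0 1" by (simp add: mem_box_cart)
  qed
  have pos: "j = k \<Longrightarrow> 0 \<le> 1 + (J - 1)" for j using J by simp
  have one: "emeasure lborel (cbox 0 (1 :: real ^ 'n)) = 1"
    by (subst emeasure_lborel_cbox) (auto simp: Basis_vec_def inner_axis intro!: prod.neutral)
  have JB: "emeasure lborel ?B = ennreal J"
  proof -
    have "emeasure lborel ?B = ennreal (\<Prod>b::real ^ 'n\<in>Basis. ((1 + (J - 1) *\<^sub>R axis k 1) - 0) \<bullet> b)"
      using J by (intro emeasure_lborel_cbox) (auto simp: Basis_vec_def inner_axis, auto simp: axis_def)
    also have "(\<Prod>b::real ^ 'n\<in>Basis. ((1 + (J - 1) *\<^sub>R axis k 1) - 0 :: real ^ 'n) \<bullet> b) = (\<Prod>b::real ^ 'n\<in>Basis. if b = axis k 1 then J else 1)"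
      by (rule prod.cong) (auto simp: Basis_vec_def inner_axis axis_eq_axis inner_add_left, auto simp: axis_def)
    also have "\<dots> = J" by (simp add: Basis_vec_def prod.delta) auto
    finally show ?thesis .
  qed
  have "emeasure lborel (D -` A) * ennreal J = emeasure lborel A"
    using lborel_linear_vimage_proportional[OF lin inj A, of ?B] A
    by (simp add: DB one JB lborel_vimage_uminus)
  then show ?thesis by (simp add: mult.commute)
qed

text \<open>Up to orthogonal maps on both sides, a linear map with \<open>T\<^sup>*T = I + p p\<^sup>*\<close> stretches one
  axis by the factor \<open>sqrt (1 + |p|\<^sup>2)\<close>.\<close>

lemma lborel_vimage_rank_one_stretch:
  fixes T :: "real ^ 'n \<Rightarrow> real ^ 'n"
  assumes T: "linear T" "\<And>x. (norm (T x))\<^sup>2 = (norm x)\<^sup>2 + (p \<bullet> x)\<^sup>2" and A: "A \<in> sets borel"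
  shows "ennreal (sqrt (1 + (norm p)\<^sup>2)) * emeasure lborel (T -` A) = emeasure lborel A"
proof -
  define J where "J = sqrt (1 + (norm p)\<^sup>2)"
  have J: "J > 0" "J\<^sup>2 = 1 + (norm p)\<^sup>2" by (auto simp: J_def add_pos_nonneg)
  \<comment> \<open>Any coordinate direction will do.\<close>
  define k :: 'n where "k = undefined"
  have "norm (norm p *\<^sub>R axis k (1::real)) = norm p" by simp
  then obtain Q :: "real ^ 'n \<Rightarrow> real ^ 'n" where Q: "orthogonal_transformation Q" "Q (norm p *\<^sub>R axis k 1) = p"
    by (rule orthogonal_transformation_exists)
  have Ql: "linear Q" "\<And>x y. Q x \<bullet> Q y = x \<bullet> y" using Q(1) by (auto simp: orthogonal_transformation_def)
  have Qn: "norm (Q x) = norm x" for x using Ql(2) by (simp add: norm_eq_sqrt_inner)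
  define D where "D = (\<lambda>x::real ^ 'n. x + ((J - 1) * x $ k) *\<^sub>R axis k 1)"
  define D' where "D' = (\<lambda>x::real ^ 'n. x + ((1 / J - 1) * x $ k) *\<^sub>R axis k 1)"
  have D'lin: "linear D'" by (rule linearI) (simp_all add: D'_def algebra_simps add_divide_distrib)
  have DD': "D' (D x) = x" "D (D' x) = x" for x
    using J by (simp_all add: D_def D'_def vec_eq_iff axis_def algebra_simps)
  have Dn: "(norm (D x))\<^sup>2 = (norm x)\<^sup>2 + (norm p * x $ k)\<^sup>2" for x
  proof -
    have "(norm (D x))\<^sup>2 = (norm x)\<^sup>2 + 2 * ((J - 1) * x $ k) * x $ k + ((J - 1) * x $ k)\<^sup>2"
      unfolding D_def power2_norm_eq_inner
      by (simp add: inner_add_left inner_add_right inner_axis inner_axis' inner_commute[of "axis k 1"] power2_eq_square algebra_simps)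
    also have "\<dots> = (norm x)\<^sup>2 + (J\<^sup>2 - 1) * (x $ k)\<^sup>2" by (simp add: power2_eq_square algebra_simps)
    also have "\<dots> = (norm x)\<^sup>2 + (norm p * x $ k)\<^sup>2" by (simp add: J power_mult_distrib)
    finally show ?thesis .
  qed
  \<comment> \<open>\<open>Q\<close> takes \<open>norm p\<close> times the axis \<open>k\<close> to
    \<open>p\<close>, so \<open>T \<circ> Q\<close> lengthens vectors exactly as the stretch
    \<open>D\<close> does. Hence \<open>R\<close> preserves norms, and
    \<open>T \<circ> Q = R \<circ> D\<close>.\<close>
  define R where "R = T \<circ> Q \<circ> D'"
  have Rl: "linear R" unfolding R_def by (intro linear_compose T Ql D'lin)
  have "(norm (R (D x)))\<^sup>2 = (norm (D x))\<^sup>2" for x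
  proof -
    have "p \<bullet> Q x = norm p * x $ k"
      using Ql(2)[of "norm p *\<^sub>R axis k 1" x] Q(2) by (simp add: inner_axis')
    then show ?thesis by (simp add: R_def DD' T(2) Dn Qn)
  qed
  then have Rn: "norm (R x) = norm x" for x
    using DD'(2) by (metis norm_ge_zero power2_eq_imp_eq)
  have R: "R (D x) = T (Q x)" for x by (simp add: R_def DD')
  have meas: "f -` A \<in> sets borel" if "linear f" "A \<in> sets borel" for f :: "real ^ 'n \<Rightarrow> real ^ 'n" and A
    using that linear_borel_measurable measurable_sets_borel by blast
  have "emeasure lborel (T -` A) = emeasure lborel (Q -` (T -` A))"
    by (rule lborel_orthogonal_vimage[symmetric]) (auto intro: Ql Qn meas T A)
  also have "Q -` (T -` A) = D -` (R -` A)" by (auto simp: R)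
  finally have "ennreal J * emeasure lborel (T -` A) = ennreal J * emeasure lborel (D -` (R -` A))" by simp
  also have "\<dots> = emeasure lborel (R -` A)"
    unfolding D_def by (rule lborel_stretch_axis_vimage[OF J(1)]) (intro meas Rl A)
  also have "\<dots> = emeasure lborel A" by (rule lborel_orthogonal_vimage[OF Rl Rn A])
  finally show ?thesis by (simp add: J_def)
qed

section \<open>Hausdorff and Lebesgue measure on a hyperplane\<close>

definition oproj :: "'a::real_inner \<Rightarrow> 'a \<Rightarrow> 'a" where
  "oproj u x = x - (x \<bullet> u) *\<^sub>R u"

lemma linear_oproj: "linear (oproj u)"
  by (rule linearI) (simp_all add: oproj_def algebra_simps)

lemma continuous_oproj: "continuous_on S (oproj u)"
  unfolding oproj_def by (intro continuous_intros)

lemma measurable_oproj [measurable]: "oproj u \<in> borel_measurable (borel :: 'a::euclidean_space measure)"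
  by (rule borel_measurable_continuous_onI[OF continuous_oproj])

lemma oproj_inner [simp]: "norm u = 1 \<Longrightarrow> oproj u x \<bullet> u = 0"
  by (simp add: oproj_def inner_diff_left dot_square_norm)

lemma oproj_id: "x \<bullet> u = 0 \<Longrightarrow> oproj u x = x"
  by (simp add: oproj_def)

lemma norm_add_orthogonal_unit:
  assumes "a \<bullet> b = 0" "norm b = 1"
  shows "(norm (a + c *\<^sub>R b))\<^sup>2 = (norm a)\<^sup>2 + c\<^sup>2"
  using norm_add_Pythagorean[of a "c *\<^sub>R b"] assms by (simp add: orthogonal_def power_mult_distrib)

lemma norm_oproj_sq:
  assumes "norm u = 1"
  shows "(norm x)\<^sup>2 = (norm (oproj u x))\<^sup>2 + (x \<bullet> u)\<^sup>2"
proof -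
  have "x = oproj u x + (x \<bullet> u) *\<^sub>R u" by (simp add: oproj_def)
  then show ?thesis using norm_add_orthogonal_unit[OF oproj_inner[OF assms] assms] by metis
qed

lemma norm_oproj_le: "norm u = 1 \<Longrightarrow> norm (oproj u x) \<le> norm x"
  using norm_oproj_sq[of u x] by (metis le_add_same_cancel1 norm_ge_zero power2_le_imp_le zero_le_power2)

lemma slab_borel:
  fixes A :: "'a::euclidean_space set"
  assumes [measurable]: "A \<in> sets borel"
  shows "{x. oproj v x \<in> A \<and> \<bar>x \<bullet> v\<bar> \<le> 1 / 2} \<in> sets borel"
  by measurable

text \<open>A measure on the Borel sets of the whole space, so that
  \<open>translation_invariant_measure_unique\<close> applies with the hyperplane as
  \<open>W\<close>.\<close>

definition hyperplane_measure :: "real ^ 'n \<Rightarrow> (real ^ 'n) measure" where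
  "hyperplane_measure v = density (hausdorff_measure (CARD('n) - 1)) (indicator {x. x \<bullet> v = 0})"

text \<open>Lebesgue measure of the hyperplane without a choice of basis: the volume of the slab of
  thickness 1 over a set.\<close>

definition hyperplane_lebesgue :: "real ^ 'n \<Rightarrow> (real ^ 'n) measure" where
  "hyperplane_lebesgue v = distr (density lborel (indicator {x. \<bar>x \<bullet> v\<bar> \<le> 1 / 2})) borel (oproj v)"

lemma emeasure_hyperplane_measure:
  fixes A :: "(real ^ 'n) set"
  assumes "A \<in> sets borel"
  shows "emeasure (hyperplane_measure v) A = hausdorff_outer_measure (CARD('n) - 1) (A \<inter> {x. x \<bullet> v = 0})"
proof -
  have [measurable]: "{x :: real ^ 'n. x \<bullet> v = 0} \<in> sets borel" by measurable
  have "emeasure (hyperplane_measure v) A = (\<integral>\<^sup>+ x. indicator {x. x \<bullet> v = 0} x * indicator A x \<partial>hausdorff_measure (CARD('n) - 1))"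
    unfolding hyperplane_measure_def using assms by (subst emeasure_density) auto
  also have "\<dots> = (\<integral>\<^sup>+ x. indicator (A \<inter> {x. x \<bullet> v = 0}) x \<partial>hausdorff_measure (CARD('n) - 1))"
    by (intro nn_integral_cong) (auto simp: indicator_def)
  also have "\<dots> = emeasure (hausdorff_measure (CARD('n) - 1)) (A \<inter> {x. x \<bullet> v = 0})"
    using assms by (intro nn_integral_indicator) auto
  also have "\<dots> = hausdorff_outer_measure (CARD('n) - 1) (A \<inter> {x. x \<bullet> v = 0})"
    using assms by (intro emeasure_hausdorff_measure) auto
  finally show ?thesis .
qed

lemma emeasure_hyperplane_lebesgue:
  fixes A :: "(real ^ 'n) set"
  assumes [measurable]: "A \<in> sets borel"
  shows "emeasure (hyperplane_lebesgue v) A = emeasure lborel {x. oproj v x \<in> A \<and> \<bar>x \<bullet> v\<bar> \<le> 1 / 2}"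
proof -
  have [measurable]: "{x :: real ^ 'n. \<bar>x \<bullet> v\<bar> \<le> 1 / 2} \<in> sets borel" by measurable
  have m: "oproj v -` A \<in> sets borel" by (rule measurable_sets_borel[OF measurable_oproj assms])
  have "emeasure (hyperplane_lebesgue v) A = emeasure (density lborel (indicator {x. \<bar>x \<bullet> v\<bar> \<le> 1 / 2})) (oproj v -` A)"
    unfolding hyperplane_lebesgue_def by (subst emeasure_distr) auto
  also have "\<dots> = (\<integral>\<^sup>+ x. indicator {x. \<bar>x \<bullet> v\<bar> \<le> 1 / 2} x * indicator (oproj v -` A) x \<partial>lborel)"
    using m by (subst emeasure_density) auto
  also have "\<dots> = (\<integral>\<^sup>+ x. indicator {x. oproj v x \<in> A \<and> \<bar>x \<bullet> v\<bar> \<le> 1 / 2} x \<partial>lborel)"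
    by (intro nn_integral_cong) (auto simp: indicator_def)
  also have "\<dots> = emeasure lborel {x. oproj v x \<in> A \<and> \<bar>x \<bullet> v\<bar> \<le> 1 / 2}"
    by (intro nn_integral_indicator) measurable
  finally show ?thesis .
qed

text \<open>Shifted by \<open>v\<close>, the disc becomes part of the flat face of a ball cut by a
  half-space, and boundaries of convex bodies have finite measure. This gives the sigma-finiteness
  that uniqueness requires.\<close>

lemma hausdorff_hyperplane_cball_finite:
  fixes v :: "real ^ 'n"
  assumes v: "norm v = 1"
  shows "hausdorff_outer_measure (CARD('n) - 1) ({x. x \<bullet> v = 0} \<inter> cball 0 R) < top"
proof -
  define R' where "R' = max R 0"
  define K where "K = cball 0 (R' + 1) \<inter> {x. v \<bullet> x \<le> 1}"
  have vv: "v \<bullet> v = 1" using v by (simp add: dot_square_norm)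
  have "convex K" unfolding K_def by (intro convex_Int convex_cball convex_halfspace_le)
  moreover have "compact K" unfolding K_def by (intro compact_Int_closed compact_cball closed_halfspace_le)
  moreover have "0 \<in> interior K"
  proof (rule interiorI[of "ball 0 1"])
    show "ball 0 1 \<subseteq> K"
    proof
      fix x :: "real ^ 'n" assume "x \<in> ball 0 1"
      then have "norm x < 1" by simp
      moreover have "v \<bullet> x \<le> norm v * norm x" by (rule norm_cauchy_schwarz)
      ultimately show "x \<in> K" using v by (simp add: K_def R'_def)
    qed
  qed auto
  ultimately have fin: "hausdorff_outer_measure (DIM(real ^ 'n) - 1) (frontier K) < top"
    by (rule hausdorff_frontier_finite)
  have "(+) v ` ({x. x \<bullet> v = 0} \<inter> cball 0 R) \<subseteq> frontier K"
  proof
    fix y assume "y \<in> (+) v ` ({x. x \<bullet> v = 0} \<inter> cball 0 R)"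
    then obtain x where x: "y = v + x" "x \<bullet> v = 0" "norm x \<le> R" by auto
    have yK: "y \<in> K"
      using x v vv norm_triangle_ineq[of v x] by (auto simp: K_def R'_def inner_add_right inner_commute)
    have "y \<notin> interior K"
    proof
      assume "y \<in> interior K"
      then obtain e where e: "e > 0" "cball y e \<subseteq> K" by (meson mem_interior_cball)
      have "y + e *\<^sub>R v \<in> cball y e" using e v by (simp add: dist_norm)
      then have "v \<bullet> (y + e *\<^sub>R v) \<le> 1" using e by (auto simp: K_def)
      then show False using x vv e by (simp add: inner_add_right inner_commute)
    qed
    then show "y \<in> frontier K" using yK closure_subset by (auto simp: frontier_def)
  qed
  then have "hausdorff_outer_measure (CARD('n) - 1) ((+) v ` ({x. x \<bullet> v = 0} \<inter> cball 0 R)) < top"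
    using fin by (metis DIM_cart DIM_real hausdorff_outer_measure_mono le_less_trans mult.right_neutral)
  then show ?thesis by (simp add: hausdorff_outer_measure_translation)
qed

text \<open>Both measures live on the hyperplane and are invariant under its translations. The
  factor that relates them stays unspecified, being a matter of normalisation.\<close>

lemma hyperplane_measure_proportional:
  fixes v :: "real ^ 'n"
  assumes v: "norm v = 1" and A: "A \<in> sets borel" and B: "B \<in> sets borel"
  shows "emeasure (hyperplane_measure v) A * emeasure (hyperplane_lebesgue v) B
    = emeasure (hyperplane_measure v) B * emeasure (hyperplane_lebesgue v) (uminus -` A)"
proof (rule translation_invariant_measure_unique[where W="{x. x \<bullet> v = 0}"])
  have W: "{x :: real ^ 'n. x \<bullet> v = 0} \<in> sets borel" by measurable
  show sM: "sets (hyperplane_measure v) = sets borel" by (simp add: hyperplane_measure_def)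
  show sN: "sets (hyperplane_lebesgue v) = sets borel" by (simp add: hyperplane_lebesgue_def)
  show "sigma_finite_measure (hyperplane_measure v)"
  proof (rule sigma_finite_if_finite_on_balls[OF sM])
    fix n :: nat
    have "hausdorff_outer_measure (CARD('n) - 1) (ball 0 (real n) \<inter> {x. x \<bullet> v = 0})
        \<le> hausdorff_outer_measure (CARD('n) - 1) ({x. x \<bullet> v = 0} \<inter> cball 0 (real n))"
      by (rule hausdorff_outer_measure_mono) auto
    then show "emeasure (hyperplane_measure v) (ball 0 (real n)) < top"
      using hausdorff_hyperplane_cball_finite[OF v, of "real n"] by (simp add: emeasure_hyperplane_measure)
  qed
  show "sigma_finite_measure (hyperplane_lebesgue v)"
  proof (rule sigma_finite_if_finite_on_balls[OF sN])
    fix n :: nat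
    have "{x. oproj v x \<in> ball 0 (real n) \<and> \<bar>x \<bullet> v\<bar> \<le> 1 / 2} \<subseteq> cball 0 (real n + 1)"
    proof clarsimp
      fix x :: "real ^ 'n" assume x: "norm (oproj v x) < real n" "\<bar>x \<bullet> v\<bar> * 2 \<le> 1"
      have "norm x \<le> norm (oproj v x) + norm ((x \<bullet> v) *\<^sub>R v)"
        using norm_triangle_ineq[of "oproj v x" "(x \<bullet> v) *\<^sub>R v"] by (simp add: oproj_def)
      then show "norm x \<le> real n + 1" using x v by simp
    qed
    then have "bounded {x. oproj v x \<in> ball 0 (real n) \<and> \<bar>x \<bullet> v\<bar> \<le> 1 / 2}"
      using bounded_cball bounded_subset by blast
    then have "emeasure lborel {x. oproj v x \<in> ball 0 (real n) \<and> \<bar>x \<bullet> v\<bar> \<le> 1 / 2} < \<infinity>"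
      by (rule emeasure_bounded_finite)
    then show "emeasure (hyperplane_lebesgue v) (ball 0 (real n)) < top"
      by (subst emeasure_hyperplane_lebesgue) (simp_all del: mem_ball)
  qed
  show "AE x in hyperplane_measure v. x \<in> {x. x \<bullet> v = 0}"
    unfolding hyperplane_measure_def using W by (subst AE_density) (auto simp: indicator_def)
  have "AE x in density lborel (indicator {x. \<bar>x \<bullet> v\<bar> \<le> 1 / 2}). oproj v x \<in> {x. x \<bullet> v = 0}"
    using v by simp
  then show "AE x in hyperplane_lebesgue v. x \<in> {x. x \<bullet> v = 0}"
    unfolding hyperplane_lebesgue_def using W by (subst AE_distr_iff) auto
  fix A w assume A: "A \<in> sets (borel :: (real ^ 'n) measure)" and w: "w \<in> {x. x \<bullet> v = 0}"
  have Aw: "(\<lambda>x. x + w) -` A \<in> sets borel" by (rule borel_vimage_translation[OF A])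
  have "(\<lambda>x. x + w) ` (((\<lambda>x. x + w) -` A) \<inter> {x. x \<bullet> v = 0}) = A \<inter> {x. x \<bullet> v = 0}" (is "?f ` ?S = _")
  proof
    show "A \<inter> {x. x \<bullet> v = 0} \<subseteq> ?f ` ?S"
    proof
      fix x assume "x \<in> A \<inter> {x. x \<bullet> v = 0}"
      then show "x \<in> ?f ` ?S" using w by (intro image_eqI[of _ _ "x - w"]) (auto simp: inner_diff_left)
    qed
  qed (use w in \<open>auto simp: inner_add_left\<close>)
  moreover have "hausdorff_outer_measure (CARD('n) - 1) (?f ` ?S) = hausdorff_outer_measure (CARD('n) - 1) ?S"
    by (rule hausdorff_outer_measure_isometric_image) simp
  ultimately show "emeasure (hyperplane_measure v) ((\<lambda>x. x + w) -` A) = emeasure (hyperplane_measure v) A"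
    using A Aw by (simp add: emeasure_hyperplane_measure)
  have "oproj v (x + w) = oproj v x + w" "(x + w) \<bullet> v = x \<bullet> v" for x
    using w by (simp_all add: oproj_def inner_add_left)
  then have "{x. oproj v x \<in> (\<lambda>x. x + w) -` A \<and> \<bar>x \<bullet> v\<bar> \<le> 1 / 2} = (\<lambda>x. x + w) -` {x. oproj v x \<in> A \<and> \<bar>x \<bullet> v\<bar> \<le> 1 / 2}"
    by auto
  moreover have "{x. oproj v x \<in> A \<and> \<bar>x \<bullet> v\<bar> \<le> 1 / 2} \<in> sets borel"
    using A by (rule slab_borel)
  ultimately show "emeasure (hyperplane_lebesgue v) ((\<lambda>x. x + w) -` A) = emeasure (hyperplane_lebesgue v) A"
    using A Aw by (simp only: emeasure_hyperplane_lebesgue lborel_vimage_translation)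
qed (use A B in auto)

text \<open>Rotation invariance makes the unknown factor between the two measures the same for all
  hyperplanes.\<close>

lemma hyperplane_unit_ball_rotate:
  fixes u v :: "real ^ 'n"
  assumes u: "norm u = 1" and v: "norm v = 1"
  shows "emeasure (hyperplane_measure v) (cball 0 1) = emeasure (hyperplane_measure u) (cball 0 1)"
    and "emeasure (hyperplane_lebesgue v) (cball 0 1) = emeasure (hyperplane_lebesgue u) (cball 0 1)"
proof -
  obtain Q :: "real ^ 'n \<Rightarrow> real ^ 'n" where Q: "orthogonal_transformation Q" "Q u = v"
    using orthogonal_transformation_exists_1[OF u v] by blast
  have Ql: "linear Q" "\<And>x y. Q x \<bullet> Q y = x \<bullet> y" using Q(1) by (auto simp: orthogonal_transformation_def)
  have Qn: "norm (Q x) = norm x" for x using Ql(2) by (simp add: norm_eq_sqrt_inner)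
  have Qs: "surj Q" using Q(1) by (rule orthogonal_transformation_surj)
  have Qv: "Q x \<bullet> v = x \<bullet> u" for x using Ql(2)[of x u] Q(2) by simp
  have "Q ` (cball 0 1 \<inter> {x. x \<bullet> u = 0}) = cball 0 1 \<inter> {x. x \<bullet> v = 0}"
  proof
    show "cball 0 1 \<inter> {x. x \<bullet> v = 0} \<subseteq> Q ` (cball 0 1 \<inter> {x. x \<bullet> u = 0})"
    proof
      fix y assume y: "y \<in> cball 0 1 \<inter> {x. x \<bullet> v = 0}"
      obtain x where "y = Q x" using Qs by blast
      then show "y \<in> Q ` (cball 0 1 \<inter> {x. x \<bullet> u = 0})" using y Qn Qv by auto
    qed
  qed (auto simp: Qn Qv)
  moreover have "dist (Q x) (Q y) = dist x y" for x y
    by (simp add: dist_norm Qn linear_diff[OF Ql(1), symmetric])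
  then have "hausdorff_outer_measure (CARD('n) - 1) (Q ` (cball 0 1 \<inter> {x. x \<bullet> u = 0})) = hausdorff_outer_measure (CARD('n) - 1) (cball 0 1 \<inter> {x. x \<bullet> u = 0})"
    by (intro hausdorff_outer_measure_isometric_image)
  ultimately show "emeasure (hyperplane_measure v) (cball 0 1) = emeasure (hyperplane_measure u) (cball 0 1)"
    by (simp add: emeasure_hyperplane_measure)
  have "oproj v (Q x) = Q (oproj u x)" for x
    by (simp add: oproj_def Qv linear_diff[OF Ql(1)] linear_scale[OF Ql(1)] Q(2))
  then have "{x. oproj u x \<in> cball 0 1 \<and> \<bar>x \<bullet> u\<bar> \<le> 1 / 2} = Q -` {x. oproj v x \<in> cball 0 1 \<and> \<bar>x \<bullet> v\<bar> \<le> 1 / 2}"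
    by (auto simp: Qv Qn)
  moreover have "{x. oproj v x \<in> cball 0 1 \<and> \<bar>x \<bullet> v\<bar> \<le> 1 / 2} \<in> sets borel" by (rule slab_borel) simp
  ultimately show "emeasure (hyperplane_lebesgue v) (cball 0 1) = emeasure (hyperplane_lebesgue u) (cball 0 1)"
    by (simp only: emeasure_hyperplane_lebesgue borel_closed closed_cball lborel_orthogonal_vimage[OF Ql(1) Qn])
qed

lemma hyperplane_lebesgue_unit_ball:
  fixes u :: "real ^ 'n"
  assumes u: "norm u = 1"
  shows "0 < emeasure (hyperplane_lebesgue u) (cball 0 1)" "emeasure (hyperplane_lebesgue u) (cball 0 1) < top"
proof -
  let ?S = "{x. oproj u x \<in> cball 0 1 \<and> \<bar>x \<bullet> u\<bar> \<le> 1 / 2}"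
  have S: "?S \<in> sets borel" by (rule slab_borel) simp
  have e: "emeasure (hyperplane_lebesgue u) (cball 0 1) = emeasure lborel ?S"
    by (rule emeasure_hyperplane_lebesgue) simp
  have "ball 0 (1 / 2) \<subseteq> ?S"
  proof
    fix x :: "real ^ 'n" assume "x \<in> ball 0 (1 / 2)"
    then have "norm x < 1 / 2" by simp
    then show "x \<in> ?S" using norm_oproj_le[OF u, of x] Cauchy_Schwarz_ineq2[of x u] u by auto
  qed
  then have "emeasure lborel (ball (0 :: real ^ 'n) (1 / 2)) \<le> emeasure lborel ?S"
    using S by (intro emeasure_mono) auto
  moreover have "0 < emeasure lborel (ball (0 :: real ^ 'n) (1 / 2))" by (auto simp: emeasure_ball)
  ultimately show "0 < emeasure (hyperplane_lebesgue u) (cball 0 1)" using e by (metis less_le_trans)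
  have "?S \<subseteq> cball 0 2"
  proof clarsimp
    fix x :: "real ^ 'n" assume x: "norm (oproj u x) \<le> 1" "\<bar>x \<bullet> u\<bar> * 2 \<le> 1"
    have "norm x \<le> norm (oproj u x) + norm ((x \<bullet> u) *\<^sub>R u)"
      using norm_triangle_ineq[of "oproj u x" "(x \<bullet> u) *\<^sub>R u"] by (simp add: oproj_def)
    then show "norm x \<le> 2" using x u by simp
  qed
  then have "bounded ?S" using bounded_cball bounded_subset by blast
  then have "emeasure lborel ?S < \<infinity>" by (rule emeasure_bounded_finite)
  then show "emeasure (hyperplane_lebesgue u) (cball 0 1) < top" using e by simp
qed

text \<open>For \<open>p\<close> orthogonal to \<open>u\<close>, this lifts
  \<open>u\<^sup>\<bottom>\<close> to the graph of the linear function with gradient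
  \<open>p\<close>, that is, to the tangent directions of a graph with slope
  \<open>p\<close>.\<close>

definition shear :: "'a::real_inner \<Rightarrow> 'a \<Rightarrow> 'a \<Rightarrow> 'a" where
  "shear u p x = x + (p \<bullet> x) *\<^sub>R u"

text \<open>For \<open>p\<close> orthogonal to \<open>u\<close>, the upward unit normal of a graph
  over \<open>u\<^sup>\<bottom>\<close> with gradient \<open>p\<close>.\<close>

definition graph_normal :: "'a::real_inner \<Rightarrow> 'a \<Rightarrow> 'a" where
  "graph_normal u p = (1 / sqrt (1 + (norm p)\<^sup>2)) *\<^sub>R (u - p)"

text \<open>The linear isomorphism that maps \<open>u\<^sup>\<bottom>\<close> onto the tangent hyperplane of the graph and \<open>u\<close>
  onto its normal.\<close>

definition tangent_map :: "'a::real_inner \<Rightarrow> 'a \<Rightarrow> 'a \<Rightarrow> 'a" where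
  "tangent_map u p x = shear u p (oproj u x) + (x \<bullet> u) *\<^sub>R graph_normal u p"

lemma norm_graph_normal:
  assumes "norm u = 1" "p \<bullet> u = 0"
  shows "norm (graph_normal u p) = 1"
proof -
  have "(norm (u - p))\<^sup>2 = 1 + (norm p)\<^sup>2"
    using assms(2) unit_inner_self[OF assms(1)] unfolding power2_norm_eq_inner
    by (simp add: inner_diff_left inner_diff_right inner_commute[of u p])
  then have "norm (u - p) = sqrt (1 + (norm p)\<^sup>2)" by (metis norm_ge_zero real_sqrt_unique)
  moreover have "sqrt (1 + (norm p)\<^sup>2) > 0" by (simp add: add_pos_nonneg)
  ultimately show ?thesis by (simp add: graph_normal_def)
qed

lemma shear_inner_normal:
  assumes "norm u = 1" "p \<bullet> u = 0" "x \<bullet> u = 0"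
  shows "shear u p x \<bullet> graph_normal u p = 0"
  using assms(2,3) unit_inner_self[OF assms(1)]
  by (simp add: shear_def graph_normal_def inner_add_left inner_diff_right inner_commute[of u p] inner_commute[of x p])

lemma oproj_shear:
  assumes "norm u = 1" "y \<bullet> u = 0"
  shows "oproj u (shear u p y) = y"
  using assms unit_inner_self[OF assms(1)] by (simp add: oproj_def shear_def inner_add_left)

lemma linear_tangent_map: "linear (tangent_map u p)"
  by (rule linearI) (simp_all add: tangent_map_def shear_def oproj_def algebra_simps)

lemma tangent_map_inner_normal:
  assumes "norm u = 1" "p \<bullet> u = 0"
  shows "tangent_map u p x \<bullet> graph_normal u p = x \<bullet> u"
  using unit_inner_self[OF norm_graph_normal[OF assms]] shear_inner_normal[OF assms oproj_inner[OF assms(1)]]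
  by (simp add: tangent_map_def inner_add_left)

text \<open>Supplies \<open>T\<^sup>T T = I + p p\<^sup>T\<close> for the tangent map, both to
  \<open>lborel_vimage_rank_one_stretch\<close> and to \<open>curvature_determinant\<close>.\<close>

lemma norm_tangent_map:
  assumes u: "norm u = 1" and p: "p \<bullet> u = 0"
  shows "(norm (tangent_map u p x))\<^sup>2 = (norm x)\<^sup>2 + (p \<bullet> x)\<^sup>2"
proof -
  let ?v = "graph_normal u p" and ?y = "oproj u x"
  have v: "norm ?v = 1" by (rule norm_graph_normal[OF u p])
  have uu: "u \<bullet> u = 1" using u by (simp add: dot_square_norm)
  have yu: "?y \<bullet> u = 0" using u by simp
  have py: "p \<bullet> ?y = p \<bullet> x" using p by (simp add: oproj_def inner_diff_right)
  have sv: "shear u p ?y \<bullet> ?v = 0" by (rule shear_inner_normal[OF u p yu])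
  have "(norm (tangent_map u p x))\<^sup>2 = (norm (shear u p ?y))\<^sup>2 + (x \<bullet> u)\<^sup>2"
    unfolding tangent_map_def by (rule norm_add_orthogonal_unit[OF sv v])
  also have "(norm (shear u p ?y))\<^sup>2 = (norm ?y)\<^sup>2 + (p \<bullet> x)\<^sup>2"
    unfolding shear_def py by (rule norm_add_orthogonal_unit[OF yu u])
  finally show ?thesis using norm_oproj_sq[OF u, of x] by simp
qed

lemma shear_image_borel:
  fixes u p :: "real ^ 'n"
  assumes u: "norm u = 1" and p: "p \<bullet> u = 0" and E: "E \<in> sets borel" "E \<subseteq> {x. x \<bullet> u = 0}"
  shows "shear u p ` E = {y. y \<bullet> graph_normal u p = 0 \<and> oproj u y \<in> E}" "shear u p ` E \<in> sets borel"
proof -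
  have uu: "u \<bullet> u = 1" using u by (simp add: dot_square_norm)
  show e: "shear u p ` E = {y. y \<bullet> graph_normal u p = 0 \<and> oproj u y \<in> E}"
  proof
    show "shear u p ` E \<subseteq> {y. y \<bullet> graph_normal u p = 0 \<and> oproj u y \<in> E}"
    proof (rule image_subsetI)
      fix x assume x: "x \<in> E"
      then have xu: "x \<bullet> u = 0" using E by auto
      have "oproj u (shear u p x) = x" by (rule oproj_shear[OF u xu])
      then show "shear u p x \<in> {y. y \<bullet> graph_normal u p = 0 \<and> oproj u y \<in> E}"
        using shear_inner_normal[OF u p xu] x by simp
    qed
    show "{y. y \<bullet> graph_normal u p = 0 \<and> oproj u y \<in> E} \<subseteq> shear u p ` E"
    proof
      fix y assume "y \<in> {y. y \<bullet> graph_normal u p = 0 \<and> oproj u y \<in> E}"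
      then have y: "y \<bullet> graph_normal u p = 0" "oproj u y \<in> E" by auto
      have "1 + (norm p)\<^sup>2 \<noteq> 0" by (metis add_pos_nonneg less_irrefl zero_le_power2 zero_less_one)
      then have "y \<bullet> u = p \<bullet> y" using y(1) by (simp add: graph_normal_def inner_diff_right inner_commute)
      then have "y = shear u p (oproj u y)" using p by (simp add: shear_def oproj_def inner_diff_right)
      then show "y \<in> shear u p ` E" using y(2) by blast
    qed
  qed
  show "shear u p ` E \<in> sets borel" unfolding e using E(1) by measurable
qed

text \<open>Up to a reflection, \<open>tangent_map\<close> carries the slab of thickness 1 over
  \<open>E\<close> onto that over the sheared set, and it multiplies volumes by
  \<open>sqrt (1 + (norm p)\<^sup>2)\<close>. Both Hausdorff measures are the same multiple of these
  volumes, so the factor passes over to them.\<close>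

lemma hausdorff_shear:
  fixes u p :: "real ^ 'n"
  assumes u: "norm u = 1" and p: "p \<bullet> u = 0" and E: "E \<in> sets borel" "E \<subseteq> {x. x \<bullet> u = 0}"
  shows "hausdorff_outer_measure (CARD('n) - 1) (shear u p ` E)
    = ennreal (sqrt (1 + (norm p)\<^sup>2)) * hausdorff_outer_measure (CARD('n) - 1) E"
proof -
  let ?v = "graph_normal u p" and ?S = "shear u p ` E" and ?J = "ennreal (sqrt (1 + (norm p)\<^sup>2))"
  let ?\<mu> = "hausdorff_outer_measure (CARD('n) - 1) :: (real ^ 'n) set \<Rightarrow> ennreal"
  have v: "norm ?v = 1" by (rule norm_graph_normal[OF u p])
  note S = shear_image_borel[OF u p E]
  have mu: "emeasure (hyperplane_measure u) E = ?\<mu> E" "emeasure (hyperplane_measure ?v) ?S = ?\<mu> ?S"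
  proof -
    have "E \<inter> {x. x \<bullet> u = 0} = E" using E by auto
    then show "emeasure (hyperplane_measure u) E = ?\<mu> E" using E by (simp add: emeasure_hyperplane_measure)
    have "?S \<inter> {x. x \<bullet> ?v = 0} = ?S" using S(1) by auto
    then show "emeasure (hyperplane_measure ?v) ?S = ?\<mu> ?S" using S by (simp add: emeasure_hyperplane_measure)
  qed
  let ?a = "emeasure (hyperplane_measure u) (cball 0 1)" and ?b = "emeasure (hyperplane_lebesgue u) (cball 0 1)"
  have nE: "uminus -` E \<in> sets borel" "uminus -` ?S \<in> sets borel"
    using E(1) S(2) by (auto intro: borel_vimage_uminus)
  have 1: "?\<mu> E * ?b = ?a * emeasure (hyperplane_lebesgue u) (uminus -` E)"
    using hyperplane_measure_proportional[OF u E(1), of "cball 0 1"] mu by simp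
  have 2: "?\<mu> ?S * ?b = ?a * emeasure (hyperplane_lebesgue ?v) (uminus -` ?S)"
    using hyperplane_measure_proportional[OF v S(2), of "cball 0 1"] mu
      hyperplane_unit_ball_rotate[OF u v] by simp
  have 3: "emeasure (hyperplane_lebesgue ?v) (uminus -` ?S) = ?J * emeasure (hyperplane_lebesgue u) (uminus -` E)"
  proof -
    let ?A = "{y. oproj ?v y \<in> uminus -` ?S \<and> \<bar>y \<bullet> ?v\<bar> \<le> 1 / 2}"
    have A: "?A \<in> sets borel" using nE(2) by (rule slab_borel)
    have "tangent_map u p -` ?A = {x. oproj u x \<in> uminus -` E \<and> \<bar>x \<bullet> u\<bar> \<le> 1 / 2}"
    proof -
      have "oproj ?v (tangent_map u p x) = shear u p (oproj u x)" for x
        using tangent_map_inner_normal[OF u p, of x] by (simp add: oproj_def[of ?v]) (simp add: tangent_map_def)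
      moreover have "- shear u p (oproj u x) \<in> ?S \<longleftrightarrow> - oproj u x \<in> E" for x
      proof -
        have "oproj u (- shear u p (oproj u x)) = - oproj u x"
          using u by (simp add: linear_neg[OF linear_oproj] oproj_shear)
        moreover have "- shear u p (oproj u x) \<bullet> ?v = 0"
          using shear_inner_normal[OF u p oproj_inner[OF u], of x] by simp
        ultimately show ?thesis unfolding S(1) by simp
      qed
      ultimately show ?thesis by (auto simp: tangent_map_inner_normal[OF u p])
    qed
    then show ?thesis
      using lborel_vimage_rank_one_stretch[OF linear_tangent_map norm_tangent_map[OF u p] A] nE
      by (simp add: emeasure_hyperplane_lebesgue)
  qed
  show ?thesis
  proof (rule ennreal_mult_cancel_finite[OF _ hyperplane_lebesgue_unit_ball[OF u]])
    have "?\<mu> ?S * ?b = ?a * (?J * emeasure (hyperplane_lebesgue u) (uminus -` E))" using 2 unfolding 3 .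
    also have "\<dots> = ?J * (?a * emeasure (hyperplane_lebesgue u) (uminus -` E))" by (rule mult.left_commute)
    also have "\<dots> = ?J * ?\<mu> E * ?b" unfolding 1[symmetric] by (simp only: mult.assoc)
    finally show "?\<mu> ?S * ?b = ?J * ?\<mu> E * ?b" .
  qed
qed

section \<open>Concavity of determinants\<close>

definition outer :: "real ^ 'n \<Rightarrow> real ^ 'n ^ 'n" where
  "outer p = (\<chi> i j. p $ i * p $ j)"

lemma outer_mult_vec: "outer p *v x = (p \<bullet> x) *\<^sub>R p"
  by (simp add: outer_def matrix_vector_mult_def vec_eq_iff inner_vec_def sum_distrib_left mult_ac)

lemma matrix_inner_transpose: "x \<bullet> (A *v y) = (transpose A *v x) \<bullet> (y :: real ^ 'n)"
  by (simp add: dot_lmul_matrix)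

lemma symmetric_matrix_inner: "transpose A = A \<Longrightarrow> x \<bullet> (A *v y) = y \<bullet> (A *v (x :: real ^ 'n))"
  by (metis inner_commute matrix_inner_transpose)

text \<open>Rotating \<open>p\<close> onto a coordinate axis makes the matrix diagonal with at most
  one entry different from 1.\<close>

lemma det_add_outer:
  fixes p :: "real ^ 'n"
  shows "det (mat 1 + c *\<^sub>R outer p) = 1 + c * (norm p)\<^sup>2"
proof -
  define k :: 'n where "k = undefined"
  have "norm (norm p *\<^sub>R axis k (1::real)) = norm p" by simp
  then obtain f :: "real ^ 'n \<Rightarrow> real ^ 'n" where f: "orthogonal_transformation f" "f (norm p *\<^sub>R axis k 1) = p"
    by (rule orthogonal_transformation_exists)
  define Q where "Q = matrix f"
  have Q: "orthogonal_matrix Q" "Q *v (norm p *\<^sub>R axis k 1) = p"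
    using f orthogonal_transformation_matrix[of f] by (auto simp: Q_def matrix_works orthogonal_transformation_linear)
  let ?E = "mat 1 + (c * (norm p)\<^sup>2) *\<^sub>R outer (axis k 1) :: real ^ 'n ^ 'n"
  have QQ: "Q ** transpose Q = mat 1" using Q(1) by (simp add: orthogonal_matrix_def)
  have "mat 1 + c *\<^sub>R outer p = Q ** ?E ** transpose Q"
  proof (rule matrix_eq[THEN iffD2], rule allI)
    fix x
    have q: "Q *v (transpose Q *v x) = x" by (simp only: matrix_vector_mul_assoc QQ matrix_vector_mul_lid)
    have "p \<bullet> x = norm p * (axis k 1 \<bullet> (transpose Q *v x))"
    proof -
      have "p \<bullet> x = x \<bullet> (Q *v (norm p *\<^sub>R axis k 1))" using Q(2) by (simp add: inner_commute)
      also have "\<dots> = (transpose Q *v x) \<bullet> (norm p *\<^sub>R axis k 1)" by (rule matrix_inner_transpose)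
      also have "\<dots> = norm p * (axis k 1 \<bullet> (transpose Q *v x))"
        by (simp only: inner_scaleR_right inner_commute[of "transpose Q *v x" "axis k 1"])
      finally show ?thesis .
    qed
    moreover have "Q *v axis k 1 = (1 / norm p) *\<^sub>R p" if "p \<noteq> 0"
      using arg_cong[OF Q(2), of "\<lambda>y. (1 / norm p) *\<^sub>R y"] that by (simp add: matrix_vector_mult_scaleR)
    ultimately have *: "(c * (norm p)\<^sup>2 * (axis k 1 \<bullet> (transpose Q *v x))) *\<^sub>R (Q *v axis k 1) = (c * (p \<bullet> x)) *\<^sub>R p"
      by (cases "p = 0") (simp_all add: power2_eq_square)
    have "(Q ** ?E ** transpose Q) *v x = Q *v (?E *v (transpose Q *v x))"
      by (simp only: matrix_vector_mul_assoc matrix_mul_assoc)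
    also have "\<dots> = x + (c * (norm p)\<^sup>2 * (axis k 1 \<bullet> (transpose Q *v x))) *\<^sub>R (Q *v axis k 1)"
      by (simp add: matrix_vector_mult_add_rdistrib matrix_vector_right_distrib scaleR_matrix_vector_assoc[symmetric]
          outer_mult_vec matrix_vector_mult_scaleR q del: transpose_matrix_vector)
    finally show "(mat 1 + c *\<^sub>R outer p) *v x = (Q ** ?E ** transpose Q) *v x"
      unfolding * by (simp add: matrix_vector_mult_add_rdistrib scaleR_matrix_vector_assoc[symmetric] outer_mult_vec)
  qed
  then have "det (mat 1 + c *\<^sub>R outer p) = det (Q ** transpose Q) * det ?E"
    by (simp add: det_mul)
  then have "det (mat 1 + c *\<^sub>R outer p) = det ?E" by (simp add: QQ)
  moreover have ent: "?E $ i $ j = (if i = j then if i = k then 1 + c * (norm p)\<^sup>2 else 1 else 0)" for i j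
    by (simp add: mat_def outer_def axis_def)
  have "det ?E = (\<Prod>i\<in>UNIV. ?E $ i $ i)" by (rule det_diagonal) (simp only: ent if_False)
  also have "\<dots> = (\<Prod>i\<in>UNIV. if i = k then 1 + c * (norm p)\<^sup>2 else 1)" unfolding ent by simp
  also have "\<dots> = 1 + c * (norm p)\<^sup>2" by (simp add: prod.delta)
  ultimately show ?thesis by simp
qed

lemma quadratic_nonneg_linear_zero:
  fixes a b :: real
  assumes "\<And>t. 0 \<le> 2 * t * a + t\<^sup>2 * b"
  shows "a = 0"
proof (rule ccontr)
  assume "a \<noteq> 0"
  \<comment> \<open>At \<open>t = - a / s\<close> with \<open>s > 0\<close> and
    \<open>s \<ge> b\<close> the expression is at most \<open>- a\<^sup>2 / s\<close>, which is
    negative.\<close>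
  define s where "s = \<bar>b\<bar> + 1"
  have s: "s > 0" "b \<le> s" by (auto simp: s_def)
  have "0 \<le> 2 * (- a / s) * a + (- a / s)\<^sup>2 * b" by (rule assms)
  also have "\<dots> \<le> 2 * (- a / s) * a + (- a / s)\<^sup>2 * s" using s by (intro add_left_mono mult_left_mono) auto
  also have "\<dots> = - (a\<^sup>2 / s)" using s by (simp add: power2_eq_square field_simps)
  finally have "a\<^sup>2 / s \<le> 0" by simp
  moreover have "a\<^sup>2 / s > 0" using s \<open>a \<noteq> 0\<close> by simp
  ultimately show False by simp
qed

lemma quadratic_form_add:
  fixes A :: "real ^ 'n ^ 'n"
  assumes "transpose A = A"
  shows "(x + t *\<^sub>R w) \<bullet> (A *v (x + t *\<^sub>R w)) = x \<bullet> (A *v x) + 2 * t * (w \<bullet> (A *v x)) + t\<^sup>2 * (w \<bullet> (A *v w))"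
  using symmetric_matrix_inner[OF assms, of x w]
  by (simp add: matrix_vector_right_distrib matrix_vector_mult_scaleR inner_add_left inner_add_right power2_eq_square algebra_simps)

text \<open>A zero of a nonnegative quadratic form is a minimum, so the gradient, a multiple of
  \<open>A *v x\<close>, vanishes there; it is tested in its own direction.\<close>

lemma psd_kernel:
  fixes A :: "real ^ 'n ^ 'n"
  assumes "transpose A = A" "\<And>x. x \<bullet> (A *v x) \<ge> 0" "x \<bullet> (A *v x) = 0"
  shows "A *v x = 0"
proof -
  let ?w = "A *v x"
  have "0 \<le> 2 * t * (?w \<bullet> ?w) + t\<^sup>2 * (?w \<bullet> (A *v ?w))" for t
    using assms(2)[of "x + t *\<^sub>R ?w"] assms(3) unfolding quadratic_form_add[OF assms(1)] by simp
  then have "?w \<bullet> ?w = 0" by (rule quadratic_nonneg_linear_zero)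
  then show ?thesis by simp
qed

lemma det_kernel_zero:
  fixes A :: "real ^ 'n ^ 'n"
  assumes "A *v x = 0" "x \<noteq> 0"
  shows "det A = 0"
  using assms by (metis invertible_det_nz invertible_left_inverse matrix_left_invertible_ker)

lemma psd_det_pos:
  fixes A :: "real ^ 'n ^ 'n"
  assumes "transpose A = A" "\<And>x. x \<bullet> (A *v x) \<ge> 0" "det A \<noteq> 0" "x \<noteq> 0"
  shows "x \<bullet> (A *v x) > 0"
  using assms psd_kernel[OF assms(1,2)] det_kernel_zero by (metis less_eq_real_def)

text \<open>The generalised eigenvectors are found one after the other by maximising the quotient of the
  quadratic forms on the orthogonal complement of the previous ones.\<close>

lemma generalised_eigenvector_exists:
  fixes A B :: "real ^ 'n ^ 'n"
  assumes A: "transpose A = A" "\<And>x. x \<noteq> 0 \<Longrightarrow> x \<bullet> (A *v x) > 0" and B: "transpose B = B"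
    and S: "finite S" "\<And>s t. s \<in> S \<Longrightarrow> t \<in> S \<Longrightarrow> s \<bullet> (A *v t) = (if s = t then 1 else 0)"
      "\<And>s. s \<in> S \<Longrightarrow> \<exists>\<mu>. B *v s = \<mu> *\<^sub>R (A *v s)" "card S < CARD('n)"
  shows "\<exists>x. x \<notin> S \<and> x \<bullet> (A *v x) = 1 \<and> (\<forall>s\<in>S. s \<bullet> (A *v x) = 0) \<and> (\<exists>\<mu>. B *v x = \<mu> *\<^sub>R (A *v x))"
proof -
  define W where "W = {y. \<forall>s\<in>S. s \<bullet> (A *v y) = 0}"
  \<comment> \<open>Projection onto the \<open>A\<close>-orthogonal complement \<open>W\<close> of
    \<open>S\<close> along the span of \<open>S\<close>.\<close>
  define pr where "pr y = y - (\<Sum>s\<in>S. (s \<bullet> (A *v y)) *\<^sub>R s)" for y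
  have sumS: "t \<bullet> (A *v (\<Sum>s\<in>S. c s *\<^sub>R s)) = c t" if "t \<in> S" for t and c :: "real ^ 'n \<Rightarrow> real"
  proof -
    have "t \<bullet> (A *v (\<Sum>s\<in>S. c s *\<^sub>R s)) = (\<Sum>s\<in>S. c s * (t \<bullet> (A *v s)))"
      by (simp add: matrix_vector_mult_scaleR linear_sum[OF matrix_vector_mul_linear] inner_sum_right)
    also have "\<dots> = (\<Sum>s\<in>S. if s = t then c s else 0)" using S(2) that by (intro sum.cong) auto
    also have "\<dots> = c t" using S(1) that by (simp add: sum.delta)
    finally show ?thesis .
  qed
  have prW: "pr y \<in> W" for y
    using sumS[of _ "\<lambda>s. s \<bullet> (A *v y)"] by (simp add: W_def pr_def matrix_vector_mult_diff_distrib inner_diff_right)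
  have W_lin: "x + t *\<^sub>R y \<in> W" if "x \<in> W" "y \<in> W" for x y t
    using that by (simp add: W_def matrix_vector_right_distrib matrix_vector_mult_scaleR inner_add_right)
  \<comment> \<open>Fewer than \<open>CARD('n)\<close> vectors do not span the space, which makes
    \<open>W\<close> nontrivial.\<close>
  have "dim S < DIM(real ^ 'n)" using S(1,4) dim_le_card'[of S] by simp
  then have "span S \<noteq> UNIV" by (metis dim_UNIV dim_span less_irrefl)
  then obtain y0 where y0: "y0 \<notin> span S" by blast
  have "pr y0 \<noteq> 0"
  proof
    assume "pr y0 = 0"
    then have "y0 = (\<Sum>s\<in>S. (s \<bullet> (A *v y0)) *\<^sub>R s)" by (simp add: pr_def)
    also have "\<dots> \<in> span S" by (intro span_sum span_scale span_base)
    finally show False using y0 by simp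
  qed
  \<comment> \<open>The quotient of the two forms is homogeneous of degree 0, so its maximum over
    the compact unit sphere of \<open>W\<close> is its maximum over \<open>W\<close> without the
    origin.\<close>
  define C where "C = W \<inter> sphere 0 1"
  have "W = (\<Inter>s\<in>S. {y. s \<bullet> (A *v y) = 0})" by (auto simp: W_def)
  moreover have "closed {y. s \<bullet> (A *v y) = 0}" for s
    by (intro closed_Collect_eq continuous_intros matrix_vector_mult_linear_continuous_on)
  ultimately have "closed W" by auto
  then have cC: "compact C" unfolding C_def by (intro closed_Int_compact compact_sphere)
  have "(1 / norm (pr y0)) *\<^sub>R pr y0 \<in> C"
    using \<open>pr y0 \<noteq> 0\<close> W_lin[of 0 "pr y0"] prW by (simp add: C_def W_def)
  then have neC: "C \<noteq> {}" by blast
  have C0: "x \<noteq> 0" if "x \<in> C" for x using that by (auto simp: C_def)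
  have nz: "\<forall>x\<in>C. x \<bullet> (A *v x) \<noteq> 0" using C0 A(2) less_imp_neq by metis
  have cont: "continuous_on C (\<lambda>x. (x \<bullet> (B *v x)) / (x \<bullet> (A *v x)))"
    by (intro continuous_intros matrix_vector_mult_linear_continuous_on nz)
  obtain x0 where x0: "x0 \<in> C" "\<And>x. x \<in> C \<Longrightarrow> (x \<bullet> (B *v x)) / (x \<bullet> (A *v x)) \<le> (x0 \<bullet> (B *v x0)) / (x0 \<bullet> (A *v x0))"
    using continuous_attains_sup[OF cC neC cont] by blast
  define \<mu> where "\<mu> = (x0 \<bullet> (B *v x0)) / (x0 \<bullet> (A *v x0))"
  have x0pos: "x0 \<bullet> (A *v x0) > 0" using C0 x0(1) A(2) by blast
  \<comment> \<open>The maximum property of \<open>x0\<close> says that the form of \<open>G\<close>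
    is nonnegative on \<open>W\<close> and vanishes at \<open>x0\<close>, so \<open>G *v x0\<close>
    is orthogonal to \<open>W\<close>. It is orthogonal to \<open>S\<close> as well, since every
    \<open>s\<close> is already a generalised eigenvector; hence it is 0.\<close>
  define G where "G = \<mu> *\<^sub>R A - B"
  have Gsym: "transpose G = G" using A(1) B by (simp add: G_def transpose_def vec_eq_iff)
  have Gv: "G *v x = \<mu> *\<^sub>R (A *v x) - B *v x" for x
    by (simp add: G_def matrix_vector_mult_diff_rdistrib scaleR_matrix_vector_assoc)
  have Gx0: "x0 \<bullet> (G *v x0) = 0" using x0pos by (simp add: Gv inner_diff_right \<mu>_def)
  have Gpos: "w \<bullet> (G *v w) \<ge> 0" if w: "w \<in> W" for w
  proof (cases "w = 0")
    case False
    let ?w = "(1 / norm w) *\<^sub>R w"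
    have "?w \<in> C" using W_lin[of 0 w "1 / norm w"] w False by (simp add: C_def W_def)
    then have "(?w \<bullet> (B *v ?w)) / (?w \<bullet> (A *v ?w)) \<le> \<mu>" unfolding \<mu>_def by (rule x0)
    moreover have "?w \<bullet> (X *v ?w) = (1 / norm w)\<^sup>2 * (w \<bullet> (X *v w))" for X
      by (simp only: matrix_vector_mult_scaleR inner_scaleR_left inner_scaleR_right power2_eq_square mult.assoc)
    ultimately have "((1 / norm w)\<^sup>2 * (w \<bullet> (B *v w))) / ((1 / norm w)\<^sup>2 * (w \<bullet> (A *v w))) \<le> \<mu>" by (simp only:)
    moreover have "(1 / norm w)\<^sup>2 \<noteq> 0" using False by simp
    ultimately have "(w \<bullet> (B *v w)) / (w \<bullet> (A *v w)) \<le> \<mu>" by (metis mult_divide_mult_cancel_left)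
    then have "w \<bullet> (B *v w) \<le> \<mu> * (w \<bullet> (A *v w))" using A(2)[OF False] by (simp only: pos_divide_le_eq)
    then show ?thesis by (simp add: Gv inner_diff_right)
  qed simp
  have x0W: "x0 \<in> W" using x0(1) by (simp add: C_def)
  have Gw: "w \<bullet> (G *v x0) = 0" if w: "w \<in> W" for w
  proof (rule quadratic_nonneg_linear_zero)
    fix t show "0 \<le> 2 * t * (w \<bullet> (G *v x0)) + t\<^sup>2 * (w \<bullet> (G *v w))"
      using Gpos[OF W_lin[OF x0W w, of t]] Gx0 unfolding quadratic_form_add[OF Gsym] by simp
  qed
  have Gs: "s \<bullet> (G *v x0) = 0" if s: "s \<in> S" for s
  proof -
    obtain m where m: "B *v s = m *\<^sub>R (A *v s)" using S(3)[OF s] by blast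
    have 1: "x0 \<bullet> (A *v s) = 0" using x0W s symmetric_matrix_inner[OF A(1), of x0 s] by (simp add: W_def)
    have "s \<bullet> (G *v x0) = x0 \<bullet> (G *v s)" by (rule symmetric_matrix_inner[OF Gsym])
    also have "\<dots> = 0" by (simp add: Gv m inner_diff_right 1)
    finally show ?thesis .
  qed
  have "y \<bullet> (G *v x0) = 0" for y
  proof -
    have "y \<bullet> (G *v x0) = (pr y + (\<Sum>s\<in>S. (s \<bullet> (A *v y)) *\<^sub>R s)) \<bullet> (G *v x0)" by (simp add: pr_def)
    also have "\<dots> = pr y \<bullet> (G *v x0) + (\<Sum>s\<in>S. (s \<bullet> (A *v y)) * (s \<bullet> (G *v x0)))"
      by (simp add: inner_add_left inner_sum_left)
    finally have "y \<bullet> (G *v x0) = pr y \<bullet> (G *v x0) + (\<Sum>s\<in>S. (s \<bullet> (A *v y)) * (s \<bullet> (G *v x0)))" .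
    then show ?thesis using Gw[OF prW] Gs by simp
  qed
  then have "G *v x0 = 0" by (metis inner_eq_zero_iff)
  then have eig: "B *v x0 = \<mu> *\<^sub>R (A *v x0)" by (simp add: Gv)
  define x where "x = (1 / sqrt (x0 \<bullet> (A *v x0))) *\<^sub>R x0"
  have xA: "x \<bullet> (A *v x) = 1" using x0pos by (simp add: x_def matrix_vector_mult_scaleR)
  have xW: "x \<in> W" using W_lin[of 0 x0] x0W by (simp add: x_def W_def)
  moreover have "x \<notin> S" using xW xA by (auto simp: W_def)
  moreover have "B *v x = \<mu> *\<^sub>R (A *v x)" using eig by (simp add: x_def matrix_vector_mult_scaleR)
  ultimately show ?thesis using xA by (auto simp: W_def)
qed

text \<open>An \<open>A\<close>-orthonormal system of generalised eigenvectors is enlarged one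
  vector at a time up to \<open>CARD('n)\<close> members; indexed by the type \<open>'n\<close>, it
  can serve as the columns of a square matrix.\<close>

lemma simultaneous_diagonalisation:
  fixes A B :: "real ^ 'n ^ 'n"
  assumes A: "transpose A = A" "\<And>x. x \<noteq> 0 \<Longrightarrow> x \<bullet> (A *v x) > 0" and B: "transpose B = B"
  obtains f :: "'n \<Rightarrow> real ^ 'n" and \<mu> where
    "\<And>i j. f i \<bullet> (A *v f j) = (if i = j then 1 else 0)"
    "\<And>i j. f i \<bullet> (B *v f j) = (if i = j then \<mu> j else 0)"
proof -
  define P where "P S \<longleftrightarrow> finite S \<and> (\<forall>s\<in>S. \<forall>t\<in>S. s \<bullet> (A *v t) = (if s = t then 1 else 0)) \<and>
      (\<forall>s\<in>S. \<exists>\<mu>. B *v s = \<mu> *\<^sub>R (A *v s))" for S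
  have "\<exists>S. P S \<and> card S = k" if "k \<le> CARD('n)" for k
    using that
  proof (induction k)
    case 0 show ?case by (rule exI[of _ "{}"]) (simp add: P_def)
  next
    case (Suc k)
    then obtain S where S: "P S" "card S = k" by auto
    then have "\<exists>x. x \<notin> S \<and> x \<bullet> (A *v x) = 1 \<and> (\<forall>s\<in>S. s \<bullet> (A *v x) = 0) \<and> (\<exists>\<mu>. B *v x = \<mu> *\<^sub>R (A *v x))"
      using Suc.prems by (intro generalised_eigenvector_exists[OF A B]) (auto simp: P_def)
    then obtain x where x: "x \<notin> S" "x \<bullet> (A *v x) = 1" "\<forall>s\<in>S. s \<bullet> (A *v x) = 0" "\<exists>\<mu>. B *v x = \<mu> *\<^sub>R (A *v x)"
      by blast
    have "\<forall>s\<in>S. x \<bullet> (A *v s) = 0" using x(3) symmetric_matrix_inner[OF A(1)] by metis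
    then have "P (insert x S)" using S x unfolding P_def by auto
    moreover have "card (insert x S) = Suc k" using S x by (simp add: P_def)
    ultimately show ?case by blast
  qed
  then obtain S where S: "P S" "card S = CARD('n)" by blast
  then obtain f where f: "bij_betw f (UNIV :: 'n set) S"
    using finite_same_card_bij[of "UNIV :: 'n set" S] by (auto simp: P_def)
  have fS: "f i \<in> S" and finj: "f i = f j \<longleftrightarrow> i = j" for i j
    using f by (auto simp: bij_betw_def inj_on_def)
  obtain \<mu> where \<mu>: "\<And>j. B *v f j = \<mu> j *\<^sub>R (A *v f j)" 
  proof -
    have "\<forall>j. \<exists>\<mu>. B *v f j = \<mu> *\<^sub>R (A *v f j)" using S(1) fS by (auto simp: P_def)
    then show thesis using that by metis
  qed
  have 1: "f i \<bullet> (A *v f j) = (if i = j then 1 else 0)" for i j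
    using S(1) fS[of i] fS[of j] finj[of i j] unfolding P_def by auto
  show thesis by (rule that[of f \<mu>]) (simp_all add: 1 \<mu>)
qed

text \<open>Polya's argument: after division by the mean \<open>m\<close>, the inequality
  \<open>y \<le> exp (y - 1)\<close> is multiplied over all indices, and the exponents add up to
  0.\<close>

lemma arith_geo_mean_prod:
  fixes x :: "'a \<Rightarrow> real"
  assumes "finite S" "S \<noteq> {}" "\<And>i. i \<in> S \<Longrightarrow> x i \<ge> 0"
  shows "root (card S) (prod x S) \<le> sum x S / card S"
proof (cases "sum x S = 0")
  case True
  then have "\<forall>i\<in>S. x i = 0" using assms by (simp add: sum_nonneg_eq_0_iff)
  then have "prod x S = 0" using assms by (metis all_not_in_conv prod_zero_iff)
  then show ?thesis using True by simp
next
  case False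
  define m where "m = sum x S / card S"
  have c: "card S > 0" using assms by (simp add: card_gt_0_iff)
  have m: "m > 0" using False assms c by (simp add: m_def sum_nonneg order_less_le)
  have "(\<Prod>i\<in>S. x i / m) \<le> (\<Prod>i\<in>S. exp (x i / m - 1))"
    using assms m exp_ge_add_one_self[of "x i / m - 1" for i] by (intro prod_mono) auto
  also have "\<dots> = exp (\<Sum>i\<in>S. x i / m - 1)" using assms(1) by (simp add: exp_sum)
  also have "(\<Sum>i\<in>S. x i / m - 1) = sum x S / m - card S" by (simp add: sum_subtractf sum_divide_distrib)
  also have "\<dots> = 0" using False c by (simp add: m_def)
  finally have "prod x S \<le> m ^ card S" using m by (simp add: prod_dividef)
  then have "root (card S) (prod x S) \<le> root (card S) (m ^ card S)" using c by simp
  also have "\<dots> = m" using m c by (intro real_root_power_cancel) auto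
  finally show ?thesis unfolding m_def .
qed

text \<open>After division by \<open>a i + b i\<close> this is the inequality of arithmetic and
  geometric means for the two families of quotients, whose arithmetic means add up to 1.\<close>

lemma root_prod_superadditive:
  fixes a b :: "'a \<Rightarrow> real"
  assumes S: "finite S" "S \<noteq> {}" and ab: "\<And>i. i \<in> S \<Longrightarrow> a i \<ge> 0" "\<And>i. i \<in> S \<Longrightarrow> b i \<ge> 0" "\<And>i. i \<in> S \<Longrightarrow> a i + b i > 0"
  shows "root (card S) (prod a S) + root (card S) (prod b S) \<le> root (card S) (\<Prod>i\<in>S. a i + b i)"
proof -
  let ?N = "card S"
  have N: "?N > 0" using S by (simp add: card_gt_0_iff)
  define c where "c i = a i + b i" for i
  have c: "c i > 0" if "i \<in> S" for i using ab that by (auto simp: c_def)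
  have r: "root ?N (prod x S) = root ?N (\<Prod>i\<in>S. x i / c i) * root ?N (prod c S)" for x
  proof -
    have "prod x S = (\<Prod>i\<in>S. x i / c i) * prod c S"
      using c by (simp flip: prod.distrib) (intro prod.cong, auto dest: c)
    then show ?thesis by (simp add: real_root_mult)
  qed
  have "root ?N (\<Prod>i\<in>S. a i / c i) + root ?N (\<Prod>i\<in>S. b i / c i) \<le> (\<Sum>i\<in>S. a i / c i) / ?N + (\<Sum>i\<in>S. b i / c i) / ?N"
    using S ab c by (intro add_mono arith_geo_mean_prod) (auto intro!: divide_nonneg_pos)
  also have "\<dots> = (\<Sum>i\<in>S. (a i + b i) / c i) / ?N" by (simp add: add_divide_distrib sum.distrib)
  also have "(\<Sum>i\<in>S. (a i + b i) / c i) = (\<Sum>i\<in>S. 1)" 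
  proof (rule sum.cong)
    fix i assume "i \<in> S"
    then show "(a i + b i) / c i = 1" using c[of i] by (simp add: c_def)
  qed simp
  also have "\<dots> / ?N = 1" using N by simp
  finally have "(root ?N (\<Prod>i\<in>S. a i / c i) + root ?N (\<Prod>i\<in>S. b i / c i)) * root ?N (prod c S) \<le> 1 * root ?N (prod c S)"
    using N c by (intro mult_right_mono) (auto intro!: prod_nonneg dest: c less_imp_le)
  then show ?thesis by (simp add: r[of a] r[of b] distrib_right) (simp add: c_def)
qed

text \<open>After simultaneous diagonalisation this is the superadditivity of the geometric mean of \<open>n + 1\<close> numbers, the last of which is \<open>1\<close>.\<close>

lemma root_det_concave:
  fixes A B :: "real ^ 'n ^ 'n"
  assumes A: "transpose A = A" "\<And>x. x \<noteq> 0 \<Longrightarrow> x \<bullet> (A *v x) > 0"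
    and B: "transpose B = B" "\<And>x. x \<noteq> 0 \<Longrightarrow> x \<bullet> (B *v x) > 0"
    and lm: "l \<ge> 0" "m \<ge> 0" "l + m = 1"
  shows "det A > 0" "det B > 0"
    "l * root (CARD('n) + 1) (det A) + m * root (CARD('n) + 1) (det B) \<le> root (CARD('n) + 1) (det (l *\<^sub>R A + m *\<^sub>R B))"
proof -
  obtain f :: "'n \<Rightarrow> real ^ 'n" and \<mu> where f: "\<And>i j. f i \<bullet> (A *v f j) = (if i = j then 1 else 0)"
      "\<And>i j. f i \<bullet> (B *v f j) = (if i = j then \<mu> j else 0)"
    using simultaneous_diagonalisation[OF A B(1)] by blast
  define M where "M = (\<chi> i j. f j $ i)"
  have Mij: "(transpose M ** C ** M) $ i $ j = f i \<bullet> (C *v f j)" for C :: "real ^ 'n ^ 'n" and i j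
  proof -
    have "(transpose M ** C ** M) $ i $ j = (transpose M ** (C ** M)) $ i $ j" by (simp only: matrix_mul_assoc)
    then show ?thesis
      by (simp add: matrix_matrix_mult_def transpose_def M_def inner_vec_def matrix_vector_mult_def)
  qed
  have detM: "det M * det M * det C = (\<Prod>i\<in>UNIV. f i \<bullet> (C *v f i))" if "\<And>i j. i \<noteq> j \<Longrightarrow> f i \<bullet> (C *v f j) = 0" for C
  proof -
    have "det (transpose M ** C ** M) = (\<Prod>i\<in>UNIV. (transpose M ** C ** M) $ i $ i)"
      by (rule det_diagonal) (simp add: Mij that)
    then show ?thesis by (simp add: Mij det_mul det_transpose mult_ac)
  qed
  have fnz: "f i \<noteq> 0" for i using f(1)[of i i] by auto
  have \<mu>: "\<mu> i > 0" for i using B(2)[OF fnz[of i]] f(2)[of i i] by simp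
  have dA: "det M * det M * det A = 1" using detM[of A] f(1) by simp
  have dB: "det M * det M * det B = (\<Prod>i\<in>UNIV. \<mu> i)" using detM[of B] f(2) by simp
  have q: "f i \<bullet> ((l *\<^sub>R A + m *\<^sub>R B) *v f j) = (if i = j then l + m * \<mu> j else 0)" for i j
    using f by (simp add: matrix_vector_mult_add_rdistrib inner_add_right scaleR_matrix_vector_assoc[symmetric])
  have dC: "det M * det M * det (l *\<^sub>R A + m *\<^sub>R B) = (\<Prod>i\<in>UNIV. l + m * \<mu> i)" using detM[of "l *\<^sub>R A + m *\<^sub>R B"] q by simp
  have MM: "det M * det M > 0" using dA by (metis mult_zero_left not_real_square_gt_zero zero_neq_one)
  show "det A > 0" using dA MM by (metis zero_less_mult_pos zero_less_one)
  show "det B > 0" using dB MM \<mu> by (metis prod_pos zero_less_mult_pos)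
  let ?N = "CARD('n) + 1"
  let ?S = "UNIV :: 'n option set"
  have NS: "card ?S = ?N" by simp
  \<comment> \<open>The additional index \<open>None\<close> carries the value 1; its factor
    \<open>l + m * 1 = 1\<close> does not change the product.\<close>
  define g where "g = case_option (1 :: real) \<mu>"
  have g: "g i > 0" for i using \<mu> by (cases i) (auto simp: g_def)
  have prS: "prod h ?S = h None * (\<Prod>i\<in>UNIV. h (Some i))" for h :: "'n option \<Rightarrow> real"
    by (simp add: UNIV_option_conv prod.reindex)
  have "root ?N (\<Prod>i\<in>?S. l) + root ?N (\<Prod>i\<in>?S. m * g i) \<le> root ?N (\<Prod>i\<in>?S. l + m * g i)"
    unfolding NS[symmetric]
  proof (rule root_prod_superadditive)
    show "l + m * g i > 0" for i
    proof (cases "m = 0")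
      case False then show ?thesis using lm g[of i] by (simp add: add_nonneg_pos)
    qed (use lm in simp)
  qed (use lm less_imp_le[OF g] in auto)
  moreover have "root ?N (\<Prod>i\<in>?S. l) = l" using lm by (simp add: real_root_power_cancel[of ?N l, simplified] del: real_root_power)
  moreover have "root ?N (\<Prod>i\<in>?S. m * g i) = m * root ?N (\<Prod>i\<in>UNIV. \<mu> i)"
  proof -
    have "root ?N (\<Prod>i\<in>?S. m * g i) = root ?N (m ^ ?N) * root ?N (prod g ?S)"
      by (simp only: prod.distrib prod_constant NS real_root_mult)
    also have "root ?N (m ^ ?N) = m" using lm by (intro real_root_power_cancel) auto
    also have "prod g ?S = (\<Prod>i\<in>UNIV. \<mu> i)" by (simp add: prS g_def)
    finally show ?thesis .
  qed
  moreover have "(\<Prod>i\<in>?S. l + m * g i) = (\<Prod>i\<in>UNIV. l + m * \<mu> i)"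
    using lm by (simp add: prS g_def)
  ultimately have "l + m * root ?N (\<Prod>i\<in>UNIV. \<mu> i) \<le> root ?N (\<Prod>i\<in>UNIV. l + m * \<mu> i)" by simp
  then have "l * root ?N 1 + m * root ?N (\<Prod>i\<in>UNIV. \<mu> i) \<le> root ?N (\<Prod>i\<in>UNIV. l + m * \<mu> i)" by simp
  \<comment> \<open>The factor that the change of basis contributes to all three determinants is
    restored on both sides; being positive, it is then cancelled.\<close>
  then have "root ?N (det M * det M) * (l * root ?N (det A) + m * root ?N (det B)) \<le> root ?N (det M * det M) * root ?N (det (l *\<^sub>R A + m *\<^sub>R B))"
    unfolding dA[symmetric] dB[symmetric] dC[symmetric] real_root_mult by (simp only: distrib_left mult_ac)
  moreover have "root ?N (det M * det M) > 0" using MM by (intro real_root_gt_zero) auto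
  ultimately show "l * root ?N (det A) + m * root ?N (det B) \<le> root ?N (det (l *\<^sub>R A + m *\<^sub>R B))"
    by (simp only: mult_le_cancel_left_pos)
qed

text \<open>If a convex function increased from \<open>x\<close> to \<open>y\<close>, its values
  beyond \<open>y\<close> would be at least \<open>\<psi> y > 0\<close>, against its limit 0 at
  infinity.\<close>

lemma Conv_class_antimono:
  assumes "\<psi> \<in> Conv_class" "0 < x" "x \<le> y"
  shows "\<psi> y \<le> \<psi> x"
proof (cases "\<psi> constant_on {0<..}")
  case True
  then show ?thesis using assms(2,3) by (auto simp: constant_on_def)
next
  case False
  then have cv: "convex_on {0<..} \<psi>" and lim: "(\<psi> \<longlongrightarrow> 0) at_top" and pos: "\<And>t. t > 0 \<Longrightarrow> \<psi> t > 0"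
    using assms(1) by (auto simp: Conv_class_def)
  show ?thesis
  proof (rule ccontr)
    assume n: "\<not> \<psi> y \<le> \<psi> x"
    then have xy: "x < y" using assms(3) by (cases "x = y") auto
    have ge: "\<psi> z \<ge> \<psi> y" if z: "z > y" for z
    proof (rule ccontr)
      assume "\<not> \<psi> z \<ge> \<psi> y"
      define t where "t = (y - x) / (z - x)"
      have t: "0 < t" "t < 1" using xy z by (auto simp: t_def)
      have "(1 - t) *\<^sub>R x + t *\<^sub>R z = x + t * (z - x)" by (simp add: algebra_simps)
      also have "t * (z - x) = y - x" using xy z by (simp add: t_def)
      finally have "\<psi> y = \<psi> ((1 - t) *\<^sub>R x + t *\<^sub>R z)" by simp
      also have "\<dots> \<le> (1 - t) * \<psi> x + t * \<psi> z"
        using t assms(2) xy z by (intro convex_onD[OF cv]) auto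
      also have "\<dots> < (1 - t) * \<psi> y + t * \<psi> y"
        using t n \<open>\<not> \<psi> z \<ge> \<psi> y\<close> by (intro add_strict_mono mult_strict_left_mono) auto
      finally show False by (simp add: algebra_simps)
    qed
    have "eventually (\<lambda>z. \<psi> z < \<psi> y) at_top"
      using pos[of y] assms(2) xy by (intro order_tendstoD(2)[OF lim]) simp
    then have "eventually (\<lambda>z. \<psi> z < \<psi> y \<and> z > y) at_top"
      using eventually_gt_at_top[of y] by eventually_elim simp
    then obtain z where "\<psi> z < \<psi> y" "z > y" 
      using eventually_happens[of "\<lambda>z. \<psi> z < \<psi> y \<and> z > y" at_top] by auto
    with ge[of z] show False by simp
  qed
qed

text \<open>Let \<open>y\<close>, \<open>z\<close> and \<open>w\<close> be the roots of the three
  determinants and \<open>t = l * r + m * s\<close>. Jensen's inequality with the weights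
  \<open>l * r / t\<close> and \<open>m * s / t\<close> has \<open>(l * y + m * z) / t\<close> as
  the mean of \<open>y / r\<close> and \<open>z / s\<close>; multiplication by \<open>t\<close>
  restores \<open>l\<close> and \<open>m\<close>. As \<open>\<psi>\<close> decreases, the larger
  value \<open>w\<close> may replace \<open>l * y + m * z\<close>.\<close>

lemma affine_integrand_convex:
  fixes A B :: "real ^ 'n ^ 'n"
  assumes \<psi>: "\<psi> \<in> Conv_class" and G: "convex_on {0<..} (\<lambda>t. \<psi> (t ^ (CARD('n) + 1)))"
    and A: "transpose A = A" "\<And>x. x \<noteq> 0 \<Longrightarrow> x \<bullet> (A *v x) > 0"
    and B: "transpose B = B" "\<And>x. x \<noteq> 0 \<Longrightarrow> x \<bullet> (B *v x) > 0"
    and lm: "l \<ge> 0" "m \<ge> 0" "l + m = 1" and s: "r > 0" "s > 0"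
  shows "\<psi> (det (l *\<^sub>R A + m *\<^sub>R B) / (l * r + m * s) ^ (CARD('n) + 1)) * (l * r + m * s)
    \<le> l * (\<psi> (det A / r ^ (CARD('n) + 1)) * r) + m * (\<psi> (det B / s ^ (CARD('n) + 1)) * s)"
proof -
  let ?N = "CARD('n) + 1"
  note rd = root_det_concave[OF A B lm]
  define y z w where "y = root ?N (det A)" and "z = root ?N (det B)" and "w = root ?N (det (l *\<^sub>R A + m *\<^sub>R B))"
  have yz: "y > 0" "z > 0" using rd(1,2) by (simp_all add: y_def z_def)
  have le: "l * y + m * z \<le> w" using rd by (simp add: y_def z_def w_def)
  have pos: "l * p + m * q > 0" if "p > 0" "q > 0" for p q
  proof (cases "m = 0")
    case False then show ?thesis using lm that by (simp add: add_nonneg_pos)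
  qed (use lm that in simp)
  let ?t = "l * r + m * s"
  have t: "?t > 0" by (rule pos[OF s])
  have w: "w > 0" using le pos[OF yz] by simp
  then have "det (l *\<^sub>R A + m *\<^sub>R B) > 0" unfolding w_def by (simp add: real_root_gt_0_iff)
  then have dC: "det (l *\<^sub>R A + m *\<^sub>R B) = w ^ ?N" unfolding w_def by (intro real_root_pow_pos[symmetric]) auto
  have dA: "det A = y ^ ?N" "det B = z ^ ?N" unfolding y_def z_def using rd by (auto simp: real_root_pow_pos simp del: power_Suc)
  have "\<psi> ((w / ?t) ^ ?N) \<le> \<psi> (((l * y + m * z) / ?t) ^ ?N)"
    using le t pos[OF yz] by (intro Conv_class_antimono[OF \<psi>] power_mono divide_right_mono zero_less_power) auto
  also have "(l * y + m * z) / ?t = (l * r / ?t) *\<^sub>R (y / r) + (m * s / ?t) *\<^sub>R (z / s)"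
    using s by (simp add: add_divide_distrib)
  also have "\<psi> (\<dots> ^ ?N) \<le> (l * r / ?t) * \<psi> ((y / r) ^ ?N) + (m * s / ?t) * \<psi> ((z / s) ^ ?N)"
  proof -
    have "(l * r / ?t) + (m * s / ?t) = 1" using t by (simp add: add_divide_distrib[symmetric])
    moreover have "l * r / ?t \<ge> 0" "m * s / ?t \<ge> 0" using t lm s by auto
    moreover have "y / r \<in> {0<..}" "z / s \<in> {0<..}" using yz s by auto
    ultimately show ?thesis using G unfolding convex_on_def by blast
  qed
  finally have "\<psi> ((w / ?t) ^ ?N) * ?t \<le> ((l * r / ?t) * \<psi> ((y / r) ^ ?N) + (m * s / ?t) * \<psi> ((z / s) ^ ?N)) * ?t"
    using t by (intro mult_right_mono) auto
  also have "\<dots> = l * (\<psi> ((y / r) ^ ?N) * r) + m * (\<psi> ((z / s) ^ ?N) * s)"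
    using t by (simp add: distrib_right)
  finally show ?thesis unfolding dA dC power_divide[symmetric] .
qed

section \<open>Graph functions of convex bodies\<close>

text \<open>The open cylinder over the relative interior of the projection. Functions constant along
  \<open>u\<close> on this set replace functions on a subset of \<open>u\<^sup>\<bottom>\<close>, so
  that interiors and derivatives are those of the whole space.\<close>

definition cyl :: "'a::euclidean_space \<Rightarrow> 'a set \<Rightarrow> 'a set" where
  "cyl u K = {x. \<exists>t. x + t *\<^sub>R u \<in> interior K}"

text \<open>The overgraph function, made constant in direction \<open>u\<close>; the undergraph
  function is the same construction for \<open>- u\<close>.\<close>

definition top_fn :: "'a::euclidean_space \<Rightarrow> 'a set \<Rightarrow> 'a \<Rightarrow> real" where
  "top_fn u K x = overgraph u K (oproj u x)"

definition top_pt :: "'a::euclidean_space \<Rightarrow> 'a set \<Rightarrow> 'a \<Rightarrow> 'a" where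
  "top_pt u K x = oproj u x + top_fn u K x *\<^sub>R u"

lemma body_facts:
  assumes "convex_body_o K"
  shows "compact K" "convex K" "0 \<in> interior K" "closed K"
  using assms by (auto simp: convex_body_o_def convex_body_def compact_imp_closed)

lemma oproj_uminus [simp]: "oproj (- u) = oproj u"
  by (simp add: oproj_def fun_eq_iff)

lemma oproj_oproj [simp]: "norm u = 1 \<Longrightarrow> oproj u (oproj u x) = oproj u x"
  by (rule oproj_id) simp

lemma oproj_add_unit [simp]:
  assumes "norm u = 1"
  shows "oproj u (x + t *\<^sub>R u) = oproj u x" "oproj u (x - t *\<^sub>R u) = oproj u x"
  using unit_inner_self[OF assms] by (simp_all add: oproj_def inner_add_left inner_diff_left algebra_simps)

lemma oproj_decomp: "x = oproj u x + (x \<bullet> u) *\<^sub>R u"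
  by (simp add: oproj_def)

lemma hproj_image: "hproj u K = oproj u ` K"
  by (simp add: hproj_def oproj_def[abs_def])

lemma hproj_iff:
  assumes "norm u = 1"
  shows "x \<in> hproj u K \<longleftrightarrow> x \<bullet> u = 0 \<and> (\<exists>t. x + t *\<^sub>R u \<in> K)"
proof
  assume "x \<in> hproj u K"
  then obtain k where k: "k \<in> K" "x = oproj u k" by (auto simp: hproj_def oproj_def)
  then have "x + (k \<bullet> u) *\<^sub>R u \<in> K" using oproj_decomp[of k u] by simp
  then show "x \<bullet> u = 0 \<and> (\<exists>t. x + t *\<^sub>R u \<in> K)" using k assms by auto
next
  assume x: "x \<bullet> u = 0 \<and> (\<exists>t. x + t *\<^sub>R u \<in> K)"
  then obtain t where t: "x + t *\<^sub>R u \<in> K" by blast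
  have "oproj u (x + t *\<^sub>R u) = x" using x assms by (simp add: oproj_id)
  then show "x \<in> hproj u K" using t by (metis hproj_image imageI)
qed

lemma hproj_oproj_iff:
  assumes "norm u = 1"
  shows "oproj u x \<in> hproj u K \<longleftrightarrow> (\<exists>t. x + t *\<^sub>R u \<in> K)"
proof -
  have e: "oproj u x + t *\<^sub>R u = x + (t - x \<bullet> u) *\<^sub>R u" for t by (simp add: oproj_def algebra_simps)
  have "(\<exists>t. oproj u x + t *\<^sub>R u \<in> K) \<longleftrightarrow> (\<exists>t. x + t *\<^sub>R u \<in> K)"
    unfolding e by (metis add_diff_cancel_right')
  then show ?thesis using assms by (simp add: hproj_iff)
qed

lemma cyl_uminus [simp]: "cyl (- u) K = cyl u K"
proof -
  have "(\<exists>t. x + t *\<^sub>R (- u) \<in> interior K) \<longleftrightarrow> (\<exists>t. x + t *\<^sub>R u \<in> interior K)" for x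
    by (metis minus_minus scaleR_minus_left scaleR_minus_right)
  then show ?thesis by (simp add: cyl_def)
qed

lemma cyl_translate [simp]: "x + t *\<^sub>R u \<in> cyl u K \<longleftrightarrow> x \<in> cyl u K"
proof
  assume "x + t *\<^sub>R u \<in> cyl u K"
  then obtain s where "x + t *\<^sub>R u + s *\<^sub>R u \<in> interior K" by (auto simp: cyl_def)
  then have "x + (t + s) *\<^sub>R u \<in> interior K" by (simp add: algebra_simps)
  then show "x \<in> cyl u K" by (auto simp: cyl_def)
next
  assume "x \<in> cyl u K"
  then obtain s where "x + s *\<^sub>R u \<in> interior K" by (auto simp: cyl_def)
  then have "x + t *\<^sub>R u + (s - t) *\<^sub>R u \<in> interior K" by (simp add: algebra_simps)
  then show "x + t *\<^sub>R u \<in> cyl u K" unfolding cyl_def by blast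
qed

lemma cyl_oproj [simp]: "oproj u x \<in> cyl u K \<longleftrightarrow> x \<in> cyl u K"
  using cyl_translate[of "oproj u x" "x \<bullet> u" u K] oproj_decomp[of x u] by simp

lemma interior_subset_cyl: "interior K \<subseteq> cyl u K"
proof
  fix x assume "x \<in> interior K"
  then have "x + 0 *\<^sub>R u \<in> interior K" by simp
  then show "x \<in> cyl u K" unfolding cyl_def by blast
qed

lemma open_cyl: "open (cyl u K)"
proof -
  have "cyl u K = (\<Union>t. (\<lambda>x. x + t *\<^sub>R u) -` interior K)" by (auto simp: cyl_def)
  moreover have "open ((\<lambda>x. x + t *\<^sub>R u) -` interior K)" for t
    by (intro open_vimage continuous_intros) auto
  ultimately show ?thesis by auto
qed

lemma convex_cyl:
  assumes "convex K"
  shows "convex (cyl u K)"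
proof (rule convexI)
  fix x y and a b :: real assume x: "x \<in> cyl u K" and y: "y \<in> cyl u K" and ab: "0 \<le> a" "0 \<le> b" "a + b = 1"
  from x y obtain s t where "x + s *\<^sub>R u \<in> interior K" "y + t *\<^sub>R u \<in> interior K" by (auto simp: cyl_def)
  then have "a *\<^sub>R (x + s *\<^sub>R u) + b *\<^sub>R (y + t *\<^sub>R u) \<in> interior K"
    using ab by (intro convexD[OF convex_interior[OF assms]])
  then have "a *\<^sub>R x + b *\<^sub>R y + (a * s + b * t) *\<^sub>R u \<in> interior K" by (simp add: algebra_simps)
  then show "a *\<^sub>R x + b *\<^sub>R y \<in> cyl u K" unfolding cyl_def by blast
qed

text \<open>Needed because it shows that bodies with the same projection share the cylinder. An
  interior point is pushed slightly away from the origin inside the projection and then pulled back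
  towards \<open>0 \<in> interior K\<close>, which brings its fibre into the interior of
  \<open>K\<close>.\<close>

lemma cyl_eq_interior:
  assumes u: "norm u = 1" and K: "convex_body_o K"
  shows "cyl u K = interior {x. oproj u x \<in> hproj u K}"
proof
  show "cyl u K \<subseteq> interior {x. oproj u x \<in> hproj u K}"
    using open_cyl interior_subset[of K] by (intro interior_maximal) (auto simp: cyl_def hproj_oproj_iff[OF u])
  show "interior {x. oproj u x \<in> hproj u K} \<subseteq> cyl u K"
  proof
    fix x assume x: "x \<in> interior {x. oproj u x \<in> hproj u K}"
    then obtain e where e: "e > 0" "ball x e \<subseteq> {x. oproj u x \<in> hproj u K}" by (meson mem_interior)
    \<comment> \<open>The scale is chosen so that \<open>d * norm x \<le> e / 2\<close>; the summand
      1 allows \<open>x = 0\<close>.\<close>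
    define d where "d = e / (2 * (norm x + 1))"
    have n1: "norm x + 1 > 0" by (simp add: add_nonneg_pos)
    then have d: "d > 0" using e by (simp add: d_def)
    have "d * norm x \<le> d * (norm x + 1)" using d by simp
    also have "\<dots> = e / 2" using n1 by (simp add: d_def field_simps)
    finally have "(1 + d) *\<^sub>R x \<in> ball x e" using e d by (simp add: dist_norm algebra_simps)
    then obtain t where t: "(1 + d) *\<^sub>R x + t *\<^sub>R u \<in> K" using e by (auto simp: hproj_oproj_iff[OF u])
    note B = body_facts[OF K]
    have "((1 + d) *\<^sub>R x + t *\<^sub>R u) - (d / (1 + d)) *\<^sub>R (((1 + d) *\<^sub>R x + t *\<^sub>R u) - 0) \<in> interior K"
      using d by (intro mem_interior_convex_shrink[OF B(2,3) t]) auto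
    also have "((1 + d) *\<^sub>R x + t *\<^sub>R u) - (d / (1 + d)) *\<^sub>R (((1 + d) *\<^sub>R x + t *\<^sub>R u) - 0)
        = (1 - d / (1 + d)) *\<^sub>R ((1 + d) *\<^sub>R x + t *\<^sub>R u)" by (simp add: algebra_simps)
    also have "1 - d / (1 + d) = 1 / (1 + d)" using d by (simp add: field_simps)
    also have "(1 / (1 + d)) *\<^sub>R ((1 + d) *\<^sub>R x + t *\<^sub>R u) = x + (t / (1 + d)) *\<^sub>R u"
      using d by (simp add: scaleR_add_right)
    finally show "x \<in> cyl u K" unfolding cyl_def by blast
  qed
qed

lemma cyl_cong:
  assumes "norm u = 1" "convex_body_o K" "convex_body_o L" "hproj u K = hproj u L"
  shows "cyl u K = cyl u L"
  using assms by (simp add: cyl_eq_interior)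

lemma fibre_compact:
  assumes u: "norm u = 1" and K: "compact K"
  shows "compact {t. x + t *\<^sub>R u \<in> K}"
proof -
  have "closed ((\<lambda>t. x + t *\<^sub>R u) -` K)"
    by (intro closed_vimage compact_imp_closed[OF K] continuous_intros)
  moreover obtain B where B: "\<And>y. y \<in> K \<Longrightarrow> norm y \<le> B" using compact_imp_bounded[OF K] by (auto simp: bounded_iff)
  have "\<bar>t\<bar> \<le> B + norm x" if "x + t *\<^sub>R u \<in> K" for t
    using B[OF that] norm_triangle_ineq4[of "x + t *\<^sub>R u" x] u by simp
  then have "bounded {t. x + t *\<^sub>R u \<in> K}" by (auto simp: bounded_iff)
  ultimately show ?thesis by (simp add: compact_eq_bounded_closed vimage_def)
qed

lemma top_fn_max:
  assumes u: "norm u = 1" and K: "compact K" and x: "oproj u x + t *\<^sub>R u \<in> K"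
  shows "top_pt u K x \<in> K" "t \<le> top_fn u K x"
proof -
  let ?S = "{t. oproj u x + t *\<^sub>R u \<in> K}"
  have "?S \<noteq> {}" using x by blast
  then obtain s where s: "s \<in> ?S" "\<And>t. t \<in> ?S \<Longrightarrow> t \<le> s"
    using compact_attains_sup[OF fibre_compact[OF u K]] by metis
  then have "top_fn u K x = s" unfolding top_fn_def overgraph_def by (intro cSup_eq_maximum) auto
  then show "top_pt u K x \<in> K" "t \<le> top_fn u K x" using s x by (auto simp: top_pt_def)
qed

lemma top_fn_unique:
  assumes u: "norm u = 1" and K: "compact K" and x: "oproj u x + s *\<^sub>R u \<in> K" "\<And>t. oproj u x + t *\<^sub>R u \<in> K \<Longrightarrow> t \<le> s"
  shows "top_fn u K x = s"
  using top_fn_max[OF u K x(1)] x(2) by (fastforce simp: top_pt_def)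

lemma top_fn_cyl [simp]:
  "norm u = 1 \<Longrightarrow> top_fn u K (x + t *\<^sub>R u) = top_fn u K x"
  "norm u = 1 \<Longrightarrow> top_fn u K (oproj u x) = top_fn u K x"
  by (simp_all add: top_fn_def)

lemma top_pt_cyl [simp]:
  "norm u = 1 \<Longrightarrow> top_pt u K (x + t *\<^sub>R u) = top_pt u K x"
  "norm u = 1 \<Longrightarrow> top_pt u K (oproj u x) = top_pt u K x"
  by (simp_all add: top_pt_def)

lemma top_pt_props [simp]:
  assumes "norm u = 1"
  shows "top_pt u K x \<bullet> u = top_fn u K x" "oproj u (top_pt u K x) = oproj u x" "top_fn u K (top_pt u K x) = top_fn u K x"
    "top_pt u K (top_pt u K x) = top_pt u K x" "top_pt u K x \<in> cyl u K \<longleftrightarrow> x \<in> cyl u K"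
  using unit_inner_self[OF assms] assms by (simp_all add: top_pt_def inner_add_left)

lemma top_pt_eq_iff:
  "norm u = 1 \<Longrightarrow> top_pt u K x = x \<longleftrightarrow> x \<bullet> u = top_fn u K x"
  by (metis oproj_decomp top_pt_def top_pt_props(1))

text \<open>Lets the lower boundary be treated as the upper boundary in direction
  \<open>- u\<close>.\<close>

lemma undergraph_eq_overgraph: "undergraph u K x = overgraph (- u) K x"
proof -
  have "{t. x + t *\<^sub>R - u \<in> K} = uminus ` {t. x + t *\<^sub>R u \<in> K}"
  proof (rule set_eqI)
    fix t
    have "t \<in> uminus ` A \<longleftrightarrow> - t \<in> A" for A :: "real set" by (metis image_iff minus_minus)
    then show "t \<in> {t. x + t *\<^sub>R - u \<in> K} \<longleftrightarrow> t \<in> uminus ` {t. x + t *\<^sub>R u \<in> K}" by simp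
  qed
  then show ?thesis by (simp add: undergraph_def overgraph_def Inf_real_def)
qed

lemma cyl_interior_below:
  assumes u: "norm u = 1" and K: "convex_body_o K" and x: "x \<in> cyl u K"
  obtains t0 where "t0 < top_fn u K x" "oproj u x + t0 *\<^sub>R u \<in> interior K"
proof -
  obtain s where "x + s *\<^sub>R u \<in> interior K" using x by (auto simp: cyl_def)
  then have s: "oproj u x + (s + x \<bullet> u) *\<^sub>R u \<in> interior K" (is "?z \<in> _") by (simp add: oproj_def algebra_simps)
  then obtain e where e: "e > 0" "cball ?z e \<subseteq> K" by (meson mem_interior_cball)
  have "?z + e *\<^sub>R u \<in> cball ?z e" using e u by (simp add: dist_norm)
  then have "oproj u x + (s + x \<bullet> u + e) *\<^sub>R u \<in> K" using e by (auto simp: algebra_simps)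
  then have "s + x \<bullet> u + e \<le> top_fn u K x" by (rule top_fn_max[OF u body_facts(1)[OF K]])
  then show thesis using that[OF _ s] e by simp
qed

lemma cyl_fibre:
  assumes u: "norm u = 1" and K: "convex_body_o K" and x: "x \<in> cyl u K"
  shows "top_pt u K x \<in> K" "oproj u x + t *\<^sub>R u \<in> K \<Longrightarrow> t \<le> top_fn u K x"
proof -
  obtain t0 where "t0 < top_fn u K x" "oproj u x + t0 *\<^sub>R u \<in> interior K" by (rule cyl_interior_below[OF assms])
  then have "oproj u x + t0 *\<^sub>R u \<in> K" using interior_subset by blast
  then show "top_pt u K x \<in> K" by (rule top_fn_max[OF u body_facts(1)[OF K]])
qed (rule top_fn_max[OF u body_facts(1)[OF K]])

lemma top_pt_frontier:
  assumes u: "norm u = 1" and K: "convex_body_o K" and x: "x \<in> cyl u K"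
  shows "top_pt u K x \<in> frontier K"
proof -
  have "top_pt u K x \<notin> interior K"
  proof
    assume "top_pt u K x \<in> interior K"
    then obtain e where e: "e > 0" "cball (top_pt u K x) e \<subseteq> K" by (meson mem_interior_cball)
    have "top_pt u K x + e *\<^sub>R u \<in> cball (top_pt u K x) e" using e u by (simp add: dist_norm)
    then have "oproj u x + (top_fn u K x + e) *\<^sub>R u \<in> K" using e by (auto simp: top_pt_def algebra_simps)
    then show False using cyl_fibre(2)[OF assms] e by fastforce
  qed
  then show ?thesis using cyl_fibre(1)[OF assms] closure_subset by (auto simp: frontier_def)
qed

lemma strictly_between_interior:
  assumes u: "norm u = 1" and K: "convex_body_o K" and t0: "oproj u x + t0 *\<^sub>R u \<in> interior K"
    and t: "t0 < t" "t < top_fn u K x"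
  shows "oproj u x + t *\<^sub>R u \<in> interior K"
proof -
  let ?f = "top_fn u K x"
  define \<theta> where "\<theta> = (?f - t) / (?f - t0)"
  have \<theta>: "0 < \<theta>" "\<theta> \<le> 1" using t by (auto simp: \<theta>_def)
  have "oproj u x + t0 *\<^sub>R u \<in> K" using t0 interior_subset by blast
  then have top: "top_pt u K x \<in> K" by (rule top_fn_max[OF u body_facts(1)[OF K]])
  have "top_pt u K x - \<theta> *\<^sub>R (top_pt u K x - (oproj u x + t0 *\<^sub>R u)) \<in> interior K"
    by (rule mem_interior_convex_shrink[OF body_facts(2)[OF K] t0 top \<theta>])
  also have "top_pt u K x - \<theta> *\<^sub>R (top_pt u K x - (oproj u x + t0 *\<^sub>R u)) = oproj u x + (?f - \<theta> * (?f - t0)) *\<^sub>R u"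
    by (simp add: top_pt_def algebra_simps)
  also have "\<theta> * (?f - t0) = ?f - t" using t by (simp add: \<theta>_def)
  finally show ?thesis by simp
qed

lemma top_fn_sum_pos:
  assumes u: "norm u = 1" and K: "convex_body_o K" and x: "x \<in> cyl u K"
  shows "top_fn u K x + top_fn (- u) K x > 0"
proof -
  obtain t0 where t0: "t0 < top_fn u K x" "oproj u x + t0 *\<^sub>R u \<in> interior K" by (rule cyl_interior_below[OF assms])
  then have "oproj (- u) x + (- t0) *\<^sub>R - u \<in> K" using interior_subset by auto
  then have "- t0 \<le> top_fn (- u) K x" using u by (intro top_fn_max[OF _ body_facts(1)[OF K]]) auto
  then show ?thesis using t0 by simp
qed

text \<open>The fibre contains an interior point of \<open>K\<close>. A point strictly between the
  two ends of the fibre is that point or lies between it and one of the ends, hence is interior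
  itself.\<close>

lemma frontier_cyl_cases:
  assumes u: "norm u = 1" and K: "convex_body_o K" and y: "y \<in> frontier K" "y \<in> cyl u K"
  shows "top_pt u K y = y \<or> top_pt (- u) K y = y"
proof (rule ccontr)
  assume n: "\<not> ?thesis"
  have yK: "y \<in> K" "y \<notin> interior K" using y body_facts(4)[OF K] by (auto simp: frontier_def)
  have u': "norm (- u) = 1" using u by simp
  have "y \<bullet> u \<le> top_fn u K y" using yK(1) oproj_decomp[of y u] by (intro cyl_fibre(2)[OF u K y(2)]) simp
  then have 1: "y \<bullet> u < top_fn u K y" using n top_pt_eq_iff[OF u] by fastforce
  have "y \<bullet> (- u) \<le> top_fn (- u) K y" using yK(1) oproj_decomp[of y u] y(2) by (intro cyl_fibre(2)[OF u' K]) auto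
  then have 2: "y \<bullet> (- u) < top_fn (- u) K y" using n top_pt_eq_iff[OF u'] by fastforce
  obtain t0 where t0: "t0 < top_fn u K y" "oproj u y + t0 *\<^sub>R u \<in> interior K" by (rule cyl_interior_below[OF u K y(2)])
  consider "t0 < y \<bullet> u" | "t0 = y \<bullet> u" | "y \<bullet> u < t0" by linarith
  then have "oproj u y + (y \<bullet> u) *\<^sub>R u \<in> interior K"
  proof cases
    case 1
    then show ?thesis using \<open>y \<bullet> u < top_fn u K y\<close> by (intro strictly_between_interior[OF u K t0(2)]) auto
  next
    case 3
    have "oproj (- u) y + (y \<bullet> (- u)) *\<^sub>R (- u) \<in> interior K"
      by (rule strictly_between_interior[OF u' K, of _ "- t0"]) (use t0 2 3 in auto)
    then show ?thesis by simp
  qed (use t0 in auto)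
  then show False using yK oproj_decomp[of y u] by simp
qed

text \<open>Points close to \<open>X\<close> can be lowered by the fixed amount
  \<open>\<tau>\<close> and are then in \<open>K\<close>, so they are not lowest points of their
  fibres.\<close>

lemma frontier_near_top:
  assumes u: "norm u = 1" and K: "convex_body_o K" and x: "X \<in> cyl u K" "top_pt u K X = X"
  obtains \<rho> where "\<rho> > 0" "\<And>Y. Y \<in> frontier K \<Longrightarrow> norm (Y - X) < \<rho> \<Longrightarrow> Y \<in> cyl u K \<and> top_pt u K Y = Y"
proof -
  obtain t0 where t0: "t0 < top_fn u K X" "oproj u X + t0 *\<^sub>R u \<in> interior K" by (rule cyl_interior_below[OF u K x(1)])
  obtain e where e: "e > 0" "ball (oproj u X + t0 *\<^sub>R u) e \<subseteq> interior K"
    using t0(2) by (metis open_contains_ball open_interior)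
  obtain e' where e': "e' > 0" "ball X e' \<subseteq> cyl u K" using x(1) open_cyl by (metis open_contains_ball)
  define \<tau> where "\<tau> = top_fn u K X - t0"
  have \<tau>: "\<tau> > 0" using t0 by (simp add: \<tau>_def)
  have XZ: "X - \<tau> *\<^sub>R u = oproj u X + t0 *\<^sub>R u"
    using x(2) by (subst x(2)[symmetric]) (simp add: top_pt_def \<tau>_def algebra_simps)
  show thesis
  proof
    show "min e e' > 0" using e e' by simp
    fix Y assume Y: "Y \<in> frontier K" "norm (Y - X) < min e e'"
    have Yc: "Y \<in> cyl u K" using Y(2) e'(2) by (auto simp: dist_norm norm_minus_commute subset_eq)
    have "Y - \<tau> *\<^sub>R u \<in> ball (oproj u X + t0 *\<^sub>R u) e"
      using Y(2) by (simp add: XZ[symmetric] dist_norm norm_minus_commute)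
    then have "Y - \<tau> *\<^sub>R u \<in> K" using e interior_subset by blast
    then have "oproj (- u) Y + (\<tau> - Y \<bullet> u) *\<^sub>R (- u) \<in> K" by (simp add: oproj_def algebra_simps)
    then have "\<tau> - Y \<bullet> u \<le> top_fn (- u) K Y" using u by (intro top_fn_max[OF _ body_facts(1)[OF K]]) auto
    then have "top_pt (- u) K Y \<noteq> Y" using \<tau> top_pt_eq_iff[of "- u" K Y] u by auto
    then show "Y \<in> cyl u K \<and> top_pt u K Y = Y" using frontier_cyl_cases[OF u K Y(1) Yc] Yc by blast
  qed
qed

lemma top_fn_concave:
  assumes u: "norm u = 1" and K: "convex_body_o K"
  shows "concave_on (cyl u K) (top_fn u K)"
  unfolding concave_on_iff
proof (intro conjI ballI allI impI)
  show "convex (cyl u K)" by (rule convex_cyl[OF body_facts(2)[OF K]])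
  fix x y :: 'a and a b :: real assume x: "x \<in> cyl u K" and y: "y \<in> cyl u K" and ab: "0 \<le> a" "0 \<le> b" "a + b = 1"
  have "a *\<^sub>R top_pt u K x + b *\<^sub>R top_pt u K y \<in> K"
    using ab cyl_fibre(1)[OF u K x] cyl_fibre(1)[OF u K y] by (intro convexD[OF body_facts(2)[OF K]])
  also have "a *\<^sub>R top_pt u K x + b *\<^sub>R top_pt u K y = oproj u (a *\<^sub>R x + b *\<^sub>R y) + (a * top_fn u K x + b * top_fn u K y) *\<^sub>R u"
    by (simp add: top_pt_def linear_add[OF linear_oproj] linear_scale[OF linear_oproj] algebra_simps)
  finally show "a * top_fn u K x + b * top_fn u K y \<le> top_fn u K (a *\<^sub>R x + b *\<^sub>R y)"
    by (rule top_fn_max[OF u body_facts(1)[OF K]])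
qed

lemma top_fn_continuous:
  assumes u: "norm u = 1" and K: "convex_body_o K"
  shows "continuous_on (cyl u K) (top_fn u K)"
proof -
  have "convex_on (cyl u K) (\<lambda>x. - top_fn u K x)" using top_fn_concave[OF assms] by (simp add: concave_on_def)
  then have "continuous_on (cyl u K) (\<lambda>x. - top_fn u K x)" by (intro convex_on_continuous open_cyl)
  then have "continuous_on (cyl u K) (\<lambda>x. - (- top_fn u K x))" by (rule continuous_on_minus)
  then show ?thesis by simp
qed

text \<open>The segment from \<open>y\<close> to \<open>z\<close> is prolonged by
  \<open>\<rho>\<close> to a point \<open>w\<close> of the larger ball, where
  \<open>\<bar>F\<bar> \<le> M\<close>; concavity along it bounds the slope by
  \<open>2 * M / \<rho>\<close>.\<close>

lemma concave_on_locally_lipschitz: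
  fixes F :: "'a::euclidean_space \<Rightarrow> real"
  assumes F: "concave_on S F" "continuous_on S F" and S: "open S" "x \<in> S"
  obtains L \<rho> where "L > 0" "\<rho> > 0" "ball x \<rho> \<subseteq> S" "\<And>y z. y \<in> ball x \<rho> \<Longrightarrow> z \<in> ball x \<rho> \<Longrightarrow> \<bar>F y - F z\<bar> \<le> L * norm (y - z)"
proof -
  have "\<exists>e>0. cball x e \<subseteq> S" by (rule bspec[OF iffD1[OF open_contains_cball S(1)] S(2)])
  then obtain e where e: "e > 0" "cball x e \<subseteq> S" by (elim exE conjE)
  have "compact (F ` cball x e)" by (rule compact_continuous_image[OF continuous_on_subset[OF F(2) e(2)] compact_cball])
  then have "bounded (F ` cball x e)" by (rule compact_imp_bounded)
  then obtain M where "\<forall>y\<in>F ` cball x e. norm y \<le> M" unfolding bounded_iff by blast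
  then have M: "\<bar>F y\<bar> \<le> M" if "y \<in> cball x e" for y using that unfolding real_norm_def by blast
  define \<rho> where "\<rho> = e / 2"
  have \<rho>: "\<rho> > 0" using e by (simp add: \<rho>_def)
  have M0: "M \<ge> 0" using M[of x] e by simp
  \<comment> \<open>The summand 1 keeps the constant positive when \<open>M = 0\<close>.\<close>
  have half: "F y - F z \<le> (2 * M + 1) / \<rho> * norm (y - z)" if y: "y \<in> ball x \<rho>" and z: "z \<in> ball x \<rho>" for y z
  proof (cases "y = z")
    case False
    define n where "n = norm (z - y)"
    have n: "n > 0" using False by (simp add: n_def)
    define w where "w = z + (\<rho> / n) *\<^sub>R (z - y)"
    have "norm (w - z) = \<rho>" using n \<rho> by (simp add: w_def n_def)
    then have "dist x w \<le> e" using z dist_triangle[of x w z] by (simp add: \<rho>_def dist_norm norm_minus_commute)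
    then have w: "w \<in> cball x e" by simp
    have yc: "y \<in> cball x e" using y \<rho> e by (simp add: \<rho>_def)
    define t where "t = n / (n + \<rho>)"
    have t: "0 \<le> t" "t \<le> 1" using n \<rho> by (auto simp: t_def)
    have "1 + \<rho> / n = (n + \<rho>) / n" using n by (simp add: field_simps)
    then have "t * (1 + \<rho> / n) = 1" using n \<rho> by (simp add: t_def)
    moreover have "(1 - t) *\<^sub>R y + t *\<^sub>R w = y + (t * (1 + \<rho> / n)) *\<^sub>R (z - y)" by (simp add: w_def algebra_simps)
    ultimately have "z = (1 - t) *\<^sub>R y + t *\<^sub>R w" by simp
    moreover have "y \<in> S" "w \<in> S" using w yc e(2) by blast+
    ultimately have "F z \<ge> (1 - t) * F y + t * F w"
      using concave_onD[OF F(1) t, of y w] by simp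
    then have "F y - F z \<le> t * (F y - F w)" by (simp add: algebra_simps)
    also have "\<dots> \<le> t * (2 * M)" using M[OF w] M[OF yc] t by (intro mult_left_mono) auto
    also have "\<dots> \<le> n / \<rho> * (2 * M)" using n \<rho> M0 by (intro mult_right_mono) (auto simp: t_def frac_le)
    also have "\<dots> \<le> n / \<rho> * (2 * M + 1)" using n \<rho> by (intro mult_left_mono) auto
    finally show ?thesis by (simp add: n_def norm_minus_commute mult_ac)
  qed simp
  show thesis
  proof
    show "(2 * M + 1) / \<rho> > 0" using M0 \<rho> by simp
    show "ball x \<rho> \<subseteq> S" using e by (auto simp: \<rho>_def subset_eq)
    fix y z assume "y \<in> ball x \<rho>" "z \<in> ball x \<rho>"
    then show "\<bar>F y - F z\<bar> \<le> (2 * M + 1) / \<rho> * norm (y - z)"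
      using half[of y z] half[of z y] by (simp add: abs_le_iff norm_minus_commute)
  qed (rule \<rho>)
qed

section \<open>Graph combinations of two bodies\<close>

lemma graph_combination_uminus: "graph_combination (- u) a K1 b K2 = graph_combination u a K1 b K2"
proof -
  have h: "hproj (- u) K = hproj u K" for K :: "'a set" by (simp add: hproj_def)
  have o: "overgraph (- u) K x = undergraph u K x" "undergraph (- u) K x = overgraph u K x" for K :: "'a set" and x
    by (simp_all add: undergraph_eq_overgraph)
  show ?thesis
  proof (rule set_eqI, rule iffI)
    fix z assume "z \<in> graph_combination (- u) a K1 b K2"
    then obtain x t where xt: "z = x + t *\<^sub>R - u" "x \<in> hproj u K1" "- (a * overgraph u K1 x + b * overgraph u K2 x) \<le> t"
      "t \<le> a * undergraph u K1 x + b * undergraph u K2 x" unfolding graph_combination_def h o by blast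
    then have "z = x + (- t) *\<^sub>R u" "- (a * undergraph u K1 x + b * undergraph u K2 x) \<le> - t"
      "- t \<le> a * overgraph u K1 x + b * overgraph u K2 x" by auto
    then show "z \<in> graph_combination u a K1 b K2" using xt(2) unfolding graph_combination_def by blast
  next
    fix z assume "z \<in> graph_combination u a K1 b K2"
    then obtain x t where xt: "z = x + t *\<^sub>R u" "x \<in> hproj u K1" "- (a * undergraph u K1 x + b * undergraph u K2 x) \<le> t"
      "t \<le> a * overgraph u K1 x + b * overgraph u K2 x" unfolding graph_combination_def by blast
    then have "z = x + (- t) *\<^sub>R - u" "- (a * overgraph u K1 x + b * overgraph u K2 x) \<le> - t"
      "- t \<le> a * undergraph u K1 x + b * undergraph u K2 x" by auto
    then show "z \<in> graph_combination (- u) a K1 b K2" using xt(2) unfolding graph_combination_def h o by blast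
  qed
qed

text \<open>Writes a dilation as a combination with weight 0, so that all three bodies of the
  inequality are instances of one construction.\<close>

lemma graph_dilation_eq: "graph_dilation u c K = graph_combination u c K 0 K'"
  by (simp add: graph_dilation_def graph_combination_def)

lemma graph_combination_commute:
  "hproj u K1 = hproj u K2 \<Longrightarrow> graph_combination u a K1 b K2 = graph_combination u b K2 a K1"
  by (simp add: graph_combination_def add.commute)

lemma hproj_fibre:
  assumes u: "norm u = 1" and K: "compact K" and x: "x \<in> hproj u K"
  shows "x + overgraph u K x *\<^sub>R u \<in> K" "x - undergraph u K x *\<^sub>R u \<in> K"
    "x + t *\<^sub>R u \<in> K \<Longrightarrow> - undergraph u K x \<le> t \<and> t \<le> overgraph u K x"
proof -
  have x0: "x \<bullet> u = 0" and ex: "\<exists>t. x + t *\<^sub>R u \<in> K" using x by (auto simp: hproj_iff[OF u])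
  then have px: "oproj u x = x" by (simp add: oproj_id)
  have u': "norm (- u) = 1" using u by simp
  obtain s where s: "x + s *\<^sub>R u \<in> K" using ex by blast
  then have s': "oproj (- u) x + (- s) *\<^sub>R - u \<in> K" by (simp add: px)
  show "x + overgraph u K x *\<^sub>R u \<in> K" "x - undergraph u K x *\<^sub>R u \<in> K"
    using top_fn_max[OF u K, of x s] top_fn_max[OF u' K s'] s
    by (auto simp: px top_pt_def top_fn_def undergraph_eq_overgraph)
  assume t: "x + t *\<^sub>R u \<in> K"
  then have "oproj (- u) x + (- t) *\<^sub>R - u \<in> K" by (simp add: px)
  then show "- undergraph u K x \<le> t \<and> t \<le> overgraph u K x"
    using top_fn_max[OF u K, of x t] top_fn_max[OF u' K, of x "- t"] t
    by (auto simp: px top_pt_def top_fn_def undergraph_eq_overgraph)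
qed

text \<open>The graph combination is a linear image of the fibre product of the two bodies, hence compact
  and convex.\<close>

lemma graph_combination_image:
  assumes u: "norm u = 1" and K1: "compact K1" "convex K1" and K2: "compact K2" "convex K2"
    and h: "hproj u K1 = hproj u K2" and ab: "a \<ge> 0" "b \<ge> 0"
  shows "graph_combination u a K1 b K2
    = (\<lambda>(x, y). oproj u x + (a * (x \<bullet> u) + b * (y \<bullet> u)) *\<^sub>R u) ` {(x, y). x \<in> K1 \<and> y \<in> K2 \<and> oproj u x = oproj u y}"
    (is "_ = ?h ` ?F")
proof
  show "?h ` ?F \<subseteq> graph_combination u a K1 b K2"
  proof clarify
    fix x y assume x: "x \<in> K1" and y: "y \<in> K2" and e: "oproj u x = oproj u y"
    let ?z = "oproj u x"
    have z: "?z \<in> hproj u K1" using x by (auto simp: hproj_def oproj_def)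
    have "?z + (x \<bullet> u) *\<^sub>R u \<in> K1" "?z + (y \<bullet> u) *\<^sub>R u \<in> K2" using x y oproj_decomp[of x u] oproj_decomp[of y u] e by simp_all
    then have "- undergraph u K1 ?z \<le> x \<bullet> u \<and> x \<bullet> u \<le> overgraph u K1 ?z" "- undergraph u K2 ?z \<le> y \<bullet> u \<and> y \<bullet> u \<le> overgraph u K2 ?z"
      using hproj_fibre(3)[OF u K1(1) z] hproj_fibre(3)[OF u K2(1)] z h by auto
    then have "a * (- undergraph u K1 ?z) \<le> a * (x \<bullet> u)" "a * (x \<bullet> u) \<le> a * overgraph u K1 ?z"
      "b * (- undergraph u K2 ?z) \<le> b * (y \<bullet> u)" "b * (y \<bullet> u) \<le> b * overgraph u K2 ?z"
      using ab by (simp_all only: mult_left_mono)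
    then show "?z + (a * (x \<bullet> u) + b * (y \<bullet> u)) *\<^sub>R u \<in> graph_combination u a K1 b K2"
      using z unfolding graph_combination_def by (intro CollectI exI[of _ ?z] exI conjI refl) auto
  qed
  show "graph_combination u a K1 b K2 \<subseteq> ?h ` ?F"
  proof
    fix w assume "w \<in> graph_combination u a K1 b K2"
    then obtain z t where w: "w = z + t *\<^sub>R u" and z: "z \<in> hproj u K1"
      and t: "- (a * undergraph u K1 z + b * undergraph u K2 z) \<le> t" "t \<le> a * overgraph u K1 z + b * overgraph u K2 z"
      unfolding graph_combination_def by blast
    have z2: "z \<in> hproj u K2" using z h by simp
    have z0: "z \<bullet> u = 0" using z by (simp add: hproj_iff[OF u])
    define f1 g1 f2 g2 where "f1 = overgraph u K1 z" and "g1 = undergraph u K1 z" and "f2 = overgraph u K2 z" and "g2 = undergraph u K2 z"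
    define lo hi where "lo = - (a * g1 + b * g2)" and "hi = a * f1 + b * f2"
    \<comment> \<open>The same relative height \<open>\<theta>\<close> is used in the fibres of both
      bodies; if the fibre of the combination degenerates to a point, \<open>\<theta> = 0\<close>
      will do.\<close>
    obtain \<theta> where \<theta>: "0 \<le> \<theta>" "\<theta> \<le> 1" "t = lo + \<theta> * (hi - lo)"
    proof (cases "hi = lo")
      case True
      then show thesis using t by (intro that[of 0]) (auto simp: lo_def hi_def f1_def f2_def g1_def g2_def)
    next
      case False
      then have "hi > lo" using t by (auto simp: lo_def hi_def f1_def f2_def g1_def g2_def)
      then show thesis using t by (intro that[of "(t - lo) / (hi - lo)"]) (auto simp: lo_def hi_def f1_def f2_def g1_def g2_def)
    qed
    define x where "x = (1 - \<theta>) *\<^sub>R (z - g1 *\<^sub>R u) + \<theta> *\<^sub>R (z + f1 *\<^sub>R u)"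
    define y where "y = (1 - \<theta>) *\<^sub>R (z - g2 *\<^sub>R u) + \<theta> *\<^sub>R (z + f2 *\<^sub>R u)"
    have x: "x \<in> K1" unfolding x_def f1_def g1_def using \<theta> hproj_fibre[OF u K1(1) z] by (intro convexD[OF K1(2)]) auto
    have y: "y \<in> K2" unfolding y_def f2_def g2_def using \<theta> hproj_fibre[OF u K2(1) z2] by (intro convexD[OF K2(2)]) auto
    have x': "x = z + (\<theta> * f1 - (1 - \<theta>) * g1) *\<^sub>R u" by (simp add: x_def algebra_simps)
    have y': "y = z + (\<theta> * f2 - (1 - \<theta>) * g2) *\<^sub>R u" by (simp add: y_def algebra_simps)
    have px: "oproj u x = z" "oproj u y = z" using u z0 by (simp_all add: x' y' oproj_id)
    have xu: "x \<bullet> u = \<theta> * f1 - (1 - \<theta>) * g1" "y \<bullet> u = \<theta> * f2 - (1 - \<theta>) * g2"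
      using unit_inner_self[OF u] z0 by (simp_all add: x' y' inner_add_left)
    have "t = a * (x \<bullet> u) + b * (y \<bullet> u)" unfolding xu \<theta>(3) lo_def hi_def by (simp add: algebra_simps)
    then have "w = ?h (x, y)" using w px by simp
    then show "w \<in> ?h ` ?F" using x y px by (intro image_eqI[of _ _ "(x, y)"]) auto
  qed
qed

lemma graph_combination_body:
  assumes u: "norm u = 1" and K1: "convex_body_o K1" and K2: "convex_body_o K2"
    and h: "hproj u K1 = hproj u K2" and ab: "a \<ge> 0" "b \<ge> 0" "a + b > 0"
  shows "convex_body_o (graph_combination u a K1 b K2)"
    and "hproj u (graph_combination u a K1 b K2) = hproj u K1"
    and "oproj u x \<in> hproj u K1 \<Longrightarrow> top_fn u (graph_combination u a K1 b K2) x = a * top_fn u K1 x + b * top_fn u K2 x"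
proof -
  let ?L = "graph_combination u a K1 b K2"
  note B1 = body_facts[OF K1] and B2 = body_facts[OF K2]
  let ?h = "\<lambda>(x, y). oproj u x + (a * (x \<bullet> u) + b * (y \<bullet> u)) *\<^sub>R u"
  let ?F = "{(x, y). x \<in> K1 \<and> y \<in> K2 \<and> oproj u x = oproj u y}"
  note im = graph_combination_image[OF u B1(1,2) B2(1,2) h ab(1,2)]
  have lin: "linear ?h"
    by (rule linearI) (auto simp: linear_add[OF linear_oproj] linear_scale[OF linear_oproj] algebra_simps)
  have Feq: "?F = (K1 \<times> K2) \<inter> {p. oproj u (fst p) = oproj u (snd p)}" by auto
  have cF: "compact ?F"
    unfolding Feq unfolding oproj_def by (intro compact_Int_closed compact_Times B1 B2 closed_Collect_eq continuous_intros)
  have "convex ?F"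
  proof (rule convexI)
    fix p q and s t :: real assume "p \<in> ?F" "q \<in> ?F" "0 \<le> s" "0 \<le> t" "s + t = 1"
    then show "s *\<^sub>R p + t *\<^sub>R q \<in> ?F"
      using convexD[OF B1(2)] convexD[OF B2(2)]
      by (auto simp: linear_add[OF linear_oproj] linear_scale[OF linear_oproj])
  qed
  then have cvL: "convex ?L" unfolding im by (rule convex_linear_image[OF lin])
  have cL: "compact ?L" unfolding im using lin cF
    by (intro compact_continuous_image linear_continuous_on) (simp add: linear_conv_bounded_linear[symmetric])
  obtain r1 r2 where r: "r1 > 0" "cball 0 r1 \<subseteq> K1" "r2 > 0" "cball 0 r2 \<subseteq> K2"
    using B1(3) B2(3) unfolding mem_interior_cball by blast
  \<comment> \<open>For a given \<open>z\<close> the point \<open>y\<close> below has the height of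
    \<open>z\<close> divided by \<open>a + b\<close>, so that the pair \<open>(y, y)\<close> is
    mapped to \<open>z\<close>. Its norm is at most \<open>(1 + 1 / (a + b)) * norm z\<close>,
    whence the radius.\<close>
  define \<rho> where "\<rho> = min r1 r2 / (1 + 1 / (a + b))"
  have c: "1 + 1 / (a + b) > 0" using ab by (simp add: add_pos_pos)
  then have \<rho>: "\<rho> > 0" using r by (simp add: \<rho>_def)
  have "cball 0 \<rho> \<subseteq> ?L"
  proof
    fix z :: 'a assume "z \<in> cball 0 \<rho>"
    then have nz: "norm z \<le> \<rho>" by simp
    define y where "y = oproj u z + ((z \<bullet> u) / (a + b)) *\<^sub>R u"
    have "\<bar>z \<bullet> u\<bar> \<le> norm z" using Cauchy_Schwarz_ineq2[of z u] u by simp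
    then have zs: "\<bar>z \<bullet> u\<bar> / (a + b) \<le> norm z / (a + b)" using ab(3) by (intro divide_right_mono) auto
    have "norm y \<le> norm (oproj u z) + norm (((z \<bullet> u) / (a + b)) *\<^sub>R u)"
      unfolding y_def by (rule norm_triangle_ineq)
    also have "norm (((z \<bullet> u) / (a + b)) *\<^sub>R u) = \<bar>z \<bullet> u\<bar> / (a + b)" using u ab(3) by simp
    also have "norm (oproj u z) + \<bar>z \<bullet> u\<bar> / (a + b) \<le> norm z + norm z / (a + b)"
      by (rule add_mono[OF norm_oproj_le[OF u] zs])
    finally have "norm y \<le> norm z + norm z / (a + b)" .
    also have "\<dots> = norm z * (1 + 1 / (a + b))" by (simp add: algebra_simps)
    also have "\<dots> \<le> \<rho> * (1 + 1 / (a + b))" using nz c by (intro mult_right_mono) auto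
    also have "\<dots> = min r1 r2" using c by (simp add: \<rho>_def)
    finally have "y \<in> K1" "y \<in> K2" using r by (auto simp: subset_eq)
    moreover have "y \<bullet> u = (z \<bullet> u) / (a + b)" using unit_inner_self[OF u] u by (simp add: y_def inner_add_left)
    then have "(a + b) * (y \<bullet> u) = z \<bullet> u" using ab(3) by simp
    then have "a * (y \<bullet> u) + b * (y \<bullet> u) = z \<bullet> u" by (simp only: distrib_right)
    then have "?h (y, y) = z" using u by (simp add: y_def oproj_decomp[symmetric])
    ultimately show "z \<in> ?L" unfolding im by (intro image_eqI[of _ _ "(y, y)"]) auto
  qed
  then have "0 \<in> interior ?L" using \<rho> by (meson mem_interior_cball)
  then show "convex_body_o ?L" using cL cvL by (auto simp: convex_body_o_def convex_body_def)
  show "hproj u ?L = hproj u K1"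
  proof
    show "hproj u ?L \<subseteq> hproj u K1"
    proof
      fix w assume "w \<in> hproj u ?L"
      then obtain x y where "x \<in> K1" "w = oproj u (?h (x, y))" unfolding im hproj_image by blast
      then show "w \<in> hproj u K1" using u by (simp add: hproj_image)
    qed
    show "hproj u K1 \<subseteq> hproj u ?L"
    proof
      fix x' assume x': "x' \<in> hproj u K1"
      then obtain x where x: "x \<in> K1" "x' = oproj u x" by (auto simp: hproj_def oproj_def)
      obtain y where y: "y \<in> K2" "x' = oproj u y" using x' h by (auto simp: hproj_def oproj_def)
      have "?h (x, y) \<in> ?L" unfolding im using x y by (intro imageI) auto
      then have "oproj u (?h (x, y)) \<in> hproj u ?L" unfolding hproj_image by (rule imageI)
      moreover have "oproj u (?h (x, y)) = x'" using u x by simp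
      ultimately show "x' \<in> hproj u ?L" by (simp only:)
    qed
  qed
  assume x: "oproj u x \<in> hproj u K1"
  let ?z = "oproj u x"
  have z2: "?z \<in> hproj u K2" using x h by simp
  show "top_fn u ?L x = a * top_fn u K1 x + b * top_fn u K2 x"
  proof (rule top_fn_unique[OF u cL])
    have "- undergraph u K1 ?z \<le> overgraph u K1 ?z" "- undergraph u K2 ?z \<le> overgraph u K2 ?z"
      using hproj_fibre[OF u B1(1) x] hproj_fibre[OF u B2(1) z2] by blast+
    then have "a * (- undergraph u K1 ?z) \<le> a * overgraph u K1 ?z" "b * (- undergraph u K2 ?z) \<le> b * overgraph u K2 ?z"
      using ab by (simp_all only: mult_left_mono)
    then show "?z + (a * top_fn u K1 x + b * top_fn u K2 x) *\<^sub>R u \<in> ?L"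
      using x unfolding graph_combination_def top_fn_def by (intro CollectI exI[of _ ?z] exI conjI refl) auto
    fix t assume "?z + t *\<^sub>R u \<in> ?L"
    then obtain z s where zs: "?z + t *\<^sub>R u = z + s *\<^sub>R u" "z \<in> hproj u K1" "s \<le> a * overgraph u K1 z + b * overgraph u K2 z"
      unfolding graph_combination_def by blast
    have z0: "z \<bullet> u = 0" using zs(2) by (simp add: hproj_iff[OF u])
    have "oproj u (?z + t *\<^sub>R u) = oproj u (z + s *\<^sub>R u)" using zs(1) by simp
    then have "?z = z" using u z0 by (simp add: oproj_id)
    moreover have "t = s" using zs(1) calculation u by (metis add_left_cancel norm_zero scaleR_cancel_right zero_neq_one)
    ultimately show "t \<le> a * top_fn u K1 x + b * top_fn u K2 x" using zs(3) by (simp add: top_fn_def)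
  qed
qed

section \<open>Second-order expansions and Gaussian curvature\<close>

definition second_order :: "(real ^ 'n \<Rightarrow> real) \<Rightarrow> real ^ 'n \<Rightarrow> real ^ 'n \<Rightarrow> real ^ 'n ^ 'n \<Rightarrow> bool" where
  "second_order F x p B \<longleftrightarrow> transpose B = B \<and>
     (\<forall>\<epsilon>>0. \<exists>\<delta>>0. \<forall>h. norm h < \<delta> \<longrightarrow> \<bar>F (x + h) - F x - p \<bullet> h + (h \<bullet> (B *v h)) / 2\<bar> \<le> \<epsilon> * (norm h)\<^sup>2)"

text \<open>The expansion of the boundary near \<open>X\<close> along \<open>v\<close>, stated for
  boundary points instead of a parametrising function. It is the common form to which expansions
  over different hyperplanes are reduced.\<close>

definition contact :: "(real ^ 'n) set \<Rightarrow> real ^ 'n \<Rightarrow> real ^ 'n \<Rightarrow> real ^ 'n ^ 'n \<Rightarrow> bool" where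
  "contact K X v A \<longleftrightarrow> (\<forall>\<epsilon>>0. \<exists>\<delta>>0. \<forall>Y\<in>frontier K. norm (Y - X) < \<delta> \<longrightarrow>
     \<bar>(X - Y) \<bullet> v - ((Y - X) \<bullet> (A *v (Y - X))) / 2\<bar> \<le> \<epsilon> * (norm (Y - X))\<^sup>2)"

lemma second_orderD:
  assumes "second_order F x p B" "\<epsilon> > 0"
  obtains \<delta> where "\<delta> > 0" "\<And>h. norm h < \<delta> \<Longrightarrow> \<bar>F (x + h) - F x - p \<bullet> h + (h \<bullet> (B *v h)) / 2\<bar> \<le> \<epsilon> * (norm h)\<^sup>2"
  using assms unfolding second_order_def by meson

lemma matrix_bound_ex:
  fixes A :: "real ^ 'n ^ 'm"
  shows "\<exists>C>0. \<forall>x y. \<bar>y \<bullet> (A *v x)\<bar> \<le> C * norm x * norm y"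
proof -
  obtain C where C: "C > 0" "\<And>x. norm (A *v x) \<le> norm x * C"
    using bounded_linear.pos_bounded[OF matrix_vector_mul_bounded_linear, of A] by auto
  have "\<bar>y \<bullet> (A *v x)\<bar> \<le> C * norm x * norm y" for x :: "real ^ 'n" and y :: "real ^ 'm"
  proof -
    have "\<bar>y \<bullet> (A *v x)\<bar> \<le> norm y * norm (A *v x)" by (rule Cauchy_Schwarz_ineq2)
    also have "\<dots> \<le> norm y * (norm x * C)" by (rule mult_left_mono[OF C(2)]) simp
    also have "\<dots> = C * norm x * norm y" by simp
    finally show ?thesis .
  qed
  then show ?thesis using C(1) by blast
qed

lemma matrix_bound:
  fixes A :: "real ^ 'n ^ 'm"
  obtains C where "C > 0" "\<And>x y. \<bar>y \<bullet> (A *v x)\<bar> \<le> C * norm x * norm y"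
  using matrix_bound_ex[of A] by auto

text \<open>The expansion is used with the fixed error 1; all quadratic terms together are at most
  \<open>(1 + C) * (norm h)\<^sup>2\<close>, which is below \<open>\<epsilon> * norm h\<close> for
  small \<open>h\<close>.\<close>

lemma second_order_differentiable:
  fixes F :: "real ^ 'n \<Rightarrow> real"
  assumes "second_order F x p B" "\<epsilon> > 0"
  obtains \<delta> where "\<delta> > 0" "\<And>h. norm h < \<delta> \<Longrightarrow> \<bar>F (x + h) - F x - p \<bullet> h\<bar> \<le> \<epsilon> * norm h"
proof -
  obtain C where C: "C > 0" "\<And>x y. \<bar>y \<bullet> (B *v x)\<bar> \<le> C * norm x * norm y" using matrix_bound[of B] by blast
  obtain \<delta> where \<delta>: "\<delta> > 0" "\<And>h. norm h < \<delta> \<Longrightarrow> \<bar>F (x + h) - F x - p \<bullet> h + (h \<bullet> (B *v h)) / 2\<bar> \<le> 1 * (norm h)\<^sup>2"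
    by (rule second_orderD[OF assms(1) zero_less_one]) blast
  show thesis
  proof (rule that[of "min \<delta> (\<epsilon> / (1 + C))"])
    show "min \<delta> (\<epsilon> / (1 + C)) > 0" using \<delta>(1) C(1) assms(2) by simp
    fix h :: "real ^ 'n" assume h: "norm h < min \<delta> (\<epsilon> / (1 + C))"
    have "\<bar>F (x + h) - F x - p \<bullet> h\<bar> \<le> 1 * (norm h)\<^sup>2 + \<bar>(h \<bullet> (B *v h)) / 2\<bar>"
      using \<delta>(2)[of h] h by linarith
    also have "\<dots> \<le> 1 * (norm h)\<^sup>2 + C * (norm h)\<^sup>2"
    proof -
      have "\<bar>h \<bullet> (B *v h)\<bar> \<le> C * (norm h)\<^sup>2" using C(2)[of h h] by (simp add: power2_eq_square mult.assoc)
      moreover have "\<bar>(h \<bullet> (B *v h)) / 2\<bar> = \<bar>h \<bullet> (B *v h)\<bar> / 2" by simp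
      ultimately show ?thesis by linarith
    qed
    also have "\<dots> = ((1 + C) * norm h) * norm h" by (simp add: power2_eq_square algebra_simps)
    also have "\<dots> \<le> \<epsilon> * norm h"
    proof (rule mult_right_mono)
      have "norm h \<le> \<epsilon> / (1 + C)" using h by simp
      then show "(1 + C) * norm h \<le> \<epsilon>" using C(1) by (simp add: pos_le_divide_eq mult.commute)
    qed simp
    finally show "\<bar>F (x + h) - F x - p \<bullet> h\<bar> \<le> \<epsilon> * norm h" .
  qed
qed

text \<open>The scheme of the arguments that let displacements shrink: after division by the scale,
  the error is a fixed multiple of an arbitrary \<open>\<epsilon>\<close>.\<close>

lemma abs_le_eps_zero:
  fixes a :: real
  assumes "\<And>\<epsilon>. \<epsilon> > 0 \<Longrightarrow> a \<le> \<epsilon> * c"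
  shows "a \<le> 0"
proof (rule ccontr)
  assume "\<not> a \<le> 0"
  then have a: "a > 0" by simp
  have d: "\<bar>c\<bar> + 1 > 0" by simp
  define e where "e = a / (2 * (\<bar>c\<bar> + 1))"
  have e: "e > 0" using a d by (simp add: e_def)
  have "a \<le> e * c" by (rule assms[OF e])
  also have "\<dots> \<le> e * (\<bar>c\<bar> + 1)" using e by (intro mult_left_mono) auto
  also have "\<dots> = a / 2" using d by (simp add: e_def field_simps)
  finally show False using a by simp
qed

lemma small_scale:
  fixes h :: "'a::real_normed_vector"
  assumes "\<delta> > 0"
  obtains t where "t > 0" "norm (t *\<^sub>R h) < \<delta>"
proof
  have d: "norm h + 1 > 0" by (simp add: add_nonneg_pos)
  show "\<delta> / (norm h + 1) > 0" using assms d by simp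
  have "\<delta> * norm h < \<delta> * (norm h + 1)" using assms by simp
  then have "\<delta> / (norm h + 1) * norm h < \<delta>" using d by (simp add: pos_divide_less_eq)
  then show "norm ((\<delta> / (norm h + 1)) *\<^sub>R h) < \<delta>" using assms d by simp
qed

lemma quadratic_form_scale:
  fixes B :: "real ^ 'n ^ 'n"
  shows "(t *\<^sub>R h) \<bullet> (B *v (t *\<^sub>R h)) = t\<^sup>2 * (h \<bullet> (B *v h))"
  by (simp add: matrix_vector_mult_scaleR power2_eq_square)

lemma norm_scale_sq: "(norm (t *\<^sub>R h))\<^sup>2 = t\<^sup>2 * (norm h)\<^sup>2"
  by (simp add: power_mult_distrib)

lemma lincomb_identity:
  fixes a b :: real
  shows "a * f' + b * g' - (a * f + b * g) - (a * P + b * Q) + (a * X + b * Y) / 2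
    = a * (f' - f - P + X / 2) + b * (g' - g - Q + Y / 2)"
  by (simp add: field_simps)

lemma abs_lincomb:
  fixes a b :: real
  shows "\<bar>a * x + b * y\<bar> \<le> \<bar>a\<bar> * \<bar>x\<bar> + \<bar>b\<bar> * \<bar>y\<bar>"
  using abs_triangle_ineq[of "a * x" "b * y"] by (simp add: abs_mult)

lemma second_order_combination:
  fixes F G H :: "real ^ 'n \<Rightarrow> real"
  assumes F: "second_order F x p B" and G: "second_order G x q C"
    and e: "e > 0" "\<And>y. y \<in> ball x e \<Longrightarrow> H y = a * F y + b * G y"
  shows "second_order H x (a *\<^sub>R p + b *\<^sub>R q) (a *\<^sub>R B + b *\<^sub>R C)"
  unfolding second_order_def
proof (intro conjI allI impI)
  have "transpose B = B" "transpose C = C" using F G by (auto simp: second_order_def)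
  then show "transpose (a *\<^sub>R B + b *\<^sub>R C) = a *\<^sub>R B + b *\<^sub>R C" by (simp add: transpose_def vec_eq_iff)
  fix \<epsilon> :: real assume \<epsilon>: "\<epsilon> > 0"
  define \<epsilon>' where "\<epsilon>' = \<epsilon> / (\<bar>a\<bar> + \<bar>b\<bar> + 1)"
  have n: "\<bar>a\<bar> + \<bar>b\<bar> + 1 > 0" by (simp add: add_nonneg_pos)
  have \<epsilon>': "\<epsilon>' > 0" using \<epsilon> n by (simp add: \<epsilon>'_def)
  obtain d1 where d1: "d1 > 0" "\<And>h. norm h < d1 \<Longrightarrow> \<bar>F (x + h) - F x - p \<bullet> h + (h \<bullet> (B *v h)) / 2\<bar> \<le> \<epsilon>' * (norm h)\<^sup>2"
    by (rule second_orderD[OF F \<epsilon>']) blast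
  obtain d2 where d2: "d2 > 0" "\<And>h. norm h < d2 \<Longrightarrow> \<bar>G (x + h) - G x - q \<bullet> h + (h \<bullet> (C *v h)) / 2\<bar> \<le> \<epsilon>' * (norm h)\<^sup>2"
    by (rule second_orderD[OF G \<epsilon>']) blast
  show "\<exists>\<delta>>0. \<forall>h. norm h < \<delta> \<longrightarrow> \<bar>H (x + h) - H x - (a *\<^sub>R p + b *\<^sub>R q) \<bullet> h + (h \<bullet> ((a *\<^sub>R B + b *\<^sub>R C) *v h)) / 2\<bar> \<le> \<epsilon> * (norm h)\<^sup>2"
  proof (intro exI[of _ "min e (min d1 d2)"] conjI allI impI)
    show "min e (min d1 d2) > 0" using e d1 d2 by simp
    fix h :: "real ^ 'n" assume h: "norm h < min e (min d1 d2)"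
    let ?RF = "F (x + h) - F x - p \<bullet> h + (h \<bullet> (B *v h)) / 2" and ?RG = "G (x + h) - G x - q \<bullet> h + (h \<bullet> (C *v h)) / 2"
    have H: "H (x + h) = a * F (x + h) + b * G (x + h)" "H x = a * F x + b * G x"
      using h e by (auto simp: dist_norm)
    have Q: "h \<bullet> ((a *\<^sub>R B + b *\<^sub>R C) *v h) = a * (h \<bullet> (B *v h)) + b * (h \<bullet> (C *v h))"
      by (simp add: matrix_vector_mult_add_rdistrib scaleR_matrix_vector_assoc[symmetric] inner_add_right)
    have "H (x + h) - H x - (a *\<^sub>R p + b *\<^sub>R q) \<bullet> h + (h \<bullet> ((a *\<^sub>R B + b *\<^sub>R C) *v h)) / 2 = a * ?RF + b * ?RG"
      unfolding H Q inner_add_left inner_scaleR_left by (rule lincomb_identity)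
    also have "\<bar>a * ?RF + b * ?RG\<bar> \<le> \<bar>a\<bar> * \<bar>?RF\<bar> + \<bar>b\<bar> * \<bar>?RG\<bar>"
      by (rule abs_lincomb)
    also have "\<dots> \<le> \<bar>a\<bar> * (\<epsilon>' * (norm h)\<^sup>2) + \<bar>b\<bar> * (\<epsilon>' * (norm h)\<^sup>2)"
      using d1(2)[of h] d2(2)[of h] h by (intro add_mono mult_left_mono) auto
    also have "\<dots> = ((\<bar>a\<bar> + \<bar>b\<bar>) * \<epsilon>') * (norm h)\<^sup>2" by (simp add: algebra_simps)
    also have "\<dots> \<le> \<epsilon> * (norm h)\<^sup>2"
    proof (rule mult_right_mono)
      have "(\<bar>a\<bar> + \<bar>b\<bar>) * \<epsilon>' \<le> (\<bar>a\<bar> + \<bar>b\<bar> + 1) * \<epsilon>'" using \<epsilon>' by (intro mult_right_mono) auto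
      also have "\<dots> = \<epsilon>" using n by (simp add: \<epsilon>'_def)
      finally show "(\<bar>a\<bar> + \<bar>b\<bar>) * \<epsilon>' \<le> \<epsilon>" .
    qed simp
    finally show "\<bar>H (x + h) - H x - (a *\<^sub>R p + b *\<^sub>R q) \<bullet> h + (h \<bullet> ((a *\<^sub>R B + b *\<^sub>R C) *v h)) / 2\<bar> \<le> \<epsilon> * (norm h)\<^sup>2" .
  qed
qed

text \<open>In the sum of the expansions at \<open>x + t h\<close> and \<open>x - t h\<close> the
  linear terms cancel, and midpoint concavity fixes the sign of what remains.\<close>

lemma second_order_concave_psd:
  assumes F: "second_order F x p B" and c: "concave_on S F" "open S" "x \<in> S"
  shows "h \<bullet> (B *v h) \<ge> 0"
proof -
  obtain e where e: "e > 0" "ball x e \<subseteq> S" using c(2,3) openE by blast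
  have "- (h \<bullet> (B *v h)) \<le> 0"
  proof (rule abs_le_eps_zero)
    fix \<epsilon> :: real assume \<epsilon>: "\<epsilon> > 0"
    obtain \<delta> where \<delta>: "\<delta> > 0" "\<And>h. norm h < \<delta> \<Longrightarrow> \<bar>F (x + h) - F x - p \<bullet> h + (h \<bullet> (B *v h)) / 2\<bar> \<le> \<epsilon> * (norm h)\<^sup>2"
      by (rule second_orderD[OF F \<epsilon>]) blast
    obtain t where t: "t > 0" "norm (t *\<^sub>R h) < min \<delta> e" by (rule small_scale[of "min \<delta> e" h]) (use \<delta> e in auto)
    let ?k = "t *\<^sub>R h"
    have kS: "x + ?k \<in> S" "x - ?k \<in> S" using t(2) e(2) by (auto simp: subset_eq dist_norm)
    have "(1 - 1 / 2) * F (x + ?k) + (1 / 2) * F (x - ?k) \<le> F ((1 - 1 / 2) *\<^sub>R (x + ?k) + (1 / 2) *\<^sub>R (x - ?k))"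
      by (rule concave_onD[OF c(1)]) (use kS in auto)
    also have "(1 - 1 / 2) *\<^sub>R (x + ?k) + (1 / 2) *\<^sub>R (x - ?k) = x"
      by (simp add: algebra_simps scaleR_add_left[symmetric] del: scaleR_add_left)
    finally have mid: "F (x + ?k) + F (x - ?k) \<le> 2 * F x" by simp
    have q: "\<bar>F (x + ?k) - F x - p \<bullet> ?k + (?k \<bullet> (B *v ?k)) / 2\<bar> \<le> \<epsilon> * (norm ?k)\<^sup>2"
      using t by (intro \<delta>) simp
    have "\<bar>F (x + - ?k) - F x - p \<bullet> (- ?k) + ((- ?k) \<bullet> (B *v (- ?k))) / 2\<bar> \<le> \<epsilon> * (norm (- ?k))\<^sup>2"
      using t by (intro \<delta>) simp
    moreover have "(- ?k) \<bullet> (B *v (- ?k)) = ?k \<bullet> (B *v ?k)" using matrix_vector_mult_scaleR[of B "- 1" ?k] by simp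
    moreover have "p \<bullet> (- ?k) = - (p \<bullet> ?k)" "norm (- ?k) = norm ?k" "x + - ?k = x - ?k" by simp_all
    ultimately have "\<bar>F (x - ?k) - F x + p \<bullet> ?k + (?k \<bullet> (B *v ?k)) / 2\<bar> \<le> \<epsilon> * (norm ?k)\<^sup>2" by (simp only: diff_minus_eq_add)
    with q mid have "- (?k \<bullet> (B *v ?k)) \<le> 2 * (\<epsilon> * (norm ?k)\<^sup>2)" by linarith
    then have "- (t\<^sup>2 * (h \<bullet> (B *v h))) \<le> 2 * (\<epsilon> * (t\<^sup>2 * (norm h)\<^sup>2))" unfolding quadratic_form_scale norm_scale_sq .
    then have "t\<^sup>2 * (- (h \<bullet> (B *v h))) \<le> t\<^sup>2 * (\<epsilon> * (2 * (norm h)\<^sup>2))" by (simp add: mult_ac)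
    then show "- (h \<bullet> (B *v h)) \<le> \<epsilon> * (2 * (norm h)\<^sup>2)" using t(1) by (subst (asm) mult_le_cancel_left_pos) auto
  qed
  then show ?thesis by simp
qed

lemma second_order_cyl_gradient:
  assumes F: "second_order F x p B" and cyl: "\<And>y t. F (y + t *\<^sub>R u) = F y"
  shows "p \<bullet> u = 0" "u \<bullet> (B *v u) = 0"
proof -
  have pu: "\<bar>p \<bullet> u\<bar> \<le> 0"
  proof (rule abs_le_eps_zero)
    fix \<epsilon> :: real assume \<epsilon>: "\<epsilon> > 0"
    obtain \<delta> where \<delta>: "\<delta> > 0" "\<And>h. norm h < \<delta> \<Longrightarrow> \<bar>F (x + h) - F x - p \<bullet> h\<bar> \<le> \<epsilon> * norm h"
      by (rule second_order_differentiable[OF F \<epsilon>]) blast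
    obtain t where t: "t > 0" "norm (t *\<^sub>R u) < \<delta>" by (rule small_scale[OF \<delta>(1)])
    have "\<bar>p \<bullet> (t *\<^sub>R u)\<bar> \<le> \<epsilon> * norm (t *\<^sub>R u)" using \<delta>(2)[OF t(2)] by (simp add: cyl)
    then have "t * \<bar>p \<bullet> u\<bar> \<le> t * (\<epsilon> * norm u)" using t(1) by (simp add: abs_mult mult_ac)
    then show "\<bar>p \<bullet> u\<bar> \<le> \<epsilon> * norm u" using t(1) by (subst (asm) mult_le_cancel_left_pos) auto
  qed
  then show pu0: "p \<bullet> u = 0" by simp
  have "\<bar>u \<bullet> (B *v u)\<bar> \<le> 0"
  proof (rule abs_le_eps_zero)
    fix \<epsilon> :: real assume \<epsilon>: "\<epsilon> > 0"
    obtain \<delta> where \<delta>: "\<delta> > 0" "\<And>h. norm h < \<delta> \<Longrightarrow> \<bar>F (x + h) - F x - p \<bullet> h + (h \<bullet> (B *v h)) / 2\<bar> \<le> \<epsilon> * (norm h)\<^sup>2"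
      by (rule second_orderD[OF F \<epsilon>]) blast
    obtain t where t: "t > 0" "norm (t *\<^sub>R u) < \<delta>" by (rule small_scale[OF \<delta>(1)])
    have "\<bar>t\<^sup>2 * (u \<bullet> (B *v u)) / 2\<bar> \<le> \<epsilon> * (t\<^sup>2 * (norm u)\<^sup>2)"
      using \<delta>(2)[OF t(2)] pu0 unfolding cyl quadratic_form_scale norm_scale_sq by simp
    then have "t\<^sup>2 * \<bar>u \<bullet> (B *v u)\<bar> / 2 \<le> \<epsilon> * (t\<^sup>2 * (norm u)\<^sup>2)" by (simp add: abs_mult)
    then have "t\<^sup>2 * \<bar>u \<bullet> (B *v u)\<bar> \<le> t\<^sup>2 * (\<epsilon> * (2 * (norm u)\<^sup>2))" by (simp add: mult_ac)
    then show "\<bar>u \<bullet> (B *v u)\<bar> \<le> \<epsilon> * (2 * (norm u)\<^sup>2)" using t(1) by (subst (asm) mult_le_cancel_left_pos) auto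
  qed
  then show "u \<bullet> (B *v u) = 0" by simp
qed

text \<open>Polarisation: the values of the forms on sums determine the mixed terms.\<close>

lemma symmetric_matrix_eqI:
  fixes A B :: "real ^ 'n ^ 'n"
  assumes "transpose A = A" "transpose B = B" "\<And>x. x \<bullet> (A *v x) = x \<bullet> (B *v x)"
  shows "A = B"
proof -
  have "y \<bullet> (A *v x) = y \<bullet> (B *v x)" for x y
    using assms(3)[of "x + 1 *\<^sub>R y"] assms(3)[of x] assms(3)[of y]
    unfolding quadratic_form_add[OF assms(1)] quadratic_form_add[OF assms(2)] by simp
  then have "A *v x = B *v x" for x by (metis vector_eq_ldot)
  then show ?thesis by (simp add: matrix_eq)
qed

lemma second_order_hessian_unique:
  assumes F: "second_order F x p B" "second_order F x p B'"
  shows "B = B'"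
proof (rule symmetric_matrix_eqI)
  show "transpose B = B" "transpose B' = B'" using F by (auto simp: second_order_def)
  fix h
  have "\<bar>h \<bullet> (B *v h) - h \<bullet> (B' *v h)\<bar> \<le> 0"
  proof (rule abs_le_eps_zero)
    fix \<epsilon> :: real assume \<epsilon>: "\<epsilon> > 0"
    obtain d1 where d1: "d1 > 0" "\<And>h. norm h < d1 \<Longrightarrow> \<bar>F (x + h) - F x - p \<bullet> h + (h \<bullet> (B *v h)) / 2\<bar> \<le> \<epsilon> * (norm h)\<^sup>2"
      by (rule second_orderD[OF F(1) \<epsilon>]) blast
    obtain d2 where d2: "d2 > 0" "\<And>h. norm h < d2 \<Longrightarrow> \<bar>F (x + h) - F x - p \<bullet> h + (h \<bullet> (B' *v h)) / 2\<bar> \<le> \<epsilon> * (norm h)\<^sup>2"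
      by (rule second_orderD[OF F(2) \<epsilon>]) blast
    obtain t where t: "t > 0" "norm (t *\<^sub>R h) < min d1 d2" by (rule small_scale[of "min d1 d2" h]) (use d1 d2 in auto)
    let ?k = "t *\<^sub>R h"
    have "\<bar>?k \<bullet> (B *v ?k) - ?k \<bullet> (B' *v ?k)\<bar> \<le> 4 * (\<epsilon> * (norm ?k)\<^sup>2)"
      using d1(2)[of ?k] d2(2)[of ?k] t(2) by linarith
    then have "\<bar>t\<^sup>2 * (h \<bullet> (B *v h)) - t\<^sup>2 * (h \<bullet> (B' *v h))\<bar> \<le> 4 * (\<epsilon> * (t\<^sup>2 * (norm h)\<^sup>2))"
      unfolding quadratic_form_scale norm_scale_sq .
    then have "\<bar>t\<^sup>2 * (h \<bullet> (B *v h) - h \<bullet> (B' *v h))\<bar> \<le> t\<^sup>2 * (\<epsilon> * (4 * (norm h)\<^sup>2))"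
      by (simp only: right_diff_distrib mult_ac)
    then have "t\<^sup>2 * \<bar>h \<bullet> (B *v h) - h \<bullet> (B' *v h)\<bar> \<le> t\<^sup>2 * (\<epsilon> * (4 * (norm h)\<^sup>2))" by (simp add: abs_mult)
    then show "\<bar>h \<bullet> (B *v h) - h \<bullet> (B' *v h)\<bar> \<le> \<epsilon> * (4 * (norm h)\<^sup>2)" using t(1) by (subst (asm) mult_le_cancel_left_pos) auto
  qed
  then show "h \<bullet> (B *v h) = h \<bullet> (B' *v h)" by simp
qed

text \<open>The boundary displacement \<open>k\<close> differs from its lift to the tangent
  hyperplane by \<open>q *\<^sub>R u\<close> with \<open>q\<close> of second order, so the quadratic
  form changes only to third order.\<close>

lemma quadratic_form_perturb:
  fixes A :: "real ^ 'n ^ 'n"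
  assumes A: "transpose A = A" "\<And>x y. \<bar>y \<bullet> (A *v x)\<bar> \<le> C * norm x * norm y" and u: "norm u = 1"
    and q: "\<bar>q\<bar> \<le> M * (norm k)\<^sup>2" "M \<ge> 0" "C \<ge> 0" "norm k \<le> 1"
  shows "\<bar>(k + q *\<^sub>R u) \<bullet> (A *v (k + q *\<^sub>R u)) - k \<bullet> (A *v k)\<bar> \<le> C * M * (2 + M) * norm k * (norm k)\<^sup>2"
proof -
  let ?n = "norm k"
  have "\<bar>(k + q *\<^sub>R u) \<bullet> (A *v (k + q *\<^sub>R u)) - k \<bullet> (A *v k)\<bar> = \<bar>2 * q * (u \<bullet> (A *v k)) + q\<^sup>2 * (u \<bullet> (A *v u))\<bar>"
    unfolding quadratic_form_add[OF A(1)] by simp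
  also have "\<dots> \<le> 2 * \<bar>q\<bar> * \<bar>u \<bullet> (A *v k)\<bar> + \<bar>q\<bar>\<^sup>2 * \<bar>u \<bullet> (A *v u)\<bar>"
    using abs_triangle_ineq[of "2 * q * (u \<bullet> (A *v k))" "q\<^sup>2 * (u \<bullet> (A *v u))"] by (simp add: abs_mult)
  also have "\<dots> \<le> 2 * (M * ?n\<^sup>2) * (C * ?n) + (M * ?n\<^sup>2)\<^sup>2 * C"
    using A(2)[of u k] A(2)[of u u] u q by (intro add_mono mult_mono power_mono) auto
  also have "\<dots> = C * M * 2 * ?n * ?n\<^sup>2 + C * M * M * (?n * ?n) * ?n\<^sup>2" by (simp add: power2_eq_square algebra_simps)
  also have "\<dots> \<le> C * M * 2 * ?n * ?n\<^sup>2 + C * M * M * (?n * 1) * ?n\<^sup>2"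
    using q by (intro add_left_mono mult_right_mono mult_left_mono) auto
  also have "\<dots> = C * M * (2 + M) * ?n * ?n\<^sup>2" by (simp add: algebra_simps)
  finally show ?thesis .
qed

lemma graph_slope_pos: "sqrt (1 + (norm p)\<^sup>2) > 0"
  by (simp add: add_pos_nonneg)

lemma abs_split: "a = - b + c / 2 \<Longrightarrow> \<bar>a\<bar> \<le> \<bar>b\<bar> + \<bar>c\<bar> / 2" for a b c :: real
  by linarith

lemma contact_identities:
  fixes J q a b x D y s n :: real
  shows "J > 0 \<Longrightarrow> - q + J * b / 2 = - J * (q / J - a / 2) + J * (b - a) / 2"
    and "J > 0 \<Longrightarrow> q / J - a / 2 = - ((J * b / 2 - q) / J) + (b - a) / 2"
    and "(x + D * y / 2) * (s * n) = (x * s + D * s * y / 2) * n"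
  by (simp_all add: field_simps)

text \<open>For boundary points \<open>Y = X + k\<close> on the upper graph, both second-order expansions concern the
  number \<open>q = p \<bullet> k - k \<bullet> u = sqrt (1 + |p|\<^sup>2) * ((X - Y) \<bullet> v)\<close>.\<close>

lemma contact_imp_second_order:
  fixes u p :: "real ^ 'n"
  assumes u: "norm u = 1" and p: "p \<bullet> u = 0" and K: "convex_body_o K" and X: "X \<in> cyl u K" "top_pt u K X = X"
    and A: "transpose A = A" and B: "transpose B = B"
      "\<And>h. h \<bullet> (B *v h) = sqrt (1 + (norm p)\<^sup>2) * (shear u p (oproj u h) \<bullet> (A *v shear u p (oproj u h)))"
    and ct: "contact K X (graph_normal u p) A"
  shows "second_order (top_fn u K) X p B"
  unfolding second_order_def
proof (intro conjI allI impI)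
  define J where "J = sqrt (1 + (norm p)\<^sup>2)"
  have J: "J > 0" unfolding J_def by (rule graph_slope_pos)
  let ?F = "top_fn u K"
  have FX: "?F X = X \<bullet> u" using X(2) top_pt_eq_iff[OF u] by metis
  obtain C where C: "C > 0" "\<And>x y. \<bar>y \<bullet> (A *v x)\<bar> \<le> C * norm x * norm y" using matrix_bound[of A] by blast
  obtain L \<rho> where L: "L > 0" "\<rho> > 0" "ball X \<rho> \<subseteq> cyl u K" "\<And>y z. y \<in> ball X \<rho> \<Longrightarrow> z \<in> ball X \<rho> \<Longrightarrow> \<bar>?F y - ?F z\<bar> \<le> L * norm (y - z)"
    by (rule concave_on_locally_lipschitz[OF top_fn_concave[OF u K] top_fn_continuous[OF u K] open_cyl X(1)]) blast
  fix \<epsilon> :: real assume \<epsilon>: "\<epsilon> > 0"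
  \<comment> \<open>\<open>M\<close> bounds \<open>\<bar>q\<bar>\<close> by a multiple of
    \<open>(norm k)\<^sup>2\<close>, \<open>D\<close> collects the third-order error, and
    \<open>1 + L\<close> bounds \<open>norm k\<close> by a multiple of \<open>norm h\<close>. The
    choices of \<open>\<epsilon>0\<close> and \<open>d1\<close> allow each of the two error terms
    half of \<open>\<epsilon>\<close>.\<close>
  define M where "M = J * (C + 1)"
  have M: "M > 0" using J C by (simp add: M_def)
  define D where "D = J * (C * M * (2 + M))"
  have D: "D > 0" using J C M by (simp add: D_def)
  define \<epsilon>0 where "\<epsilon>0 = min 1 (\<epsilon> / (2 * J * (1 + L)\<^sup>2))"
  have \<epsilon>0: "\<epsilon>0 > 0" "\<epsilon>0 \<le> 1" "J * \<epsilon>0 * (1 + L)\<^sup>2 \<le> \<epsilon> / 2"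
  proof -
    have L1: "2 * J * (1 + L)\<^sup>2 > 0" using J L by simp
    then show "\<epsilon>0 > 0" "\<epsilon>0 \<le> 1" using \<epsilon> by (auto simp: \<epsilon>0_def)
    have "\<epsilon>0 \<le> \<epsilon> / (2 * J * (1 + L)\<^sup>2)" by (simp add: \<epsilon>0_def)
    then have "\<epsilon>0 * (2 * J * (1 + L)\<^sup>2) \<le> \<epsilon>" using L1 by (simp only: pos_le_divide_eq)
    then show "J * \<epsilon>0 * (1 + L)\<^sup>2 \<le> \<epsilon> / 2" by (simp add: mult_ac)
  qed
  obtain d0 where d0: "d0 > 0" "\<And>Y. Y \<in> frontier K \<Longrightarrow> norm (Y - X) < d0 \<Longrightarrow>
      \<bar>(X - Y) \<bullet> graph_normal u p - ((Y - X) \<bullet> (A *v (Y - X))) / 2\<bar> \<le> \<epsilon>0 * (norm (Y - X))\<^sup>2"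
    using ct \<epsilon>0(1) unfolding contact_def by meson
  define d1 where "d1 = min d0 (min 1 (\<epsilon> / (D * (1 + L)\<^sup>2)))"
  have L1: "(1 + L)\<^sup>2 > 0" using L by simp
  have d1: "d1 > 0" using d0 \<epsilon> D L1 by (simp add: d1_def)
  define \<delta> where "\<delta> = min \<rho> (d1 / (1 + L))"
  show "\<exists>\<delta>>0. \<forall>h. norm h < \<delta> \<longrightarrow> \<bar>?F (X + h) - ?F X - p \<bullet> h + (h \<bullet> (B *v h)) / 2\<bar> \<le> \<epsilon> * (norm h)\<^sup>2"
  proof (intro exI[of _ \<delta>] conjI allI impI)
    show "\<delta> > 0" using L d1 by (simp add: \<delta>_def)
    fix h :: "real ^ 'n" assume h: "norm h < \<delta>"
    let ?Y = "top_pt u K (X + h)"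
    define k where "k = ?Y - X"
    define q where "q = p \<bullet> h - k \<bullet> u"
    have Xh: "X + h \<in> ball X \<rho>" "X \<in> ball X \<rho>" using h L(2) by (auto simp: \<delta>_def dist_norm)
    have YF: "?Y \<in> frontier K" using Xh(1) L(3) by (intro top_pt_frontier[OF u K]) blast
    have kh: "k = oproj u h + (?F (X + h) - ?F X) *\<^sub>R u"
    proof -
      have "k = top_pt u K (X + h) - top_pt u K X" using X(2) by (simp add: k_def)
      then show ?thesis by (simp add: top_pt_def linear_add[OF linear_oproj] algebra_simps)
    qed
    have ku: "k \<bullet> u = ?F (X + h) - ?F X" using unit_inner_self[OF u] u by (simp add: kh inner_add_left)
    have "norm k \<le> norm (oproj u h) + norm ((?F (X + h) - ?F X) *\<^sub>R u)" unfolding kh by (rule norm_triangle_ineq)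
    also have "\<dots> \<le> norm h + L * norm h"
      using norm_oproj_le[OF u, of h] L(4)[OF Xh] u by (intro add_mono) auto
    finally have nk: "norm k \<le> (1 + L) * norm h" by (simp add: algebra_simps)
    have "norm h < d1 / (1 + L)" using h by (simp add: \<delta>_def)
    then have "(1 + L) * norm h < d1" using L(1) by (simp add: pos_less_divide_eq mult.commute)
    then have kd: "norm k < d1" using nk by simp
    have pk: "p \<bullet> k = p \<bullet> h" using p by (simp add: kh oproj_def inner_add_right inner_diff_right)
    have qv: "(X - ?Y) \<bullet> graph_normal u p = q / J"
    proof -
      have "(X - ?Y) \<bullet> graph_normal u p = - (k \<bullet> graph_normal u p)" by (simp add: k_def inner_diff_left)
      also have "k \<bullet> graph_normal u p = (k \<bullet> u - p \<bullet> k) / J"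
        by (simp add: graph_normal_def J_def inner_diff_right inner_commute[of k p])
      finally show ?thesis by (simp add: q_def pk minus_divide_left)
    qed
    have c: "\<bar>q / J - (k \<bullet> (A *v k)) / 2\<bar> \<le> \<epsilon>0 * (norm k)\<^sup>2"
      using d0(2)[OF YF] kd unfolding qv k_def[symmetric] by (simp add: d1_def)
    have kA: "\<bar>k \<bullet> (A *v k)\<bar> \<le> C * (norm k)\<^sup>2" using C(2)[of k k] by (simp add: power2_eq_square mult.assoc)
    have n2: "0 \<le> (norm k)\<^sup>2" by simp
    have "\<epsilon>0 * (norm k)\<^sup>2 \<le> 1 * (norm k)\<^sup>2" by (rule mult_right_mono[OF \<epsilon>0(2) n2])
    then have "\<bar>q / J\<bar> \<le> (C + 1) * (norm k)\<^sup>2" using c kA unfolding distrib_right by linarith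
    then have "J * \<bar>q / J\<bar> \<le> J * ((C + 1) * (norm k)\<^sup>2)" using J by (intro mult_left_mono) auto
    then have qM: "\<bar>q\<bar> \<le> M * (norm k)\<^sup>2" using J by (simp add: M_def)
    \<comment> \<open>Here the slope enters: lifting the horizontal part of \<open>h\<close> to the
      tangent hyperplane overshoots the boundary by exactly \<open>q\<close>.\<close>
    have Sh: "shear u p (oproj u h) = k + q *\<^sub>R u"
    proof -
      have "p \<bullet> oproj u h = p \<bullet> h" using p by (simp add: oproj_def inner_diff_right)
      then show ?thesis unfolding shear_def q_def ku by (simp add: kh algebra_simps)
    qed
    let ?P = "(k + q *\<^sub>R u) \<bullet> (A *v (k + q *\<^sub>R u)) - k \<bullet> (A *v k)"
    have pert: "\<bar>?P\<bar> \<le> C * M * (2 + M) * norm k * (norm k)\<^sup>2"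
      using C M qM kd u by (intro quadratic_form_perturb[OF A]) (auto simp: d1_def)
    have "?F (X + h) - ?F X - p \<bullet> h + (h \<bullet> (B *v h)) / 2 = - q + J * ((k + q *\<^sub>R u) \<bullet> (A *v (k + q *\<^sub>R u))) / 2"
      unfolding B(2) Sh J_def[symmetric] q_def ku by simp
    also have "\<dots> = - J * (q / J - (k \<bullet> (A *v k)) / 2) + J * ?P / 2" by (rule contact_identities(1)[OF J])
    finally have "?F (X + h) - ?F X - p \<bullet> h + (h \<bullet> (B *v h)) / 2 = - (J * (q / J - (k \<bullet> (A *v k)) / 2)) + J * ?P / 2"
      by (simp only: mult_minus_left)
    then have "\<bar>?F (X + h) - ?F X - p \<bullet> h + (h \<bullet> (B *v h)) / 2\<bar> \<le> \<bar>J * (q / J - (k \<bullet> (A *v k)) / 2)\<bar> + \<bar>J * ?P\<bar> / 2"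
      by (rule abs_split)
    also have "\<dots> = J * \<bar>q / J - (k \<bullet> (A *v k)) / 2\<bar> + J * \<bar>?P\<bar> / 2" using J by (simp add: abs_mult)
    also have "\<dots> \<le> J * (\<epsilon>0 * (norm k)\<^sup>2) + J * (C * M * (2 + M) * norm k * (norm k)\<^sup>2) / 2"
      using c pert J by (intro add_mono divide_right_mono mult_left_mono) auto
    also have "\<dots> = (J * \<epsilon>0 + D * norm k / 2) * (norm k)\<^sup>2" by (simp add: D_def algebra_simps)
    also have "\<dots> \<le> (J * \<epsilon>0 + D * norm k / 2) * ((1 + L) * norm h)\<^sup>2"
      using nk J \<epsilon>0 D by (intro mult_left_mono power_mono) auto
    also have "\<dots> = (J * \<epsilon>0 * (1 + L)\<^sup>2 + D * (1 + L)\<^sup>2 * norm k / 2) * (norm h)\<^sup>2"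
      unfolding power_mult_distrib by (rule contact_identities(3))
    also have "\<dots> \<le> \<epsilon> * (norm h)\<^sup>2"
    proof (rule mult_right_mono)
      have "norm k \<le> \<epsilon> / (D * (1 + L)\<^sup>2)" using kd by (simp add: d1_def)
      then have "norm k * (D * (1 + L)\<^sup>2) \<le> \<epsilon>" using D L1 by (subst (asm) pos_le_divide_eq) auto
      then show "J * \<epsilon>0 * (1 + L)\<^sup>2 + D * (1 + L)\<^sup>2 * norm k / 2 \<le> \<epsilon>" using \<epsilon>0(3) by (simp add: mult_ac)
    qed simp
    finally show "\<bar>?F (X + h) - ?F X - p \<bullet> h + (h \<bullet> (B *v h)) / 2\<bar> \<le> \<epsilon> * (norm h)\<^sup>2" .
  qed
qed (rule B(1))

text \<open>The displacement \<open>k\<close> of a boundary point may itself be inserted into the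
  expansion, since \<open>top_fn\<close> ignores its component along \<open>u\<close>.
  \<open>frontier_near_top\<close> guarantees that all boundary points close to \<open>X\<close> lie
  on the upper graph.\<close>

lemma second_order_imp_contact:
  fixes u p :: "real ^ 'n"
  assumes u: "norm u = 1" and p: "p \<bullet> u = 0" and K: "convex_body_o K" and X: "X \<in> cyl u K" "top_pt u K X = X"
    and A: "transpose A = A"
    and B: "\<And>h. h \<bullet> (B *v h) = sqrt (1 + (norm p)\<^sup>2) * (shear u p (oproj u h) \<bullet> (A *v shear u p (oproj u h)))"
    and so: "second_order (top_fn u K) X p B"
  shows "contact K X (graph_normal u p) A"
  unfolding contact_def
proof (intro allI impI)
  define J where "J = sqrt (1 + (norm p)\<^sup>2)"
  have J: "J > 0" unfolding J_def by (rule graph_slope_pos)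
  have J1: "J \<ge> 1" unfolding J_def by simp
  let ?F = "top_fn u K"
  have FX: "?F X = X \<bullet> u" using X(2) top_pt_eq_iff[OF u] by metis
  obtain C where C: "C > 0" "\<And>x y. \<bar>y \<bullet> (A *v x)\<bar> \<le> C * norm x * norm y" using matrix_bound[of A] by blast
  obtain CB where CB: "CB > 0" "\<And>x y. \<bar>y \<bullet> (B *v x)\<bar> \<le> CB * norm x * norm y" using matrix_bound[of B] by blast
  obtain \<rho> where \<rho>: "\<rho> > 0" "\<And>Y. Y \<in> frontier K \<Longrightarrow> norm (Y - X) < \<rho> \<Longrightarrow> Y \<in> cyl u K \<and> top_pt u K Y = Y"
    by (rule frontier_near_top[OF u K X]) blast
  fix \<epsilon> :: real assume \<epsilon>: "\<epsilon> > 0"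
  define M where "M = CB + 1"
  have M: "M > 0" using CB by (simp add: M_def)
  define D where "D = C * M * (2 + M)"
  have D: "D > 0" using C M by (simp add: D_def)
  define \<epsilon>0 where "\<epsilon>0 = min 1 (\<epsilon> / 2)"
  have \<epsilon>0: "\<epsilon>0 > 0" "\<epsilon>0 \<le> 1" "\<epsilon>0 \<le> \<epsilon> / 2" using \<epsilon> by (auto simp: \<epsilon>0_def)
  obtain d0 where d0: "d0 > 0" "\<And>h. norm h < d0 \<Longrightarrow> \<bar>?F (X + h) - ?F X - p \<bullet> h + (h \<bullet> (B *v h)) / 2\<bar> \<le> \<epsilon>0 * (norm h)\<^sup>2"
    by (rule second_orderD[OF so \<epsilon>0(1)]) blast
  define \<delta> where "\<delta> = min \<rho> (min d0 (min 1 (\<epsilon> / D)))"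
  show "\<exists>\<delta>>0. \<forall>Y\<in>frontier K. norm (Y - X) < \<delta> \<longrightarrow>
      \<bar>(X - Y) \<bullet> graph_normal u p - ((Y - X) \<bullet> (A *v (Y - X))) / 2\<bar> \<le> \<epsilon> * (norm (Y - X))\<^sup>2"
  proof (intro exI[of _ \<delta>] conjI ballI impI)
    show "\<delta> > 0" using \<rho> d0 \<epsilon> D by (simp add: \<delta>_def)
    fix Y assume Y: "Y \<in> frontier K" "norm (Y - X) < \<delta>"
    define k where "k = Y - X"
    define q where "q = p \<bullet> k - k \<bullet> u"
    have nk: "norm k < \<rho>" "norm k < d0" "norm k < 1" "norm k < \<epsilon> / D" using Y(2) by (auto simp: k_def \<delta>_def)
    have "top_pt u K Y = Y" using \<rho>(2)[OF Y(1)] nk by (simp add: k_def)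
    then have FY: "?F (X + k) = Y \<bullet> u" using top_pt_eq_iff[OF u, of K Y] by (simp add: k_def)
    have c: "\<bar>(k \<bullet> (B *v k)) / 2 - q\<bar> \<le> \<epsilon>0 * (norm k)\<^sup>2"
    proof -
      have "?F (X + k) - ?F X = k \<bullet> u" unfolding FY FX by (simp add: k_def inner_diff_left)
      then show ?thesis using d0(2)[OF nk(2)] by (simp add: q_def algebra_simps)
    qed
    have kB: "\<bar>k \<bullet> (B *v k)\<bar> \<le> CB * (norm k)\<^sup>2" using CB(2)[of k k] by (simp add: power2_eq_square mult.assoc)
    have n2: "0 \<le> (norm k)\<^sup>2" by simp
    have "\<epsilon>0 * (norm k)\<^sup>2 \<le> 1 * (norm k)\<^sup>2" by (rule mult_right_mono[OF \<epsilon>0(2) n2])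
    then have qM: "\<bar>q\<bar> \<le> M * (norm k)\<^sup>2" using c kB unfolding M_def distrib_right by linarith
    have qv: "(X - Y) \<bullet> graph_normal u p = q / J"
    proof -
      have "(X - Y) \<bullet> graph_normal u p = - (k \<bullet> graph_normal u p)" by (simp add: k_def inner_diff_left)
      also have "k \<bullet> graph_normal u p = (k \<bullet> u - p \<bullet> k) / J"
        by (simp add: graph_normal_def J_def inner_diff_right inner_commute[of k p])
      finally show ?thesis by (simp add: q_def minus_divide_left)
    qed
    have Sh: "shear u p (oproj u k) = k + q *\<^sub>R u"
    proof -
      have "p \<bullet> oproj u k = p \<bullet> k" using p by (simp add: oproj_def inner_diff_right)
      then show ?thesis unfolding shear_def q_def by (simp add: oproj_def algebra_simps)
    qed
    let ?P = "(k + q *\<^sub>R u) \<bullet> (A *v (k + q *\<^sub>R u)) - k \<bullet> (A *v k)"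
    have pert: "\<bar>?P\<bar> \<le> D * norm k * (norm k)\<^sup>2"
      unfolding D_def using C M qM nk u by (intro quadratic_form_perturb[OF A]) auto
    have Bk: "k \<bullet> (B *v k) = J * ((k + q *\<^sub>R u) \<bullet> (A *v (k + q *\<^sub>R u)))" unfolding B Sh J_def ..
    have "q / J - (k \<bullet> (A *v k)) / 2 = - (((k \<bullet> (B *v k)) / 2 - q) / J) + ?P / 2"
      unfolding Bk by (rule contact_identities(2)[OF J])
    then have "\<bar>q / J - (k \<bullet> (A *v k)) / 2\<bar> \<le> \<bar>((k \<bullet> (B *v k)) / 2 - q) / J\<bar> + \<bar>?P\<bar> / 2" by (rule abs_split)
    also have "\<dots> \<le> \<bar>(k \<bullet> (B *v k)) / 2 - q\<bar> + \<bar>?P\<bar> / 2"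
    proof -
      have "\<bar>((k \<bullet> (B *v k)) / 2 - q) / J\<bar> = \<bar>(k \<bullet> (B *v k)) / 2 - q\<bar> / J" using J by (simp add: abs_divide)
      also have "\<dots> \<le> \<bar>(k \<bullet> (B *v k)) / 2 - q\<bar> / 1" using J1 by (intro divide_left_mono) auto
      finally show ?thesis by simp
    qed
    also have "\<dots> \<le> \<epsilon>0 * (norm k)\<^sup>2 + D * norm k * (norm k)\<^sup>2 / 2"
      using c pert by (intro add_mono divide_right_mono) auto
    also have "\<dots> = (\<epsilon>0 + D * norm k / 2) * (norm k)\<^sup>2" by (simp add: algebra_simps)
    also have "\<dots> \<le> \<epsilon> * (norm k)\<^sup>2"
    proof (rule mult_right_mono)
      have "norm k \<le> \<epsilon> / D" using nk by simp
      then have "norm k * D \<le> \<epsilon>" using D by (simp only: pos_le_divide_eq)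
      then show "\<epsilon>0 + D * norm k / 2 \<le> \<epsilon>" using \<epsilon>0(3) by (simp add: mult.commute)
    qed simp
    finally show "\<bar>(X - Y) \<bullet> graph_normal u p - ((Y - X) \<bullet> (A *v (Y - X))) / 2\<bar> \<le> \<epsilon> * (norm (Y - X))\<^sup>2"
      unfolding qv k_def .
  qed
qed

text \<open>Some ball around a point straight below \<open>X\<close> lies in \<open>K\<close>. Its
  point furthest in direction \<open>v\<close> satisfies the support inequality at \<open>X\<close>,
  which would fail if \<open>v\<close> did not point upwards.\<close>

lemma outer_normal_inner_pos:
  assumes K: "convex_body_o K" and v: "is_outer_unit_normal K X v"
    and X: "X \<in> cyl u K" "top_pt u K X = X" and u: "norm u = 1"
  shows "v \<bullet> u > 0"
proof -
  obtain t0 where t0: "t0 < top_fn u K X" "oproj u X + t0 *\<^sub>R u \<in> interior K" by (rule cyl_interior_below[OF u K X(1)])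
  let ?z = "oproj u X + t0 *\<^sub>R u"
  obtain e where e: "e > 0" "cball ?z e \<subseteq> K" using t0(2) unfolding mem_interior_cball by blast
  have nv: "norm v = 1" using v by (simp add: is_outer_unit_normal_def)
  have "?z + e *\<^sub>R v \<in> cball ?z e" using e(1) nv by (simp add: dist_norm)
  then have "?z + e *\<^sub>R v \<in> K" using e(2) by blast
  then have "(?z + e *\<^sub>R v - X) \<bullet> v \<le> 0" using v by (simp add: is_outer_unit_normal_def)
  moreover have "?z + e *\<^sub>R v - X = e *\<^sub>R v - (top_fn u K X - t0) *\<^sub>R u"
    using X(2) by (subst (2) X(2)[symmetric]) (simp add: top_pt_def algebra_simps)
  ultimately have "e \<le> (top_fn u K X - t0) * (u \<bullet> v)"
    using unit_inner_self[OF nv] by (simp add: inner_diff_left)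
  then have "(top_fn u K X - t0) * (u \<bullet> v) > 0" using e(1) by linarith
  then show ?thesis using t0(1) by (simp add: zero_less_mult_iff inner_commute[of v u])
qed

text \<open>Inverts \<open>graph_normal\<close>: every unit normal that points upwards belongs to a
  slope.\<close>

lemma normal_slope:
  assumes u: "norm u = 1" and v: "norm v = 1" "v \<bullet> u > 0"
  defines "p \<equiv> u - (1 / (v \<bullet> u)) *\<^sub>R v"
  shows "p \<bullet> u = 0" "graph_normal u p = v"
proof -
  have c: "v \<bullet> u \<noteq> 0" using v(2) by simp
  show pu: "p \<bullet> u = 0" using unit_inner_self[OF u] c by (simp add: p_def inner_diff_left)
  have up: "u - p = (1 / (v \<bullet> u)) *\<^sub>R v" by (simp add: p_def)
  have "norm (u - p) = sqrt (1 + (norm p)\<^sup>2)"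
  proof -
    have "norm (graph_normal u p) = 1" by (rule norm_graph_normal[OF u pu])
    then show ?thesis using graph_slope_pos[of p] by (simp add: graph_normal_def)
  qed
  moreover have "norm (u - p) = 1 / (v \<bullet> u)" unfolding up using v by simp
  ultimately have "sqrt (1 + (norm p)\<^sup>2) = 1 / (v \<bullet> u)" by simp
  then show "graph_normal u p = v" unfolding graph_normal_def up using c by simp
qed

text \<open>Points of \<open>K\<close> pulled towards \<open>X\<close> lie below the graph, and to
  first order this is the support inequality for \<open>graph_normal u p\<close>. A second normal
  would have another slope \<open>p'\<close>; moving along \<open>p - p'\<close> raises the graph
  faster than that support allows.\<close>

lemma differentiable_imp_smooth:
  fixes u p X :: "real ^ 'n"
  assumes u: "norm u = 1" and p: "p \<bullet> u = 0" and K: "convex_body_o K" and X: "X \<in> cyl u K" "top_pt u K X = X"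
    and so: "second_order (top_fn u K) X p B"
  shows "is_outer_unit_normal K X n \<longleftrightarrow> n = graph_normal u p"
proof -
  let ?F = "top_fn u K"
  have FX: "?F X = X \<bullet> u" using X(2) top_pt_eq_iff[OF u] by metis
  have XK: "X \<in> K" using cyl_fibre(1)[OF u K X(1)] X(2) by simp
  obtain e where e: "e > 0" "ball X e \<subseteq> cyl u K" using X(1) open_cyl openE by blast
  have nrm: "is_outer_unit_normal K X (graph_normal u p)"
    unfolding is_outer_unit_normal_def
  proof (intro conjI ballI norm_graph_normal[OF u p])
    fix y assume y: "y \<in> K"
    have "(y - X) \<bullet> (u - p) \<le> 0"
    proof (rule abs_le_eps_zero)
      fix \<epsilon> :: real assume \<epsilon>: "\<epsilon> > 0"
      obtain \<delta> where \<delta>: "\<delta> > 0" "\<And>h. norm h < \<delta> \<Longrightarrow> \<bar>?F (X + h) - ?F X - p \<bullet> h\<bar> \<le> \<epsilon> * norm h"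
        by (rule second_order_differentiable[OF so \<epsilon>]) blast
      obtain s where s: "s > 0" "norm (s *\<^sub>R (y - X)) < min \<delta> e" by (rule small_scale[of "min \<delta> e" "y - X"]) (use \<delta> e in auto)
      define t where "t = min s 1"
      have t: "0 < t" "t \<le> 1" "t \<le> s" using s by (auto simp: t_def)
      let ?h = "t *\<^sub>R (y - X)"
      have "norm ?h \<le> norm (s *\<^sub>R (y - X))" using t s by (simp add: mult_right_mono)
      then have nh: "norm ?h < \<delta>" "norm ?h < e" using s(2) by auto
      have "(1 - t) *\<^sub>R X + t *\<^sub>R y \<in> K" using t by (intro convexD[OF body_facts(2)[OF K] XK y]) auto
      also have "(1 - t) *\<^sub>R X + t *\<^sub>R y = X + ?h" by (simp add: algebra_simps)
      finally have inK: "X + ?h \<in> K" .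
      have "X + ?h \<in> ball X e" using nh by (simp add: dist_norm)
      then have c: "X + ?h \<in> cyl u K" using e(2) by blast
      have "oproj u (X + ?h) + ((X + ?h) \<bullet> u) *\<^sub>R u \<in> K" using inK oproj_decomp[of "X + ?h" u] by simp
      then have "(X + ?h) \<bullet> u \<le> ?F (X + ?h)" by (rule cyl_fibre(2)[OF u K c])
      also have "\<dots> \<le> ?F X + p \<bullet> ?h + \<epsilon> * norm ?h" using \<delta>(2)[OF nh(1)] by linarith
      finally have "?h \<bullet> u - p \<bullet> ?h \<le> \<epsilon> * norm ?h" unfolding FX by (simp add: inner_add_left)
      moreover have "t * ((y - X) \<bullet> (u - p)) = ?h \<bullet> u - p \<bullet> ?h"
        by (simp only: inner_scaleR_left inner_scaleR_right inner_diff_right[of "y - X" u p] right_diff_distrib inner_commute[of p "y - X"])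
      moreover have "\<epsilon> * norm ?h = t * (\<epsilon> * norm (y - X))" using t(1) by simp
      ultimately have "t * ((y - X) \<bullet> (u - p)) \<le> t * (\<epsilon> * norm (y - X))" by (simp only:)
      then show "(y - X) \<bullet> (u - p) \<le> \<epsilon> * norm (y - X)" using t(1) by (simp only: mult_le_cancel_left_pos)
    qed
    then show "(y - X) \<bullet> graph_normal u p \<le> 0"
      using graph_slope_pos[of p] by (simp add: graph_normal_def divide_nonpos_pos)
  qed
  show ?thesis
  proof
    assume n: "is_outer_unit_normal K X n"
    have nn: "norm n = 1" using n by (simp add: is_outer_unit_normal_def)
    have nu: "n \<bullet> u > 0" by (rule outer_normal_inner_pos[OF K n X u])
    define p' where "p' = u - (1 / (n \<bullet> u)) *\<^sub>R n"
    have p': "p' \<bullet> u = 0" "graph_normal u p' = n" using normal_slope[OF u nn nu] by (simp_all add: p'_def)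
    have "(p - p') \<bullet> (p - p') \<le> 0"
    proof (rule abs_le_eps_zero)
      fix \<epsilon> :: real assume \<epsilon>: "\<epsilon> > 0"
      obtain \<delta> where \<delta>: "\<delta> > 0" "\<And>h. norm h < \<delta> \<Longrightarrow> \<bar>?F (X + h) - ?F X - p \<bullet> h\<bar> \<le> \<epsilon> * norm h"
        by (rule second_order_differentiable[OF so \<epsilon>]) blast
      obtain t where t: "t > 0" "norm (t *\<^sub>R (p - p')) < min \<delta> e" by (rule small_scale[of "min \<delta> e" "p - p'"]) (use \<delta> e in auto)
      let ?h = "t *\<^sub>R (p - p')"
      have "X + ?h \<in> ball X e" using t by (simp add: dist_norm)
      then have c: "X + ?h \<in> cyl u K" using e(2) by blast
      have "top_pt u K (X + ?h) \<in> K" by (rule cyl_fibre(1)[OF u K c])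
      then have "(top_pt u K (X + ?h) - X) \<bullet> n \<le> 0" using n by (simp add: is_outer_unit_normal_def)
      moreover have "top_pt u K (X + ?h) - X = oproj u ?h + (?F (X + ?h) - ?F X) *\<^sub>R u"
      proof -
        have "top_pt u K (X + ?h) - X = top_pt u K (X + ?h) - top_pt u K X" using X(2) by simp
        also have "\<dots> = oproj u ?h + (?F (X + ?h) - ?F X) *\<^sub>R u"
          by (simp add: top_pt_def linear_add[OF linear_oproj] scaleR_diff_left)
        finally show ?thesis .
      qed
      moreover have "n = (n \<bullet> u) *\<^sub>R (u - p')" using nu by (simp add: p'_def)
      ultimately have "(oproj u ?h + (?F (X + ?h) - ?F X) *\<^sub>R u) \<bullet> ((n \<bullet> u) *\<^sub>R (u - p')) \<le> 0" by simp
      then have "(oproj u ?h + (?F (X + ?h) - ?F X) *\<^sub>R u) \<bullet> (u - p') \<le> 0"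
        using nu by (simp only: inner_scaleR_right mult_le_0_iff) linarith
      moreover have "(oproj u ?h + (?F (X + ?h) - ?F X) *\<^sub>R u) \<bullet> (u - p') = ?F (X + ?h) - ?F X - ?h \<bullet> p'"
      proof -
        have "oproj u ?h \<bullet> u = 0" using u by simp
        moreover have "u \<bullet> p' = 0" using p'(1) by (simp only: inner_commute)
        moreover have "oproj u ?h \<bullet> p' = ?h \<bullet> p'" unfolding oproj_def inner_diff_left inner_scaleR_left \<open>u \<bullet> p' = 0\<close> by simp
        ultimately show ?thesis using unit_inner_self[OF u]
          unfolding inner_add_left inner_diff_right inner_scaleR_left[of "?F (X + ?h) - ?F X"] by (simp del: inner_scaleR_left)
      qed
      ultimately have "?F (X + ?h) - ?F X \<le> ?h \<bullet> p'" by linarith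
      moreover have "p \<bullet> ?h - \<epsilon> * norm ?h \<le> ?F (X + ?h) - ?F X" 
      proof -
        have "norm ?h < \<delta>" using t(2) by (simp only: min_less_iff_conj)
        from \<delta>(2)[OF this] show ?thesis by linarith
      qed
      ultimately have "p \<bullet> ?h - ?h \<bullet> p' \<le> \<epsilon> * norm ?h" by linarith
      then have "t * (p \<bullet> (p - p') - (p - p') \<bullet> p') \<le> t * (\<epsilon> * norm (p - p'))"
        unfolding inner_scaleR_left inner_scaleR_right norm_scaleR abs_of_pos[OF t(1)] by (simp add: algebra_simps)
      then have "p \<bullet> (p - p') - (p - p') \<bullet> p' \<le> \<epsilon> * norm (p - p')" using t(1) by (simp only: mult_le_cancel_left_pos)
      moreover have "p \<bullet> (p - p') - (p - p') \<bullet> p' = (p - p') \<bullet> (p - p')"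
        by (simp add: inner_diff_left inner_diff_right inner_commute[of p' p])
      ultimately show "(p - p') \<bullet> (p - p') \<le> \<epsilon> * norm (p - p')" by simp
    qed
    then have "(p - p') \<bullet> (p - p') = 0" by (rule order_antisym[OF _ inner_ge_zero])
    then have "p = p'" by simp
    then show "n = graph_normal u p" using p'(2) by simp
  qed (use nrm in simp)
qed

text \<open>At a smooth point the inward normal line meets the interior: otherwise a hyperplane separating
  it from the interior would give a second outer normal.\<close>

lemma smooth_point_cyl:
  fixes X :: "'a::euclidean_space"
  assumes K: "convex_body_o K" and sm: "smooth_boundary_point K X"
  defines "v \<equiv> outer_normal K X"
  shows "is_outer_unit_normal K X v" "norm v = 1" "X \<in> cyl v K" "top_pt v K X = X"
proof -
  note B = body_facts[OF K]
  have X: "X \<in> K" "X \<notin> interior K" using sm B(4) by (auto simp: smooth_boundary_point_def frontier_def)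
  have ex1: "\<exists>!u. is_outer_unit_normal K X u" using sm by (simp add: smooth_boundary_point_def)
  show v: "is_outer_unit_normal K X v" unfolding v_def outer_normal_def by (rule theI'[OF ex1])
  then show nv: "norm v = 1" by (simp add: is_outer_unit_normal_def)
  have vv: "v \<bullet> v = 1" by (rule unit_inner_self[OF nv])
  show "X \<in> cyl v K"
  proof (rule ccontr)
    assume n: "X \<notin> cyl v K"
    define T where "T = range (\<lambda>t. X + t *\<^sub>R v)"
    have "interior K \<inter> T = {}" using n by (auto simp: T_def cyl_def)
    moreover have "convex T"
    proof -
      have "T = (+) X ` ((\<lambda>t. t *\<^sub>R v) ` UNIV)" by (auto simp: T_def)
      moreover have "convex ((\<lambda>t. t *\<^sub>R v) ` (UNIV :: real set))"
        by (intro convex_linear_image linear_scaleR_left convex_UNIV)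
      ultimately show ?thesis using convex_translation by metis
    qed
    moreover have "T \<noteq> {}" "interior K \<noteq> {}" using B(3) by (auto simp: T_def)
    ultimately obtain a b where ab: "a \<noteq> 0" "\<forall>x\<in>interior K. a \<bullet> x \<le> b" "\<forall>x\<in>T. a \<bullet> x \<ge> b"
      using separating_hyperplane_sets[OF convex_interior[OF B(2)], of T] by metis
    have line: "a \<bullet> X + t * (a \<bullet> v) \<ge> b" for t
      using ab(3) by (auto simp: T_def inner_add_right)
    \<comment> \<open>A linear function bounded below on a whole line is constant along it.\<close>
    have av: "a \<bullet> v = 0"
    proof (rule ccontr)
      assume "a \<bullet> v \<noteq> 0"
      then show False using line[of "(b - 1 - a \<bullet> X) / (a \<bullet> v)"] by simp
    qed
    have "closure (interior K) = closure K" using B(2,3) by (intro convex_closure_interior) auto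
    then have Kc: "K \<subseteq> closure (interior K)" using closure_subset by simp
    have "interior K \<subseteq> {x. a \<bullet> x \<le> b}" using ab(2) by auto
    then have "closure (interior K) \<subseteq> {x. a \<bullet> x \<le> b}" by (intro closure_minimal closed_halfspace_le)
    then have le: "a \<bullet> y \<le> b" if "y \<in> K" for y using Kc that by blast
    have Xb: "a \<bullet> X \<ge> b" using line[of 0] by simp
    define n where "n = (1 / norm a) *\<^sub>R a"
    have "(y - X) \<bullet> n \<le> 0" if "y \<in> K" for y
    proof -
      have "(y - X) \<bullet> a \<le> 0" using le[OF that] Xb by (simp add: inner_diff_left inner_commute[of y a] inner_commute[of X a])
      then show ?thesis using ab(1) by (simp add: n_def divide_nonpos_pos)
    qed
    then have "is_outer_unit_normal K X n" using ab(1) by (simp add: is_outer_unit_normal_def n_def)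
    then have "n = v" using ex1 v by blast
    then have "n \<bullet> v = 1" using vv by simp
    then show False using av by (simp add: n_def)
  qed
  have "top_fn v K X = X \<bullet> v"
  proof (rule top_fn_unique[OF nv B(1)])
    show "oproj v X + (X \<bullet> v) *\<^sub>R v \<in> K" using X(1) oproj_decomp[of X v] by simp
    fix t assume "oproj v X + t *\<^sub>R v \<in> K"
    then have "(oproj v X + t *\<^sub>R v - X) \<bullet> v \<le> 0" using v by (simp add: is_outer_unit_normal_def)
    then show "t \<le> X \<bullet> v" using vv nv by (simp add: inner_diff_left inner_add_left)
  qed
  then show "top_pt v K X = X" using top_pt_eq_iff[OF nv] by metis
qed

text \<open>Reduces the graph over the tangent hyperplane to \<open>top_fn\<close> in the direction
  of the normal, so that the curvature becomes an expansion of a concave function.\<close>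

lemma tangent_graph_eq:
  fixes X :: "'a::euclidean_space"
  assumes K: "convex_body_o K" and sm: "smooth_boundary_point K X"
  defines "v \<equiv> outer_normal K X"
  assumes y: "y \<bullet> v = 0" "X + y \<in> cyl v K"
  shows "tangent_graph K X y = X \<bullet> v - top_fn v K (X + y)"
proof -
  note S = smooth_point_cyl[OF K sm, folded v_def]
  have e: "X + y - s *\<^sub>R v = oproj v (X + y) + (X \<bullet> v - s) *\<^sub>R v" for s
    using y(1) by (simp add: oproj_def inner_add_left algebra_simps)
  show ?thesis
    unfolding tangent_graph_def v_def[symmetric]
  proof (rule cInf_eq_minimum)
    have "oproj v (X + y) + top_fn v K (X + y) *\<^sub>R v \<in> K" using cyl_fibre(1)[OF S(2) K y(2)] by (simp add: top_pt_def)
    then show "X \<bullet> v - top_fn v K (X + y) \<in> {s. X + y - s *\<^sub>R v \<in> K}" by (simp add: e)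
    fix s assume "s \<in> {s. X + y - s *\<^sub>R v \<in> K}"
    then have "oproj v (X + y) + (X \<bullet> v - s) *\<^sub>R v \<in> K" by (simp add: e)
    then have "X \<bullet> v - s \<le> top_fn v K (X + y)" by (rule cyl_fibre(2)[OF S(2) K y(2)])
    then show "X \<bullet> v - top_fn v K (X + y) \<le> s" by simp
  qed
qed

text \<open>The limit in the definition runs over the tangent hyperplane. As
  \<open>top_fn v K\<close> is constant along \<open>v\<close> and \<open>A *v v = 0\<close>, the
  expansion extends to all displacements; its gradient is 0 because the graph is taken over the
  tangent hyperplane.\<close>

lemma has_second_fundamental_form_iff:
  fixes X :: "real ^ 'n"
  assumes K: "convex_body_o K" and sm: "smooth_boundary_point K X"
  defines "v \<equiv> outer_normal K X"
  shows "has_second_fundamental_form K X A \<longleftrightarrow> A *v v = 0 \<and> second_order (top_fn v K) X 0 A"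
proof -
  note S = smooth_point_cyl[OF K sm, folded v_def]
  let ?F = "top_fn v K"
  have FX: "?F X = X \<bullet> v" using S(4) top_pt_eq_iff[OF S(2)] by metis
  obtain e where e: "e > 0" "ball X e \<subseteq> cyl v K" using S(3) open_cyl openE by blast
  have tg: "tangent_graph K X y = ?F X - ?F (X + y)" if "y \<bullet> v = 0" "norm y < e" for y
  proof -
    have "X + y \<in> ball X e" using that by (simp add: dist_norm)
    then have "X + y \<in> cyl v K" using e(2) by blast
    with that(1) have "tangent_graph K X y = X \<bullet> v - ?F (X + y)" unfolding v_def by (rule tangent_graph_eq[OF K sm])
    then show ?thesis by (simp only: FX)
  qed
  let ?Q = "\<lambda>y. (tangent_graph K X y - (1 / 2) * (y \<bullet> (A *v y))) / (norm y)\<^sup>2"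
  have "((?Q \<longlongrightarrow> 0) (at 0 within {y. y \<bullet> v = 0})) \<longleftrightarrow> second_order ?F X 0 A"
    if sym: "transpose A = A" and Av: "A *v v = 0"
  proof
    assume lim: "(?Q \<longlongrightarrow> 0) (at 0 within {y. y \<bullet> v = 0})"
    show "second_order ?F X 0 A"
      unfolding second_order_def
    proof (intro conjI allI impI sym)
      fix \<epsilon> :: real assume \<epsilon>: "\<epsilon> > 0"
      obtain d where d: "d > 0" "\<And>y. y \<bullet> v = 0 \<Longrightarrow> 0 < dist y 0 \<Longrightarrow> dist y 0 < d \<Longrightarrow> dist (?Q y) 0 < \<epsilon>"
        using tendstoD[OF lim \<epsilon>] unfolding eventually_at by auto
      show "\<exists>\<delta>>0. \<forall>h. norm h < \<delta> \<longrightarrow> \<bar>?F (X + h) - ?F X - 0 \<bullet> h + (h \<bullet> (A *v h)) / 2\<bar> \<le> \<epsilon> * (norm h)\<^sup>2"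
      proof (intro exI[of _ "min d e"] conjI allI impI)
        show "min d e > 0" using d e by simp
        fix h :: "real ^ 'n" assume h: "norm h < min d e"
        define y where "y = oproj v h"
        have yv: "y \<bullet> v = 0" using S(2) by (simp add: y_def)
        have ny: "norm y \<le> norm h" unfolding y_def by (rule norm_oproj_le[OF S(2)])
        have hy: "h = y + (h \<bullet> v) *\<^sub>R v" unfolding y_def by (rule oproj_decomp)
        have Fh: "?F (X + h) = ?F (X + y)"
          using top_fn_cyl(1)[OF S(2), of K "X + y" "h \<bullet> v"] hy by (simp add: add.assoc)
        have Ah: "h \<bullet> (A *v h) = y \<bullet> (A *v y)"
          using quadratic_form_add[OF sym, of y "h \<bullet> v" v] symmetric_matrix_inner[OF sym, of v y] hy Av by simp
        have tgy: "tangent_graph K X y = ?F X - ?F (X + y)" using yv ny h by (intro tg) auto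
        show "\<bar>?F (X + h) - ?F X - 0 \<bullet> h + (h \<bullet> (A *v h)) / 2\<bar> \<le> \<epsilon> * (norm h)\<^sup>2"
        proof (cases "y = 0")
          case True
          then show ?thesis unfolding Fh Ah using \<epsilon> by simp
        next
          case False
          then have n2: "(norm y)\<^sup>2 > 0" by simp
          have "dist (?Q y) 0 < \<epsilon>" using False ny h yv by (intro d) auto
          then have "\<bar>tangent_graph K X y - (1 / 2) * (y \<bullet> (A *v y))\<bar> / (norm y)\<^sup>2 < \<epsilon>" by (simp add: dist_real_def abs_divide)
          then have "\<bar>tangent_graph K X y - (1 / 2) * (y \<bullet> (A *v y))\<bar> < \<epsilon> * (norm y)\<^sup>2" using n2 by (simp only: pos_divide_less_eq)
          also have "\<dots> \<le> \<epsilon> * (norm h)\<^sup>2" using ny \<epsilon> by (intro mult_left_mono power_mono) auto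
          finally show ?thesis unfolding Fh Ah tgy inner_zero_left by linarith
        qed
      qed
    qed
  next
    assume so: "second_order ?F X 0 A"
    show "(?Q \<longlongrightarrow> 0) (at 0 within {y. y \<bullet> v = 0})"
    proof (rule tendstoI)
      fix \<epsilon> :: real assume \<epsilon>: "\<epsilon> > 0"
      \<comment> \<open>Half of \<open>\<epsilon>\<close>, since the limit asks for a strict
        inequality.\<close>
      then have \<epsilon>2: "\<epsilon> / 2 > 0" by simp
      obtain \<delta> where \<delta>: "\<delta> > 0" "\<And>h. norm h < \<delta> \<Longrightarrow> \<bar>?F (X + h) - ?F X - 0 \<bullet> h + (h \<bullet> (A *v h)) / 2\<bar> \<le> \<epsilon> / 2 * (norm h)\<^sup>2"
        by (rule second_orderD[OF so \<epsilon>2]) blast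
      show "\<forall>\<^sub>F y in at 0 within {y. y \<bullet> v = 0}. dist (?Q y) 0 < \<epsilon>"
        unfolding eventually_at
      proof (intro exI[of _ "min \<delta> e"] conjI ballI impI)
        show "min \<delta> e > 0" using \<delta> e by simp
        fix y assume y: "y \<in> {y. y \<bullet> v = 0}" "y \<noteq> 0 \<and> dist y 0 < min \<delta> e"
        then have n2: "(norm y)\<^sup>2 > 0" by simp
        have tgy: "tangent_graph K X y = ?F X - ?F (X + y)" using y by (intro tg) auto
        have "\<bar>?F (X + y) - ?F X - 0 \<bullet> y + (y \<bullet> (A *v y)) / 2\<bar> \<le> \<epsilon> / 2 * (norm y)\<^sup>2" using y by (intro \<delta>) auto
        then have "\<bar>tangent_graph K X y - (1 / 2) * (y \<bullet> (A *v y))\<bar> \<le> \<epsilon> / 2 * (norm y)\<^sup>2"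
          unfolding tgy inner_zero_left by linarith
        then have "\<bar>tangent_graph K X y - (1 / 2) * (y \<bullet> (A *v y))\<bar> / (norm y)\<^sup>2 \<le> \<epsilon> / 2" using n2 by (simp only: pos_divide_le_eq)
        moreover have "dist (?Q y) 0 = \<bar>tangent_graph K X y - (1 / 2) * (y \<bullet> (A *v y))\<bar> / (norm y)\<^sup>2"
          by (simp only: dist_real_def diff_0_right abs_divide abs_power2)
        ultimately show "dist (?Q y) 0 < \<epsilon>" using \<epsilon> by linarith
      qed
    qed
  qed
  moreover have "second_order ?F X 0 A \<Longrightarrow> transpose A = A" by (simp add: second_order_def)
  ultimately show ?thesis unfolding has_second_fundamental_form_def v_def[symmetric] using sm by blast
qed

lemma graph_normal_0 [simp]: "graph_normal u 0 = u"
  by (simp add: graph_normal_def)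

lemma shear_0 [simp]: "shear u 0 x = x"
  by (simp add: shear_def)

text \<open>The two transfer lemmas for \<open>u = v\<close> and slope 0, where the lift to the
  tangent hyperplane is the projection itself and \<open>B = A\<close>.\<close>

lemma has_second_fundamental_form_contact:
  fixes X :: "real ^ 'n"
  assumes K: "convex_body_o K" and sm: "smooth_boundary_point K X"
  defines "v \<equiv> outer_normal K X"
  assumes A: "transpose A = A" "A *v v = 0"
  shows "has_second_fundamental_form K X A \<longleftrightarrow> contact K X v A"
proof -
  note S = smooth_point_cyl[OF K sm, folded v_def]
  have q: "h \<bullet> (A *v h) = sqrt (1 + (norm 0)\<^sup>2) * (shear v 0 (oproj v h) \<bullet> (A *v shear v 0 (oproj v h)))" for h
    using quadratic_form_add[OF A(1), of "oproj v h" "h \<bullet> v" v] symmetric_matrix_inner[OF A(1), of v "oproj v h"] A(2)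
    by (simp add: oproj_decomp[of h v, symmetric])
  have z: "(0 :: real ^ 'n) \<bullet> v = 0" by simp
  have "second_order (top_fn v K) X 0 A \<longleftrightarrow> contact K X v A"
    using contact_imp_second_order[OF S(2) z K S(3,4) A(1) A(1) q]
      second_order_imp_contact[OF S(2) z K S(3,4) A(1) q] by (simp only: graph_normal_0) blast
  then show ?thesis unfolding has_second_fundamental_form_iff[OF K sm] using A(2) by (simp add: v_def)
qed

section \<open>Curvature as a determinant over the projection\<close>

lemma has_gauss_curvature_unique:
  fixes X :: "real ^ 'n"
  assumes K: "convex_body_o K" and k: "has_gauss_curvature K X k"
  shows "gauss_curvature K X = k"
proof -
  have u: "A = A'" if A: "has_second_fundamental_form K X A" "has_second_fundamental_form K X A'" for A A'
  proof -
    have "smooth_boundary_point K X" using A by (simp add: has_second_fundamental_form_def)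
    then show ?thesis using A has_second_fundamental_form_iff[OF K] second_order_hessian_unique by blast
  qed
  show ?thesis unfolding gauss_curvature_def
  proof (rule the_equality)
    show "has_gauss_curvature K X k" by (rule k)
    fix k' assume "has_gauss_curvature K X k'"
    then show "k' = k" using k u unfolding has_gauss_curvature_def by blast
  qed
qed

lemma det_scaleR:
  fixes M :: "real ^ 'n ^ 'n"
  shows "det (c *\<^sub>R M) = c ^ CARD('n) * det M"
proof -
  have e: "(c *\<^sub>R mat 1 :: real ^ 'n ^ 'n) $ i $ j = (if i = j then c else 0)" for i j by (simp add: mat_def)
  have "c *\<^sub>R M = (c *\<^sub>R mat 1) ** M" by (simp add: matrix_eq scaleR_matrix_vector_assoc[symmetric] matrix_vector_mul_assoc[symmetric])
  moreover have "det (c *\<^sub>R mat 1 :: real ^ 'n ^ 'n) = (\<Prod>i\<in>(UNIV :: 'n set). (c *\<^sub>R mat 1 :: real ^ 'n ^ 'n) $ i $ i)"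
    by (rule det_diagonal) (simp only: e if_False)
  moreover have "\<dots> = c ^ CARD('n)" unfolding e by simp
  ultimately show ?thesis by (simp add: det_mul)
qed

lemma transpose_outer: "transpose (outer u) = outer u"
  by (simp add: outer_def transpose_def vec_eq_iff mult.commute)

lemma transpose_add: "transpose (A + B) = transpose A + transpose B"
  by (simp add: transpose_def vec_eq_iff)

lemma transpose_scaleR: "transpose (c *\<^sub>R A) = c *\<^sub>R transpose A"
  by (simp add: transpose_def vec_eq_iff)

lemma matrix_conjugate_inner:
  fixes M T :: "real ^ 'n ^ 'n"
  shows "x \<bullet> ((transpose T ** M ** T) *v x) = (T *v x) \<bullet> (M *v (T *v x))"
proof -
  have "(transpose T ** M ** T) *v x = transpose T *v (M *v (T *v x))" by (simp only: matrix_vector_mul_assoc matrix_mul_assoc)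
  then show ?thesis using matrix_inner_transpose[of x "transpose T" "M *v (T *v x)"] by (simp only: transpose_transpose)
qed

lemma transpose_conjugate:
  fixes M T :: "real ^ 'n ^ 'n"
  assumes "transpose M = M"
  shows "transpose (transpose T ** M ** T) = transpose T ** M ** T"
  by (simp add: matrix_transpose_mul assms matrix_mul_assoc)

lemma inner_outer: "x \<bullet> (outer u *v x) = (u \<bullet> x)\<^sup>2"
  by (simp add: outer_mult_vec power2_eq_square inner_commute[of x u])

text \<open>Let \<open>J\<close> be the root of \<open>1 + (norm p)\<^sup>2\<close> and
  \<open>v\<close> the normal. Conjugation with \<open>tangent_map\<close>, whose squared
  determinant is \<open>J\<^sup>2\<close>, takes \<open>A + v v\<^sup>T\<close> to
  \<open>(1 / J) B + u u\<^sup>T\<close>; dividing only the \<open>n - 1\<close> directions in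
  \<open>u\<^sup>\<bottom>\<close> by \<open>J\<close> costs the factor \<open>J^(n - 1)\<close>.
  Together this is the exponent \<open>n + 1\<close>.\<close>

lemma curvature_determinant:
  fixes u p :: "real ^ 'n"
  assumes u: "norm u = 1" and p: "p \<bullet> u = 0" and A: "transpose A = A" "A *v graph_normal u p = 0"
    and B: "transpose B = B" "B *v u = 0"
      "\<And>h. h \<bullet> (B *v h) = sqrt (1 + (norm p)\<^sup>2) * (shear u p (oproj u h) \<bullet> (A *v shear u p (oproj u h)))"
  shows "det (B + outer u) = sqrt (1 + (norm p)\<^sup>2) ^ (CARD('n) + 1) * det (A + outer (graph_normal u p))"
proof -
  define J where "J = sqrt (1 + (norm p)\<^sup>2)"
  have J: "J > 0" unfolding J_def by (rule graph_slope_pos)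
  have J2: "J * J = 1 + (norm p)\<^sup>2" unfolding J_def by (simp add: add_nonneg_nonneg)
  let ?v = "graph_normal u p"
  define T where "T = matrix (tangent_map u p)"
  have T: "T *v x = tangent_map u p x" for x unfolding T_def by (simp add: matrix_works linear_tangent_map)
  have TT: "transpose T ** mat 1 ** T = mat 1 + 1 *\<^sub>R outer p"
  proof (rule symmetric_matrix_eqI)
    show "transpose (transpose T ** mat 1 ** T) = transpose T ** mat 1 ** T" by (rule transpose_conjugate) (simp add: transpose_mat)
    show "transpose (mat 1 + 1 *\<^sub>R outer p) = mat 1 + 1 *\<^sub>R outer p" by (simp add: transpose_add transpose_mat transpose_outer)
    fix x
    show "x \<bullet> ((transpose T ** mat 1 ** T) *v x) = x \<bullet> ((mat 1 + 1 *\<^sub>R outer p) *v x)"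
      unfolding matrix_conjugate_inner T using norm_tangent_map[OF u p, of x]
      by (simp add: matrix_vector_mult_add_rdistrib inner_add_right inner_outer power2_norm_eq_inner)
  qed
  have dT: "det T * det T = J * J"
    using arg_cong[OF TT, of det] unfolding det_mul det_transpose det_add_outer J2 by simp
  have C: "transpose T ** (A + outer ?v) ** T = (1 / J) *\<^sub>R B + outer u"
  proof (rule symmetric_matrix_eqI)
    show "transpose (transpose T ** (A + outer ?v) ** T) = transpose T ** (A + outer ?v) ** T"
      by (rule transpose_conjugate) (simp add: transpose_add A transpose_outer)
    show "transpose ((1 / J) *\<^sub>R B + outer u) = (1 / J) *\<^sub>R B + outer u"
      by (simp only: transpose_add transpose_scaleR B transpose_outer)
    fix x
    let ?s = "shear u p (oproj u x)"
    have Tx: "tangent_map u p x = ?s + (x \<bullet> u) *\<^sub>R ?v" by (simp add: tangent_map_def)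
    have "(tangent_map u p x) \<bullet> (A *v (tangent_map u p x)) = ?s \<bullet> (A *v ?s)"
      unfolding Tx quadratic_form_add[OF A(1)] using symmetric_matrix_inner[OF A(1), of ?v ?s] A(2) by simp
    also have "\<dots> = (1 / J) * (x \<bullet> (B *v x))" unfolding B(3) J_def[symmetric] using J by simp
    finally have 1: "(tangent_map u p x) \<bullet> (A *v (tangent_map u p x)) = (1 / J) * (x \<bullet> (B *v x))" .
    have 2: "?v \<bullet> tangent_map u p x = u \<bullet> x"
      using tangent_map_inner_normal[OF u p, of x] inner_commute[of ?v "tangent_map u p x"] inner_commute[of u x] by simp
    show "x \<bullet> ((transpose T ** (A + outer ?v) ** T) *v x) = x \<bullet> (((1 / J) *\<^sub>R B + outer u) *v x)"
      unfolding matrix_conjugate_inner T matrix_vector_mult_add_rdistrib inner_add_right inner_outer 1 2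
      by (simp add: scaleR_matrix_vector_assoc[symmetric])
  qed
  \<comment> \<open>The right-hand factor divides \<open>u\<^sup>\<bottom>\<close> by
    \<open>J\<close> and fixes \<open>u\<close>.\<close>
  have E: "(1 / J) *\<^sub>R B + outer u = (B + outer u) ** ((1 / J) *\<^sub>R (mat 1 + (J - 1) *\<^sub>R outer u))"
  proof (rule matrix_eq[THEN iffD2], rule allI)
    fix x
    have uu: "u \<bullet> u = 1" by (rule unit_inner_self[OF u])
    have "((B + outer u) ** ((1 / J) *\<^sub>R (mat 1 + (J - 1) *\<^sub>R outer u))) *v x
        = (B + outer u) *v ((1 / J) *\<^sub>R (x + ((J - 1) * (u \<bullet> x)) *\<^sub>R u))"
      by (simp add: matrix_vector_mul_assoc[symmetric] scaleR_matrix_vector_assoc[symmetric] matrix_vector_mult_add_rdistrib outer_mult_vec)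
    also have "\<dots> = (1 / J) *\<^sub>R (B *v x + (u \<bullet> x) *\<^sub>R u + ((J - 1) * (u \<bullet> x)) *\<^sub>R u)"
      by (simp add: matrix_vector_mult_scaleR matrix_vector_right_distrib matrix_vector_mult_add_rdistrib outer_mult_vec B(2) uu)
    also have "B *v x + (u \<bullet> x) *\<^sub>R u + ((J - 1) * (u \<bullet> x)) *\<^sub>R u = B *v x + (J * (u \<bullet> x)) *\<^sub>R u"
      by (simp add: left_diff_distrib scaleR_diff_left)
    also have "(1 / J) *\<^sub>R (B *v x + (J * (u \<bullet> x)) *\<^sub>R u) = (1 / J) *\<^sub>R (B *v x) + (u \<bullet> x) *\<^sub>R u"
      using J by (simp add: scaleR_add_right)
    finally show "((1 / J) *\<^sub>R B + outer u) *v x = ((B + outer u) ** ((1 / J) *\<^sub>R (mat 1 + (J - 1) *\<^sub>R outer u))) *v x"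
      by (simp add: matrix_vector_mult_add_rdistrib scaleR_matrix_vector_assoc[symmetric] outer_mult_vec)
  qed
  have "det ((1 / J) *\<^sub>R B + outer u) = det (B + outer u) * ((1 / J) ^ CARD('n) * J)"
    unfolding E det_mul det_scaleR det_add_outer using u by simp
  moreover have "det ((1 / J) *\<^sub>R B + outer u) = J * J * det (A + outer ?v)"
    unfolding C[symmetric] det_mul det_transpose dT[symmetric] by (simp only: mult_ac)
  ultimately have "det (B + outer u) * ((1 / J) ^ CARD('n) * J) = J * J * det (A + outer ?v)" by (rule trans[OF sym])
  then have "J * (det (B + outer u) * (1 / J) ^ CARD('n)) = J * (J * det (A + outer ?v))" by (simp only: mult_ac)
  then have "det (B + outer u) * (1 / J) ^ CARD('n) = J * det (A + outer ?v)" using J by (simp only: mult_cancel_left) simp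
  then have "det (B + outer u) = J ^ CARD('n) * (J * det (A + outer ?v))" using J by (simp add: power_one_over divide_simps mult_ac)
  then show ?thesis by (simp add: J_def mult_ac)
qed

lemma second_order_cyl:
  fixes u :: "real ^ 'n"
  assumes u: "norm u = 1" and K: "convex_body_o K" and X: "X \<in> cyl u K" and so: "second_order (top_fn u K) X p B"
  shows "p \<bullet> u = 0" "B *v u = 0" "transpose B = B" "\<And>h. h \<bullet> (B *v h) \<ge> 0"
proof -
  show sym: "transpose B = B" using so by (simp add: second_order_def)
  show psd: "\<And>h. h \<bullet> (B *v h) \<ge> 0" by (rule second_order_concave_psd[OF so top_fn_concave[OF u K] open_cyl X])
  show "p \<bullet> u = 0" by (rule second_order_cyl_gradient(1)[OF so]) (simp add: u)
  have "u \<bullet> (B *v u) = 0" by (rule second_order_cyl_gradient(2)[OF so]) (simp add: u)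
  then show "B *v u = 0" by (rule psd_kernel[OF sym psd])
qed

text \<open>The slope is the one determined by the outer normal, and \<open>B\<close> is
  \<open>sqrt (1 + (norm p)\<^sup>2)\<close> times the pull-back of the second fundamental form
  under the lift from \<open>u\<^sup>\<bottom>\<close> to the tangent hyperplane.\<close>

lemma gauss_curvature_imp_second_order:
  fixes u :: "real ^ 'n"
  assumes u: "norm u = 1" and K: "convex_body_o K" and X: "X \<in> cyl u K" "top_pt u K X = X"
    and k: "has_gauss_curvature K X k" "k > 0"
  shows "\<exists>p B. second_order (top_fn u K) X p B \<and> det (B + outer u) > 0"
proof -
  obtain A where A: "has_second_fundamental_form K X A" "k = det (A + outer (outer_normal K X))"
    using k(1) by (auto simp: has_gauss_curvature_def outer_def)
  have sm: "smooth_boundary_point K X" and sym: "transpose A = A" and Av: "A *v outer_normal K X = 0"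
    using A(1) by (auto simp: has_second_fundamental_form_def)
  let ?v = "outer_normal K X"
  note S = smooth_point_cyl[OF K sm]
  have vu: "?v \<bullet> u > 0" by (rule outer_normal_inner_pos[OF K S(1) X u])
  define p where "p = u - (1 / (?v \<bullet> u)) *\<^sub>R ?v"
  have p: "p \<bullet> u = 0" "graph_normal u p = ?v" using normal_slope[OF u S(2) vu] by (simp_all add: p_def)
  have ct: "contact K X (graph_normal u p) A"
    unfolding p(2) using has_second_fundamental_form_contact[OF K sm sym Av] A(1) by simp
  define J where "J = sqrt (1 + (norm p)\<^sup>2)"
  have J: "J > 0" unfolding J_def by (rule graph_slope_pos)
  define S where "S = matrix (\<lambda>h. shear u p (oproj u h))"
  have "linear (\<lambda>h. shear u p (oproj u h))"
    by (rule linearI) (simp_all add: shear_def linear_add[OF linear_oproj] linear_scale[OF linear_oproj] inner_add_right algebra_simps)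
  then have Sh: "S *v h = shear u p (oproj u h)" for h by (simp add: S_def matrix_works)
  define B where "B = J *\<^sub>R (transpose S ** A ** S)"
  have Bsym: "transpose B = B" unfolding B_def transpose_scaleR transpose_conjugate[OF sym] ..
  have Bq: "h \<bullet> (B *v h) = sqrt (1 + (norm p)\<^sup>2) * (shear u p (oproj u h) \<bullet> (A *v shear u p (oproj u h)))" for h
    unfolding B_def J_def[symmetric] scaleR_matrix_vector_assoc[symmetric] inner_scaleR_right matrix_conjugate_inner Sh ..
  have so: "second_order (top_fn u K) X p B" by (rule contact_imp_second_order[OF u p(1) K X sym Bsym Bq ct])
  have "det (B + outer u) = J ^ (CARD('n) + 1) * det (A + outer (graph_normal u p))"
    unfolding J_def by (rule curvature_determinant[OF u p(1) sym _ Bsym second_order_cyl(2)[OF u K X(1) so] Bq]) (simp add: p Av)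
  also have "\<dots> > 0" using J k A(2) p(2) by simp
  finally show ?thesis using so by blast
qed

text \<open>Here the curvature is produced and not assumed, as the graph combination requires. The
  second fundamental form is \<open>B\<close> transported by the inverse \<open>W\<close> of
  \<open>tangent_map\<close> and divided by \<open>sqrt (1 + (norm p)\<^sup>2)\<close>.\<close>

lemma second_order_imp_gauss_curvature:
  fixes u :: "real ^ 'n"
  assumes u: "norm u = 1" and K: "convex_body_o K" and X: "X \<in> cyl u K" "top_pt u K X = X"
    and so: "second_order (top_fn u K) X p B"
  shows "outer_normal K X = graph_normal u p"
    and "gauss_curvature K X = det (B + outer u) / sqrt (1 + (norm p)\<^sup>2) ^ (CARD('n) + 1)"
proof -
  let ?v = "graph_normal u p"
  note so' = second_order_cyl[OF u K X(1) so]
  note p = so'(1)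
  have nrm: "is_outer_unit_normal K X n \<longleftrightarrow> n = ?v" for n by (rule differentiable_imp_smooth[OF u p K X so])
  have "X \<in> frontier K" using top_pt_frontier[OF u K X(1)] X(2) by simp
  then have sm: "smooth_boundary_point K X" unfolding smooth_boundary_point_def nrm by simp
  show on: "outer_normal K X = ?v" unfolding outer_normal_def nrm by simp
  define J where "J = sqrt (1 + (norm p)\<^sup>2)"
  have J: "J > 0" unfolding J_def by (rule graph_slope_pos)
  have inj: "inj (tangent_map u p)"
  proof (rule linear_injective_0[OF linear_tangent_map, THEN iffD2], intro allI impI)
    fix x assume "tangent_map u p x = 0"
    then have "(norm x)\<^sup>2 + (p \<bullet> x)\<^sup>2 = 0" using norm_tangent_map[OF u p, of x] by simp
    then show "x = 0" by (simp add: add_nonneg_eq_0_iff)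
  qed
  obtain g where g: "linear g" "\<And>x. g (tangent_map u p x) = x"
    using linear_injective_left_inverse[OF linear_tangent_map inj] by (metis comp_apply id_apply)
  define W where "W = matrix g"
  have W: "W *v (tangent_map u p x) = x" for x by (simp add: W_def matrix_works g)
  have uu: "u \<bullet> u = 1" by (rule unit_inner_self[OF u])
  have "tangent_map u p u = ?v" using uu by (simp add: tangent_map_def oproj_def shear_def)
  then have Wv: "W *v ?v = u" using W[of u] by simp
  have Ws: "W *v (shear u p (oproj u h)) = oproj u h" for h
  proof -
    have "tangent_map u p (oproj u h) = shear u p (oproj u h)" using u by (simp add: tangent_map_def)
    then show ?thesis using W[of "oproj u h"] by simp
  qed
  define A where "A = (1 / J) *\<^sub>R (transpose W ** B ** W)"
  have sym: "transpose A = A" unfolding A_def transpose_scaleR transpose_conjugate[OF so'(3)] ..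
  have Av: "A *v ?v = 0"
  proof -
    have "(transpose W ** B ** W) *v ?v = transpose W *v (B *v (W *v ?v))" by (simp only: matrix_vector_mul_assoc matrix_mul_assoc)
    then show ?thesis unfolding A_def scaleR_matrix_vector_assoc[symmetric] by (simp add: Wv so'(2))
  qed
  have Bq: "h \<bullet> (B *v h) = sqrt (1 + (norm p)\<^sup>2) * (shear u p (oproj u h) \<bullet> (A *v shear u p (oproj u h)))" for h
  proof -
    have "h \<bullet> (B *v h) = oproj u h \<bullet> (B *v oproj u h)"
      using quadratic_form_add[OF so'(3), of "oproj u h" "h \<bullet> u" u] symmetric_matrix_inner[OF so'(3), of u "oproj u h"] so'(2)
      by (simp add: oproj_decomp[of h u, symmetric])
    also have "\<dots> = J * (shear u p (oproj u h) \<bullet> (A *v shear u p (oproj u h)))"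
      unfolding A_def scaleR_matrix_vector_assoc[symmetric] inner_scaleR_right matrix_conjugate_inner Ws using J by simp
    finally show ?thesis by (simp only: J_def)
  qed
  have "contact K X ?v A" by (rule second_order_imp_contact[OF u p K X sym Bq so])
  then have "has_second_fundamental_form K X A"
    using has_second_fundamental_form_contact[OF K sm sym] Av unfolding on by blast
  then have "has_gauss_curvature K X (det (A + outer ?v))"
    unfolding has_gauss_curvature_def on outer_def by blast
  then have "gauss_curvature K X = det (A + outer ?v)" by (rule has_gauss_curvature_unique[OF K])
  moreover have "det (B + outer u) = J ^ (CARD('n) + 1) * det (A + outer ?v)"
    unfolding J_def by (rule curvature_determinant[OF u p sym Av so'(3,2) Bq])
  ultimately show "gauss_curvature K X = det (B + outer u) / sqrt (1 + (norm p)\<^sup>2) ^ (CARD('n) + 1)"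
    using J by (simp add: J_def)
qed

section \<open>The area formula for graphs of concave functions\<close>

definition has_grad :: "('a::real_inner \<Rightarrow> real) \<Rightarrow> 'a \<Rightarrow> 'a \<Rightarrow> bool" where
  "has_grad F x p \<longleftrightarrow> (\<forall>\<epsilon>>0. \<exists>\<delta>>0. \<forall>h. norm h < \<delta> \<longrightarrow> \<bar>F (x + h) - F x - p \<bullet> h\<bar> \<le> \<epsilon> * norm h)"

lemma second_order_has_grad: "second_order F x p B \<Longrightarrow> has_grad F x p"
  unfolding has_grad_def by (meson second_order_differentiable)

text \<open>For a body with the origin in its interior this is the relative interior of the
  projection, by \<open>cyl_eq_interior\<close>.\<close>

definition base :: "'a::euclidean_space \<Rightarrow> 'a set \<Rightarrow> 'a set" where
  "base u K = cyl u K \<inter> {x. x \<bullet> u = 0}"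

definition area_factor :: "'a::real_inner \<Rightarrow> real" where
  "area_factor p = sqrt (1 + (norm p)\<^sup>2)"

lemma cyl_borel: "cyl u K \<in> sets borel"
  by (rule borel_open[OF open_cyl])

lemma base_borel: "base u K \<in> sets borel"
proof -
  have "{x. x \<bullet> u = 0} \<in> sets (borel :: 'a::euclidean_space measure)" by measurable
  then show ?thesis unfolding base_def by (intro sets.Int cyl_borel)
qed

lemma top_pt_continuous:
  assumes "norm u = 1" "convex_body_o K"
  shows "continuous_on (cyl u K) (top_pt u K)"
  unfolding top_pt_def by (intro continuous_intros continuous_oproj top_fn_continuous assms)

lemma base_oproj: "x \<in> base u K \<Longrightarrow> oproj u x = x"
  by (simp add: base_def oproj_id)

lemma oproj_base: "norm u = 1 \<Longrightarrow> x \<in> cyl u K \<Longrightarrow> oproj u x \<in> base u K"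
  by (simp add: base_def)

lemma top_image_eq:
  assumes u: "norm u = 1" and E: "E \<subseteq> base u K"
  shows "top_pt u K ` E = {X. X \<in> cyl u K \<and> X \<bullet> u = top_fn u K X \<and> oproj u X \<in> E}"
proof
  show "top_pt u K ` E \<subseteq> {X. X \<in> cyl u K \<and> X \<bullet> u = top_fn u K X \<and> oproj u X \<in> E}"
  proof (rule image_subsetI)
    fix x assume x: "x \<in> E"
    then have xb: "x \<in> base u K" using E by blast
    have "x \<in> cyl u K" "oproj u x = x" using xb base_oproj[OF xb] by (simp_all add: base_def)
    then show "top_pt u K x \<in> {X. X \<in> cyl u K \<and> X \<bullet> u = top_fn u K X \<and> oproj u X \<in> E}" using u x by simp
  qed
  show "{X. X \<in> cyl u K \<and> X \<bullet> u = top_fn u K X \<and> oproj u X \<in> E} \<subseteq> top_pt u K ` E"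
  proof
    fix X assume X: "X \<in> {X. X \<in> cyl u K \<and> X \<bullet> u = top_fn u K X \<and> oproj u X \<in> E}"
    then have "top_pt u K (oproj u X) = X" using top_pt_eq_iff[OF u] u by (simp only: top_pt_cyl mem_Collect_eq)
    then show "X \<in> top_pt u K ` E" using X by (metis (no_types, lifting) imageI mem_Collect_eq)
  qed
qed

text \<open>The graph is relatively closed in the open cylinder, and the image of \<open>E\<close>
  is the part of the graph whose projection lies in \<open>E\<close>; so it is an intersection of
  Borel sets.\<close>

lemma top_image_borel:
  assumes u: "norm u = 1" and K: "convex_body_o K" and E: "E \<subseteq> base u K" "E \<in> sets borel"
  shows "top_pt u K ` E \<in> sets borel"
proof -
  have "closedin (top_of_set (cyl u K)) {X \<in> cyl u K. X \<bullet> u - top_fn u K X \<in> {0}}"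
    by (intro continuous_closedin_preimage[unfolded vimage_def Int_def, simplified] continuous_intros top_fn_continuous u K | simp)+
  then obtain T where T: "closed T" "{X \<in> cyl u K. X \<bullet> u - top_fn u K X \<in> {0}} = cyl u K \<inter> T"
    unfolding closedin_closed by blast
  have "top_pt u K ` E = (cyl u K \<inter> T) \<inter> (oproj u -` E)"
    unfolding top_image_eq[OF u E(1)] T(2)[symmetric] by auto
  moreover have "oproj u -` E \<in> sets borel" by (rule measurable_sets_borel[OF measurable_oproj E(2)])
  moreover have "cyl u K \<inter> T \<in> sets borel" using T(1) by (intro sets.Int cyl_borel borel_closed)
  ultimately show ?thesis by simp
qed

lemma inj_on_top_base: "norm u = 1 \<Longrightarrow> inj_on (top_pt u K) (base u K)"
  by (rule inj_onI) (metis base_oproj top_pt_props(2))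

text \<open>\<open>top_pt\<close> is locally Lipschitz, and by Lindelof's theorem countably many
  open sets with a Lipschitz bound cover the cylinder.\<close>

lemma top_null_image:
  fixes u :: "real ^ 'n"
  assumes u: "norm u = 1" and K: "convex_body_o K" and N: "N \<subseteq> cyl u K" "hausdorff_outer_measure d N = 0"
  shows "hausdorff_outer_measure d (top_pt u K ` N) = 0"
proof -
  define P where "P B \<longleftrightarrow> (\<exists>L>0. \<forall>y\<in>B. \<forall>z\<in>B. \<bar>top_fn u K y - top_fn u K z\<bar> \<le> L * norm (y - z))" for B
  define \<B> where "\<B> = {B. open B \<and> P B}"
  have "x \<in> \<Union>\<B>" if xc: "x \<in> cyl u K" for x
  proof -
    obtain L \<rho> where L: "L > 0" "\<rho> > 0" "\<And>y z. y \<in> ball x \<rho> \<Longrightarrow> z \<in> ball x \<rho> \<Longrightarrow> \<bar>top_fn u K y - top_fn u K z\<bar> \<le> L * norm (y - z)"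
      by (rule concave_on_locally_lipschitz[OF top_fn_concave[OF u K] top_fn_continuous[OF u K] open_cyl xc]) blast
    then have "P (ball x \<rho>)" unfolding P_def by blast
    then have "ball x \<rho> \<in> \<B>" by (simp add: \<B>_def)
    then show ?thesis using L(2) by (meson UnionI centre_in_ball)
  qed
  then have cov: "cyl u K \<subseteq> \<Union>\<B>" by blast
  have "\<And>S. S \<in> \<B> \<Longrightarrow> open S" by (simp add: \<B>_def)
  then obtain \<C> where C: "\<C> \<subseteq> \<B>" "countable \<C>" "\<Union>\<C> = \<Union>\<B>" by (rule Lindelof)
  have "hausdorff_outer_measure d (top_pt u K ` (N \<inter> B)) = 0" if B: "B \<in> \<C>" for B
  proof -
    obtain L where L: "L > 0" "\<And>y z. y \<in> B \<Longrightarrow> z \<in> B \<Longrightarrow> \<bar>top_fn u K y - top_fn u K z\<bar> \<le> L * norm (y - z)"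
      using B C(1) unfolding \<B>_def P_def by blast
    have "dist (top_pt u K y) (top_pt u K z) \<le> (1 + L) * dist y z" if "y \<in> N \<inter> B" "z \<in> N \<inter> B" for y z
    proof -
      have "top_pt u K y - top_pt u K z = oproj u (y - z) + (top_fn u K y - top_fn u K z) *\<^sub>R u"
        by (simp add: top_pt_def linear_diff[OF linear_oproj] scaleR_diff_left)
      then have "norm (top_pt u K y - top_pt u K z) \<le> norm (oproj u (y - z)) + norm ((top_fn u K y - top_fn u K z) *\<^sub>R u)"
        using norm_triangle_ineq by metis
      also have "\<dots> \<le> norm (y - z) + L * norm (y - z)"
        using norm_oproj_le[OF u, of "y - z"] L(2)[of y z] that u by (intro add_mono) auto
      finally show ?thesis by (simp add: dist_norm algebra_simps)
    qed
    then have "hausdorff_outer_measure d (top_pt u K ` (N \<inter> B)) \<le> ennreal ((1 + L) ^ d) * hausdorff_outer_measure d (N \<inter> B)"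
      using L(1) by (intro hausdorff_outer_measure_lipschitz_image) auto
    also have "hausdorff_outer_measure d (N \<inter> B) = 0" by (rule hausdorff_outer_measure_null_subset[OF N(2)]) blast
    finally show ?thesis by simp
  qed
  then have "hausdorff_outer_measure d (\<Union>B\<in>\<C>. top_pt u K ` (N \<inter> B)) = 0"
    by (rule hausdorff_outer_measure_null_countable_UN[OF C(2)])
  moreover have "top_pt u K ` N \<subseteq> (\<Union>B\<in>\<C>. top_pt u K ` (N \<inter> B))"
  proof (rule image_subsetI)
    fix x assume x: "x \<in> N"
    then obtain B where "B \<in> \<C>" "x \<in> B" using N(1) cov C(3) by blast
    then show "top_pt u K x \<in> (\<Union>B\<in>\<C>. top_pt u K ` (N \<inter> B))" using x by blast
  qed
  ultimately show ?thesis by (rule hausdorff_outer_measure_null_subset)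
qed

text \<open>Neither the graph nor the affine piece is shorter than its projection, so an error relative to
  distances in the projection is a relative error for both.\<close>

lemma area_piece:
  fixes u q :: "real ^ 'n"
  assumes u: "norm u = 1" and q: "q \<bullet> u = 0" and P: "P \<in> sets borel" "P \<subseteq> base u K" and \<epsilon>: "\<epsilon> > 0"
    and near: "\<And>x y. x \<in> P \<Longrightarrow> y \<in> P \<Longrightarrow> \<bar>top_fn u K y - top_fn u K x - q \<bullet> (y - x)\<bar> \<le> \<epsilon> * norm (y - x)"
  defines "\<mu> \<equiv> hausdorff_outer_measure (CARD('n) - 1)" and "c \<equiv> ennreal ((1 + \<epsilon>) ^ (CARD('n) - 1))"
  shows "\<mu> (top_pt u K ` P) \<le> c * (ennreal (area_factor q) * \<mu> P)"
    and "ennreal (area_factor q) * \<mu> P \<le> c * \<mu> (top_pt u K ` P)"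
proof -
  have P0: "P \<subseteq> {x. x \<bullet> u = 0}" using P(2) by (auto simp: base_def)
  have sh: "\<mu> (shear u q ` P) = ennreal (area_factor q) * \<mu> P"
    unfolding \<mu>_def area_factor_def by (rule hausdorff_shear[OF u q P(1) P0])
  have est: "norm (top_pt u K y - top_pt u K x) \<le> (1 + \<epsilon>) * norm (shear u q y - shear u q x)"
    "norm (shear u q y - shear u q x) \<le> (1 + \<epsilon>) * norm (top_pt u K y - top_pt u K x)" if x: "x \<in> P" and y: "y \<in> P" for x y
  proof -
    have xy: "oproj u x = x" "oproj u y = y" "x \<bullet> u = 0" "y \<bullet> u = 0" using x y P0 by (auto intro: oproj_id)
    define a where "a = top_pt u K y - top_pt u K x"
    define b where "b = shear u q y - shear u q x"
    define r where "r = top_fn u K y - top_fn u K x - q \<bullet> (y - x)"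
    have a: "a = (y - x) + (top_fn u K y - top_fn u K x) *\<^sub>R u" by (simp add: a_def top_pt_def xy scaleR_diff_left)
    have b: "b = (y - x) + (q \<bullet> (y - x)) *\<^sub>R u" by (simp add: b_def shear_def inner_diff_right scaleR_diff_left)
    have yx: "oproj u (y - x) = y - x" by (simp add: linear_diff[OF linear_oproj] xy)
    have "oproj u a = y - x" "oproj u b = y - x" unfolding a b using u yx by simp_all
    then have na: "norm (y - x) \<le> norm a" "norm (y - x) \<le> norm b"
      using norm_oproj_le[OF u, of a] norm_oproj_le[OF u, of b] by simp_all
    have ab: "a = b + r *\<^sub>R u" by (simp add: a b r_def scaleR_diff_left)
    have r: "\<bar>r\<bar> \<le> \<epsilon> * norm (y - x)" unfolding r_def by (rule near[OF x y])
    have "norm a \<le> norm b + \<bar>r\<bar>" unfolding ab using norm_triangle_ineq[of b "r *\<^sub>R u"] u by simp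
    also have "\<dots> \<le> norm b + \<epsilon> * norm b" using r na(2) \<epsilon> by (intro add_left_mono) (meson less_imp_le mult_left_mono order_trans)
    finally show "norm (top_pt u K y - top_pt u K x) \<le> (1 + \<epsilon>) * norm (shear u q y - shear u q x)"
      by (simp add: a_def b_def distrib_right)
    have "norm b \<le> norm a + \<bar>r\<bar>" using norm_triangle_ineq4[of a "r *\<^sub>R u"] u by (simp add: ab)
    also have "\<dots> \<le> norm a + \<epsilon> * norm a" using r na(1) \<epsilon> by (intro add_left_mono) (meson less_imp_le mult_left_mono order_trans)
    finally show "norm (shear u q y - shear u q x) \<le> (1 + \<epsilon>) * norm (top_pt u K y - top_pt u K x)"
      by (simp add: a_def b_def distrib_right)
  qed
  \<comment> \<open>Shearing moves points along \<open>u\<close> only and is invisible to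
    \<open>top_pt\<close>; so the graph and the affine piece are images of each other under explicit
    maps with constant \<open>1 + \<epsilon>\<close>.\<close>
  have tsh: "top_pt u K (shear u q x) = top_pt u K x" for x using u by (simp add: shear_def)
  have sht: "shear u q (oproj u (top_pt u K x)) = shear u q x" if "x \<in> P" for x
    using that P0 u by (auto simp: oproj_id)
  have "\<mu> (top_pt u K ` (shear u q ` P)) \<le> c * \<mu> (shear u q ` P)"
    unfolding \<mu>_def c_def
  proof (rule hausdorff_outer_measure_lipschitz_image)
    fix X Y assume "X \<in> shear u q ` P" "Y \<in> shear u q ` P"
    then obtain x y where "X = shear u q x" "Y = shear u q y" "x \<in> P" "y \<in> P" by blast
    then show "dist (top_pt u K X) (top_pt u K Y) \<le> (1 + \<epsilon>) * dist X Y"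
      using est(1)[of y x] by (simp add: tsh dist_norm)
  qed (use \<epsilon> in simp)
  moreover have "top_pt u K ` (shear u q ` P) = top_pt u K ` P" by (simp add: image_image tsh)
  ultimately show "\<mu> (top_pt u K ` P) \<le> c * (ennreal (area_factor q) * \<mu> P)" unfolding sh by simp
  have "\<mu> ((\<lambda>X. shear u q (oproj u X)) ` (top_pt u K ` P)) \<le> c * \<mu> (top_pt u K ` P)"
    unfolding \<mu>_def c_def
  proof (rule hausdorff_outer_measure_lipschitz_image)
    fix X Y assume "X \<in> top_pt u K ` P" "Y \<in> top_pt u K ` P"
    then obtain x y where "X = top_pt u K x" "Y = top_pt u K y" "x \<in> P" "y \<in> P" by blast
    then show "dist (shear u q (oproj u X)) (shear u q (oproj u Y)) \<le> (1 + \<epsilon>) * dist X Y"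
      using est(2)[of y x] sht[of x] sht[of y] by (simp only: dist_norm)
  qed (use \<epsilon> in simp)
  moreover have "(\<lambda>X. shear u q (oproj u X)) ` (top_pt u K ` P) = shear u q ` P"
    unfolding image_image by (rule image_cong[OF refl sht])
  ultimately show "ennreal (area_factor q) * \<mu> P \<le> c * \<mu> (top_pt u K ` P)" unfolding sh[symmetric] by simp
qed

lemma area_factor_pos: "area_factor p > 0"
  unfolding area_factor_def by (rule graph_slope_pos)

text \<open>The area factor of \<open>p\<close> is \<open>norm (u - p)\<close>, so the triangle
  inequality applies; since the factor is at least 1, the absolute error is also a relative
  one.\<close>

lemma area_factor_close:
  assumes u: "norm u = 1" and p: "p \<bullet> u = 0" "q \<bullet> u = 0" and d: "norm (p - q) \<le> \<epsilon>"
  shows "area_factor p \<le> (1 + \<epsilon>) * area_factor q"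
proof -
  have n: "norm (u - p) = area_factor p" if "p \<bullet> u = 0" for p
  proof -
    have "norm (graph_normal u p) = 1" by (rule norm_graph_normal[OF u that])
    then show ?thesis using graph_slope_pos[of p] by (simp add: graph_normal_def area_factor_def)
  qed
  have e: "\<epsilon> \<ge> 0" using d norm_ge_zero order_trans by blast
  have q1: "area_factor q \<ge> 1" by (simp add: area_factor_def)
  have "area_factor p = norm ((u - q) - (p - q))" using n[OF p(1)] by simp
  also have "\<dots> \<le> norm (u - q) + norm (p - q)" by (rule norm_triangle_ineq4)
  also have "\<dots> \<le> area_factor q + \<epsilon>" using n[OF p(2)] d by simp
  also have "\<dots> \<le> area_factor q + \<epsilon> * area_factor q" using q1 e mult_left_mono[of 1 "area_factor q" \<epsilon>] by simp
  finally show ?thesis by (simp add: distrib_right)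
qed

text \<open>Points of the base at which one affine slope approximates the graph up to
  \<open>\<epsilon>\<close> within distance \<open>1 / (k + 1)\<close>. The ball of half that radius
  makes any two points of the piece close enough for the estimate; with \<open>q\<close> and
  \<open>z\<close> from a countable dense set there are countably many pieces.\<close>

definition affine_piece :: "'a::euclidean_space \<Rightarrow> 'a set \<Rightarrow> real \<Rightarrow> 'a \<times> nat \<times> 'a \<Rightarrow> 'a set" where
  "affine_piece u K \<epsilon> = (\<lambda>(q, k, z). {x \<in> cyl u K. \<forall>y\<in>base u K. norm (y - x) < 1 / real (Suc k) \<longrightarrow>
      \<bar>top_fn u K y - top_fn u K x - oproj u q \<bullet> (y - x)\<bar> \<le> \<epsilon> * norm (y - x)} \<inter> ball z (1 / (2 * real (Suc k))) \<inter> base u K)"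

text \<open>For fixed \<open>y\<close> the condition on \<open>x\<close> is the union of two
  relatively closed conditions, and relative closedness survives the uncountable intersection over
  \<open>y\<close>.\<close>

lemma affine_piece_borel:
  assumes u: "norm u = 1" and K: "convex_body_o K"
  shows "affine_piece u K \<epsilon> i \<in> sets borel"
proof -
  obtain q k z where i: "i = (q, k, z)" by (cases i) auto
  let ?G = "\<lambda>y. {x \<in> cyl u K. norm (y - x) < 1 / real (Suc k) \<longrightarrow>
      \<bar>top_fn u K y - top_fn u K x - oproj u q \<bullet> (y - x)\<bar> \<le> \<epsilon> * norm (y - x)}"
  have ci: "closedin (top_of_set (cyl u K)) {x \<in> cyl u K. g x \<in> {0..}}" if "continuous_on (cyl u K) g" for g :: "'a \<Rightarrow> real"
    using continuous_closedin_preimage[OF that closed_atLeast[of 0]] by (simp add: vimage_def Int_def)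
  have cl: "closedin (top_of_set (cyl u K)) (?G y)" for y
  proof -
    have "?G y = {x \<in> cyl u K. norm (y - x) - 1 / real (Suc k) \<in> {0..}}
      \<union> {x \<in> cyl u K. \<epsilon> * norm (y - x) - \<bar>top_fn u K y - top_fn u K x - oproj u q \<bullet> (y - x)\<bar> \<in> {0..}}"
      by auto
    also have "closedin (top_of_set (cyl u K)) \<dots>"
      by (intro closedin_Un ci continuous_intros top_fn_continuous u K)
    finally show ?thesis .
  qed
  \<comment> \<open>The index set of the intersection has to be nonempty.\<close>
  have "0 \<in> base u K" using interior_subset_cyl body_facts(3)[OF K] by (auto simp: base_def)
  then have "closedin (top_of_set (cyl u K)) (\<Inter>y\<in>base u K. ?G y)" by (intro closedin_INT cl) auto
  then obtain T where T: "closed T" "(\<Inter>y\<in>base u K. ?G y) = cyl u K \<inter> T" unfolding closedin_closed by blast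
  have "affine_piece u K \<epsilon> i = (cyl u K \<inter> T) \<inter> ball z (1 / (2 * real (Suc k))) \<inter> base u K"
    unfolding T(2)[symmetric] affine_piece_def i using \<open>0 \<in> base u K\<close> by auto
  moreover have "\<dots> \<in> sets borel"
    by (intro sets.Int cyl_borel base_borel borel_closed[OF T(1)] borel_open[OF open_ball])
  ultimately show ?thesis by (simp only:)
qed

lemma affine_piece_near:
  assumes "x \<in> affine_piece u K \<epsilon> (q, k, z)" "y \<in> affine_piece u K \<epsilon> (q, k, z)"
  shows "\<bar>top_fn u K y - top_fn u K x - oproj u q \<bullet> (y - x)\<bar> \<le> \<epsilon> * norm (y - x)"
proof -
  have "dist z x < 1 / (2 * real (Suc k))" "dist z y < 1 / (2 * real (Suc k))" using assms by (auto simp: affine_piece_def)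
  then have "dist y x < 1 / (2 * real (Suc k)) + 1 / (2 * real (Suc k))" using dist_triangle3[of y x z] by linarith
  also have "\<dots> = 1 / real (Suc k)" by (simp add: field_simps)
  finally have "norm (y - x) < 1 / real (Suc k)" by (simp add: dist_norm)
  then show ?thesis using assms by (auto simp: affine_piece_def)
qed

lemma half_gap:
  fixes x :: real
  assumes "x \<le> e + (x - e) / 2"
  shows "x \<le> e"
  using assms by (simp add: field_simps)

text \<open>The two linear approximations at \<open>x\<close> are compared along
  \<open>p - oproj u q\<close>, where they differ most; \<open>e\<close> is half of the supposed
  excess over \<open>\<epsilon>\<close>.\<close>

lemma affine_piece_grad:
  assumes u: "norm u = 1" and \<epsilon>: "\<epsilon> > 0" and x: "x \<in> affine_piece u K \<epsilon> (q, k, z)" and g: "has_grad (top_fn u K) x p" "p \<bullet> u = 0"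
  shows "norm (p - oproj u q) \<le> \<epsilon>"
proof (rule ccontr)
  let ?q = "oproj u q" and ?F = "top_fn u K"
  assume n: "\<not> norm (p - ?q) \<le> \<epsilon>"
  define e where "e = (norm (p - ?q) - \<epsilon>) / 2"
  have e: "e > 0" using n by (simp add: e_def)
  obtain \<delta> where \<delta>: "\<delta> > 0" "\<And>h. norm h < \<delta> \<Longrightarrow> \<bar>?F (x + h) - ?F x - p \<bullet> h\<bar> \<le> e * norm h"
    using g(1) e unfolding has_grad_def by meson
  have xb: "x \<in> base u K" using x by (simp add: affine_piece_def)
  then have "x \<in> cyl u K" by (simp add: base_def)
  then obtain \<rho> where \<rho>: "\<rho> > 0" "ball x \<rho> \<subseteq> cyl u K" using open_cyl openE by blast
  obtain t where t: "t > 0" "norm (t *\<^sub>R (p - ?q)) < min (1 / real (Suc k)) (min \<delta> \<rho>)"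
    by (rule small_scale[of "min (1 / real (Suc k)) (min \<delta> \<rho>)" "p - ?q"]) (use \<delta>(1) \<rho>(1) in auto)
  define h where "h = t *\<^sub>R (p - ?q)"
  have nh: "norm h < 1 / real (Suc k)" "norm h < \<delta>" "norm h < \<rho>" using t(2) by (auto simp: h_def)
  have "x + h \<in> ball x \<rho>" using nh by (simp add: dist_norm)
  then have "x + h \<in> cyl u K" using \<rho>(2) by blast
  moreover have "h \<bullet> u = 0" using g(2) u by (simp add: h_def inner_diff_left)
  ultimately have yb: "x + h \<in> base u K" using xb by (simp add: base_def inner_add_left)
  have "\<forall>y\<in>base u K. norm (y - x) < 1 / real (Suc k) \<longrightarrow> \<bar>?F y - ?F x - ?q \<bullet> (y - x)\<bar> \<le> \<epsilon> * norm (y - x)"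
    using x by (simp add: affine_piece_def)
  then have "norm (x + h - x) < 1 / real (Suc k) \<longrightarrow> \<bar>?F (x + h) - ?F x - ?q \<bullet> (x + h - x)\<bar> \<le> \<epsilon> * norm (x + h - x)"
    using yb by (rule bspec)
  then have "\<bar>?F (x + h) - ?F x - ?q \<bullet> h\<bar> \<le> \<epsilon> * norm h" using nh(1) by simp
  with \<delta>(2)[OF nh(2)] have "p \<bullet> h - ?q \<bullet> h \<le> (\<epsilon> + e) * norm h" unfolding distrib_right by linarith
  moreover have "p \<bullet> h - ?q \<bullet> h = norm (p - ?q) * norm h"
  proof -
    have "p \<bullet> h - ?q \<bullet> h = (p - ?q) \<bullet> h" by (simp only: inner_diff_left)
    also have "\<dots> = t * (norm (p - ?q))\<^sup>2" unfolding h_def inner_scaleR_right power2_norm_eq_inner ..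
    also have "\<dots> = norm (p - ?q) * norm h" unfolding h_def norm_scaleR using t(1) by (simp add: power2_eq_square)
    finally show ?thesis .
  qed
  moreover have "norm (p - ?q) > 0" using n \<epsilon> by linarith
  then have "norm h > 0" using t(1) unfolding h_def by simp
  ultimately have "norm (p - ?q) \<le> \<epsilon> + e" by simp
  then show False using n half_gap[of "norm (p - ?q)" \<epsilon>] by (simp only: e_def) simp
qed

text \<open>Half of \<open>\<epsilon>\<close> pays for the expansion at \<open>x\<close>, the other
  half for replacing the gradient by a point of the dense set.\<close>

lemma affine_piece_cover:
  assumes u: "norm u = 1" and x: "x \<in> base u K" and g: "has_grad (top_fn u K) x p" "p \<bullet> u = 0" and \<epsilon>: "\<epsilon> > 0"
    and Q: "\<And>X. open X \<Longrightarrow> X \<noteq> {} \<Longrightarrow> \<exists>d\<in>Q. d \<in> X"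
  shows "\<exists>q\<in>Q. \<exists>k. \<exists>z\<in>Q. x \<in> affine_piece u K \<epsilon> (q, k, z)"
proof -
  have e2: "\<epsilon> / 2 > 0" using \<epsilon> by simp
  obtain \<delta> where \<delta>: "\<delta> > 0" "\<And>h. norm h < \<delta> \<Longrightarrow> \<bar>top_fn u K (x + h) - top_fn u K x - p \<bullet> h\<bar> \<le> \<epsilon> / 2 * norm h"
    using g(1) e2 unfolding has_grad_def by meson
  obtain q where q: "q \<in> Q" "q \<in> ball p (\<epsilon> / 2)" using Q[of "ball p (\<epsilon> / 2)"] e2 by auto
  obtain k where k: "1 / real (Suc k) < \<delta>" using nat_approx_posE[OF \<delta>(1)] by auto
  have "1 / (2 * real (Suc k)) > 0" by simp
  then obtain z where z: "z \<in> Q" "z \<in> ball x (1 / (2 * real (Suc k)))"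
    using Q[of "ball x (1 / (2 * real (Suc k)))"] by (metis ball_eq_empty linorder_not_le open_ball)
  have "norm (p - oproj u q) \<le> \<epsilon> / 2"
  proof -
    have "p - oproj u q = oproj u (p - q)" by (simp add: linear_diff[OF linear_oproj] oproj_id[OF g(2)])
    then have "norm (p - oproj u q) \<le> norm (p - q)" using norm_oproj_le[OF u, of "p - q"] by simp
    also have "\<dots> \<le> \<epsilon> / 2" using q(2) by (simp add: dist_norm)
    finally show ?thesis .
  qed
  then have near: "\<bar>top_fn u K y - top_fn u K x - oproj u q \<bullet> (y - x)\<bar> \<le> \<epsilon> * norm (y - x)"
    if "norm (y - x) < 1 / real (Suc k)" for y
  proof -
    have "\<bar>(p - oproj u q) \<bullet> (y - x)\<bar> \<le> norm (p - oproj u q) * norm (y - x)" by (rule Cauchy_Schwarz_ineq2)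
    also have "\<dots> \<le> \<epsilon> / 2 * norm (y - x)" by (rule mult_right_mono) (use \<open>norm (p - oproj u q) \<le> \<epsilon> / 2\<close> in auto)
    finally have "\<bar>p \<bullet> (y - x) - oproj u q \<bullet> (y - x)\<bar> \<le> \<epsilon> / 2 * norm (y - x)" by (simp only: inner_diff_left)
    moreover have "\<bar>top_fn u K (x + (y - x)) - top_fn u K x - p \<bullet> (y - x)\<bar> \<le> \<epsilon> / 2 * norm (y - x)"
      using that k by (intro \<delta>) linarith
    then have "\<bar>top_fn u K y - top_fn u K x - p \<bullet> (y - x)\<bar> \<le> \<epsilon> / 2 * norm (y - x)" by simp
    ultimately show ?thesis by linarith
  qed
  have "x \<in> affine_piece u K \<epsilon> (q, k, z)"
    using near z(2) x by (auto simp: affine_piece_def base_def dist_commute)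
  then show ?thesis using q(1) z(1) by blast
qed

lemma ennreal_le_limit_power:
  fixes a b :: ennreal
  assumes "\<And>\<epsilon>. \<epsilon> > 0 \<Longrightarrow> a \<le> ennreal ((1 + \<epsilon>) ^ N) * b"
  shows "a \<le> b"
proof (cases "b = top")
  case False
  have "(\<lambda>n. ennreal ((1 + 1 / real (Suc n)) ^ N)) \<longlonglongrightarrow> ennreal ((1 + 0) ^ N)"
    by (intro tendsto_ennrealI tendsto_power tendsto_add tendsto_const LIMSEQ_inverse_real_of_nat[unfolded inverse_eq_divide])
  then have "(\<lambda>n. b * ennreal ((1 + 1 / real (Suc n)) ^ N)) \<longlonglongrightarrow> b * ennreal ((1 + 0) ^ N)"
    using False by (intro ennreal_tendsto_cmult) (auto simp: less_top)
  moreover have "a \<le> b * ennreal ((1 + 1 / real (Suc n)) ^ N)" for n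
    using assms[of "1 / real (Suc n)"] by (simp add: mult.commute)
  ultimately have "a \<le> b * ennreal ((1 + 0) ^ N)" by (intro LIMSEQ_le_const) auto
  then show ?thesis by simp
qed simp

text \<open>On an affine piece, the measure of the graph and the integral agree up to a factor
  \<open>(1 + \<epsilon>)^n\<close>: the exponent \<open>n - 1\<close> comes from
  \<open>area_piece\<close>, one more from \<open>area_factor_close\<close>. Both sides are
  countably additive over the disjoint pieces, and \<open>\<epsilon>\<close> tends to 0.\<close>

lemma area_formula:
  fixes u :: "real ^ 'n"
  assumes u: "norm u = 1" and K: "convex_body_o K"
    and p: "p \<in> borel_measurable borel"
    and N: "N \<in> sets borel" "hausdorff_outer_measure (CARD('n) - 1) N = 0"
    and g: "\<And>x. x \<in> base u K - N \<Longrightarrow> has_grad (top_fn u K) x (p x) \<and> p x \<bullet> u = 0"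
    and E: "E \<in> sets borel" "E \<subseteq> base u K"
  shows "hausdorff_outer_measure (CARD('n) - 1) (top_pt u K ` E)
    = (\<integral>\<^sup>+ x. ennreal (area_factor (p x)) * indicator E x \<partial>hausdorff_measure (CARD('n) - 1))"
proof -
  let ?m = "CARD('n) - 1"
  define H where "H = (hausdorff_measure ?m :: (real ^ 'n) measure)"
  define \<mu> where "\<mu> = (hausdorff_outer_measure ?m :: (real ^ 'n) set \<Rightarrow> ennreal)"
  have Hm: "emeasure H A = \<mu> A" if "A \<in> sets borel" for A unfolding H_def \<mu>_def by (rule emeasure_hausdorff_measure[OF that])
  have sH: "sets H = sets borel" by (simp add: H_def)
  define J where "J = (\<lambda>x. ennreal (area_factor (p x)))"
  have Jm: "J \<in> borel_measurable H"
    unfolding J_def area_factor_def measurable_cong_sets[OF sH refl] using p by measurable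
  define D where "D = density H J"
  have Dm: "emeasure D A = (\<integral>\<^sup>+ x. J x * indicator A x \<partial>H)" if "A \<in> sets borel" for A
    unfolding D_def using that sH by (intro emeasure_density Jm) simp
  obtain Q :: "(real ^ 'n) set" where Q0: "countable Q" "\<forall>X. open X \<longrightarrow> X \<noteq> {} \<longrightarrow> (\<exists>d\<in>Q. d \<in> X)"
    using countable_dense_exists by blast
  then have Q: "countable Q" "\<And>X. open X \<Longrightarrow> X \<noteq> {} \<Longrightarrow> \<exists>d\<in>Q. d \<in> X" by blast+
  have Qne: "Q \<noteq> {}" using Q(2)[of UNIV] by auto
  define I where "I = Q \<times> (UNIV :: nat set) \<times> Q"
  have I: "countable I" "I \<noteq> {}" using Q(1) Qne by (auto simp: I_def)
  have main: "\<mu> (top_pt u K ` E) \<le> ennreal ((1 + \<epsilon>) ^ Suc ?m) * emeasure D E \<and> emeasure D E \<le> ennreal ((1 + \<epsilon>) ^ Suc ?m) * \<mu> (top_pt u K ` E)"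
    if \<epsilon>: "\<epsilon> > 0" for \<epsilon>
  proof -
    define P where "P i = affine_piece u K \<epsilon> (from_nat_into I i)" for i
    define A where "A i = (E - N) \<inter> disjointed P i" for i
    have PB: "P i \<in> sets borel" for i unfolding P_def by (rule affine_piece_borel[OF u K])
    have "range (disjointed P) \<subseteq> sets borel" using PB by (intro sets.range_disjointed_sets) auto
    then have AB: "A i \<in> sets borel" for i unfolding A_def using E(1) N(1) by (intro sets.Int sets.Diff) auto
    have Adisj: "disjoint_family A"
      using disjoint_family_disjointed[of P] unfolding disjoint_family_on_def A_def by blast
    have Asub: "A i \<subseteq> base u K" for i using E(2) by (auto simp: A_def)
    have AP: "A i \<subseteq> P i" for i using disjointed_subset[of P i] by (auto simp: A_def)
    have cov: "E - N = (\<Union>i. A i)"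
    proof
      show "E - N \<subseteq> (\<Union>i. A i)"
      proof
        fix x assume x: "x \<in> E - N"
        then have xb: "x \<in> base u K" "x \<in> base u K - N" using E(2) by auto
        obtain q k z where "q \<in> Q" "z \<in> Q" "x \<in> affine_piece u K \<epsilon> (q, k, z)"
          using affine_piece_cover[OF u xb(1) _ _ \<epsilon> Q(2)] g[OF xb(2)] by metis
        then have "(q, k, z) \<in> I" "x \<in> affine_piece u K \<epsilon> (q, k, z)" by (auto simp: I_def)
        then have "x \<in> P (to_nat_on I (q, k, z))" unfolding P_def using I(1) by simp
        then have "x \<in> (\<Union>i. disjointed P i)" unfolding UN_disjointed_eq by blast
        then show "x \<in> (\<Union>i. A i)" using x by (auto simp: A_def)
      qed
    qed (auto simp: A_def)
    have EN: "E = (E \<inter> N) \<union> (\<Union>i. A i)" using cov by blast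
    have nullD: "emeasure D E = (\<Sum>i. emeasure D (A i))"
    proof -
      have "emeasure H (E \<inter> N) = 0"
        using Hm[of "E \<inter> N"] E(1) N hausdorff_outer_measure_null_subset[OF N(2), of "E \<inter> N"] by (simp add: \<mu>_def sets.Int)
      then have "E \<inter> N \<in> null_sets H" using E(1) N(1) sH by (auto simp: null_sets_def)
      then have "emeasure D (E \<inter> N) = 0"
        unfolding Dm[OF sets.Int[OF E(1) N(1)]] by (rule nn_integral_null_set)
      then have "E \<inter> N \<in> null_sets D" using E(1) N(1) sH by (auto simp: null_sets_def D_def)
      moreover have "(\<Union>i. A i) \<in> sets D" using AB sH by (auto simp: D_def)
      ultimately have "emeasure D E = emeasure D (\<Union>i. A i)" using EN emeasure_Un_null_set[of "\<Union>i. A i" D "E \<inter> N"] by (simp add: Un_commute)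
      also have "\<dots> = (\<Sum>i. emeasure D (A i))" using AB Adisj sH by (intro suminf_emeasure[symmetric]) (auto simp: D_def)
      finally show ?thesis .
    qed
    \<comment> \<open>The pieces stay disjoint on the graph because \<open>top_pt\<close> is
      injective on the base, and the image of the exceptional set is null by
      \<open>top_null_image\<close>.\<close>
    have nullM: "\<mu> (top_pt u K ` E) = (\<Sum>i. \<mu> (top_pt u K ` A i))"
    proof -
      have tB: "top_pt u K ` A i \<in> sets borel" for i by (rule top_image_borel[OF u K Asub AB])
      have "disjoint_family (\<lambda>i. top_pt u K ` A i)"
        unfolding disjoint_family_on_def
      proof (intro ballI impI)
        fix i j :: nat assume "i \<noteq> j"
        then have "A i \<inter> A j = {}" using Adisj by (auto simp: disjoint_family_on_def)
        then show "top_pt u K ` A i \<inter> top_pt u K ` A j = {}"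
          using inj_on_image_Int[OF inj_on_top_base[OF u, of K] Asub[of i] Asub[of j]] by simp
      qed
      then have "(\<Sum>i. emeasure H (top_pt u K ` A i)) = emeasure H (\<Union>i. top_pt u K ` A i)"
        using tB sH by (intro suminf_emeasure) auto
      moreover have "(\<Union>i. top_pt u K ` A i) \<in> sets borel" using tB by auto
      ultimately have s: "\<mu> (\<Union>i. top_pt u K ` A i) = (\<Sum>i. \<mu> (top_pt u K ` A i))" using Hm tB by simp
      have "\<mu> (top_pt u K ` (E \<inter> N)) = 0"
        unfolding \<mu>_def
      proof (rule top_null_image[OF u K])
        show "E \<inter> N \<subseteq> cyl u K" using E(2) by (auto simp: base_def)
        show "hausdorff_outer_measure ?m (E \<inter> N) = 0" by (rule hausdorff_outer_measure_null_subset[OF N(2)]) blast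
      qed
      moreover have "top_pt u K ` E = top_pt u K ` (E \<inter> N) \<union> (\<Union>i. top_pt u K ` A i)" using EN by blast
      ultimately have "\<mu> (top_pt u K ` E) \<le> 0 + \<mu> (\<Union>i. top_pt u K ` A i)"
        unfolding \<mu>_def by (metis hausdorff_outer_measure_Un)
      moreover have "\<mu> (\<Union>i. top_pt u K ` A i) \<le> \<mu> (top_pt u K ` E)"
        unfolding \<mu>_def by (rule hausdorff_outer_measure_mono) (use EN in blast)
      ultimately show ?thesis using s by simp
    qed
    have piece: "\<mu> (top_pt u K ` A i) \<le> ennreal ((1 + \<epsilon>) ^ Suc ?m) * emeasure D (A i)
      \<and> emeasure D (A i) \<le> ennreal ((1 + \<epsilon>) ^ Suc ?m) * \<mu> (top_pt u K ` A i)" for i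
    proof -
      obtain q k z where qkz: "from_nat_into I i = (q, k, z)" by (cases "from_nat_into I i") auto
      let ?q = "oproj u q"
      have qu: "?q \<bullet> u = 0" using u by simp
      have Ai: "A i \<subseteq> affine_piece u K \<epsilon> (q, k, z)" using AP[of i] unfolding P_def qkz .
      note ap = area_piece[OF u qu AB Asub \<epsilon>, of i, OF affine_piece_near, OF subsetD[OF Ai] subsetD[OF Ai], folded \<mu>_def]
      have close: "area_factor (p x) \<le> (1 + \<epsilon>) * area_factor ?q" "area_factor ?q \<le> (1 + \<epsilon>) * area_factor (p x)" if x: "x \<in> A i" for x
      proof -
        have "x \<in> base u K - N" using x Asub[of i] by (auto simp: A_def)
        then have gx: "has_grad (top_fn u K) x (p x)" "p x \<bullet> u = 0" using g by blast+
        have d: "norm (p x - ?q) \<le> \<epsilon>" by (rule affine_piece_grad[OF u \<epsilon> subsetD[OF Ai x] gx])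
        then show "area_factor (p x) \<le> (1 + \<epsilon>) * area_factor ?q" by (rule area_factor_close[OF u gx(2) qu])
        have "norm (?q - p x) \<le> \<epsilon>" using d by (simp only: norm_minus_commute)
        then show "area_factor ?q \<le> (1 + \<epsilon>) * area_factor (p x)" by (rule area_factor_close[OF u qu gx(2)])
      qed
      have e1: "ennreal (1 + \<epsilon>) * ennreal ((1 + \<epsilon>) ^ ?m) = ennreal ((1 + \<epsilon>) ^ Suc ?m)"
        unfolding power_Suc using \<epsilon> by (intro ennreal_mult[symmetric]) auto
      have const: "(\<integral>\<^sup>+ x. ennreal c * indicator (A i) x \<partial>H) = ennreal c * \<mu> (A i)" for c
        using AB[of i] Hm sH by (simp add: nn_integral_cmult_indicator)
      have "ennreal (area_factor ?q) * \<mu> (A i) \<le> ennreal (1 + \<epsilon>) * emeasure D (A i)"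
      proof -
        have "ennreal (area_factor ?q) * \<mu> (A i) = (\<integral>\<^sup>+ x. ennreal (area_factor ?q) * indicator (A i) x \<partial>H)" by (simp add: const)
        also have "\<dots> \<le> (\<integral>\<^sup>+ x. ennreal (1 + \<epsilon>) * (J x * indicator (A i) x) \<partial>H)"
        proof (rule nn_integral_mono)
          fix x show "ennreal (area_factor ?q) * indicator (A i) x \<le> ennreal (1 + \<epsilon>) * (J x * indicator (A i) x)"
          proof (cases "x \<in> A i")
            case True
            have "ennreal (area_factor ?q) \<le> ennreal ((1 + \<epsilon>) * area_factor (p x))" by (rule ennreal_leI[OF close(2)[OF True]])
            also have "\<dots> = ennreal (1 + \<epsilon>) * J x"
              unfolding J_def using \<epsilon> less_imp_le[OF area_factor_pos[of "p x"]] by (intro ennreal_mult) auto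
            finally show ?thesis unfolding indicator_simps(1)[OF True] mult_1_right .
          qed simp
        qed
        also have "\<dots> = ennreal (1 + \<epsilon>) * emeasure D (A i)"
          unfolding Dm[OF AB] by (intro nn_integral_cmult borel_measurable_times_ennreal Jm borel_measurable_indicator) (use AB sH in auto)
        finally show ?thesis .
      qed
      then have "ennreal ((1 + \<epsilon>) ^ ?m) * (ennreal (area_factor ?q) * \<mu> (A i)) \<le> ennreal ((1 + \<epsilon>) ^ ?m) * (ennreal (1 + \<epsilon>) * emeasure D (A i))"
        by (rule mult_left_mono) simp
      then have 1: "\<mu> (top_pt u K ` A i) \<le> ennreal ((1 + \<epsilon>) ^ Suc ?m) * emeasure D (A i)"
        using order_trans[OF ap(1)] unfolding e1[symmetric] mult.assoc mult.left_commute[of "ennreal (1 + \<epsilon>)"] by simp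
      have "emeasure D (A i) \<le> ennreal (1 + \<epsilon>) * (ennreal (area_factor ?q) * \<mu> (A i))"
      proof -
        have "emeasure D (A i) \<le> (\<integral>\<^sup>+ x. ennreal ((1 + \<epsilon>) * area_factor ?q) * indicator (A i) x \<partial>H)"
          unfolding Dm[OF AB]
        proof (rule nn_integral_mono)
          fix x show "J x * indicator (A i) x \<le> ennreal ((1 + \<epsilon>) * area_factor ?q) * indicator (A i) x"
            using close(1)[of x] by (auto simp: indicator_def J_def intro!: ennreal_leI)
        qed
        also have "\<dots> = ennreal (1 + \<epsilon>) * (ennreal (area_factor ?q) * \<mu> (A i))"
          unfolding const using \<epsilon> less_imp_le[OF area_factor_pos[of ?q]] by (simp add: ennreal_mult mult.assoc)
        finally show ?thesis .
      qed
      also have "\<dots> \<le> ennreal (1 + \<epsilon>) * (ennreal ((1 + \<epsilon>) ^ ?m) * \<mu> (top_pt u K ` A i))"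
        by (rule mult_left_mono[OF ap(2)]) (assumption | rule zero_le)+
      finally have 2: "emeasure D (A i) \<le> ennreal ((1 + \<epsilon>) ^ Suc ?m) * \<mu> (top_pt u K ` A i)"
        unfolding e1[symmetric] by (simp only: mult.assoc)
      show ?thesis using 1 2 by blast
    qed
    show ?thesis
      unfolding nullD nullM ennreal_suminf_cmult[symmetric] using piece by (intro conjI suminf_le) auto
  qed
  have "\<mu> (top_pt u K ` E) = emeasure D E"
    by (rule antisym; rule ennreal_le_limit_power[where N="Suc ?m"]) (use main in blast)+
  then show ?thesis unfolding Dm[OF E(1)] by (simp add: \<mu>_def J_def H_def)
qed

text \<open>The formula for sets says that the measure on the graph is the image of a weighted
  measure on the base; an equality of measures extends to integrals.\<close>

lemma area_formula_integral:
  fixes u :: "real ^ 'n"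
  assumes u: "norm u = 1" and K: "convex_body_o K"
    and p: "p \<in> borel_measurable borel"
    and N: "N \<in> sets borel" "hausdorff_outer_measure (CARD('n) - 1) N = 0"
    and g: "\<And>x. x \<in> base u K - N \<Longrightarrow> has_grad (top_fn u K) x (p x) \<and> p x \<bullet> u = 0"
    and f: "f \<in> borel_measurable borel"
  shows "(\<integral>\<^sup>+ X. f X * indicator (top_pt u K ` base u K) X \<partial>hausdorff_measure (CARD('n) - 1))
    = (\<integral>\<^sup>+ x. f (top_pt u K x) * ennreal (area_factor (p x)) * indicator (base u K) x \<partial>hausdorff_measure (CARD('n) - 1))"
proof -
  define H where "H = (hausdorff_measure (CARD('n) - 1) :: (real ^ 'n) measure)"
  have sH: "sets H = sets borel" by (simp add: H_def)
  note [measurable_cong] = sH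
  let ?T = "top_pt u K ` base u K"
  have T: "?T \<in> sets borel" by (rule top_image_borel[OF u K subset_refl base_borel])
  \<comment> \<open>A Borel extension of \<open>top_pt\<close>, whose continuity is known on the
    cylinder only.\<close>
  define t where "t x = (if x \<in> cyl u K then top_pt u K x else 0)" for x
  have tm: "t \<in> borel_measurable borel"
    unfolding t_def by (intro borel_measurable_continuous_on_if top_pt_continuous u K continuous_on_const cyl_borel)
  have Jm: "(\<lambda>x. ennreal (area_factor (p x))) \<in> borel_measurable borel" unfolding area_factor_def using p by measurable
  note [measurable] = T tm Jm f base_borel
  define W where "W = (\<lambda>x. ennreal (area_factor (p x)) * indicator (base u K) x)"
  have Wm[measurable]: "W \<in> borel_measurable borel" unfolding W_def by measurable
  have eq: "density H (indicator ?T) = distr (density H W) borel t"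
  proof (rule measure_eqI)
    show "sets (density H (indicator ?T)) = sets (distr (density H W) borel t)" by (simp add: sH)
    fix A assume "A \<in> sets (density H (indicator ?T))"
    then have A[measurable]: "A \<in> sets borel" by (simp add: sH)
    define E where "E = base u K \<inter> t -` A"
    have "t -` A \<in> sets borel" by (rule measurable_sets_borel[OF tm A])
    then have EB: "E \<in> sets borel" unfolding E_def using base_borel by (intro sets.Int) auto
    have Eb: "E \<subseteq> base u K" by (auto simp: E_def)
    have tE: "top_pt u K ` E = A \<inter> ?T" unfolding E_def t_def by (auto simp: base_def)
    have "emeasure (density H (indicator ?T)) A = (\<integral>\<^sup>+ x. indicator ?T x * indicator A x \<partial>H)"
      using sH by (intro emeasure_density) auto
    also have "\<dots> = (\<integral>\<^sup>+ x. indicator (A \<inter> ?T) x \<partial>H)" by (intro nn_integral_cong) (auto simp: indicator_def)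
    also have "\<dots> = emeasure H (A \<inter> ?T)" using A T sH by (intro nn_integral_indicator) auto
    also have "\<dots> = hausdorff_outer_measure (CARD('n) - 1) (top_pt u K ` E)"
      unfolding tE H_def using A T by (intro emeasure_hausdorff_measure) auto
    also have "\<dots> = (\<integral>\<^sup>+ x. ennreal (area_factor (p x)) * indicator E x \<partial>H)"
      unfolding H_def by (rule area_formula[OF u K p N g EB Eb])
    also have "\<dots> = (\<integral>\<^sup>+ x. W x * indicator (t -` A) x \<partial>H)"
      by (intro nn_integral_cong) (auto simp: indicator_def W_def E_def)
    also have "\<dots> = emeasure (density H W) (t -` A)"
      using measurable_sets_borel[OF tm A] sH by (intro emeasure_density[symmetric]) auto
    also have "\<dots> = emeasure (distr (density H W) borel t) A"
    proof -
      have "space (density H W) = UNIV" by (simp add: H_def)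
      moreover have "t \<in> measurable (density H W) borel" using tm by (metis measurable_cong_sets sets_density sH)
      ultimately show ?thesis using A by (simp add: emeasure_distr)
    qed
    finally show "emeasure (density H (indicator ?T)) A = emeasure (distr (density H W) borel t) A" .
  qed
  have "(\<integral>\<^sup>+ X. f X * indicator ?T X \<partial>H) = (\<integral>\<^sup>+ X. f X \<partial>density H (indicator ?T))"
    by (subst nn_integral_density) (auto simp: mult.commute)
  also have "\<dots> = (\<integral>\<^sup>+ x. f (t x) \<partial>density H W)" unfolding eq by (rule nn_integral_distr) auto
  also have "\<dots> = (\<integral>\<^sup>+ x. W x * f (t x) \<partial>H)" by (rule nn_integral_density) auto
  also have "\<dots> = (\<integral>\<^sup>+ x. f (top_pt u K x) * ennreal (area_factor (p x)) * indicator (base u K) x \<partial>H)"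
    by (intro nn_integral_cong) (auto simp: W_def t_def indicator_def base_def mult.commute)
  finally show ?thesis by (simp only: H_def)
qed

section \<open>The vertical part of the boundary\<close>

lemma positive_curvature_aeE:
  fixes K :: "(real ^ 'n) set"
  assumes "positive_gauss_curvature_ae K"
  obtains N where "N \<in> sets borel" "hausdorff_outer_measure (CARD('n) - 1) N = 0"
    "\<And>X. X \<in> frontier K \<Longrightarrow> X \<notin> N \<Longrightarrow> \<exists>k>0. has_gauss_curvature K X k"
proof -
  let ?H = "hausdorff_measure (CARD('n) - 1) :: (real ^ 'n) measure"
  have fr: "frontier K \<inter> space ?H \<in> sets ?H" by (simp add: borel_closed)
  have "AE X in ?H. X \<in> frontier K \<longrightarrow> (\<exists>k>0. has_gauss_curvature K X k)"
    using assms unfolding positive_gauss_curvature_ae_def surface_measure_def AE_restrict_space_iff[OF fr] .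
  then obtain N where N: "{X \<in> space ?H. \<not> (X \<in> frontier K \<longrightarrow> (\<exists>k>0. has_gauss_curvature K X k))} \<subseteq> N" "emeasure ?H N = 0" "N \<in> sets ?H"
    by (rule AE_E)
  have NB: "N \<in> sets borel" using N(3) by simp
  show thesis
  proof (rule that[OF NB])
    show "hausdorff_outer_measure (CARD('n) - 1) N = 0" using N(2) emeasure_hausdorff_measure[OF NB] by simp
  qed (use N(1) in auto)
qed

lemma subset_closure_cyl:
  assumes K: "convex_body_o K"
  shows "K \<subseteq> closure (cyl u K)"
proof -
  note B = body_facts[OF K]
  have "closure (interior K) = closure K" using B(2,3) by (intro convex_closure_interior) auto
  then have "K \<subseteq> closure (interior K)" using closure_subset by simp
  also have "\<dots> \<subseteq> closure (cyl u K)" by (rule closure_mono[OF interior_subset_cyl])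
  finally show ?thesis .
qed

text \<open>If the fibre through a boundary point over the relative boundary of the projection is
  a nondegenerate segment, the direction of the segment is a principal direction with curvature 0.\<close>

lemma vertical_fibre_degenerate:
  fixes u :: "real ^ 'n"
  assumes u: "norm u = 1" and K: "convex_body_o K" and X: "X \<in> frontier K" "X \<notin> cyl u K"
    and k: "has_gauss_curvature K X k" "k > 0" and t: "X + t *\<^sub>R u \<in> K"
  shows "t = 0"
proof (rule ccontr)
  assume t0: "t \<noteq> 0"
  obtain A where A: "has_second_fundamental_form K X A" "k = det (A + outer (outer_normal K X))"
    using k(1) by (auto simp: has_gauss_curvature_def outer_def)
  then have sm: "smooth_boundary_point K X" by (simp add: has_second_fundamental_form_def)
  define v where "v = outer_normal K X"
  note S = smooth_point_cyl[OF K sm, folded v_def]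
  note B = body_facts[OF K]
  have XK: "X \<in> K" using X(1) B(4) by (auto simp: frontier_def)
  have ex1: "\<exists>!u. is_outer_unit_normal K X u" using sm by (simp add: smooth_boundary_point_def)
  \<comment> \<open>A hyperplane separating \<open>X\<close> from the cylinder is parallel to
    \<open>u\<close>, as the cylinder contains a full line in that direction. It supports
    \<open>K\<close> at \<open>X\<close>, so by uniqueness its normal is \<open>v\<close>.\<close>
  have vu: "v \<bullet> u = 0"
  proof -
    have "cyl u K \<inter> {X} = {}" using X(2) by blast
    moreover have z: "0 \<in> cyl u K" using interior_subset_cyl B(3) by blast
    then have "cyl u K \<noteq> {}" by blast
    ultimately obtain a b where ab: "a \<noteq> 0" "\<forall>x\<in>cyl u K. a \<bullet> x \<le> b" "\<forall>x\<in>{X}. a \<bullet> x \<ge> b"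
      using separating_hyperplane_sets[OF convex_cyl[OF B(2)], of "{X}" u] by auto
    have line: "s * (a \<bullet> u) \<le> b" for s
    proof -
      have "0 + s *\<^sub>R u \<in> cyl u K" using z by (simp only: cyl_translate)
      then have "a \<bullet> (0 + s *\<^sub>R u) \<le> b" using ab(2) by blast
      then show ?thesis by simp
    qed
    have au: "a \<bullet> u = 0"
    proof (rule ccontr)
      assume "a \<bullet> u \<noteq> 0"
      then show False using line[of "(b + 1) / (a \<bullet> u)"] by simp
    qed
    have "cyl u K \<subseteq> {x. a \<bullet> x \<le> b}" using ab(2) by auto
    then have "closure (cyl u K) \<subseteq> {x. a \<bullet> x \<le> b}" by (intro closure_minimal closed_halfspace_le)
    then have le: "a \<bullet> y \<le> b" if "y \<in> K" for y using subset_closure_cyl[OF K, of u] that by blast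
    define n where "n = (1 / norm a) *\<^sub>R a"
    have "(y - X) \<bullet> n \<le> 0" if "y \<in> K" for y
    proof -
      have "(y - X) \<bullet> a \<le> 0" using le[OF that] ab(3) by (simp add: inner_diff_left inner_commute[of y a] inner_commute[of X a])
      then show ?thesis using ab(1) by (simp add: n_def divide_nonpos_pos)
    qed
    then have "is_outer_unit_normal K X n" using ab(1) by (simp add: is_outer_unit_normal_def n_def)
    then have "n = v" using ex1 S(1) by blast
    moreover have "n \<bullet> u = 0" using au by (simp add: n_def)
    ultimately show ?thesis by simp
  qed
  have so: "second_order (top_fn v K) X 0 A" and Av: "A *v v = 0"
    using has_second_fundamental_form_iff[OF K sm] A(1) by (simp_all add: v_def)
  have sym: "transpose A = A" using so by (simp add: second_order_def)
  have psd: "\<And>h. h \<bullet> (A *v h) \<ge> 0" by (rule second_order_concave_psd[OF so top_fn_concave[OF S(2) K] open_cyl S(3)])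
  have FX: "top_fn v K X = X \<bullet> v" using S(4) top_pt_eq_iff[OF S(2)] by metis
  have "\<bar>u \<bullet> (A *v u)\<bar> \<le> 0"
  proof (rule abs_le_eps_zero)
    fix \<epsilon> :: real assume \<epsilon>: "\<epsilon> > 0"
    obtain \<delta> where \<delta>: "\<delta> > 0" "\<And>h. norm h < \<delta> \<Longrightarrow> \<bar>top_fn v K (X + h) - top_fn v K X - 0 \<bullet> h + (h \<bullet> (A *v h)) / 2\<bar> \<le> \<epsilon> * (norm h)\<^sup>2"
      by (rule second_orderD[OF so \<epsilon>]) blast
    obtain e where e: "e > 0" "ball X e \<subseteq> cyl v K" using S(3) open_cyl openE by blast
    obtain s where s: "s > 0" "norm (s *\<^sub>R (t *\<^sub>R u)) < min \<delta> e" by (rule small_scale[of "min \<delta> e" "t *\<^sub>R u"]) (use \<delta> e in auto)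
    define r where "r = min s 1"
    have r: "r > 0" "r \<le> 1" "r \<le> s" using s(1) by (auto simp: r_def)
    define h where "h = (r * t) *\<^sub>R u"
    have "norm h \<le> norm (s *\<^sub>R (t *\<^sub>R u))" unfolding h_def norm_scaleR abs_mult using r s(1) u by (simp add: mult_right_mono)
    then have nh: "norm h < \<delta>" "norm h < e" using s(2) by auto
    have "(1 - r) *\<^sub>R X + r *\<^sub>R (X + t *\<^sub>R u) \<in> K" using r by (intro convexD[OF B(2) XK t]) auto
    then have inK: "X + h \<in> K" by (simp add: h_def algebra_simps)
    have hv: "(X + h) \<bullet> v = X \<bullet> v" using vu by (simp add: h_def inner_add_left inner_commute[of u v])
    have c: "X + h \<in> cyl v K" using nh e(2) by (auto simp: subset_eq dist_norm)
    have "oproj v (X + h) + ((X + h) \<bullet> v) *\<^sub>R v \<in> K" using inK oproj_decomp[of "X + h" v] by simp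
    then have "(X + h) \<bullet> v \<le> top_fn v K (X + h)" by (rule cyl_fibre(2)[OF S(2) K c])
    moreover have "(top_pt v K (X + h) - X) \<bullet> v \<le> 0"
      using S(1) cyl_fibre(1)[OF S(2) K c] by (simp add: is_outer_unit_normal_def)
    then have "top_fn v K (X + h) \<le> X \<bullet> v" using S(2) by (simp add: inner_diff_left)
    \<comment> \<open>The segment lies both in \<open>K\<close> and in the supporting hyperplane, so
      the graph over the tangent hyperplane does not bend along it.\<close>
    ultimately have "top_fn v K (X + h) = top_fn v K X" unfolding FX hv by simp
    then have "\<bar>(h \<bullet> (A *v h)) / 2\<bar> \<le> \<epsilon> * (norm h)\<^sup>2" using \<delta>(2)[OF nh(1)] by simp
    then have "\<bar>((r * t)\<^sup>2 * (u \<bullet> (A *v u))) / 2\<bar> \<le> \<epsilon> * ((r * t)\<^sup>2 * (norm u)\<^sup>2)"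
      unfolding h_def quadratic_form_scale norm_scale_sq .
    then have "(r * t)\<^sup>2 * \<bar>u \<bullet> (A *v u)\<bar> / 2 \<le> \<epsilon> * (r * t)\<^sup>2" using u by (simp add: abs_mult)
    then have "(r * t)\<^sup>2 * \<bar>u \<bullet> (A *v u)\<bar> \<le> (r * t)\<^sup>2 * (\<epsilon> * 2)" by (simp add: mult_ac)
    moreover have "(r * t)\<^sup>2 > 0" using r t0 by simp
    ultimately show "\<bar>u \<bullet> (A *v u)\<bar> \<le> \<epsilon> * 2" by (simp only: mult_le_cancel_left_pos)
  qed
  then have "u \<bullet> (A *v u) = 0" by simp
  then have "A *v u = 0" by (rule psd_kernel[OF sym psd])
  then have "(A + outer v) *v u = 0" by (simp add: matrix_vector_mult_add_rdistrib outer_mult_vec vu)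
  moreover have "u \<noteq> 0" using u by auto
  ultimately have "det (A + outer v) = 0" by (rule det_kernel_zero)
  then show False using A(2) k(2) by (simp add: v_def)
qed

text \<open>The full vertical cylinder over the relative boundary of the projection and not just the
  part in \<open>K\<close>; its invariance under translations along \<open>u\<close> is what the
  measure estimates exploit.\<close>

definition rim :: "'a::euclidean_space \<Rightarrow> 'a set \<Rightarrow> 'a set" where
  "rim u K = {x. oproj u x \<in> hproj u K \<and> x \<notin> cyl u K}"

definition thick_rim :: "'a::euclidean_space \<Rightarrow> 'a set \<Rightarrow> 'a set" where
  "thick_rim u K = {x \<in> rim u K. \<exists>s t. s < t \<and> oproj u x + s *\<^sub>R u \<in> K \<and> oproj u x + t *\<^sub>R u \<in> K}"

lemma rim_translate: "norm u = 1 \<Longrightarrow> x + t *\<^sub>R u \<in> rim u K \<longleftrightarrow> x \<in> rim u K"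
  by (simp add: rim_def)

text \<open>A nondegenerate segment contains one with rational ends. The countable union serves both
  measurability and countable subadditivity.\<close>

lemma thick_rim_pieces:
  "thick_rim u K = (\<Union>(q, r)\<in>{(q, r) \<in> \<rat> \<times> \<rat>. q < r}. {x \<in> rim u K. oproj u x + q *\<^sub>R u \<in> K \<and> oproj u x + r *\<^sub>R u \<in> K})"
  if K: "convex K" for K :: "'a::euclidean_space set"
proof
  show "thick_rim u K \<subseteq> (\<Union>(q, r)\<in>{(q, r) \<in> \<rat> \<times> \<rat>. q < r}. {x \<in> rim u K. oproj u x + q *\<^sub>R u \<in> K \<and> oproj u x + r *\<^sub>R u \<in> K})"
  proof
    fix x assume "x \<in> thick_rim u K"
    then obtain s t where st: "x \<in> rim u K" "s < t" "oproj u x + s *\<^sub>R u \<in> K" "oproj u x + t *\<^sub>R u \<in> K" by (auto simp: thick_rim_def)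
    obtain q where q: "q \<in> \<rat>" "s < q" "q < t" using Rats_dense_in_real[OF st(2)] by blast
    obtain r where r: "r \<in> \<rat>" "q < r" "r < t" using Rats_dense_in_real[OF q(3)] by blast
    have mid: "oproj u x + w *\<^sub>R u \<in> K" if w: "s < w" "w < t" for w
    proof -
      define \<theta> where "\<theta> = (w - s) / (t - s)"
      have \<theta>: "0 \<le> \<theta>" "\<theta> \<le> 1" using w by (auto simp: \<theta>_def)
      have "(1 - \<theta>) *\<^sub>R (oproj u x + s *\<^sub>R u) + \<theta> *\<^sub>R (oproj u x + t *\<^sub>R u) \<in> K"
        using \<theta> by (intro convexD[OF K st(3,4)]) auto
      also have "(1 - \<theta>) *\<^sub>R (oproj u x + s *\<^sub>R u) + \<theta> *\<^sub>R (oproj u x + t *\<^sub>R u) = oproj u x + (s + \<theta> * (t - s)) *\<^sub>R u"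
        by (simp add: algebra_simps)
      also have "\<theta> * (t - s) = w - s" using w by (simp add: \<theta>_def)
      finally show ?thesis by simp
    qed
    have "oproj u x + q *\<^sub>R u \<in> K" "oproj u x + r *\<^sub>R u \<in> K" using q r by (auto intro!: mid)
    then show "x \<in> (\<Union>(q, r)\<in>{(q, r) \<in> \<rat> \<times> \<rat>. q < r}. {x \<in> rim u K. oproj u x + q *\<^sub>R u \<in> K \<and> oproj u x + r *\<^sub>R u \<in> K})"
      using st(1) q r by blast
  qed
qed (auto simp: thick_rim_def)

lemma countable_rational_pairs: "countable {(q, r) \<in> \<rat> \<times> \<rat>. q < (r :: real)}"
  by (rule countable_subset[of _ "\<rat> \<times> \<rat>"]) (auto intro: countable_SIGMA countable_rat)

text \<open>Translates in direction \<open>u\<close> of the null part of the boundary cover the cylinder over the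
  thick part of the rim.\<close>

lemma thick_rim_null:
  fixes u :: "real ^ 'n"
  assumes u: "norm u = 1" and K: "convex_body_o K" and pos: "positive_gauss_curvature_ae K"
  shows "hausdorff_outer_measure (CARD('n) - 1) (thick_rim u K) = 0"
proof -
  let ?\<mu> = "hausdorff_outer_measure (CARD('n) - 1) :: (real ^ 'n) set \<Rightarrow> ennreal"
  note B = body_facts[OF K]
  obtain N where N: "?\<mu> N = 0" "\<And>X. X \<in> frontier K \<Longrightarrow> X \<notin> N \<Longrightarrow> \<exists>k>0. has_gauss_curvature K X k"
    by (rule positive_curvature_aeE[OF pos]) blast
  have piece: "?\<mu> {x \<in> rim u K. oproj u x + q *\<^sub>R u \<in> K \<and> oproj u x + r *\<^sub>R u \<in> K} = 0" if qr: "q < r" for q r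
  proof -
    let ?Z = "{x \<in> rim u K. oproj u x + q *\<^sub>R u \<in> K \<and> oproj u x + r *\<^sub>R u \<in> K}"
    define S where "S = {x \<in> ?Z. q \<le> x \<bullet> u \<and> x \<bullet> u \<le> r}"
    have "S \<subseteq> N"
    proof (rule subsetI, rule ccontr)
      fix X assume X: "X \<in> S" "X \<notin> N"
      have rimX: "X \<notin> cyl u K" and Xq: "oproj u X + q *\<^sub>R u \<in> K" and Xr: "oproj u X + r *\<^sub>R u \<in> K" and Xu: "q \<le> X \<bullet> u" "X \<bullet> u \<le> r"
        using X(1) by (auto simp: S_def rim_def)
      have eqr: "oproj u X + w *\<^sub>R u = X + (w - X \<bullet> u) *\<^sub>R u" for w by (simp add: oproj_def algebra_simps)
      define \<theta> where "\<theta> = (X \<bullet> u - q) / (r - q)"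
      have \<theta>: "0 \<le> \<theta>" "\<theta> \<le> 1" using Xu qr by (auto simp: \<theta>_def)
      have "(1 - \<theta>) *\<^sub>R (oproj u X + q *\<^sub>R u) + \<theta> *\<^sub>R (oproj u X + r *\<^sub>R u) \<in> K"
        using \<theta> by (intro convexD[OF B(2) Xq Xr]) auto
      also have "(1 - \<theta>) *\<^sub>R (oproj u X + q *\<^sub>R u) + \<theta> *\<^sub>R (oproj u X + r *\<^sub>R u) = oproj u X + (q + \<theta> * (r - q)) *\<^sub>R u"
        by (simp add: algebra_simps)
      also have "\<theta> * (r - q) = X \<bullet> u - q" using qr by (simp add: \<theta>_def)
      finally have XK: "X \<in> K" using oproj_decomp[of X u] by simp
      moreover have "X \<notin> interior K" using rimX interior_subset_cyl by blast
      ultimately have Xf: "X \<in> frontier K" using closure_subset by (auto simp: frontier_def)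
      obtain k where k: "k > 0" "has_gauss_curvature K X k" using N(2)[OF Xf X(2)] by blast
      have "q - X \<bullet> u = 0" "r - X \<bullet> u = 0"
        using vertical_fibre_degenerate[OF u K Xf rimX k(2,1)] Xq Xr unfolding eqr by blast+
      then show False using qr by simp
    qed
    then have S0: "?\<mu> S = 0" by (rule hausdorff_outer_measure_null_subset[OF N(1)])
    have T0: "?\<mu> ((+) ((real_of_int j * (r - q)) *\<^sub>R u) ` S) = 0" for j
      using S0 by (simp add: hausdorff_outer_measure_translation)
    have "?\<mu> (\<Union>j\<in>(UNIV :: int set). (+) ((real_of_int j * (r - q)) *\<^sub>R u) ` S) = 0"
      by (rule hausdorff_outer_measure_null_countable_UN) (use T0 in auto)
    moreover have "?Z \<subseteq> (\<Union>j\<in>(UNIV :: int set). (+) ((real_of_int j * (r - q)) *\<^sub>R u) ` S)"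
    proof
      fix x assume x: "x \<in> ?Z"
      \<comment> \<open>The slabs of height \<open>r - q\<close> tile the cylinder; \<open>j\<close>
        is the number of a slab that contains \<open>x\<close>.\<close>
      define j where "j = \<lfloor>(x \<bullet> u - q) / (r - q)\<rfloor>"
      define y where "y = x - (real_of_int j * (r - q)) *\<^sub>R u"
      have d: "r - q > 0" using qr by simp
      have "real_of_int j \<le> (x \<bullet> u - q) / (r - q)" "(x \<bullet> u - q) / (r - q) \<le> real_of_int j + 1" unfolding j_def by linarith+
      then have j: "real_of_int j * (r - q) \<le> x \<bullet> u - q" "x \<bullet> u - q \<le> (real_of_int j + 1) * (r - q)"
        using d by (simp_all only: pos_le_divide_eq pos_divide_le_eq)
      have yu: "y \<bullet> u = x \<bullet> u - real_of_int j * (r - q)" using unit_inner_self[OF u] by (simp add: y_def inner_diff_left)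
      have py: "oproj u y = oproj u x" using u by (simp add: y_def)
      have "y + (real_of_int j * (r - q)) *\<^sub>R u = x" by (simp add: y_def)
      then have "y \<in> rim u K" using x rim_translate[OF u, of y "real_of_int j * (r - q)" K] by simp
      then have "y \<in> S" using x j unfolding S_def distrib_right by (simp add: py yu)
      moreover have "x = (real_of_int j * (r - q)) *\<^sub>R u + y" by (simp add: y_def)
      ultimately show "x \<in> (\<Union>j\<in>(UNIV :: int set). (+) ((real_of_int j * (r - q)) *\<^sub>R u) ` S)" by blast
    qed
    ultimately show ?thesis by (rule hausdorff_outer_measure_null_subset)
  qed
  show ?thesis
    unfolding thick_rim_pieces[OF B(2)]
    by (rule hausdorff_outer_measure_null_countable_UN[OF countable_rational_pairs]) (use piece in auto)
qed

lemma thick_rim_borel: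
  fixes u :: "'a::euclidean_space"
  assumes u: "norm u = 1" and K: "convex_body_o K"
  shows "rim u K \<in> sets borel" "thick_rim u K \<in> sets borel"
proof -
  note B = body_facts[OF K]
  have "compact (hproj u K)" unfolding hproj_image by (rule compact_continuous_image[OF continuous_oproj B(1)])
  then have "hproj u K \<in> sets borel" by (intro borel_closed compact_imp_closed)
  then have hB: "oproj u -` hproj u K \<in> sets borel" by (rule measurable_sets_borel[OF measurable_oproj])
  have e: "rim u K = oproj u -` hproj u K - cyl u K" by (auto simp: rim_def)
  show rB: "rim u K \<in> sets borel" unfolding e by (intro sets.Diff hB cyl_borel)
  have pB: "{x. oproj u x + q *\<^sub>R u \<in> K} \<in> sets borel" for q
  proof -
    have "closed ((\<lambda>x. oproj u x + q *\<^sub>R u) -` K)"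
      by (intro closed_vimage B(4) continuous_intros continuous_oproj)
    then show ?thesis by (simp add: vimage_def borel_closed)
  qed
  have e: "{x \<in> rim u K. oproj u x + q *\<^sub>R u \<in> K \<and> oproj u x + r *\<^sub>R u \<in> K} = rim u K \<inter> {x. oproj u x + q *\<^sub>R u \<in> K} \<inter> {x. oproj u x + r *\<^sub>R u \<in> K}" for q r
    by auto
  show "thick_rim u K \<in> sets borel"
    unfolding thick_rim_pieces[OF B(2)]
    by (rule sets.countable_UN'[OF countable_rational_pairs]) (auto simp: e intro!: sets.Int rB pB)
qed

text \<open>A bounded part of the rim lies on the boundary of the convex body \<open>C\<close>, a
  truncated cylinder over the projection, and such boundaries have finite measure.\<close>

lemma rim_slab_finite:
  fixes u :: "real ^ 'n"
  assumes u: "norm u = 1" and K: "convex_body_o K"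
  shows "hausdorff_outer_measure (CARD('n) - 1) (rim u K \<inter> {x. \<bar>x \<bullet> u\<bar> \<le> R}) < top"
proof -
  note B = body_facts[OF K]
  \<comment> \<open>The summand 1 puts the origin into the interior of \<open>C\<close>, whatever
    \<open>R\<close> is.\<close>
  define R' where "R' = \<bar>R\<bar> + 1"
  define C where "C = {x. oproj u x \<in> hproj u K \<and> \<bar>x \<bullet> u\<bar> \<le> R'}"
  have hc: "compact (hproj u K)" "convex (hproj u K)"
    unfolding hproj_image by (rule compact_continuous_image[OF continuous_oproj B(1)], rule convex_linear_image[OF linear_oproj B(2)])
  have Ceq: "C = (\<lambda>(x, t). x + t *\<^sub>R u) ` (hproj u K \<times> {- R'..R'})"
  proof
    show "C \<subseteq> (\<lambda>(x, t). x + t *\<^sub>R u) ` (hproj u K \<times> {- R'..R'})"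
    proof
      fix x assume "x \<in> C"
      then have "(oproj u x, x \<bullet> u) \<in> hproj u K \<times> {- R'..R'}" by (auto simp: C_def)
      then show "x \<in> (\<lambda>(x, t). x + t *\<^sub>R u) ` (hproj u K \<times> {- R'..R'})"
        using oproj_decomp[of x u] by (intro image_eqI[of _ _ "(oproj u x, x \<bullet> u)"]) auto
    qed
    show "(\<lambda>(x, t). x + t *\<^sub>R u) ` (hproj u K \<times> {- R'..R'}) \<subseteq> C"
    proof (rule image_subsetI)
      fix p assume "p \<in> hproj u K \<times> {- R'..R'}"
      then obtain x t where p: "p = (x, t)" "x \<in> hproj u K" "\<bar>t\<bar> \<le> R'" by (cases p) auto
      then have "x \<bullet> u = 0" by (simp add: hproj_iff[OF u])
      then have "oproj u (x + t *\<^sub>R u) = x" "(x + t *\<^sub>R u) \<bullet> u = t" using u unit_inner_self[OF u] by (simp_all add: oproj_id inner_add_left)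
      then show "(\<lambda>(x, t). x + t *\<^sub>R u) p \<in> C" using p by (simp add: C_def)
    qed
  qed
  have "continuous_on (hproj u K \<times> {- R'..R'}) (\<lambda>(x, t). x + t *\<^sub>R u)"
    unfolding split_beta by (intro continuous_intros)
  then have cC: "compact C" unfolding Ceq by (intro compact_continuous_image compact_Times hc compact_Icc)
  have vC: "convex C"
  proof -
    have "linear (\<lambda>(x, t). x + t *\<^sub>R u)" by (rule linearI) (auto simp: algebra_simps)
    then show ?thesis unfolding Ceq by (intro convex_linear_image convex_Times hc convex_real_interval)
  qed
  have zC: "0 \<in> interior C"
  proof (rule interiorI)
    show "open (cyl u K \<inter> {x. \<bar>x \<bullet> u\<bar> < R'})" by (intro open_Int open_cyl open_Collect_less continuous_intros)
    show "0 \<in> cyl u K \<inter> {x. \<bar>x \<bullet> u\<bar> < R'}" using B(3) interior_subset_cyl by (auto simp: R'_def)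
    show "cyl u K \<inter> {x. \<bar>x \<bullet> u\<bar> < R'} \<subseteq> C"
      using interior_subset[of "{x. oproj u x \<in> hproj u K}"] unfolding cyl_eq_interior[OF u K] C_def by auto
  qed
  have "rim u K \<inter> {x. \<bar>x \<bullet> u\<bar> \<le> R} \<subseteq> frontier C"
  proof
    fix x assume x: "x \<in> rim u K \<inter> {x. \<bar>x \<bullet> u\<bar> \<le> R}"
    then have "x \<in> C" by (auto simp: C_def rim_def R'_def)
    moreover have "interior C \<subseteq> cyl u K" unfolding cyl_eq_interior[OF u K] by (rule interior_mono) (auto simp: C_def)
    then have "x \<notin> interior C" using x by (auto simp: rim_def)
    ultimately show "x \<in> frontier C" using closure_subset by (auto simp: frontier_def)
  qed
  then have "hausdorff_outer_measure (CARD('n) - 1) (rim u K \<inter> {x. \<bar>x \<bullet> u\<bar> \<le> R}) \<le> hausdorff_outer_measure (CARD('n) - 1) (frontier C)"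
    by (rule hausdorff_outer_measure_mono)
  also have "\<dots> < top" using hausdorff_frontier_finite[OF vC cC zC] by simp
  finally show ?thesis .
qed

text \<open>The degenerate part of the rim has infinitely many disjoint translates inside a set of finite
  measure.\<close>

lemma thin_rim_null:
  fixes u :: "real ^ 'n"
  assumes u: "norm u = 1" and K: "convex_body_o K"
  shows "hausdorff_outer_measure (CARD('n) - 1) (frontier K \<inter> rim u K - thick_rim u K) = 0"
proof -
  let ?\<mu> = "hausdorff_outer_measure (CARD('n) - 1) :: (real ^ 'n) set \<Rightarrow> ennreal"
  let ?H = "hausdorff_measure (CARD('n) - 1) :: (real ^ 'n) measure"
  note B = body_facts[OF K]
  define S where "S = frontier K \<inter> rim u K - thick_rim u K"
  have SB: "S \<in> sets borel" unfolding S_def by (intro sets.Diff sets.Int thick_rim_borel[OF u K] borel_closed frontier_closed)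
  obtain R where R: "\<And>y. y \<in> K \<Longrightarrow> norm y \<le> R" using compact_imp_bounded[OF B(1)] unfolding bounded_iff by blast
  \<comment> \<open>Shifts by the distinct amounts \<open>1 / (j + 1)\<close>, all at most 1, keep
    the translates within a bounded slab; they are disjoint because every line parallel to
    \<open>u\<close> meets \<open>S\<close> at most once.\<close>
  define T where "T j = (+) ((1 / real (Suc j)) *\<^sub>R u) ` S" for j :: nat
  have TB: "T j \<in> sets borel" for j
  proof -
    have e: "T j = (\<lambda>x. x + (- (1 / real (Suc j)) *\<^sub>R u)) -` S"
      unfolding T_def by (auto simp: image_iff) (metis add.commute diff_add_cancel)
    show ?thesis unfolding e by (rule borel_vimage_translation[OF SB])
  qed
  have T\<mu>: "?\<mu> (T j) = ?\<mu> S" for j unfolding T_def by (rule hausdorff_outer_measure_translation)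
  have SK: "S \<subseteq> K" using B(4) by (auto simp: S_def frontier_def)
  have uniq: "s = 0" if "x \<in> S" "x + s *\<^sub>R u \<in> K" for x s
  proof (rule ccontr)
    assume s: "s \<noteq> 0"
    have xK: "x \<in> K" using that(1) SK by blast
    have e: "oproj u x + (x \<bullet> u + w) *\<^sub>R u = x + w *\<^sub>R u" for w by (simp add: oproj_def algebra_simps)
    have 0: "oproj u x + (x \<bullet> u) *\<^sub>R u \<in> K" using xK e[of 0] by simp
    have 1: "oproj u x + (x \<bullet> u + s) *\<^sub>R u \<in> K" using that(2) e[of s] by simp
    have "\<exists>a b. a < b \<and> oproj u x + a *\<^sub>R u \<in> K \<and> oproj u x + b *\<^sub>R u \<in> K"
    proof (cases "s > 0")
      case True
      then show ?thesis using 0 1 by (intro exI[of _ "x \<bullet> u"] exI[of _ "x \<bullet> u + s"]) auto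
    next
      case False
      then show ?thesis using 0 1 s by (intro exI[of _ "x \<bullet> u + s"] exI[of _ "x \<bullet> u"]) auto
    qed
    then have "x \<in> thick_rim u K" using that(1) by (auto simp: thick_rim_def S_def)
    then show False using that(1) by (simp add: S_def)
  qed
  have disj: "T i \<inter> T j = {}" if ij: "i \<noteq> j" for i j
  proof (rule ccontr)
    assume "T i \<inter> T j \<noteq> {}"
    then obtain x y where xy: "x \<in> S" "y \<in> S" "(1 / real (Suc i)) *\<^sub>R u + x = (1 / real (Suc j)) *\<^sub>R u + y" unfolding T_def by blast
    then have "y = x + (1 / real (Suc i) - 1 / real (Suc j)) *\<^sub>R u" by (simp add: algebra_simps)
    then have "1 / real (Suc i) - 1 / real (Suc j) = 0" using uniq[OF xy(1)] xy(2) SK by blast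
    then show False using ij by simp
  qed
  let ?W = "rim u K \<inter> {x. \<bar>x \<bullet> u\<bar> \<le> R + 1}"
  have W: "?\<mu> ?W < top" by (rule rim_slab_finite[OF u K])
  have TW: "T j \<subseteq> ?W" for j
  proof
    fix y assume "y \<in> T j"
    then obtain x where x: "x \<in> S" "y = x + (1 / real (Suc j)) *\<^sub>R u" unfolding T_def by (auto simp: add.commute)
    have "\<bar>x \<bullet> u\<bar> \<le> R" using R[of x] SK x(1) Cauchy_Schwarz_ineq2[of x u] u by auto
    moreover have "0 \<le> 1 / real (Suc j)" "1 / real (Suc j) \<le> 1" by auto
    moreover have "y \<bullet> u = x \<bullet> u + 1 / real (Suc j)" using unit_inner_self[OF u] by (simp add: x(2) inner_add_left)
    ultimately have "\<bar>y \<bullet> u\<bar> \<le> R + 1" by linarith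
    then show "y \<in> ?W" using x rim_translate[OF u] by (simp add: S_def)
  qed
  have bound: "of_nat n * ?\<mu> S \<le> ?\<mu> ?W" for n
  proof -
    have "of_nat n * ?\<mu> S = (\<Sum>j<n. emeasure ?H (T j))"
      using TB T\<mu> by (simp add: emeasure_hausdorff_measure)
    also have "\<dots> = emeasure ?H (\<Union>j<n. T j)"
      using TB disj by (intro sum_emeasure) (auto simp: disjoint_family_on_def)
    also have "\<dots> = ?\<mu> (\<Union>j<n. T j)" using TB by (intro emeasure_hausdorff_measure) auto
    also have "\<dots> \<le> ?\<mu> ?W" by (rule hausdorff_outer_measure_mono) (use TW in blast)
    finally show ?thesis .
  qed
  have "?\<mu> S = 0"
  proof (rule ccontr)
    assume n0: "?\<mu> S \<noteq> 0"
    have "?\<mu> S < top" using bound[of 1] W by (simp add: le_less_trans)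
    then obtain a where a: "?\<mu> S = ennreal a" "a > 0" using n0 by (cases "?\<mu> S") (auto simp: zero_less_iff_neq_zero)
    obtain b where b: "?\<mu> ?W = ennreal b" "b \<ge> 0" using W by (cases "?\<mu> ?W") auto
    obtain n :: nat where "b / a < real n" using reals_Archimedean2 by blast
    then have "b < real n * a" using a(2) by (simp add: pos_divide_less_eq)
    moreover have "real n * a \<le> b" using bound[of n] a b unfolding a(1) b(1)
      by (simp add: ennreal_of_nat_eq_real_of_nat ennreal_mult[symmetric])
    ultimately show False by simp
  qed
  then show ?thesis by (simp add: S_def)
qed

text \<open>Where the fibres of \<open>K1\<close> and \<open>K2\<close> over a boundary point of the
  projection are both single points, so is the fibre of the combination. Hence a boundary point of
  the combination outside the cylinder lies in one of the two given thick rims or in the thin rim of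
  the combination, and all three are null.\<close>

lemma vertical_part_null:
  fixes u :: "real ^ 'n"
  assumes u: "norm u = 1" and K1: "convex_body_o K1" and K2: "convex_body_o K2"
    and h: "hproj u K1 = hproj u K2" and ab: "a \<ge> 0" "b \<ge> 0" "a + b > 0"
    and pos: "positive_gauss_curvature_ae K1" "positive_gauss_curvature_ae K2"
  defines "L \<equiv> graph_combination u a K1 b K2"
  shows "hausdorff_outer_measure (CARD('n) - 1) (frontier L - cyl u L) = 0"
proof -
  let ?\<mu> = "hausdorff_outer_measure (CARD('n) - 1) :: (real ^ 'n) set \<Rightarrow> ennreal"
  note LB = graph_combination_body[OF u K1 K2 h ab, folded L_def]
  have c1: "cyl u L = cyl u K1" by (rule cyl_cong[OF u LB(1) K1 LB(2)])
  have c2: "cyl u L = cyl u K2" using cyl_cong[OF u K1 K2 h] c1 by simp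
  have "frontier L - cyl u L \<subseteq> (frontier L \<inter> rim u L - thick_rim u L) \<union> (thick_rim u K1 \<union> thick_rim u K2)"
  proof
    fix X assume X: "X \<in> frontier L - cyl u L"
    have XL: "X \<in> L" using X body_facts(4)[OF LB(1)] by (auto simp: frontier_def)
    have hX: "oproj u X \<in> hproj u L" unfolding hproj_image using XL by (rule imageI)
    have rX: "X \<in> rim u L" using X hX by (simp add: rim_def)
    have h1: "oproj u X \<in> hproj u K1" and h2: "oproj u X \<in> hproj u K2" using hX LB(2) h by simp_all
    have r1: "X \<in> rim u K1" and r2: "X \<in> rim u K2" using X c1 c2 h1 h2 by (simp_all add: rim_def)
    show "X \<in> (frontier L \<inter> rim u L - thick_rim u L) \<union> (thick_rim u K1 \<union> thick_rim u K2)"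
    proof (rule ccontr)
      assume n: "\<not> ?thesis"
      then have n1: "X \<notin> thick_rim u K1" and n2: "X \<notin> thick_rim u K2" and t: "X \<in> thick_rim u L" using X rX by auto
      have flat: "overgraph u K (oproj u X) = - undergraph u K (oproj u X)"
        if K: "convex_body_o K" "oproj u X \<in> hproj u K" "X \<in> rim u K" "X \<notin> thick_rim u K" for K
      proof -
        note hf = hproj_fibre[OF u body_facts(1)[OF K(1)] K(2)]
        have lo: "oproj u X + (- undergraph u K (oproj u X)) *\<^sub>R u \<in> K" using hf(2) by simp
        have "\<not> - undergraph u K (oproj u X) < overgraph u K (oproj u X)"
        proof
          assume "- undergraph u K (oproj u X) < overgraph u K (oproj u X)"
          then have "\<exists>s t. s < t \<and> oproj u X + s *\<^sub>R u \<in> K \<and> oproj u X + t *\<^sub>R u \<in> K" using lo hf(1) by blast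
          then show False using K(3,4) by (simp add: thick_rim_def)
        qed
        moreover have "- undergraph u K (oproj u X) \<le> overgraph u K (oproj u X)" using hf(3)[OF hf(1)] by simp
        ultimately show ?thesis by simp
      qed
      note f1 = flat[OF K1 h1 r1 n1] and f2 = flat[OF K2 h2 r2 n2]
      obtain s t where st: "s < t" "oproj u X + s *\<^sub>R u \<in> L" "oproj u X + t *\<^sub>R u \<in> L" using t by (auto simp: thick_rim_def)
      have height: "w = a * overgraph u K1 (oproj u X) + b * overgraph u K2 (oproj u X)" if w: "oproj u X + w *\<^sub>R u \<in> L" for w
      proof -
        obtain z r where z: "oproj u X + w *\<^sub>R u = z + r *\<^sub>R u" "z \<in> hproj u K1"
          "- (a * undergraph u K1 z + b * undergraph u K2 z) \<le> r" "r \<le> a * overgraph u K1 z + b * overgraph u K2 z"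
          using w unfolding L_def graph_combination_def by blast
        have z0: "z \<bullet> u = 0" using z(2) by (simp add: hproj_iff[OF u])
        have "oproj u (oproj u X + w *\<^sub>R u) = oproj u (z + r *\<^sub>R u)" using z(1) by simp
        then have zX: "oproj u X = z" using u z0 by (simp add: oproj_id)
        then have "w *\<^sub>R u = r *\<^sub>R u" using z(1) by simp
        then have "w = r" using u by (metis norm_zero scaleR_cancel_right zero_neq_one)
        moreover have "- (a * undergraph u K1 z + b * undergraph u K2 z) = a * overgraph u K1 z + b * overgraph u K2 z"
          using f1 f2 unfolding zX by simp
        ultimately show ?thesis using z(3,4) zX by simp
      qed
      show False using height[OF st(2)] height[OF st(3)] st(1) by simp
    qed
  qed
  moreover have "?\<mu> ((frontier L \<inter> rim u L - thick_rim u L) \<union> (thick_rim u K1 \<union> thick_rim u K2)) = 0"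
  proof -
    have "?\<mu> (thick_rim u K1 \<union> thick_rim u K2) \<le> 0 + 0"
      using hausdorff_outer_measure_Un[of "CARD('n) - 1" "thick_rim u K1" "thick_rim u K2"]
      unfolding thick_rim_null[OF u K1 pos(1)] thick_rim_null[OF u K2 pos(2)] .
    moreover have "?\<mu> ((frontier L \<inter> rim u L - thick_rim u L) \<union> (thick_rim u K1 \<union> thick_rim u K2))
      \<le> 0 + ?\<mu> (thick_rim u K1 \<union> thick_rim u K2)"
      using hausdorff_outer_measure_Un[of "CARD('n) - 1" "frontier L \<inter> rim u L - thick_rim u L" "thick_rim u K1 \<union> thick_rim u K2"]
      unfolding thin_rim_null[OF u LB(1)] .
    ultimately show ?thesis by simp
  qed
  ultimately show ?thesis by (rule hausdorff_outer_measure_null_subset[rotated])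
qed

section \<open>The affine surface area as an integral over the projection\<close>

text \<open>A limit along a fixed sequence of difference quotients is Borel measurable without any
  information on where it exists, and it yields the gradient wherever a second-order expansion
  holds.\<close>

definition grad_sel :: "(real ^ 'n \<Rightarrow> real) \<Rightarrow> real ^ 'n \<Rightarrow> real ^ 'n" where
  "grad_sel F x = (\<chi> i. lim (\<lambda>k. real (Suc k) * (F (x + (1 / real (Suc k)) *\<^sub>R axis i 1) - F x)))"

text \<open>Minus the second symmetric difference quotient, in accordance with the sign of
  \<open>B\<close> in \<open>second_order\<close>.\<close>

definition hess_form :: "(real ^ 'n \<Rightarrow> real) \<Rightarrow> real ^ 'n \<Rightarrow> real ^ 'n \<Rightarrow> real" where
  "hess_form F h x = lim (\<lambda>k. - (real (Suc k))\<^sup>2 *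
     (F (x + (1 / real (Suc k)) *\<^sub>R h) + F (x + (- (1 / real (Suc k))) *\<^sub>R h) - 2 * F x))"

text \<open>Polarisation recovers the matrix from its quadratic form.\<close>

definition hess_sel :: "(real ^ 'n \<Rightarrow> real) \<Rightarrow> real ^ 'n \<Rightarrow> real ^ 'n ^ 'n" where
  "hess_sel F x = (\<chi> i j. (hess_form F (axis i 1 + axis j 1) x - hess_form F (axis i 1) x - hess_form F (axis j 1) x) / 2)"

lemma small_step:
  fixes h :: "'a::real_normed_vector"
  assumes "\<delta> > 0"
  shows "\<exists>N. \<forall>k\<ge>N. norm ((1 / real (Suc k)) *\<^sub>R h) < \<delta>"
proof -
  obtain N :: nat where N: "norm h / \<delta> < real N" using reals_Archimedean2 by blast
  have "norm ((1 / real (Suc k)) *\<^sub>R h) < \<delta>" if "k \<ge> N" for k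
  proof -
    have "norm h / \<delta> < real (Suc k)" using N that by linarith
    then have "norm h < \<delta> * real (Suc k)" using assms by (simp add: pos_divide_less_eq mult.commute)
    then have "norm h / real (Suc k) < \<delta>" by (subst pos_divide_less_eq) auto
    then show ?thesis by simp
  qed
  then show ?thesis by blast
qed

lemma second_order_grad_limit:
  assumes so: "second_order F x p B"
  shows "(\<lambda>k. real (Suc k) * (F (x + (1 / real (Suc k)) *\<^sub>R h) - F x)) \<longlonglongrightarrow> p \<bullet> h"
proof (rule LIMSEQ_I)
  fix r :: real assume r: "r > 0"
  define \<epsilon> where "\<epsilon> = r / (norm h + 1)"
  have n: "norm h + 1 > 0" by (simp add: add_nonneg_pos)
  have \<epsilon>: "\<epsilon> > 0" using r n by (simp add: \<epsilon>_def)
  have \<epsilon>h: "\<epsilon> * norm h < r"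
  proof -
    have "\<epsilon> * norm h < \<epsilon> * (norm h + 1)" using \<epsilon> by simp
    also have "\<dots> = r" using n by (simp add: \<epsilon>_def)
    finally show ?thesis .
  qed
  obtain \<delta> where \<delta>: "\<delta> > 0" "\<And>h. norm h < \<delta> \<Longrightarrow> \<bar>F (x + h) - F x - p \<bullet> h\<bar> \<le> \<epsilon> * norm h"
    by (rule second_order_differentiable[OF so \<epsilon>]) blast
  obtain N where N: "\<forall>k\<ge>N. norm ((1 / real (Suc k)) *\<^sub>R h) < \<delta>" using small_step[OF \<delta>(1)] by blast
  show "\<exists>N. \<forall>k\<ge>N. norm (real (Suc k) * (F (x + (1 / real (Suc k)) *\<^sub>R h) - F x) - p \<bullet> h) < r"
  proof (intro exI[of _ N] allI impI)
    fix k assume "k \<ge> N"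
    define c where "c = real (Suc k)"
    have c: "c > 0" by (simp add: c_def)
    have "norm ((1 / c) *\<^sub>R h) < \<delta>" using N \<open>k \<ge> N\<close> unfolding c_def by blast
    then have "\<bar>F (x + (1 / c) *\<^sub>R h) - F x - p \<bullet> ((1 / c) *\<^sub>R h)\<bar> \<le> \<epsilon> * norm ((1 / c) *\<^sub>R h)" by (rule \<delta>(2))
    then have "c * \<bar>F (x + (1 / c) *\<^sub>R h) - F x - p \<bullet> ((1 / c) *\<^sub>R h)\<bar> \<le> c * (\<epsilon> * norm ((1 / c) *\<^sub>R h))"
      using c by (intro mult_left_mono) auto
    also have "\<dots> = \<epsilon> * norm h" using c by simp
    also have "c * \<bar>F (x + (1 / c) *\<^sub>R h) - F x - p \<bullet> ((1 / c) *\<^sub>R h)\<bar> = \<bar>c * (F (x + (1 / c) *\<^sub>R h) - F x - p \<bullet> ((1 / c) *\<^sub>R h))\<bar>"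
      using c by (simp add: abs_mult)
    also have "c * (F (x + (1 / c) *\<^sub>R h) - F x - p \<bullet> ((1 / c) *\<^sub>R h)) = c * (F (x + (1 / c) *\<^sub>R h) - F x) - p \<bullet> h"
      using c by (simp add: right_diff_distrib)
    finally show "norm (real (Suc k) * (F (x + (1 / real (Suc k)) *\<^sub>R h) - F x) - p \<bullet> h) < r"
      using \<epsilon>h unfolding real_norm_def c_def by linarith
  qed
qed

lemma second_order_hess_limit:
  assumes so: "second_order F x p B"
  shows "(\<lambda>k. - (real (Suc k))\<^sup>2 * (F (x + (1 / real (Suc k)) *\<^sub>R h) + F (x + (- (1 / real (Suc k))) *\<^sub>R h) - 2 * F x))
    \<longlonglongrightarrow> h \<bullet> (B *v h)"
proof (rule LIMSEQ_I)
  fix r :: real assume r: "r > 0"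
  define \<epsilon> where "\<epsilon> = r / (2 * ((norm h)\<^sup>2 + 1))"
  have n: "(norm h)\<^sup>2 + 1 > 0" by (simp add: add_nonneg_pos)
  have \<epsilon>: "\<epsilon> > 0" using r n by (simp add: \<epsilon>_def)
  have \<epsilon>h: "2 * (\<epsilon> * (norm h)\<^sup>2) < r"
  proof -
    have "2 * (\<epsilon> * (norm h)\<^sup>2) < 2 * (\<epsilon> * ((norm h)\<^sup>2 + 1))" using \<epsilon> by simp
    also have "\<dots> = \<epsilon> * (2 * ((norm h)\<^sup>2 + 1))" by simp
    also have "\<dots> = r" unfolding \<epsilon>_def using n by (intro nonzero_eq_divide_eq[THEN iffD1]) auto
    finally show ?thesis .
  qed
  obtain \<delta> where \<delta>: "\<delta> > 0" "\<And>h. norm h < \<delta> \<Longrightarrow> \<bar>F (x + h) - F x - p \<bullet> h + (h \<bullet> (B *v h)) / 2\<bar> \<le> \<epsilon> * (norm h)\<^sup>2"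
    by (rule second_orderD[OF so \<epsilon>]) blast
  obtain N where N: "\<forall>k\<ge>N. norm ((1 / real (Suc k)) *\<^sub>R h) < \<delta>" using small_step[OF \<delta>(1)] by blast
  show "\<exists>N. \<forall>k\<ge>N. norm (- (real (Suc k))\<^sup>2 * (F (x + (1 / real (Suc k)) *\<^sub>R h) + F (x + (- (1 / real (Suc k))) *\<^sub>R h) - 2 * F x) - h \<bullet> (B *v h)) < r"
  proof (intro exI[of _ N] allI impI)
    fix k assume "k \<ge> N"
    define c where "c = real (Suc k)"
    have c: "c > 0" by (simp add: c_def)
    have nd: "norm ((1 / c) *\<^sub>R h) < \<delta>" using N \<open>k \<ge> N\<close> unfolding c_def by blast
    then have nd': "norm ((- (1 / c)) *\<^sub>R h) < \<delta>" by simp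
    define q where "q = h \<bullet> (B *v h)"
    have e1: "\<bar>F (x + (1 / c) *\<^sub>R h) - F x - (1 / c) * (p \<bullet> h) + ((1 / c)\<^sup>2 * q) / 2\<bar> \<le> \<epsilon> * ((1 / c)\<^sup>2 * (norm h)\<^sup>2)"
      using \<delta>(2)[OF nd] unfolding quadratic_form_scale norm_scale_sq q_def inner_scaleR_right .
    have e2: "\<bar>F (x + (- (1 / c)) *\<^sub>R h) - F x - (- (1 / c)) * (p \<bullet> h) + ((- (1 / c))\<^sup>2 * q) / 2\<bar> \<le> \<epsilon> * ((- (1 / c))\<^sup>2 * (norm h)\<^sup>2)"
      using \<delta>(2)[OF nd'] unfolding quadratic_form_scale norm_scale_sq q_def inner_scaleR_right .
    define Z where "Z = F (x + (1 / c) *\<^sub>R h) + F (x + (- (1 / c)) *\<^sub>R h) - 2 * F x"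
    have s: "(- (1 / c))\<^sup>2 = (1 / c)\<^sup>2" by simp
    have "\<bar>Z + (1 / c)\<^sup>2 * q\<bar> \<le> 2 * (\<epsilon> * ((1 / c)\<^sup>2 * (norm h)\<^sup>2))"
      using e1 e2 unfolding Z_def s mult_minus_left by linarith
    then have "c\<^sup>2 * \<bar>Z + (1 / c)\<^sup>2 * q\<bar> \<le> c\<^sup>2 * (2 * (\<epsilon> * ((1 / c)\<^sup>2 * (norm h)\<^sup>2)))" by (rule mult_left_mono) simp
    also have "\<dots> = 2 * (\<epsilon> * (norm h)\<^sup>2)" using c by (simp add: power_divide)
    also have "c\<^sup>2 * \<bar>Z + (1 / c)\<^sup>2 * q\<bar> = \<bar>- c\<^sup>2 * Z - q\<bar>"
    proof -
      have "- c\<^sup>2 * Z - q = - (c\<^sup>2 * (Z + (1 / c)\<^sup>2 * q))" using c by (simp add: distrib_left power_divide)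
      then show ?thesis by (simp only: abs_minus_cancel abs_mult abs_power2)
    qed
    finally have "\<bar>- c\<^sup>2 * Z - q\<bar> < r" using \<epsilon>h by linarith
    then show "norm (- (real (Suc k))\<^sup>2 * (F (x + (1 / real (Suc k)) *\<^sub>R h) + F (x + (- (1 / real (Suc k))) *\<^sub>R h) - 2 * F x) - h \<bullet> (B *v h)) < r"
      unfolding real_norm_def Z_def q_def c_def .
  qed
qed

lemma grad_sel_eq:
  assumes so: "second_order F x p B"
  shows "grad_sel F x = p"
proof -
  have "lim (\<lambda>k. real (Suc k) * (F (x + (1 / real (Suc k)) *\<^sub>R axis i 1) - F x)) = p $ i" for i
    using limI[OF second_order_grad_limit[OF so, of "axis i 1"]] by (simp add: inner_axis)
  then show ?thesis by (simp add: grad_sel_def vec_eq_iff)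
qed

lemma hess_sel_eq:
  assumes so: "second_order F x p B"
  shows "hess_sel F x = B"
proof -
  have sym: "transpose B = B" using so by (simp add: second_order_def)
  have hf: "hess_form F h x = h \<bullet> (B *v h)" for h
    unfolding hess_form_def by (rule limI[OF second_order_hess_limit[OF so]])
  have "(hess_form F (axis i 1 + axis j 1) x - hess_form F (axis i 1) x - hess_form F (axis j 1) x) / 2 = B $ i $ j" for i j
  proof -
    have "hess_form F (axis i 1 + 1 *\<^sub>R axis j 1) x = axis i 1 \<bullet> (B *v axis i 1) + 2 * 1 * (axis j 1 \<bullet> (B *v axis i 1)) + 1\<^sup>2 * (axis j 1 \<bullet> (B *v axis j 1))"
      unfolding hf by (rule quadratic_form_add[OF sym])
    moreover have "axis j 1 \<bullet> (B *v axis i 1) = B $ i $ j"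
      unfolding symmetric_matrix_inner[OF sym, of "axis j 1" "axis i 1"]
      by (simp add: inner_axis' matrix_vector_mult_basis column_def)
    ultimately show ?thesis by (simp add: hf)
  qed
  then show ?thesis by (simp add: hess_sel_def vec_eq_iff)
qed

lemma grad_sel_borel:
  fixes F :: "real ^ 'n \<Rightarrow> real"
  assumes [measurable]: "F \<in> borel_measurable borel"
  shows "grad_sel F \<in> borel_measurable borel"
proof -
  have m: "(\<lambda>x. lim (\<lambda>k. real (Suc k) * (F (x + (1 / real (Suc k)) *\<^sub>R axis i 1) - F x))) \<in> borel_measurable borel" for i
    by measurable
  show ?thesis
    unfolding borel_measurable_euclidean_space[of "grad_sel F" borel]
  proof
    fix b :: "real ^ 'n" assume "b \<in> Basis"
    then obtain i where "b = axis i 1" by (auto simp: Basis_vec_def)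
    then have "(\<lambda>x. grad_sel F x \<bullet> b) = (\<lambda>x. lim (\<lambda>k. real (Suc k) * (F (x + (1 / real (Suc k)) *\<^sub>R axis i 1) - F x)))"
      by (simp add: grad_sel_def inner_axis)
    then show "(\<lambda>x. grad_sel F x \<bullet> b) \<in> borel_measurable borel" using m by (simp only:)
  qed
qed

lemma hess_det_borel:
  fixes F :: "real ^ 'n \<Rightarrow> real"
  assumes [measurable]: "F \<in> borel_measurable borel"
  shows "(\<lambda>x. det (hess_sel F x + C)) \<in> borel_measurable borel"
proof -
  have hf[measurable]: "hess_form F h \<in> borel_measurable borel" for h
    unfolding hess_form_def[abs_def] by measurable
  have [measurable]: "(\<lambda>x. (hess_sel F x + C) $ i $ j) \<in> borel_measurable borel" for i j
    unfolding hess_sel_def by simp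
  show ?thesis unfolding det_def by measurable
qed

text \<open>Extension by 0 makes the function Borel on the whole space.\<close>

definition top0 :: "'a::euclidean_space \<Rightarrow> 'a set \<Rightarrow> 'a \<Rightarrow> real" where
  "top0 u K x = (if x \<in> cyl u K then top_fn u K x else 0)"

text \<open>Where the graph has gradient \<open>p\<close>, this is the inner product of the boundary
  point \<open>top_pt u K x\<close> with the normal \<open>u - p\<close> before
  normalisation.\<close>

definition support_sel :: "real ^ 'n \<Rightarrow> (real ^ 'n) set \<Rightarrow> real ^ 'n \<Rightarrow> real" where
  "support_sel u K x = top0 u K x - grad_sel (top0 u K) x \<bullet> x"

definition ratio_sel :: "real ^ 'n \<Rightarrow> (real ^ 'n) set \<Rightarrow> real ^ 'n \<Rightarrow> real" where
  "ratio_sel u K x = det (hess_sel (top0 u K) x + outer u) / support_sel u K x ^ (CARD('n) + 1)"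

definition as_density :: "(real \<Rightarrow> real) \<Rightarrow> real ^ 'n \<Rightarrow> (real ^ 'n) set \<Rightarrow> real ^ 'n \<Rightarrow> ennreal" where
  "as_density \<psi> u K x = psi_ext \<psi> (ratio_sel u K x) * ennreal (support_sel u K x)"

lemma top0_borel:
  assumes "norm u = 1" "convex_body_o K"
  shows "top0 u K \<in> borel_measurable borel"
  unfolding top0_def[abs_def]
  by (intro borel_measurable_continuous_on_if top_fn_continuous assms continuous_on_const cyl_borel)

text \<open>A convex function on the open half-line is continuous, and off the half-line the
  extension is constant.\<close>

lemma psi_ext_borel:
  assumes "\<psi> \<in> Conv_class"
  shows "psi_ext \<psi> \<in> borel_measurable borel"
proof (cases "\<psi> constant_on {0<..}")
  case True
  then have "psi_ext \<psi> = (\<lambda>t. ennreal (\<psi> 1))" by (auto simp: psi_ext_def constant_on_def fun_eq_iff)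
  then show ?thesis by simp
next
  case False
  then have "convex_on {0<..} \<psi>" using assms by (auto simp: Conv_class_def)
  then have "continuous_on {0<..} \<psi>" by (intro convex_on_continuous) auto
  then have [measurable]: "(\<lambda>t. if t \<in> {0<..} then \<psi> t else 0) \<in> borel_measurable borel"
    by (intro borel_measurable_continuous_on_if continuous_on_const) auto
  have "psi_ext \<psi> = (\<lambda>t. if 0 < t then ennreal (if t \<in> {0<..} then \<psi> t else 0) else \<infinity>)"
    using False by (auto simp: psi_ext_def fun_eq_iff)
  moreover have "(\<lambda>t. if 0 < t then ennreal (if t \<in> {0<..} then \<psi> t else 0) else \<infinity>) \<in> borel_measurable borel"
    by measurable
  ultimately show ?thesis by (simp only:)
qed

lemma sel_borel:
  fixes u :: "real ^ 'n"
  assumes u: "norm u = 1" and K: "convex_body_o K"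
  shows "support_sel u K \<in> borel_measurable borel" "ratio_sel u K \<in> borel_measurable borel"
    "grad_sel (top0 u K) \<in> borel_measurable borel"
proof -
  note t[measurable] = top0_borel[OF u K]
  note g[measurable] = grad_sel_borel[OF t]
  note h[measurable] = hess_det_borel[OF t, of "outer u"]
  show s[measurable]: "support_sel u K \<in> borel_measurable borel" unfolding support_sel_def[abs_def] by measurable
  show "ratio_sel u K \<in> borel_measurable borel" unfolding ratio_sel_def[abs_def] by measurable
  show "grad_sel (top0 u K) \<in> borel_measurable borel" by (rule g)
qed

lemma second_order_local:
  fixes F G :: "real ^ 'n \<Rightarrow> real"
  assumes "second_order F x p B" "e > 0" "\<And>y. y \<in> ball x e \<Longrightarrow> G y = F y"
  shows "second_order G x p B"
  using second_order_combination[OF assms(1,1,2), of G 1 0] assms(3) by simp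

lemma sel_eq:
  fixes u :: "real ^ 'n"
  assumes x: "x \<in> cyl u K" and so: "second_order (top_fn u K) x p B"
  shows "grad_sel (top0 u K) x = p" "support_sel u K x = top_fn u K x - p \<bullet> x"
    "ratio_sel u K x = det (B + outer u) / (top_fn u K x - p \<bullet> x) ^ (CARD('n) + 1)"
proof -
  obtain e where e: "e > 0" "ball x e \<subseteq> cyl u K" using x open_cyl openE by blast
  have so0: "second_order (top0 u K) x p B"
    by (rule second_order_local[OF so e(1)]) (use e(2) in \<open>auto simp: top0_def\<close>)
  show g: "grad_sel (top0 u K) x = p" by (rule grad_sel_eq[OF so0])
  show s: "support_sel u K x = top_fn u K x - p \<bullet> x" using x by (simp add: support_sel_def g top0_def)
  show "ratio_sel u K x = det (B + outer u) / (top_fn u K x - p \<bullet> x) ^ (CARD('n) + 1)"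
    unfolding ratio_sel_def s hess_sel_eq[OF so0] ..
qed

lemma second_order_translate:
  assumes u: "norm u = 1" and so: "second_order (top_fn u K) x p B"
  shows "second_order (top_fn u K) (x + t *\<^sub>R u) p B"
proof -
  have "top_fn u K (x + t *\<^sub>R u + h) = top_fn u K (x + h)" for h
    using top_fn_cyl(1)[OF u, of K "x + h" t] by (simp only: add_ac)
  then show ?thesis using so u by (simp add: second_order_def)
qed

lemma top_pt_as_translate: "top_pt u K x = x + (top_fn u K x - x \<bullet> u) *\<^sub>R u"
  by (simp add: top_pt_def oproj_def algebra_simps)

text \<open>The body contains \<open>r *\<^sub>R n\<close> for some \<open>r > 0\<close>, and the
  support inequality applies to this point.\<close>

lemma support_pos:
  assumes K: "convex_body_o K" and n: "is_outer_unit_normal K X n"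
  shows "X \<bullet> n > 0"
proof -
  obtain r where r: "r > 0" "cball 0 r \<subseteq> K" using body_facts(3)[OF K] unfolding mem_interior_cball by blast
  have nn: "norm n = 1" using n by (simp add: is_outer_unit_normal_def)
  have "r *\<^sub>R n \<in> cball 0 r" using r(1) nn by simp
  then have "r *\<^sub>R n \<in> K" using r(2) by blast
  then have "(r *\<^sub>R n - X) \<bullet> n \<le> 0" using n by (simp add: is_outer_unit_normal_def)
  then show ?thesis using r(1) unit_inner_self[OF nn] by (simp add: inner_diff_left)
qed

text \<open>Normalising the normal divides \<open>s\<close> by the area factor, and the curvature is
  the determinant divided by its power \<open>n + 1\<close>; in the argument of
  \<open>\<psi>\<close> these powers cancel.\<close>

lemma boundary_data:
  fixes u :: "real ^ 'n"
  assumes u: "norm u = 1" and K: "convex_body_o K" and x: "x \<in> cyl u K" and so: "second_order (top_fn u K) x p B"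
  defines "X \<equiv> top_pt u K x" and "s \<equiv> top_fn u K x - p \<bullet> x"
  shows "second_order (top_fn u K) X p B" "s > 0" "top_fn u K X - p \<bullet> X = s"
    "X \<bullet> outer_normal K X = s / area_factor p"
    "gauss_curvature K X / (X \<bullet> outer_normal K X) ^ (CARD('n) + 1) = det (B + outer u) / s ^ (CARD('n) + 1)"
proof -
  have X: "X \<in> cyl u K" "top_pt u K X = X" using u x by (simp_all add: X_def)
  have p: "p \<bullet> u = 0" by (rule second_order_cyl(1)[OF u K x so])
  show soX: "second_order (top_fn u K) X p B" unfolding X_def top_pt_as_translate by (rule second_order_translate[OF u so])
  note g = second_order_imp_gauss_curvature[OF u K X soX]
  have pX: "p \<bullet> X = p \<bullet> x" using p by (simp add: X_def top_pt_as_translate inner_add_right)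
  have FX: "top_fn u K X = top_fn u K x" using u by (simp add: X_def)
  show sX: "top_fn u K X - p \<bullet> X = s" by (simp add: FX pX s_def)
  have J: "area_factor p > 0" by (rule area_factor_pos)
  have Xu: "X \<bullet> u = top_fn u K x" using u by (simp add: X_def)
  show Xn: "X \<bullet> outer_normal K X = s / area_factor p"
    unfolding g(1) graph_normal_def area_factor_def
    by (simp add: inner_diff_right Xu s_def inner_commute[of X p] pX)
  have "is_outer_unit_normal K X (outer_normal K X)"
    unfolding g(1) using differentiable_imp_smooth[OF u p K X soX] by blast
  then have "s / area_factor p > 0" using support_pos[OF K] Xn by metis
  then show "s > 0" using J by (simp add: zero_less_divide_iff)
  show "gauss_curvature K X / (X \<bullet> outer_normal K X) ^ (CARD('n) + 1) = det (B + outer u) / s ^ (CARD('n) + 1)"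
    unfolding g(2) Xn power_divide area_factor_def[symmetric] using J by simp
qed

definition as_integrand :: "(real \<Rightarrow> real) \<Rightarrow> (real ^ 'n) set \<Rightarrow> real ^ 'n \<Rightarrow> ennreal" where
  "as_integrand \<psi> K X = psi_ext \<psi> (gauss_curvature K X / (X \<bullet> outer_normal K X) ^ (CARD('n) + 1))
     * ennreal (X \<bullet> outer_normal K X)"

lemma null_set_AE:
  fixes N :: "(real ^ 'n) set"
  assumes "N \<in> sets borel" "hausdorff_outer_measure d N = 0"
  shows "AE X in hausdorff_measure d. X \<notin> N"
  using assms by (intro AE_not_in) (auto simp: null_sets_def emeasure_hausdorff_measure)

text \<open>The integrand of \<open>as_psi\<close> is built from description operators. On the graph
  it agrees almost everywhere with a function \<open>G\<close> made of the Borel selections, to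
  which the area formula can be applied.\<close>

lemma as_integrand_upper:
  fixes u :: "real ^ 'n"
  assumes u: "norm u = 1" and K: "convex_body_o K" and \<psi>: "\<psi> \<in> Conv_class"
    and N: "N \<in> sets borel" "hausdorff_outer_measure (CARD('n) - 1) N = 0"
    and so: "\<And>x. x \<in> base u K - N \<Longrightarrow> \<exists>p B. second_order (top_fn u K) x p B"
  obtains G where "G \<in> borel_measurable borel"
    "AE X in hausdorff_measure (CARD('n) - 1). X \<in> top_pt u K ` base u K \<longrightarrow> as_integrand \<psi> K X = G X"
    "(\<integral>\<^sup>+ X. G X * indicator (top_pt u K ` base u K) X \<partial>hausdorff_measure (CARD('n) - 1))
      = (\<integral>\<^sup>+ x. as_density \<psi> u K x * indicator (base u K) x \<partial>hausdorff_measure (CARD('n) - 1))"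
proof
  let ?H = "hausdorff_measure (CARD('n) - 1) :: (real ^ 'n) measure"
  let ?g = "grad_sel (top0 u K)"
  note [measurable] = sel_borel[OF u K] psi_ext_borel[OF \<psi>]
  \<comment> \<open>The selections are evaluated at the boundary point itself; since
    \<open>top_fn\<close> is constant along \<open>u\<close>, they have the same values there as at
    its projection.\<close>
  define G where "G = (\<lambda>X. psi_ext \<psi> (ratio_sel u K X) * ennreal (support_sel u K X / area_factor (?g X)))"
  show Gm: "G \<in> borel_measurable borel" unfolding G_def area_factor_def by measurable
  have point: "as_integrand \<psi> K (top_pt u K x) = G (top_pt u K x)"
      "G (top_pt u K x) * ennreal (area_factor (?g x)) = as_density \<psi> u K x"
      "has_grad (top_fn u K) x (?g x) \<and> ?g x \<bullet> u = 0" if x: "x \<in> base u K - N" for x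
  proof -
    obtain p B where pB: "second_order (top_fn u K) x p B" using so[OF x] by blast
    have xc: "x \<in> cyl u K" using x by (simp add: base_def)
    then have Xc: "top_pt u K x \<in> cyl u K" using u by simp
    note bd = boundary_data[OF u K xc pB]
    note se = sel_eq[OF xc pB] and sX = sel_eq[OF Xc bd(1)]
    have J: "area_factor p > 0" by (rule area_factor_pos)
    show 1: "as_integrand \<psi> K (top_pt u K x) = G (top_pt u K x)"
      unfolding as_integrand_def bd(5) unfolding bd(4) G_def sX bd(3) ..
    have e: "ennreal ((top_fn u K x - p \<bullet> x) / area_factor p) * ennreal (area_factor p) = ennreal (top_fn u K x - p \<bullet> x)"
      using J bd(2) by (subst ennreal_mult[symmetric]) auto
    show "G (top_pt u K x) * ennreal (area_factor (?g x)) = as_density \<psi> u K x"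
      unfolding G_def sX bd(3) as_density_def se mult.assoc e ..
    show "has_grad (top_fn u K) x (?g x) \<and> ?g x \<bullet> u = 0"
      unfolding se using second_order_has_grad[OF pB] second_order_cyl(1)[OF u K xc pB] by blast
  qed
  show "AE X in ?H. X \<in> top_pt u K ` base u K \<longrightarrow> as_integrand \<psi> K X = G X"
  proof -
    let ?Z = "top_pt u K ` (base u K \<inter> N)"
    have "?Z \<in> sets borel" by (rule top_image_borel[OF u K]) (use base_borel N(1) in auto)
    moreover have "hausdorff_outer_measure (CARD('n) - 1) ?Z = 0"
    proof (rule top_null_image[OF u K])
      show "base u K \<inter> N \<subseteq> cyl u K" by (auto simp: base_def)
      show "hausdorff_outer_measure (CARD('n) - 1) (base u K \<inter> N) = 0" by (rule hausdorff_outer_measure_null_subset[OF N(2)]) blast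
    qed
    ultimately have "AE X in ?H. X \<notin> ?Z" by (rule null_set_AE)
    then show ?thesis
    proof (rule eventually_mono, intro impI)
      fix X assume "X \<notin> ?Z" "X \<in> top_pt u K ` base u K"
      then obtain x where "x \<in> base u K - N" "X = top_pt u K x" by blast
      then show "as_integrand \<psi> K X = G X" using point(1) by simp
    qed
  qed
  have "(\<integral>\<^sup>+ X. G X * indicator (top_pt u K ` base u K) X \<partial>?H)
    = (\<integral>\<^sup>+ x. G (top_pt u K x) * ennreal (area_factor (?g x)) * indicator (base u K) x \<partial>?H)"
    by (rule area_formula_integral[OF u K sel_borel(3)[OF u K] N point(3) Gm])
  also have "\<dots> = (\<integral>\<^sup>+ x. as_density \<psi> u K x * indicator (base u K) x \<partial>?H)"
  proof (rule nn_integral_cong_AE)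
    show "AE x in ?H. G (top_pt u K x) * ennreal (area_factor (?g x)) * indicator (base u K) x = as_density \<psi> u K x * indicator (base u K) x"
      using null_set_AE[OF N]
    proof (rule eventually_mono)
      fix x assume "x \<notin> N"
      then show "G (top_pt u K x) * ennreal (area_factor (?g x)) * indicator (base u K) x = as_density \<psi> u K x * indicator (base u K) x"
        using point(2)[of x] by (cases "x \<in> base u K") simp_all
    qed
  qed
  finally show "(\<integral>\<^sup>+ X. G X * indicator (top_pt u K ` base u K) X \<partial>?H) = (\<integral>\<^sup>+ x. as_density \<psi> u K x * indicator (base u K) x \<partial>?H)" .
qed

text \<open>Up to the null vertical part, the boundary is the union of the upper and the lower
  graph. They are disjoint since every fibre over the open cylinder has positive length.\<close>

lemma as_psi_eq:
  fixes u :: "real ^ 'n"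
  assumes u: "norm u = 1" and K: "convex_body_o K" and \<psi>: "\<psi> \<in> Conv_class"
    and V: "hausdorff_outer_measure (CARD('n) - 1) (frontier K - cyl u K) = 0"
    and N: "N \<in> sets borel" "hausdorff_outer_measure (CARD('n) - 1) N = 0"
    and so: "\<And>x. x \<in> base u K - N \<Longrightarrow> \<exists>p B. second_order (top_fn u K) x p B"
    and so': "\<And>x. x \<in> base u K - N \<Longrightarrow> \<exists>p B. second_order (top_fn (- u) K) x p B"
  shows "as_psi \<psi> K = (\<integral>\<^sup>+ x. as_density \<psi> u K x * indicator (base u K) x \<partial>hausdorff_measure (CARD('n) - 1))
    + (\<integral>\<^sup>+ x. as_density \<psi> (- u) K x * indicator (base u K) x \<partial>hausdorff_measure (CARD('n) - 1))"
proof -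
  let ?H = "hausdorff_measure (CARD('n) - 1) :: (real ^ 'n) measure"
  have u': "norm (- u) = 1" using u by simp
  have b': "base (- u) K = base u K" by (simp add: base_def)
  let ?T = "top_pt u K ` base u K" and ?T' = "top_pt (- u) K ` base u K"
  obtain G where G: "G \<in> borel_measurable borel" "AE X in ?H. X \<in> ?T \<longrightarrow> as_integrand \<psi> K X = G X"
    "(\<integral>\<^sup>+ X. G X * indicator ?T X \<partial>?H) = (\<integral>\<^sup>+ x. as_density \<psi> u K x * indicator (base u K) x \<partial>?H)"
    by (rule as_integrand_upper[OF u K \<psi> N so])
  obtain G' where G': "G' \<in> borel_measurable borel" "AE X in ?H. X \<in> ?T' \<longrightarrow> as_integrand \<psi> K X = G' X"
    "(\<integral>\<^sup>+ X. G' X * indicator ?T' X \<partial>?H) = (\<integral>\<^sup>+ x. as_density \<psi> (- u) K x * indicator (base u K) x \<partial>?H)"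
    by (rule as_integrand_upper[OF u' K \<psi> N, unfolded b', OF so'])
  have T: "?T \<in> sets borel" by (rule top_image_borel[OF u K subset_refl base_borel])
  have T': "?T' \<in> sets borel" using top_image_borel[OF u' K subset_refl base_borel] unfolding b' .
  have Tiff: "X \<in> ?T \<longleftrightarrow> X \<in> cyl u K \<and> X \<bullet> u = top_fn u K X" for X
    unfolding top_image_eq[OF u subset_refl] using oproj_base[OF u] by auto
  have T'iff: "X \<in> ?T' \<longleftrightarrow> X \<in> cyl u K \<and> X \<bullet> (- u) = top_fn (- u) K X" for X
    using top_image_eq[OF u' subset_refl, of K] oproj_base[OF u', of X K] unfolding b' by auto
  have disj: "X \<notin> ?T'" if "X \<in> ?T" for X
    using that top_fn_sum_pos[OF u K, of X] unfolding Tiff T'iff by auto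
  have fr: "X \<in> frontier K" if "X \<in> ?T \<or> X \<in> ?T'" for X
    using that top_pt_frontier[OF u K] top_pt_frontier[OF u' K] by (auto simp: base_def)
  have frT: "X \<in> ?T \<or> X \<in> ?T'" if "X \<in> frontier K" "X \<in> cyl u K" for X
    using frontier_cyl_cases[OF u K that] that(2) top_pt_eq_iff[OF u, of K X] top_pt_eq_iff[OF u', of K X]
    unfolding Tiff T'iff by blast
  have "frontier K - cyl u K \<in> sets borel" by (intro sets.Diff borel_closed frontier_closed cyl_borel)
  then have AV: "AE X in ?H. X \<notin> frontier K - cyl u K" by (rule null_set_AE[OF _ V])
  have frB: "frontier K \<inter> space ?H \<in> sets ?H" by (simp add: borel_closed)
  have "as_psi \<psi> K = (\<integral>\<^sup>+ X. as_integrand \<psi> K X \<partial>restrict_space ?H (frontier K))"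
    unfolding as_psi_def as_integrand_def surface_measure_def ..
  also have "\<dots> = (\<integral>\<^sup>+ X. as_integrand \<psi> K X * indicator (frontier K) X \<partial>?H)"
    by (rule nn_integral_restrict_space[OF frB])
  also have "\<dots> = (\<integral>\<^sup>+ X. G X * indicator ?T X + G' X * indicator ?T' X \<partial>?H)"
  proof (rule nn_integral_cong_AE, use G(2) G'(2) AV in eventually_elim)
    fix X assume X: "X \<in> ?T \<longrightarrow> as_integrand \<psi> K X = G X" "X \<in> ?T' \<longrightarrow> as_integrand \<psi> K X = G' X" "X \<notin> frontier K - cyl u K"
    show "as_integrand \<psi> K X * indicator (frontier K) X = G X * indicator ?T X + G' X * indicator ?T' X"
    proof (cases "X \<in> ?T")
      case True
      then have "X \<notin> ?T'" "X \<in> frontier K" using disj fr by blast+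
      then show ?thesis using True X(1) by simp
    next
      case F: False
      show ?thesis
      proof (cases "X \<in> ?T'")
        case True
        then have "X \<in> frontier K" using fr by blast
        then show ?thesis using True F X(2) by simp
      next
        case False
        then have "X \<notin> frontier K" using F frT X(3) by blast
        then show ?thesis using F False by simp
      qed
    qed
  qed
  also have "\<dots> = (\<integral>\<^sup>+ X. G X * indicator ?T X \<partial>?H) + (\<integral>\<^sup>+ X. G' X * indicator ?T' X \<partial>?H)"
    using G(1) G'(1) T T' by (intro nn_integral_add) auto
  finally show ?thesis unfolding G(3) G'(3) .
qed

text \<open>The exceptional set moves from the boundary to the base: it is Borel as a preimage under
  \<open>top_pt\<close>, and null because it lies in the projection of a null set and projections do
  not increase distances.\<close>

lemma curvature_data:
  fixes u :: "real ^ 'n"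
  assumes u: "norm u = 1" and K: "convex_body_o K" and pos: "positive_gauss_curvature_ae K"
  obtains N where "N \<in> sets borel" "hausdorff_outer_measure (CARD('n) - 1) N = 0"
    "\<And>x. x \<in> base u K - N \<Longrightarrow> \<exists>p B. second_order (top_fn u K) x p B \<and> det (B + outer u) > 0"
proof -
  obtain M where M: "M \<in> sets borel" "hausdorff_outer_measure (CARD('n) - 1) M = 0"
    "\<And>X. X \<in> frontier K \<Longrightarrow> X \<notin> M \<Longrightarrow> \<exists>k>0. has_gauss_curvature K X k"
    by (rule positive_curvature_aeE[OF pos]) blast
  define t where "t x = (if x \<in> cyl u K then top_pt u K x else 0)" for x
  have tm: "t \<in> borel_measurable borel"
    unfolding t_def by (intro borel_measurable_continuous_on_if top_pt_continuous u K continuous_on_const cyl_borel)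
  define N where "N = base u K \<inter> t -` M"
  have NB: "N \<in> sets borel" unfolding N_def by (intro sets.Int base_borel measurable_sets_borel[OF tm M(1)])
  have "hausdorff_outer_measure (CARD('n) - 1) (oproj u ` M) \<le> ennreal (1 ^ (CARD('n) - 1)) * hausdorff_outer_measure (CARD('n) - 1) M"
  proof (rule hausdorff_outer_measure_lipschitz_image)
    fix x y show "dist (oproj u x) (oproj u y) \<le> 1 * dist x y"
      using norm_oproj_le[OF u, of "x - y"] by (simp add: dist_norm linear_diff[OF linear_oproj])
  qed simp
  then have "hausdorff_outer_measure (CARD('n) - 1) (oproj u ` M) = 0" using M(2) by simp
  moreover have "N \<subseteq> oproj u ` M"
  proof
    fix x assume x: "x \<in> N"
    then have "top_pt u K x \<in> M" "x \<in> base u K" by (auto simp: N_def t_def base_def)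
    moreover have "oproj u (top_pt u K x) = x" using u base_oproj[OF \<open>x \<in> base u K\<close>] by simp
    ultimately show "x \<in> oproj u ` M" by (intro image_eqI[of _ _ "top_pt u K x"]) simp_all
  qed
  ultimately have N0: "hausdorff_outer_measure (CARD('n) - 1) N = 0" by (rule hausdorff_outer_measure_null_subset)
  show thesis
  proof (rule that[OF NB N0])
    fix x assume x: "x \<in> base u K - N"
    then have xc: "x \<in> cyl u K" and XM: "top_pt u K x \<notin> M" by (auto simp: base_def N_def t_def)
    have Xf: "top_pt u K x \<in> frontier K" by (rule top_pt_frontier[OF u K xc])
    obtain k where k: "k > 0" "has_gauss_curvature K (top_pt u K x) k" using M(3)[OF Xf XM] by blast
    have X: "top_pt u K x \<in> cyl u K" "top_pt u K (top_pt u K x) = top_pt u K x" using u xc by simp_all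
    obtain p B where pB: "second_order (top_fn u K) (top_pt u K x) p B" "det (B + outer u) > 0"
      using gauss_curvature_imp_second_order[OF u K X k(2,1)] by blast
    have "second_order (top_fn u K) (top_pt u K x + (- (top_fn u K x - x \<bullet> u)) *\<^sub>R u) p B"
      by (rule second_order_translate[OF u pB(1)])
    moreover have "top_pt u K x + (- (top_fn u K x - x \<bullet> u)) *\<^sub>R u = x" unfolding top_pt_as_translate scaleR_minus_left by simp
    ultimately show "\<exists>p B. second_order (top_fn u K) x p B \<and> det (B + outer u) > 0" using pB(2) by auto
  qed
qed

lemma combination_second_order:
  fixes u :: "real ^ 'n"
  assumes u: "norm u = 1" and K1: "convex_body_o K1" and K2: "convex_body_o K2"
    and h: "hproj u K1 = hproj u K2" and ab: "a \<ge> 0" "b \<ge> 0" "a + b > 0"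
    and x: "x \<in> cyl u K1" and so1: "second_order (top_fn u K1) x p1 B1" and so2: "second_order (top_fn u K2) x p2 B2"
  defines "L \<equiv> graph_combination u a K1 b K2"
  shows "second_order (top_fn u L) x (a *\<^sub>R p1 + b *\<^sub>R p2) (a *\<^sub>R B1 + b *\<^sub>R B2)"
    and "top_fn u L x - (a *\<^sub>R p1 + b *\<^sub>R p2) \<bullet> x = a * (top_fn u K1 x - p1 \<bullet> x) + b * (top_fn u K2 x - p2 \<bullet> x)"
proof -
  have tf: "top_fn u L y = a * top_fn u K1 y + b * top_fn u K2 y" if "y \<in> cyl u K1" for y
  proof -
    have "oproj u y \<in> hproj u K1" using that interior_subset unfolding cyl_eq_interior[OF u K1] by blast
    then show ?thesis unfolding L_def by (rule graph_combination_body(3)[OF u K1 K2 h ab])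
  qed
  obtain e where e: "e > 0" "ball x e \<subseteq> cyl u K1" using x open_cyl openE by blast
  show "second_order (top_fn u L) x (a *\<^sub>R p1 + b *\<^sub>R p2) (a *\<^sub>R B1 + b *\<^sub>R B2)"
    by (rule second_order_combination[OF so1 so2 e(1)]) (use tf e(2) in blast)
  show "top_fn u L x - (a *\<^sub>R p1 + b *\<^sub>R p2) \<bullet> x = a * (top_fn u K1 x - p1 \<bullet> x) + b * (top_fn u K2 x - p2 \<bullet> x)"
    unfolding tf[OF x] by (simp add: inner_add_left algebra_simps)
qed

text \<open>The factor \<open>c\<close> multiplies \<open>B\<close> only. Definiteness for
  \<open>c = 1\<close> follows from the positive determinant; it makes one of the two nonnegative
  summands positive, and this survives the scaling.\<close>

lemma scaled_hessian_pd:
  fixes u :: "real ^ 'n"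
  assumes u: "norm u = 1" and K: "convex_body_o K" and x: "x \<in> cyl u K" and so: "second_order (top_fn u K) x p B"
    and d: "det (B + outer u) > 0" and c: "c > 0"
  shows "transpose (c *\<^sub>R B + outer u) = c *\<^sub>R B + outer u" "\<And>y. y \<noteq> 0 \<Longrightarrow> y \<bullet> ((c *\<^sub>R B + outer u) *v y) > 0"
proof -
  note s = second_order_cyl[OF u K x so]
  show "transpose (c *\<^sub>R B + outer u) = c *\<^sub>R B + outer u" by (simp only: transpose_add transpose_scaleR transpose_outer s(3))
  have sym: "transpose (B + outer u) = B + outer u" by (simp only: transpose_add transpose_outer s(3))
  have q: "y \<bullet> ((B + outer u) *v y) = y \<bullet> (B *v y) + (u \<bullet> y)\<^sup>2" for y
    by (simp only: matrix_vector_mult_add_rdistrib inner_add_right inner_outer)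
  fix y :: "real ^ 'n" assume y: "y \<noteq> 0"
  have "y \<bullet> ((B + outer u) *v y) > 0"
  proof (rule psd_det_pos[OF sym _ _ y])
    show "z \<bullet> ((B + outer u) *v z) \<ge> 0" for z unfolding q by (intro add_nonneg_nonneg s(4)) simp
    show "det (B + outer u) \<noteq> 0" using d by simp
  qed
  then have "y \<bullet> (B *v y) > 0 \<or> (u \<bullet> y)\<^sup>2 > 0" unfolding q by (metis add_nonpos_nonpos not_less)
  then have "c * (y \<bullet> (B *v y)) + (u \<bullet> y)\<^sup>2 > 0"
  proof
    assume "y \<bullet> (B *v y) > 0"
    then have "c * (y \<bullet> (B *v y)) > 0" using c by simp
    then show ?thesis by (rule add_pos_nonneg) simp
  next
    assume "(u \<bullet> y)\<^sup>2 > 0"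
    moreover have "c * (y \<bullet> (B *v y)) \<ge> 0" using c s(4)[of y] by simp
    ultimately show ?thesis by (intro add_nonneg_pos)
  qed
  then show "y \<bullet> ((c *\<^sub>R B + outer u) *v y) > 0"
    by (simp only: matrix_vector_mult_add_rdistrib inner_add_right inner_outer scaleR_matrix_vector_assoc[symmetric] inner_scaleR_right)
qed

lemma as_density_ineq:
  fixes u :: "real ^ 'n"
  assumes u: "norm u = 1" and K1: "convex_body_o K1" and K2: "convex_body_o K2"
    and h: "hproj u K1 = hproj u K2" and ab: "a \<ge> 0" "b \<ge> 0" "a + b > 0"
    and \<psi>: "\<psi> \<in> Conv_class" and G: "convex_on {0<..} (\<lambda>t. \<psi> (t ^ (CARD('n) + 1)))"
    and x: "x \<in> cyl u K1" and so1: "second_order (top_fn u K1) x p1 B1" "det (B1 + outer u) > 0"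
    and so2: "second_order (top_fn u K2) x p2 B2" "det (B2 + outer u) > 0"
  shows "as_density \<psi> u (graph_combination u a K1 b K2) x
    \<le> ennreal (a / (a + b)) * as_density \<psi> u (graph_combination u (a + b) K1 0 K2) x
      + ennreal (b / (a + b)) * as_density \<psi> u (graph_combination u 0 K1 (a + b) K2) x"
proof -
  define c where "c = a + b"
  have c: "c > 0" using ab(3) by (simp add: c_def)
  define l m where "l = a / c" and "m = b / c"
  have lm: "l \<ge> 0" "m \<ge> 0" "l + m = 1" "l * c = a" "m * c = b"
    using ab c by (auto simp: l_def m_def c_def add_divide_distrib[symmetric])
  have x2: "x \<in> cyl u K2" using x cyl_cong[OF u K1 K2 h] by simp
  define s1 s2 where "s1 = top_fn u K1 x - p1 \<bullet> x" and "s2 = top_fn u K2 x - p2 \<bullet> x"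
  have s: "s1 > 0" "s2 > 0" unfolding s1_def s2_def using boundary_data(2)[OF u K1 x so1(1)] boundary_data(2)[OF u K2 x2 so2(1)] by auto
  have C: "cyl u (graph_combination u a' K1 b' K2) = cyl u K1" if "a' \<ge> 0" "b' \<ge> 0" "a' + b' > 0" for a' b'
    using graph_combination_body(1,2)[OF u K1 K2 h that] by (intro cyl_cong[OF u _ K1])
  have dens: "as_density \<psi> u (graph_combination u a' K1 b' K2) x
      = psi_ext \<psi> (det (a' *\<^sub>R B1 + b' *\<^sub>R B2 + outer u) / (a' * s1 + b' * s2) ^ (CARD('n) + 1)) * ennreal (a' * s1 + b' * s2)"
    if ab': "a' \<ge> 0" "b' \<ge> 0" "a' + b' > 0" for a' b'
  proof -
    note cs = combination_second_order[OF u K1 K2 h ab' x so1(1) so2(1)]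
    have xL: "x \<in> cyl u (graph_combination u a' K1 b' K2)" using x C[OF ab'] by simp
    show ?thesis unfolding as_density_def sel_eq[OF xL cs(1)] cs(2) s1_def s2_def ..
  qed
  \<comment> \<open>The matrices of the two dilates by \<open>c = a + b\<close>. Because
    \<open>l + m = 1\<close>, their mean keeps the summand \<open>u u\<^sup>T\<close> unchanged and
    is the matrix of the combination.\<close>
  define C1 C2 where "C1 = c *\<^sub>R B1 + outer u" and "C2 = c *\<^sub>R B2 + outer u"
  note pd1 = scaled_hessian_pd[OF u K1 x so1 c, folded C1_def] and pd2 = scaled_hessian_pd[OF u K2 x2 so2 c, folded C2_def]
  have CL: "l *\<^sub>R C1 + m *\<^sub>R C2 = a *\<^sub>R B1 + b *\<^sub>R B2 + outer u"
  proof -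
    have "l *\<^sub>R C1 + m *\<^sub>R C2 = (l * c) *\<^sub>R B1 + (m * c) *\<^sub>R B2 + (l + m) *\<^sub>R outer u"
      by (simp add: C1_def C2_def scaleR_add_right scaleR_add_left)
    then show ?thesis unfolding lm by simp
  qed
  have sL: "l * (c * s1) + m * (c * s2) = a * s1 + b * s2" using lm by (metis mult.assoc)
  have cs: "c * s1 > 0" "c * s2 > 0" using c s by auto
  have aff: "\<psi> (det (a *\<^sub>R B1 + b *\<^sub>R B2 + outer u) / (a * s1 + b * s2) ^ (CARD('n) + 1)) * (a * s1 + b * s2)
    \<le> l * (\<psi> (det C1 / (c * s1) ^ (CARD('n) + 1)) * (c * s1)) + m * (\<psi> (det C2 / (c * s2) ^ (CARD('n) + 1)) * (c * s2))"
    using affine_integrand_convex[OF \<psi> G pd1(1) _ pd2(1) _ lm(1,2,3) cs] pd1(2) pd2(2) unfolding CL sL by blast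
  have rd: "det C1 > 0" "det C2 > 0"
    "l * root (CARD('n) + 1) (det C1) + m * root (CARD('n) + 1) (det C2) \<le> root (CARD('n) + 1) (det (l *\<^sub>R C1 + m *\<^sub>R C2))"
    using root_det_concave[OF pd1(1) _ pd2(1) _ lm(1,2,3)] pd1(2) pd2(2) by blast+
  have "l * root (CARD('n) + 1) (det C1) + m * root (CARD('n) + 1) (det C2) > 0"
  proof (cases "m = 0")
    case False
    then show ?thesis using lm rd(1,2) by (intro add_nonneg_pos) auto
  qed (use lm rd(1) in auto)
  then have "root (CARD('n) + 1) (det (l *\<^sub>R C1 + m *\<^sub>R C2)) > 0" using rd(3) by linarith
  \<comment> \<open>A positive determinant keeps \<open>psi_ext\<close> away from its value at 0,
    which may be infinite.\<close>
  then have dL: "det (a *\<^sub>R B1 + b *\<^sub>R B2 + outer u) > 0" unfolding CL by (simp add: real_root_gt_0_iff)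
  have spos: "a * s1 + b * s2 > 0"
  proof (cases "b = 0")
    case False
    then show ?thesis using ab s by (intro add_nonneg_pos) auto
  qed (use ab s in auto)
  have \<psi>pos: "\<psi> t \<ge> 0" if "t > 0" for t using \<psi> that by (auto simp: Conv_class_def less_imp_le)
  have psi: "psi_ext \<psi> (d / r ^ (CARD('n) + 1)) * ennreal r = ennreal (\<psi> (d / r ^ (CARD('n) + 1)) * r)" if "d > 0" "r > 0" for d r
  proof -
    have "d / r ^ (CARD('n) + 1) > 0" using that by (intro divide_pos_pos zero_less_power)
    then show ?thesis using \<psi>pos that(2) by (simp add: psi_ext_def ennreal_mult del: power_Suc)
  qed
  have dn: "\<psi> (d / r ^ (CARD('n) + 1)) * r \<ge> 0" if "d > 0" "r > 0" for d r
    using that by (intro mult_nonneg_nonneg \<psi>pos divide_pos_pos zero_less_power) auto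
  have D: "as_density \<psi> u (graph_combination u a K1 b K2) x = ennreal (\<psi> (det (a *\<^sub>R B1 + b *\<^sub>R B2 + outer u) / (a * s1 + b * s2) ^ (CARD('n) + 1)) * (a * s1 + b * s2))"
    unfolding dens[OF ab] by (rule psi[OF dL spos])
  have D1: "as_density \<psi> u (graph_combination u c K1 0 K2) x = ennreal (\<psi> (det C1 / (c * s1) ^ (CARD('n) + 1)) * (c * s1))"
    using dens[of c 0] c psi[OF rd(1) cs(1)] by (simp add: C1_def)
  have D2: "as_density \<psi> u (graph_combination u 0 K1 c K2) x = ennreal (\<psi> (det C2 / (c * s2) ^ (CARD('n) + 1)) * (c * s2))"
    using dens[of 0 c] c psi[OF rd(2) cs(2)] by (simp add: C2_def)
  show ?thesis
    unfolding c_def[symmetric] D D1 D2 l_def[symmetric] m_def[symmetric]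
    using ennreal_leI[OF aff] lm dn[OF rd(1) cs(1)] dn[OF rd(2) cs(2)]
    by (simp only: ennreal_plus ennreal_mult mult_nonneg_nonneg)
qed

text \<open>All three bodies are combinations of \<open>K1\<close> and \<open>K2\<close>, with the
  same base and one common null set outside of which both bodies expand to second order on both
  graphs. The pointwise inequality is integrated over the upper and the lower graph
  separately.\<close>

lemma as_psi_graph_combination:
  fixes u :: "real ^ 'n"
  assumes u: "norm u = 1" and K1: "convex_body_o K1" and K2: "convex_body_o K2"
    and h: "hproj u K1 = hproj u K2" and ab: "a \<ge> 0" "b \<ge> 0" "a + b > 0"
    and \<psi>: "\<psi> \<in> Conv_class" and G: "convex_on {0<..} (\<lambda>t. \<psi> (t ^ (CARD('n) + 1)))"
    and pos: "positive_gauss_curvature_ae K1" "positive_gauss_curvature_ae K2"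
  shows "as_psi \<psi> (graph_combination u a K1 b K2)
    \<le> ennreal (a / (a + b)) * as_psi \<psi> (graph_combination u (a + b) K1 0 K2)
      + ennreal (b / (a + b)) * as_psi \<psi> (graph_combination u 0 K1 (a + b) K2)"
proof -
  let ?H = "hausdorff_measure (CARD('n) - 1) :: (real ^ 'n) measure"
  let ?\<mu> = "hausdorff_outer_measure (CARD('n) - 1) :: (real ^ 'n) set \<Rightarrow> ennreal"
  have u': "norm (- u) = 1" using u by simp
  have h': "hproj (- u) K1 = hproj (- u) K2" using h by (simp add: hproj_image)
  have bm: "base (- u) K = base u K" for K :: "(real ^ 'n) set" by (simp add: base_def)
  have c12: "cyl u K2 = cyl u K1" using cyl_cong[OF u K1 K2 h] by simp
  have b12: "base u K2 = base u K1" using c12 by (simp add: base_def)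
  obtain N1 where N1: "N1 \<in> sets borel" "?\<mu> N1 = 0" "\<And>x. x \<in> base u K1 - N1 \<Longrightarrow> \<exists>p B. second_order (top_fn u K1) x p B \<and> det (B + outer u) > 0"
    by (rule curvature_data[OF u K1 pos(1)]) blast
  obtain N2 where N2: "N2 \<in> sets borel" "?\<mu> N2 = 0" "\<And>x. x \<in> base u K2 - N2 \<Longrightarrow> \<exists>p B. second_order (top_fn u K2) x p B \<and> det (B + outer u) > 0"
    by (rule curvature_data[OF u K2 pos(2)]) blast
  obtain N3 where N3: "N3 \<in> sets borel" "?\<mu> N3 = 0" "\<And>x. x \<in> base (- u) K1 - N3 \<Longrightarrow> \<exists>p B. second_order (top_fn (- u) K1) x p B \<and> det (B + outer (- u)) > 0"
    by (rule curvature_data[OF u' K1 pos(1)]) blast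
  obtain N4 where N4: "N4 \<in> sets borel" "?\<mu> N4 = 0" "\<And>x. x \<in> base (- u) K2 - N4 \<Longrightarrow> \<exists>p B. second_order (top_fn (- u) K2) x p B \<and> det (B + outer (- u)) > 0"
    by (rule curvature_data[OF u' K2 pos(2)]) blast
  define N where "N = N1 \<union> N2 \<union> N3 \<union> N4"
  have NB: "N \<in> sets borel" using N1(1) N2(1) N3(1) N4(1) by (simp add: N_def)
  have N0: "?\<mu> N = 0"
  proof -
    have z: "?\<mu> (A \<union> B) = 0" if "?\<mu> A = 0" "?\<mu> B = 0" for A B
      using hausdorff_outer_measure_Un[of "CARD('n) - 1" A B] that by simp
    show ?thesis unfolding N_def by (intro z N1(2) N2(2) N3(2) N4(2))
  qed
  let ?L = "\<lambda>a b. graph_combination u a K1 b K2"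
  \<comment> \<open>The combination does not change when \<open>u\<close> is replaced by
    \<open>- u\<close>, so the lower graphs are upper graphs of combinations as well.\<close>
  have Lm: "?L a' b' = graph_combination (- u) a' K1 b' K2" for a' b' by (simp only: graph_combination_uminus)
  have rep: "as_psi \<psi> (?L a' b') = (\<integral>\<^sup>+ x. as_density \<psi> u (?L a' b') x * indicator (base u K1) x \<partial>?H)
      + (\<integral>\<^sup>+ x. as_density \<psi> (- u) (?L a' b') x * indicator (base u K1) x \<partial>?H)"
    and body: "convex_body_o (?L a' b')" if ab': "a' \<ge> 0" "b' \<ge> 0" "a' + b' > 0" for a' b'
  proof -
    note LB = graph_combination_body[OF u K1 K2 h ab']
    have cL: "cyl u (?L a' b') = cyl u K1" by (rule cyl_cong[OF u LB(1) K1 LB(2)])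
    then have bL: "base u (?L a' b') = base u K1" by (simp add: base_def)
    show "convex_body_o (?L a' b')" by (rule LB(1))
    have "as_psi \<psi> (?L a' b') = (\<integral>\<^sup>+ x. as_density \<psi> u (?L a' b') x * indicator (base u (?L a' b')) x \<partial>?H)
      + (\<integral>\<^sup>+ x. as_density \<psi> (- u) (?L a' b') x * indicator (base u (?L a' b')) x \<partial>?H)"
    proof (rule as_psi_eq[OF u LB(1) \<psi> vertical_part_null[OF u K1 K2 h ab' pos] NB N0])
      fix x assume x: "x \<in> base u (?L a' b') - N"
      then have xc: "x \<in> cyl u K1" "x \<in> cyl (- u) K1" and x1: "x \<in> base u K1 - N1" "x \<in> base u K2 - N2" "x \<in> base (- u) K1 - N3" "x \<in> base (- u) K2 - N4"
        unfolding bL bm b12 by (auto simp: N_def base_def)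
      obtain p1 B1 p2 B2 where "second_order (top_fn u K1) x p1 B1" "second_order (top_fn u K2) x p2 B2"
        using N1(3)[OF x1(1)] N2(3)[OF x1(2)] by blast
      then show "\<exists>p B. second_order (top_fn u (?L a' b')) x p B"
        using combination_second_order(1)[OF u K1 K2 h ab' xc(1)] by blast
      obtain p3 B3 p4 B4 where "second_order (top_fn (- u) K1) x p3 B3" "second_order (top_fn (- u) K2) x p4 B4"
        using N3(3)[OF x1(3)] N4(3)[OF x1(4)] by blast
      then show "\<exists>p B. second_order (top_fn (- u) (?L a' b')) x p B"
        unfolding Lm using combination_second_order(1)[OF u' K1 K2 h' ab' xc(2)] by blast
    qed
    then show "as_psi \<psi> (?L a' b') = (\<integral>\<^sup>+ x. as_density \<psi> u (?L a' b') x * indicator (base u K1) x \<partial>?H)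
      + (\<integral>\<^sup>+ x. as_density \<psi> (- u) (?L a' b') x * indicator (base u K1) x \<partial>?H)" unfolding bL .
  qed
  let ?c = "a + b" and ?l = "ennreal (a / (a + b))" and ?m = "ennreal (b / (a + b))"
  have c0: "?c \<ge> 0" "0 \<le> (0 :: real)" "?c + 0 > 0" "0 + ?c > 0" using ab by auto
  have dm: "as_density \<psi> w (?L a' b') \<in> borel_measurable ?H" if "norm w = 1" "a' \<ge> 0" "b' \<ge> 0" "a' + b' > 0" for w a' b'
  proof -
    note [measurable] = sel_borel(1,2)[OF that(1) body[OF that(2,3,4)]] psi_ext_borel[OF \<psi>]
    have "as_density \<psi> w (?L a' b') \<in> borel_measurable borel" unfolding as_density_def[abs_def] by measurable
    then show ?thesis by (simp add: measurable_cong_sets[OF sets_hausdorff_measure refl])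
  qed
  have ineq: "(\<integral>\<^sup>+ x. as_density \<psi> w (?L a b) x * indicator (base u K1) x \<partial>?H)
    \<le> ?l * (\<integral>\<^sup>+ x. as_density \<psi> w (?L ?c 0) x * indicator (base u K1) x \<partial>?H)
      + ?m * (\<integral>\<^sup>+ x. as_density \<psi> w (?L 0 ?c) x * indicator (base u K1) x \<partial>?H)"
    if w: "norm w = 1" and pt: "\<And>x. x \<in> base u K1 - N \<Longrightarrow> as_density \<psi> w (?L a b) x \<le> ?l * as_density \<psi> w (?L ?c 0) x + ?m * as_density \<psi> w (?L 0 ?c) x" for w
  proof -
    have im: "(indicator (base u K1) :: real ^ 'n \<Rightarrow> ennreal) \<in> borel_measurable ?H"
      by (rule borel_measurable_indicator) (simp add: base_borel)
    note m1 = borel_measurable_times_ennreal[OF dm[OF w c0(1,2,3)] im] and m2 = borel_measurable_times_ennreal[OF dm[OF w c0(2,1,4)] im]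
    have "(\<integral>\<^sup>+ x. as_density \<psi> w (?L a b) x * indicator (base u K1) x \<partial>?H)
      \<le> (\<integral>\<^sup>+ x. ?l * (as_density \<psi> w (?L ?c 0) x * indicator (base u K1) x) + ?m * (as_density \<psi> w (?L 0 ?c) x * indicator (base u K1) x) \<partial>?H)"
    proof (rule nn_integral_mono_AE, rule eventually_mono[OF null_set_AE[OF NB N0]])
      fix x assume "x \<notin> N"
      then show "as_density \<psi> w (?L a b) x * indicator (base u K1) x
        \<le> ?l * (as_density \<psi> w (?L ?c 0) x * indicator (base u K1) x) + ?m * (as_density \<psi> w (?L 0 ?c) x * indicator (base u K1) x)"
        using pt[of x] by (cases "x \<in> base u K1") simp_all
    qed
    also have "\<dots> = (\<integral>\<^sup>+ x. ?l * (as_density \<psi> w (?L ?c 0) x * indicator (base u K1) x) \<partial>?H)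
      + (\<integral>\<^sup>+ x. ?m * (as_density \<psi> w (?L 0 ?c) x * indicator (base u K1) x) \<partial>?H)"
      by (intro nn_integral_add borel_measurable_times_ennreal borel_measurable_const dm w c0 im)
    also have "\<dots> = ?l * (\<integral>\<^sup>+ x. as_density \<psi> w (?L ?c 0) x * indicator (base u K1) x \<partial>?H)
      + ?m * (\<integral>\<^sup>+ x. as_density \<psi> w (?L 0 ?c) x * indicator (base u K1) x \<partial>?H)"
      unfolding nn_integral_cmult[OF m1] nn_integral_cmult[OF m2] ..
    finally show ?thesis .
  qed
  have up: "(\<integral>\<^sup>+ x. as_density \<psi> u (?L a b) x * indicator (base u K1) x \<partial>?H)
    \<le> ?l * (\<integral>\<^sup>+ x. as_density \<psi> u (?L ?c 0) x * indicator (base u K1) x \<partial>?H)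
      + ?m * (\<integral>\<^sup>+ x. as_density \<psi> u (?L 0 ?c) x * indicator (base u K1) x \<partial>?H)"
  proof (rule ineq[OF u])
    fix x assume x: "x \<in> base u K1 - N"
    then have xc: "x \<in> cyl u K1" and x1: "x \<in> base u K1 - N1" "x \<in> base u K2 - N2" unfolding b12 by (auto simp: N_def base_def)
    obtain p1 B1 p2 B2 where "second_order (top_fn u K1) x p1 B1" "det (B1 + outer u) > 0" "second_order (top_fn u K2) x p2 B2" "det (B2 + outer u) > 0"
      using N1(3)[OF x1(1)] N2(3)[OF x1(2)] by blast
    then show "as_density \<psi> u (?L a b) x \<le> ?l * as_density \<psi> u (?L ?c 0) x + ?m * as_density \<psi> u (?L 0 ?c) x"
      by (rule as_density_ineq[OF u K1 K2 h ab \<psi> G xc])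
  qed
  have down: "(\<integral>\<^sup>+ x. as_density \<psi> (- u) (?L a b) x * indicator (base u K1) x \<partial>?H)
    \<le> ?l * (\<integral>\<^sup>+ x. as_density \<psi> (- u) (?L ?c 0) x * indicator (base u K1) x \<partial>?H)
      + ?m * (\<integral>\<^sup>+ x. as_density \<psi> (- u) (?L 0 ?c) x * indicator (base u K1) x \<partial>?H)"
  proof (rule ineq[OF u'])
    fix x assume x: "x \<in> base u K1 - N"
    then have xc: "x \<in> cyl (- u) K1" and x1: "x \<in> base (- u) K1 - N3" "x \<in> base (- u) K2 - N4" unfolding bm b12 by (auto simp: N_def base_def)
    obtain p1 B1 p2 B2 where "second_order (top_fn (- u) K1) x p1 B1" "det (B1 + outer (- u)) > 0" "second_order (top_fn (- u) K2) x p2 B2" "det (B2 + outer (- u)) > 0"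
      using N3(3)[OF x1(1)] N4(3)[OF x1(2)] by blast
    then show "as_density \<psi> (- u) (?L a b) x \<le> ?l * as_density \<psi> (- u) (?L ?c 0) x + ?m * as_density \<psi> (- u) (?L 0 ?c) x"
      unfolding Lm by (rule as_density_ineq[OF u' K1 K2 h' ab \<psi> G xc])
  qed
  show ?thesis
    unfolding rep[OF ab] rep[OF c0(1,2,3)] rep[OF c0(2,1,4)]
    using add_mono[OF up down] by (simp only: distrib_left add_ac)
qed

lemma norm_last_basis: "norm last_basis = 1"
  by (simp add: last_basis_def)

theorem theorem3p6:
  fixes \<psi> :: "real \<Rightarrow> real" and a b :: real
    and K1 K2 :: "(real ^ 'n::{finite,linorder}) set"
  assumes "\<psi> \<in> Conv_class"
    and "a \<ge> 0" and "b \<ge> 0" and "\<not> (a = 0 \<and> b = 0)"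
    and "convex_on {0<..} (\<lambda>t. \<psi> (t ^ (CARD('n) + 1)))"
    and "convex_body_o K1" and "convex_body_o K2"
    and "hproj last_basis K1 = hproj last_basis K2"
    and "positive_gauss_curvature_ae K1" and "positive_gauss_curvature_ae K2"
  shows "as_psi \<psi> (graph_combination last_basis a K1 b K2)
    \<le> ennreal (a / (a + b)) * as_psi \<psi> (graph_dilation last_basis (a + b) K1)
      + ennreal (b / (a + b)) * as_psi \<psi> (graph_dilation last_basis (a + b) K2)"
proof -
  have ab: "a + b > 0" using assms(2,3,4) by linarith
  have "graph_dilation last_basis (a + b) K1 = graph_combination last_basis (a + b) K1 0 K2" by (rule graph_dilation_eq)
  moreover have "graph_dilation last_basis (a + b) K2 = graph_combination last_basis 0 K1 (a + b) K2"
    unfolding graph_dilation_eq[of last_basis "a + b" K2 K1] by (rule graph_combination_commute[OF assms(8)[symmetric]])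
  ultimately show ?thesis
    using as_psi_graph_combination[OF norm_last_basis assms(6,7,8,2,3) ab assms(1,5,9,10)] by simp
qed

end
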